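(* Let $\mathbf{k}$ be a field and let $\mathcal{C}$ be a symmetric monoidal category. A lax symmetric monoidal functor $F:\mathcal{C}\to \mathrm{Ch}_*(\mathbf{k})$ is formal if and only if it is weakly equivalent to a lax symmetric monoidal functor $\tilde F:\mathcal{C}\to\mathrm{Ch}_*(\mathbf{k})$ that admits a factorization $\tilde F=U\circ G$, where $G:\mathcal{C}\to \mathrm{Ch}_*(\mathrm{grVect})^{pure}$ is a lax symmetric monoidal functor and $U:\mathrm{Ch}_*(\mathrm{grVect})^{pure}\to\mathrm{Ch}_*(\mathbf{k})$ is the functor forgetting the weight.
   Context: $\mathrm{Ch}_*(\mathbf{k})$ is the symmetric monoidal category of chain complexes of $\mathbf{k}$-vector spaces. $\mathrm{grVect}$ is the category of $\mathbb{Z}$-graded $\mathbf{k}$-vector spaces with its usual tensor product, and with symmetry isomorphism involving no sign. An object $V$ of $\mathrm{Ch}_*(\mathrm{grVect})$ has a homological degree (subscript) and a weight (superscript, coming from $\mathrm{grVect}$). The category $\mathrm{Ch}_*(\mathrm{grVect})$ is symmetric monoidal with $$(C\otimes D)^p_m=\bigoplus_{n,q\in\mathbb{Z}}C^q_n\otimes D^{p-q}_{m-n},$$ the symmetry involving the usual Koszul sign for the homological degree and no sign for the weight. $V$ has pure homology if $H_n(V)^p=0$ for all $p\neq n$; $\mathrm{Ch}_*(\mathrm{grVect})^{pure}$ is the full subcategory of complexes with pure homology. The functor $U$ sends $V$ to $\bigoplus_p V^p$. Two lax symmetric monoidal functors $\mathcal{C}\to \mathrm{Ch}_*(\mathbf{k})$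 are weakly equivalent if they are connected by a finite zig-zag of natural transformations of lax symmetric monoidal functors (monoidal natural transformations) each of which is a quasi-isomorphism at every object of $\mathcal{C}$. The homology functor $H:\mathrm{Ch}_*(\mathbf{k})\to\mathrm{Ch}_*(\mathbf{k})$ (homology viewed as a complex with zero differential) is lax symmetric monoidal via the Künneth morphism. $F$ is formal if it is weakly equivalent to $H\circ F$. *)

theory Defs
  imports "HOL-Algebra.Module" "HOL-Algebra.AbelCoset" "HOL-Library.Product_Plus"
begin

section \<open>Symmetric monoidal categories and lax symmetric monoidal functors\<close>

record ('o, 'a) smc =
  Obj :: "'o set"
  Arr :: "'a set"
  Dom :: "'a \<Rightarrow> 'o"
  Cod :: "'a \<Rightarrow> 'o"
  Id :: "'o \<Rightarrow> 'a"
  Comp :: "'a \<Rightarrow> 'a \<Rightarrow> 'a"  (infixr \<open>\<cdot>\<index>\<close> 65)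
  TensO :: "'o \<Rightarrow> 'o \<Rightarrow> 'o"  (infixr \<open>\<boxtimes>\<index>\<close> 75)
  TensA :: "'a \<Rightarrow> 'a \<Rightarrow> 'a"  (infixr \<open>\<boxdot>\<index>\<close> 75)
  Unit :: "'o"
  Assoc :: "'o \<Rightarrow> 'o \<Rightarrow> 'o \<Rightarrow> 'a"
  LUnit :: "'o \<Rightarrow> 'a"
  RUnit :: "'o \<Rightarrow> 'a"
  Braid :: "'o \<Rightarrow> 'o \<Rightarrow> 'a"

definition Hom :: "('o, 'a) smc \<Rightarrow> 'o \<Rightarrow> 'o \<Rightarrow> 'a set" where
  "Hom C A B = {f \<in> Arr C. Dom C f = A \<and> Cod C f = B}"

definition Iso :: "('o, 'a) smc \<Rightarrow> 'o \<Rightarrow> 'o \<Rightarrow> 'a set" where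
  "Iso C A B = {f \<in> Hom C A B. \<exists>g \<in> Hom C B A. g \<cdot>\<^bsub>C\<^esub> f = Id C A \<and> f \<cdot>\<^bsub>C\<^esub> g = Id C B}"

locale category =
  fixes C :: "('o, 'a) smc" (structure)
  assumes dom_obj: "f \<in> Arr C \<Longrightarrow> Dom C f \<in> Obj C"
    and cod_obj: "f \<in> Arr C \<Longrightarrow> Cod C f \<in> Obj C"
    and id_hom: "X \<in> Obj C \<Longrightarrow> Id C X \<in> Hom C X X"
    and comp_hom: "\<lbrakk>f \<in> Hom C X Y; g \<in> Hom C Y Z\<rbrakk> \<Longrightarrow> g \<cdot> f \<in> Hom C X Z"
    and comp_id: "f \<in> Hom C X Y \<Longrightarrow> f \<cdot> Id C X = f"
    and id_comp: "f \<in> Hom C X Y \<Longrightarrow> Id C Y \<cdot> f = f"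
    and comp_assoc:
      "\<lbrakk>f \<in> Hom C W X; g \<in> Hom C X Y; h \<in> Hom C Y Z\<rbrakk> \<Longrightarrow> (h \<cdot> g) \<cdot> f = h \<cdot> (g \<cdot> f)"

locale symmetric_monoidal_category = category C for C :: "('o, 'a) smc" (structure) +
  assumes unit_obj: "Unit C \<in> Obj C"
    and tens_obj: "\<lbrakk>X \<in> Obj C; Y \<in> Obj C\<rbrakk> \<Longrightarrow> X \<boxtimes> Y \<in> Obj C"
    and tens_hom:
      "\<lbrakk>f \<in> Hom C X X'; g \<in> Hom C Y Y'\<rbrakk> \<Longrightarrow> f \<boxdot> g \<in> Hom C (X \<boxtimes> Y) (X' \<boxtimes> Y')"
    and tens_id: "\<lbrakk>X \<in> Obj C; Y \<in> Obj C\<rbrakk> \<Longrightarrow> Id C X \<boxdot> Id C Y = Id C (X \<boxtimes> Y)"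
    and tens_comp:
      "\<lbrakk>f \<in> Hom C X X'; f' \<in> Hom C X' X''; g \<in> Hom C Y Y'; g' \<in> Hom C Y' Y''\<rbrakk>
        \<Longrightarrow> (f' \<cdot> f) \<boxdot> (g' \<cdot> g) = (f' \<boxdot> g') \<cdot> (f \<boxdot> g)"
    and assoc_iso:
      "\<lbrakk>X \<in> Obj C; Y \<in> Obj C; Z \<in> Obj C\<rbrakk>
        \<Longrightarrow> Assoc C X Y Z \<in> Iso C ((X \<boxtimes> Y) \<boxtimes> Z) (X \<boxtimes> (Y \<boxtimes> Z))"
    and assoc_natural:
      "\<lbrakk>f \<in> Hom C X X'; g \<in> Hom C Y Y'; h \<in> Hom C Z Z'\<rbrakk>
        \<Longrightarrow> Assoc C X' Y' Z' \<cdot> ((f \<boxdot> g) \<boxdot> h) = (f \<boxdot> (g \<boxdot> h)) \<cdot> Assoc C X Y Z"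
    and lunit_iso: "X \<in> Obj C \<Longrightarrow> LUnit C X \<in> Iso C (Unit C \<boxtimes> X) X"
    and lunit_natural:
      "f \<in> Hom C X Y \<Longrightarrow> LUnit C Y \<cdot> (Id C (Unit C) \<boxdot> f) = f \<cdot> LUnit C X"
    and runit_iso: "X \<in> Obj C \<Longrightarrow> RUnit C X \<in> Iso C (X \<boxtimes> Unit C) X"
    and runit_natural:
      "f \<in> Hom C X Y \<Longrightarrow> RUnit C Y \<cdot> (f \<boxdot> Id C (Unit C)) = f \<cdot> RUnit C X"
    and braid_iso:
      "\<lbrakk>X \<in> Obj C; Y \<in> Obj C\<rbrakk> \<Longrightarrow> Braid C X Y \<in> Iso C (X \<boxtimes> Y) (Y \<boxtimes> X)"
    and braid_natural:
      "\<lbrakk>f \<in> Hom C X X'; g \<in> Hom C Y Y'\<rbrakk>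
        \<Longrightarrow> Braid C X' Y' \<cdot> (f \<boxdot> g) = (g \<boxdot> f) \<cdot> Braid C X Y"
    and pentagon:
      "\<lbrakk>W \<in> Obj C; X \<in> Obj C; Y \<in> Obj C; Z \<in> Obj C\<rbrakk>
        \<Longrightarrow> Assoc C W X (Y \<boxtimes> Z) \<cdot> Assoc C (W \<boxtimes> X) Y Z =
            (Id C W \<boxdot> Assoc C X Y Z) \<cdot> Assoc C W (X \<boxtimes> Y) Z \<cdot> (Assoc C W X Y \<boxdot> Id C Z)"
    and triangle:
      "\<lbrakk>X \<in> Obj C; Y \<in> Obj C\<rbrakk>
        \<Longrightarrow> (Id C X \<boxdot> LUnit C Y) \<cdot> Assoc C X (Unit C) Y = RUnit C X \<boxdot> Id C Y"
    and hexagon: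
      "\<lbrakk>X \<in> Obj C; Y \<in> Obj C; Z \<in> Obj C\<rbrakk>
        \<Longrightarrow> Assoc C Y Z X \<cdot> Braid C X (Y \<boxtimes> Z) \<cdot> Assoc C X Y Z =
            (Id C Y \<boxdot> Braid C X Z) \<cdot> Assoc C Y X Z \<cdot> (Braid C X Y \<boxdot> Id C Z)"
    and symmetry:
      "\<lbrakk>X \<in> Obj C; Y \<in> Obj C\<rbrakk> \<Longrightarrow> Braid C Y X \<cdot> Braid C X Y = Id C (X \<boxtimes> Y)"

definition full_subcategory :: "('o, 'a) smc \<Rightarrow> ('o \<Rightarrow> bool) \<Rightarrow> ('o, 'a) smc" where
  "full_subcategory C P =
     C\<lparr>Obj := {X \<in> Obj C. P X}, Arr := {f \<in> Arr C. P (Dom C f) \<and> P (Cod C f)}\<rparr>"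

text \<open>The structure maps of a lax monoidal functor \<open>F\<close> are
  \<open>Mu F X Y : F X \<boxtimes> F Y \<rightarrow> F (X \<boxtimes> Y)\<close> and \<open>Eps F : Unit \<rightarrow> F Unit\<close>.\<close>

record ('o, 'a, 'p, 'b) lax_functor =
  FO :: "'o \<Rightarrow> 'p"
  FA :: "'a \<Rightarrow> 'b"
  Mu :: "'o \<Rightarrow> 'o \<Rightarrow> 'b"
  Eps :: "'b"

locale lax_symmetric_monoidal_functor =
  fixes C :: "('o, 'a) smc" and D :: "('p, 'b) smc" and F :: "('o, 'a, 'p, 'b) lax_functor"
  assumes F_obj: "X \<in> Obj C \<Longrightarrow> FO F X \<in> Obj D"
    and F_hom: "f \<in> Hom C X Y \<Longrightarrow> FA F f \<in> Hom D (FO F X) (FO F Y)"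
    and F_id: "X \<in> Obj C \<Longrightarrow> FA F (Id C X) = Id D (FO F X)"
    and F_comp:
      "\<lbrakk>f \<in> Hom C X Y; g \<in> Hom C Y Z\<rbrakk> \<Longrightarrow> FA F (g \<cdot>\<^bsub>C\<^esub> f) = FA F g \<cdot>\<^bsub>D\<^esub> FA F f"
    and Mu_hom:
      "\<lbrakk>X \<in> Obj C; Y \<in> Obj C\<rbrakk>
        \<Longrightarrow> Mu F X Y \<in> Hom D (FO F X \<boxtimes>\<^bsub>D\<^esub> FO F Y) (FO F (X \<boxtimes>\<^bsub>C\<^esub> Y))"
    and Eps_hom: "Eps F \<in> Hom D (Unit D) (FO F (Unit C))"
    and Mu_natural:
      "\<lbrakk>f \<in> Hom C X X'; g \<in> Hom C Y Y'\<rbrakk>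
        \<Longrightarrow> FA F (f \<boxdot>\<^bsub>C\<^esub> g) \<cdot>\<^bsub>D\<^esub> Mu F X Y = Mu F X' Y' \<cdot>\<^bsub>D\<^esub> (FA F f \<boxdot>\<^bsub>D\<^esub> FA F g)"
    and Mu_assoc:
      "\<lbrakk>X \<in> Obj C; Y \<in> Obj C; Z \<in> Obj C\<rbrakk>
        \<Longrightarrow> FA F (Assoc C X Y Z) \<cdot>\<^bsub>D\<^esub> Mu F (X \<boxtimes>\<^bsub>C\<^esub> Y) Z \<cdot>\<^bsub>D\<^esub> (Mu F X Y \<boxdot>\<^bsub>D\<^esub> Id D (FO F Z)) =
            Mu F X (Y \<boxtimes>\<^bsub>C\<^esub> Z) \<cdot>\<^bsub>D\<^esub> (Id D (FO F X) \<boxdot>\<^bsub>D\<^esub> Mu F Y Z)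
              \<cdot>\<^bsub>D\<^esub> Assoc D (FO F X) (FO F Y) (FO F Z)"
    and Mu_lunit:
      "X \<in> Obj C \<Longrightarrow>
        FA F (LUnit C X) \<cdot>\<^bsub>D\<^esub> Mu F (Unit C) X \<cdot>\<^bsub>D\<^esub> (Eps F \<boxdot>\<^bsub>D\<^esub> Id D (FO F X)) = LUnit D (FO F X)"
    and Mu_runit:
      "X \<in> Obj C \<Longrightarrow>
        FA F (RUnit C X) \<cdot>\<^bsub>D\<^esub> Mu F X (Unit C) \<cdot>\<^bsub>D\<^esub> (Id D (FO F X) \<boxdot>\<^bsub>D\<^esub> Eps F) = RUnit D (FO F X)"
    and Mu_symmetric:
      "\<lbrakk>X \<in> Obj C; Y \<in> Obj C\<rbrakk>
        \<Longrightarrow> FA F (Braid C X Y) \<cdot>\<^bsub>D\<^esub> Mu F X Y = Mu F Y X \<cdot>\<^bsub>D\<^esub> Braid D (FO F X) (FO F Y)"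

text \<open>\<open>lax_comp E G F\<close> is \<open>G \<circ> F\<close>, where \<open>E\<close> is the codomain of \<open>G\<close>.\<close>

definition lax_comp ::
  "('q, 'c) smc \<Rightarrow> ('p, 'b, 'q, 'c) lax_functor \<Rightarrow> ('o, 'a, 'p, 'b) lax_functor
    \<Rightarrow> ('o, 'a, 'q, 'c) lax_functor" where
  "lax_comp E G F =
     \<lparr>FO = \<lambda>X. FO G (FO F X),
      FA = \<lambda>f. FA G (FA F f),
      Mu = \<lambda>X Y. FA G (Mu F X Y) \<cdot>\<^bsub>E\<^esub> Mu G (FO F X) (FO F Y),
      Eps = FA G (Eps F) \<cdot>\<^bsub>E\<^esub> Eps G\<rparr>"

locale monoidal_transformation =
  fixes C :: "('o, 'a) smc" and D :: "('p, 'b) smc"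
    and F G :: "('o, 'a, 'p, 'b) lax_functor" and \<eta> :: "'o \<Rightarrow> 'b"
  assumes component_hom: "X \<in> Obj C \<Longrightarrow> \<eta> X \<in> Hom D (FO F X) (FO G X)"
    and natural: "f \<in> Hom C X Y \<Longrightarrow> \<eta> Y \<cdot>\<^bsub>D\<^esub> FA F f = FA G f \<cdot>\<^bsub>D\<^esub> \<eta> X"
    and monoidal_Mu:
      "\<lbrakk>X \<in> Obj C; Y \<in> Obj C\<rbrakk>
        \<Longrightarrow> \<eta> (X \<boxtimes>\<^bsub>C\<^esub> Y) \<cdot>\<^bsub>D\<^esub> Mu F X Y = Mu G X Y \<cdot>\<^bsub>D\<^esub> (\<eta> X \<boxdot>\<^bsub>D\<^esub> \<eta> Y)"
    and monoidal_Eps: "\<eta> (Unit C) \<cdot>\<^bsub>D\<^esub> Eps F = Eps G"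


section \<open>Vector spaces inside a fixed type\<close>

text \<open>Vector spaces over \<open>K\<close> are the modules of \<open>HOL-Algebra\<close>; their elements are taken
  from a type \<open>'u\<close>, which bounds the size of the spaces. The usual constructions produce modules
  over other types. They are copied into \<open>'u\<close> along an arbitrary map \<open>small_emb M\<close> that is
  injective on \<open>carrier M\<close> whenever such a map exists; this is always the case below if \<open>'u\<close> is
  infinite and at least as large as \<open>carrier K\<close>.\<close>

definition small_emb :: "('k, 'x) module \<Rightarrow> 'x \<Rightarrow> 'u" where
  "small_emb M = (SOME e. inj_on e (carrier M))"

definition small :: "('k, 'x) module \<Rightarrow> ('k, 'u) module" where
  "small M =
     (let e = small_emb M; e' = the_inv_into (carrier M) e in
      \<lparr>carrier = e ` carrier M, mult = undefined, one = undefined,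
       zero = e \<zero>\<^bsub>M\<^esub>,
       add = \<lambda>a b. e (e' a \<oplus>\<^bsub>M\<^esub> e' b),
       smult = \<lambda>c a. e (c \<odot>\<^bsub>M\<^esub> e' a)\<rparr>)"

definition linear_maps ::
  "('k, 'z) ring_scheme \<Rightarrow> ('k, 'x) module \<Rightarrow> ('k, 'y) module \<Rightarrow> ('x \<Rightarrow> 'y) set" where
  "linear_maps K V W =
     {f. (\<forall>x \<in> carrier V. f x \<in> carrier W) \<and>
         (\<forall>x \<in> carrier V. \<forall>y \<in> carrier V. f (x \<oplus>\<^bsub>V\<^esub> y) = f x \<oplus>\<^bsub>W\<^esub> f y) \<and>
         (\<forall>c \<in> carrier K. \<forall>x \<in> carrier V. f (c \<odot>\<^bsub>V\<^esub> x) = c \<odot>\<^bsub>W\<^esub> f x)}"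

text \<open>The linear map determined by \<open>P\<close> (usually its values on generators). It is
  \<open>undefined\<close> outside \<open>carrier V\<close>, so that equality of maps is equality on \<open>carrier V\<close>.\<close>

definition the_linear ::
  "('k, 'z) ring_scheme \<Rightarrow> ('k, 'x) module \<Rightarrow> ('k, 'y) module \<Rightarrow> (('x \<Rightarrow> 'y) \<Rightarrow> bool)
    \<Rightarrow> 'x \<Rightarrow> 'y" where
  "the_linear K V W P = (THE f. f \<in> linear_maps K V W \<inter> extensional (carrier V) \<and> P f)"

definition ground_module :: "('k, 'z) ring_scheme \<Rightarrow> ('k, 'k) module" where
  "ground_module K =
     \<lparr>carrier = carrier K, mult = undefined, one = undefined,
      zero = \<zero>\<^bsub>K\<^esub>, add = add K, smult = mult K\<rparr>"

definition ext_dsum :: "'i set \<Rightarrow> ('i \<Rightarrow> ('k, 'x) module) \<Rightarrow> ('k, 'i \<Rightarrow> 'x) module" where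
  "ext_dsum I V =
     \<lparr>carrier = {f \<in> \<Pi>\<^sub>E i\<in>I. carrier (V i). finite {i \<in> I. f i \<noteq> \<zero>\<^bsub>V i\<^esub>}},
      mult = undefined, one = undefined,
      zero = \<lambda>i\<in>I. \<zero>\<^bsub>V i\<^esub>,
      add = \<lambda>f g. \<lambda>i\<in>I. f i \<oplus>\<^bsub>V i\<^esub> g i,
      smult = \<lambda>c f. \<lambda>i\<in>I. c \<odot>\<^bsub>V i\<^esub> f i\<rparr>"

definition single :: "'i set \<Rightarrow> ('i \<Rightarrow> ('k, 'x) module) \<Rightarrow> 'i \<Rightarrow> 'x \<Rightarrow> 'i \<Rightarrow> 'x" where
  "single I V i x = (\<lambda>j\<in>I. if j = i then x else \<zero>\<^bsub>V j\<^esub>)"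

definition quot_module :: "('k, 'x) module \<Rightarrow> 'x set \<Rightarrow> ('k, 'x set) module" where
  "quot_module M B =
     \<lparr>carrier = a_rcosets\<^bsub>M\<^esub> B, mult = undefined, one = undefined,
      zero = B,
      add = set_add M,
      smult = \<lambda>c X. \<Union>x\<in>X. B +>\<^bsub>M\<^esub> (c \<odot>\<^bsub>M\<^esub> x)\<rparr>"

definition gen_submodule :: "('k, 'z) ring_scheme \<Rightarrow> ('k, 'x) module \<Rightarrow> 'x set \<Rightarrow> 'x set" where
  "gen_submodule K M S = \<Inter>{N. submodule N K M \<and> S \<subseteq> N}"

definition dsum :: "('i \<Rightarrow> ('k, 'u) module) \<Rightarrow> ('k, 'u) module" where
  "dsum V = small (ext_dsum UNIV V)"

definition dsum_in :: "('i \<Rightarrow> ('k, 'u) module) \<Rightarrow> 'i \<Rightarrow> 'u \<Rightarrow> 'u" where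
  "dsum_in V i x = small_emb (ext_dsum UNIV V) (single UNIV V i x)"

text \<open>The tensor product is the quotient of the free module on the set of pairs by the
  bilinearity relations.\<close>

definition pair_free ::
  "('k, 'z) ring_scheme \<Rightarrow> ('k, 'u) module \<Rightarrow> ('k, 'u) module \<Rightarrow> ('k, 'u \<times> 'u \<Rightarrow> 'k) module" where
  "pair_free K V W = ext_dsum (carrier V \<times> carrier W) (\<lambda>_. ground_module K)"

definition pair_gen ::
  "('k, 'z) ring_scheme \<Rightarrow> ('k, 'u) module \<Rightarrow> ('k, 'u) module \<Rightarrow> 'u \<Rightarrow> 'u \<Rightarrow> 'u \<times> 'u \<Rightarrow> 'k" where
  "pair_gen K V W x y =
     single (carrier V \<times> carrier W) (\<lambda>_. ground_module K) (x, y) \<one>\<^bsub>K\<^esub>"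

definition bilinear_relations ::
  "('k, 'z) ring_scheme \<Rightarrow> ('k, 'u) module \<Rightarrow> ('k, 'u) module \<Rightarrow> ('u \<times> 'u \<Rightarrow> 'k) set" where
  "bilinear_relations K V W =
     (let \<delta> = pair_gen K V W; P = pair_free K V W in
      {\<delta> (x \<oplus>\<^bsub>V\<^esub> x') y \<ominus>\<^bsub>P\<^esub> (\<delta> x y \<oplus>\<^bsub>P\<^esub> \<delta> x' y) | x x' y.
         x \<in> carrier V \<and> x' \<in> carrier V \<and> y \<in> carrier W} \<union>
      {\<delta> x (y \<oplus>\<^bsub>W\<^esub> y') \<ominus>\<^bsub>P\<^esub> (\<delta> x y \<oplus>\<^bsub>P\<^esub> \<delta> x y') | x y y'.
         x \<in> carrier V \<and> y \<in> carrier W \<and> y' \<in> carrier W} \<union>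
      {\<delta> (c \<odot>\<^bsub>V\<^esub> x) y \<ominus>\<^bsub>P\<^esub> c \<odot>\<^bsub>P\<^esub> \<delta> x y | c x y.
         c \<in> carrier K \<and> x \<in> carrier V \<and> y \<in> carrier W} \<union>
      {\<delta> x (c \<odot>\<^bsub>W\<^esub> y) \<ominus>\<^bsub>P\<^esub> c \<odot>\<^bsub>P\<^esub> \<delta> x y | c x y.
         c \<in> carrier K \<and> x \<in> carrier V \<and> y \<in> carrier W})"

definition ext_tensor ::
  "('k, 'z) ring_scheme \<Rightarrow> ('k, 'u) module \<Rightarrow> ('k, 'u) module \<Rightarrow> ('k, ('u \<times> 'u \<Rightarrow> 'k) set) module"
  where
  "ext_tensor K V W =
     quot_module (pair_free K V W) (gen_submodule K (pair_free K V W) (bilinear_relations K V W))"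

definition tensor ::
  "('k, 'z) ring_scheme \<Rightarrow> ('k, 'u) module \<Rightarrow> ('k, 'u) module \<Rightarrow> ('k, 'u) module" where
  "tensor K V W = small (ext_tensor K V W)"

definition pure_tensor ::
  "('k, 'z) ring_scheme \<Rightarrow> ('k, 'u) module \<Rightarrow> ('k, 'u) module \<Rightarrow> 'u \<Rightarrow> 'u \<Rightarrow> 'u" where
  "pure_tensor K V W x y =
     small_emb (ext_tensor K V W)
       (gen_submodule K (pair_free K V W) (bilinear_relations K V W)
          +>\<^bsub>pair_free K V W\<^esub> pair_gen K V W x y)"


section \<open>Chain complexes\<close>

text \<open>Chain complexes in \<open>Vect\<close> and in \<open>grVect\<close> are treated together as complexes graded by an
  abelian group \<open>'g\<close> with a homological degree \<open>hdeg\<close>; the differential shifts the grading by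
  \<open>bdeg\<close>. For \<open>Vect\<close> the grading group is \<open>int\<close>. For \<open>grVect\<close> it is \<open>int \<times> int\<close>, whose elements
  are pairs (homological degree, weight): a complex consists of spaces \<open>sp V (n, p)\<close> and
  differentials \<open>sp V (n, p) \<rightarrow> sp V (n - 1, p)\<close>, and \<open>sp\<close> of a tensor product in degree \<open>(m, p)\<close>
  is the direct sum of the \<open>sp V (n, q) \<otimes> sp W (m - n, p - q)\<close> over all \<open>(n, q)\<close>. The Koszul
  signs only depend on \<open>hdeg\<close>, hence not on the weight.\<close>

class complex_grading = ab_group_add +
  fixes hdeg :: "'a \<Rightarrow> int" and bdeg :: "'a"
  assumes hdeg_add: "hdeg (a + b) = hdeg a + hdeg b"
    and hdeg_bdeg: "hdeg bdeg = - 1"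

instantiation int :: complex_grading
begin

definition hdeg_int :: "int \<Rightarrow> int" where "hdeg_int n = n"
definition bdeg_int :: "int" where "bdeg_int = - 1"

instance by standard (simp_all add: hdeg_int_def bdeg_int_def)

end

instantiation prod :: (complex_grading, ab_group_add) complex_grading
begin

definition hdeg_prod :: "'a \<times> 'b \<Rightarrow> int" where "hdeg_prod n = hdeg (fst n)"
definition bdeg_prod :: "'a \<times> 'b" where "bdeg_prod = (bdeg, 0)"

instance by standard (simp_all add: hdeg_prod_def bdeg_prod_def hdeg_add hdeg_bdeg)

end

record ('g, 'k, 'u) cpx =
  sp :: "'g \<Rightarrow> ('k, 'u) module"
  bd :: "'g \<Rightarrow> 'u \<Rightarrow> 'u"

record ('g, 'k, 'u) cmap =
  src :: "('g, 'k, 'u) cpx"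
  tgt :: "('g, 'k, 'u) cpx"
  fn :: "'g \<Rightarrow> 'u \<Rightarrow> 'u"

definition chain_complex ::
  "('k, 'z) ring_scheme \<Rightarrow> ('g::complex_grading, 'k, 'u) cpx \<Rightarrow> bool" where
  "chain_complex K V \<longleftrightarrow>
     (\<forall>n. module K (sp V n)) \<and>
     (\<forall>n. bd V n \<in> linear_maps K (sp V n) (sp V (n + bdeg))) \<and>
     (\<forall>n. \<forall>x \<in> carrier (sp V n). bd V (n + bdeg) (bd V n x) = \<zero>\<^bsub>sp V (n + bdeg + bdeg)\<^esub>)"

definition chain_map ::
  "('k, 'z) ring_scheme \<Rightarrow> ('g::complex_grading, 'k, 'u) cmap \<Rightarrow> bool" where
  "chain_map K f \<longleftrightarrow>
     chain_complex K (src f) \<and> chain_complex K (tgt f) \<and>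
     (\<forall>n. fn f n \<in> linear_maps K (sp (src f) n) (sp (tgt f) n)
            \<inter> extensional (carrier (sp (src f) n))) \<and>
     (\<forall>n. \<forall>x \<in> carrier (sp (src f) n).
        bd (tgt f) n (fn f n x) = fn f (n + bdeg) (bd (src f) n x))"

definition cmap_id :: "('g, 'k, 'u) cpx \<Rightarrow> ('g, 'k, 'u) cmap" where
  "cmap_id V = \<lparr>src = V, tgt = V, fn = \<lambda>n. \<lambda>x\<in>carrier (sp V n). x\<rparr>"

definition cmap_comp :: "('g, 'k, 'u) cmap \<Rightarrow> ('g, 'k, 'u) cmap \<Rightarrow> ('g, 'k, 'u) cmap" where
  "cmap_comp g f =
     \<lparr>src = src f, tgt = tgt g, fn = \<lambda>n. \<lambda>x\<in>carrier (sp (src f) n). fn g n (fn f n x)\<rparr>"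

definition koszul :: "('k, 'z) ring_scheme \<Rightarrow> int \<Rightarrow> 'k" where
  "koszul K n = (if even n then \<one>\<^bsub>K\<^esub> else \<ominus>\<^bsub>K\<^esub> \<one>\<^bsub>K\<^esub>)"

definition tens_sp ::
  "('k, 'z) ring_scheme \<Rightarrow> ('g::complex_grading, 'k, 'u) cpx \<Rightarrow> ('g, 'k, 'u) cpx
    \<Rightarrow> 'g \<Rightarrow> ('k, 'u) module" where
  "tens_sp K V W m = dsum (\<lambda>n. tensor K (sp V n) (sp W (m - n)))"

text \<open>\<open>ten K V W a b x y\<close> is the element \<open>x \<otimes> y\<close> of degree \<open>a + b\<close>, for \<open>x\<close> of degree \<open>a\<close> and \<open>y\<close>
  of degree \<open>b\<close>.\<close>

definition ten ::
  "('k, 'z) ring_scheme \<Rightarrow> ('g::complex_grading, 'k, 'u) cpx \<Rightarrow> ('g, 'k, 'u) cpx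
    \<Rightarrow> 'g \<Rightarrow> 'g \<Rightarrow> 'u \<Rightarrow> 'u \<Rightarrow> 'u" where
  "ten K V W a b x y =
     dsum_in (\<lambda>n. tensor K (sp V n) (sp W (a + b - n))) a (pure_tensor K (sp V a) (sp W b) x y)"

definition tens_cpx ::
  "('k, 'z) ring_scheme \<Rightarrow> ('g::complex_grading, 'k, 'u) cpx \<Rightarrow> ('g, 'k, 'u) cpx
    \<Rightarrow> ('g, 'k, 'u) cpx" where
  "tens_cpx K V W =
     \<lparr>sp = tens_sp K V W,
      bd = \<lambda>m. the_linear K (tens_sp K V W m) (tens_sp K V W (m + bdeg)) (\<lambda>h.
        \<forall>a b. \<forall>x \<in> carrier (sp V a). \<forall>y \<in> carrier (sp W b). a + b = m \<longrightarrow>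
          h (ten K V W a b x y) =
            ten K V W (a + bdeg) b (bd V a x) y
              \<oplus>\<^bsub>tens_sp K V W (m + bdeg)\<^esub>
            koszul K (hdeg a) \<odot>\<^bsub>tens_sp K V W (m + bdeg)\<^esub> ten K V W a (b + bdeg) x (bd W b y))\<rparr>"

definition tens_cmap ::
  "('k, 'z) ring_scheme \<Rightarrow> ('g::complex_grading, 'k, 'u) cmap \<Rightarrow> ('g, 'k, 'u) cmap
    \<Rightarrow> ('g, 'k, 'u) cmap" where
  "tens_cmap K f g =
     (let V = src f; W = src g; V' = tgt f; W' = tgt g in
      \<lparr>src = tens_cpx K V W, tgt = tens_cpx K V' W',
       fn = \<lambda>m. the_linear K (tens_sp K V W m) (tens_sp K V' W' m) (\<lambda>h.
         \<forall>a b. \<forall>x \<in> carrier (sp V a). \<forall>y \<in> carrier (sp W b). a + b = m \<longrightarrow>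
           h (ten K V W a b x y) = ten K V' W' a b (fn f a x) (fn g b y))\<rparr>)"

definition unit_module ::
  "('k, 'z) ring_scheme \<Rightarrow> 'g::complex_grading \<Rightarrow> ('k, 'k) module" where
  "unit_module K n =
     (ground_module K)\<lparr>carrier := if n = 0 then carrier K else {\<zero>\<^bsub>K\<^esub>}\<rparr>"

definition unit_cpx :: "('k, 'z) ring_scheme \<Rightarrow> ('g::complex_grading, 'k, 'u) cpx" where
  "unit_cpx K =
     \<lparr>sp = \<lambda>n. small (unit_module K n), bd = \<lambda>n x. \<zero>\<^bsub>small (unit_module K (n + bdeg))\<^esub>\<rparr>"

definition unit_elt :: "('k, 'z) ring_scheme \<Rightarrow> 'g::complex_grading itself \<Rightarrow> 'k \<Rightarrow> 'u" where
  "unit_elt K _ c = small_emb (unit_module K (0::'g)) c"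

definition assoc_cmap ::
  "('k, 'z) ring_scheme \<Rightarrow> ('g::complex_grading, 'k, 'u) cpx \<Rightarrow> ('g, 'k, 'u) cpx
    \<Rightarrow> ('g, 'k, 'u) cpx \<Rightarrow> ('g, 'k, 'u) cmap" where
  "assoc_cmap K V W X =
     (let S = tens_cpx K (tens_cpx K V W) X; T = tens_cpx K V (tens_cpx K W X) in
      \<lparr>src = S, tgt = T,
       fn = \<lambda>m. the_linear K (sp S m) (sp T m) (\<lambda>h.
         \<forall>a b c. \<forall>x \<in> carrier (sp V a). \<forall>y \<in> carrier (sp W b). \<forall>z \<in> carrier (sp X c).
           a + b + c = m \<longrightarrow>
           h (ten K (tens_cpx K V W) X (a + b) c (ten K V W a b x y) z) =
             ten K V (tens_cpx K W X) a (b + c) x (ten K W X b c y z))\<rparr>)"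

definition lunit_cmap ::
  "('k, 'z) ring_scheme \<Rightarrow> ('g::complex_grading, 'k, 'u) cpx \<Rightarrow> ('g, 'k, 'u) cmap" where
  "lunit_cmap K V =
     \<lparr>src = tens_cpx K (unit_cpx K) V, tgt = V,
      fn = \<lambda>m. the_linear K (tens_sp K (unit_cpx K) V m) (sp V m) (\<lambda>h.
        \<forall>c \<in> carrier K. \<forall>x \<in> carrier (sp V m).
          h (ten K (unit_cpx K) V 0 m (unit_elt K TYPE('g) c) x) = c \<odot>\<^bsub>sp V m\<^esub> x)\<rparr>"

definition runit_cmap ::
  "('k, 'z) ring_scheme \<Rightarrow> ('g::complex_grading, 'k, 'u) cpx \<Rightarrow> ('g, 'k, 'u) cmap" where
  "runit_cmap K V =
     \<lparr>src = tens_cpx K V (unit_cpx K), tgt = V,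
      fn = \<lambda>m. the_linear K (tens_sp K V (unit_cpx K) m) (sp V m) (\<lambda>h.
        \<forall>c \<in> carrier K. \<forall>x \<in> carrier (sp V m).
          h (ten K V (unit_cpx K) m 0 x (unit_elt K TYPE('g) c)) = c \<odot>\<^bsub>sp V m\<^esub> x)\<rparr>"

definition braid_cmap ::
  "('k, 'z) ring_scheme \<Rightarrow> ('g::complex_grading, 'k, 'u) cpx \<Rightarrow> ('g, 'k, 'u) cpx
    \<Rightarrow> ('g, 'k, 'u) cmap" where
  "braid_cmap K V W =
     \<lparr>src = tens_cpx K V W, tgt = tens_cpx K W V,
      fn = \<lambda>m. the_linear K (tens_sp K V W m) (tens_sp K W V m) (\<lambda>h.
        \<forall>a b. \<forall>x \<in> carrier (sp V a). \<forall>y \<in> carrier (sp W b). a + b = m \<longrightarrow>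
          h (ten K V W a b x y) =
            koszul K (hdeg a * hdeg b) \<odot>\<^bsub>tens_sp K W V m\<^esub> ten K W V b a y x)\<rparr>"

definition complexes ::
  "('k, 'z) ring_scheme \<Rightarrow> (('g::complex_grading, 'k, 'u) cpx, ('g, 'k, 'u) cmap) smc" where
  "complexes K =
     \<lparr>Obj = {V. chain_complex K V},
      Arr = {f. chain_map K f},
      Dom = src, Cod = tgt, Id = cmap_id, Comp = cmap_comp,
      TensO = tens_cpx K, TensA = tens_cmap K, Unit = unit_cpx K,
      Assoc = assoc_cmap K, LUnit = lunit_cmap K, RUnit = runit_cmap K, Braid = braid_cmap K\<rparr>"

definition Ch :: "('k, 'z) ring_scheme \<Rightarrow> ((int, 'k, 'u) cpx, (int, 'k, 'u) cmap) smc" where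
  "Ch K = complexes K"

definition Ch_grVect ::
  "('k, 'z) ring_scheme \<Rightarrow> ((int \<times> int, 'k, 'u) cpx, (int \<times> int, 'k, 'u) cmap) smc" where
  "Ch_grVect K = complexes K"


section \<open>Homology\<close>

definition cycles :: "('g::complex_grading, 'k, 'u) cpx \<Rightarrow> 'g \<Rightarrow> 'u set" where
  "cycles V n = {x \<in> carrier (sp V n). bd V n x = \<zero>\<^bsub>sp V (n + bdeg)\<^esub>}"

definition boundaries :: "('g::complex_grading, 'k, 'u) cpx \<Rightarrow> 'g \<Rightarrow> 'u set" where
  "boundaries V n = bd V (n - bdeg) ` carrier (sp V (n - bdeg))"

definition homology :: "('g::complex_grading, 'k, 'u) cpx \<Rightarrow> 'g \<Rightarrow> ('k, 'u set) module" where
  "homology V n = quot_module ((sp V n)\<lparr>carrier := cycles V n\<rparr>) (boundaries V n)"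

definition H_cpx :: "('g::complex_grading, 'k, 'u) cpx \<Rightarrow> ('g, 'k, 'u) cpx" where
  "H_cpx V =
     \<lparr>sp = \<lambda>n. small (homology V n), bd = \<lambda>n x. \<zero>\<^bsub>small (homology V (n + bdeg))\<^esub>\<rparr>"

definition H_class :: "('g::complex_grading, 'k, 'u) cpx \<Rightarrow> 'g \<Rightarrow> 'u \<Rightarrow> 'u" where
  "H_class V n x = small_emb (homology V n) (boundaries V n +>\<^bsub>sp V n\<^esub> x)"

definition H_cmap ::
  "('k, 'z) ring_scheme \<Rightarrow> ('g::complex_grading, 'k, 'u) cmap \<Rightarrow> ('g, 'k, 'u) cmap" where
  "H_cmap K f =
     \<lparr>src = H_cpx (src f), tgt = H_cpx (tgt f),
      fn = \<lambda>n. the_linear K (sp (H_cpx (src f)) n) (sp (H_cpx (tgt f)) n) (\<lambda>h.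
        \<forall>x \<in> cycles (src f) n. h (H_class (src f) n x) = H_class (tgt f) n (fn f n x))\<rparr>"

definition kunneth ::
  "('k, 'z) ring_scheme \<Rightarrow> ('g::complex_grading, 'k, 'u) cpx \<Rightarrow> ('g, 'k, 'u) cpx
    \<Rightarrow> ('g, 'k, 'u) cmap" where
  "kunneth K V W =
     (let S = tens_cpx K (H_cpx V) (H_cpx W); T = H_cpx (tens_cpx K V W) in
      \<lparr>src = S, tgt = T,
       fn = \<lambda>m. the_linear K (sp S m) (sp T m) (\<lambda>h.
         \<forall>a b. \<forall>x \<in> cycles V a. \<forall>y \<in> cycles W b. a + b = m \<longrightarrow>
           h (ten K (H_cpx V) (H_cpx W) a b (H_class V a x) (H_class W b y)) =
             H_class (tens_cpx K V W) m (ten K V W a b x y))\<rparr>)"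

definition H_functor ::
  "('k, 'z) ring_scheme \<Rightarrow>
    ((int, 'k, 'u) cpx, (int, 'k, 'u) cmap, (int, 'k, 'u) cpx, (int, 'k, 'u) cmap) lax_functor"
  where
  "H_functor K =
     \<lparr>FO = H_cpx, FA = H_cmap K, Mu = kunneth K,
      Eps =
        \<lparr>src = unit_cpx K, tgt = H_cpx (unit_cpx K),
         fn = \<lambda>n. the_linear K (sp (unit_cpx K) n) (sp (H_cpx (unit_cpx K)) n) (\<lambda>h.
           \<forall>x \<in> carrier (sp (unit_cpx K) n). h x = H_class (unit_cpx K) n x)\<rparr>\<rparr>"

definition quasi_iso ::
  "('k, 'z) ring_scheme \<Rightarrow> ('g::complex_grading, 'k, 'u) cmap \<Rightarrow> bool" where
  "quasi_iso K f \<longleftrightarrow>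
     chain_map K f \<and>
     (\<forall>n. bij_betw (fn (H_cmap K f) n) (carrier (sp (H_cpx (src f)) n))
                   (carrier (sp (H_cpx (tgt f)) n)))"

definition pure_homology :: "(int \<times> int, 'k, 'u) cpx \<Rightarrow> bool" where
  "pure_homology V \<longleftrightarrow>
     (\<forall>n p. p \<noteq> n \<longrightarrow> carrier (homology V (n, p)) = {\<zero>\<^bsub>homology V (n, p)\<^esub>})"

definition Ch_grVect_pure ::
  "('k, 'z) ring_scheme \<Rightarrow> ((int \<times> int, 'k, 'u) cpx, (int \<times> int, 'k, 'u) cmap) smc" where
  "Ch_grVect_pure K = full_subcategory (Ch_grVect K) pure_homology"


section \<open>Forgetting the weight\<close>

definition U_sp :: "(int \<times> int, 'k, 'u) cpx \<Rightarrow> int \<Rightarrow> ('k, 'u) module" where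
  "U_sp V n = dsum (\<lambda>p. sp V (n, p))"

definition U_in :: "(int \<times> int, 'k, 'u) cpx \<Rightarrow> int \<Rightarrow> int \<Rightarrow> 'u \<Rightarrow> 'u" where
  "U_in V n p x = dsum_in (\<lambda>q. sp V (n, q)) p x"

definition U_cpx ::
  "('k, 'z) ring_scheme \<Rightarrow> (int \<times> int, 'k, 'u) cpx \<Rightarrow> (int, 'k, 'u) cpx" where
  "U_cpx K V =
     \<lparr>sp = U_sp V,
      bd = \<lambda>n. the_linear K (U_sp V n) (U_sp V (n + bdeg)) (\<lambda>h.
        \<forall>p. \<forall>x \<in> carrier (sp V (n, p)). h (U_in V n p x) = U_in V (n + bdeg) p (bd V (n, p) x))\<rparr>"

definition U_cmap ::
  "('k, 'z) ring_scheme \<Rightarrow> (int \<times> int, 'k, 'u) cmap \<Rightarrow> (int, 'k, 'u) cmap" where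
  "U_cmap K f =
     \<lparr>src = U_cpx K (src f), tgt = U_cpx K (tgt f),
      fn = \<lambda>n. the_linear K (U_sp (src f) n) (U_sp (tgt f) n) (\<lambda>h.
        \<forall>p. \<forall>x \<in> carrier (sp (src f) (n, p)).
          h (U_in (src f) n p x) = U_in (tgt f) n p (fn f (n, p) x))\<rparr>"

definition U_mu ::
  "('k, 'z) ring_scheme \<Rightarrow> (int \<times> int, 'k, 'u) cpx \<Rightarrow> (int \<times> int, 'k, 'u) cpx
    \<Rightarrow> (int, 'k, 'u) cmap" where
  "U_mu K V W =
     (let S = tens_cpx K (U_cpx K V) (U_cpx K W); T = U_cpx K (tens_cpx K V W) in
      \<lparr>src = S, tgt = T,
       fn = \<lambda>m. the_linear K (sp S m) (sp T m) (\<lambda>h.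
         \<forall>a b p q. \<forall>x \<in> carrier (sp V (a, p)). \<forall>y \<in> carrier (sp W (b, q)). a + b = m \<longrightarrow>
           h (ten K (U_cpx K V) (U_cpx K W) a b (U_in V a p x) (U_in W b q y)) =
             U_in (tens_cpx K V W) m (p + q) (ten K V W (a, p) (b, q) x y))\<rparr>)"

definition U_eps :: "('k, 'z) ring_scheme \<Rightarrow> (int, 'k, 'u) cmap" where
  "U_eps K =
     \<lparr>src = unit_cpx K, tgt = U_cpx K (unit_cpx K),
      fn = \<lambda>n. the_linear K (sp (unit_cpx K) n) (U_sp (unit_cpx K) n) (\<lambda>h.
        n = 0 \<longrightarrow> (\<forall>c \<in> carrier K.
          h (unit_elt K TYPE(int) c) = U_in (unit_cpx K) 0 0 (unit_elt K TYPE(int \<times> int) c)))\<rparr>"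

definition U_functor ::
  "('k, 'z) ring_scheme \<Rightarrow>
    ((int \<times> int, 'k, 'u) cpx, (int \<times> int, 'k, 'u) cmap, (int, 'k, 'u) cpx, (int, 'k, 'u) cmap)
      lax_functor" where
  "U_functor K = \<lparr>FO = U_cpx K, FA = U_cmap K, Mu = U_mu K, Eps = U_eps K\<rparr>"


section \<open>Weak equivalence and formality\<close>

definition weq_step ::
  "('k, 'z) ring_scheme \<Rightarrow> ('o, 'a) smc
    \<Rightarrow> ('o, 'a, (int, 'k, 'u) cpx, (int, 'k, 'u) cmap) lax_functor
    \<Rightarrow> ('o, 'a, (int, 'k, 'u) cpx, (int, 'k, 'u) cmap) lax_functor \<Rightarrow> bool" where
  "weq_step K C F G \<longleftrightarrow>
     lax_symmetric_monoidal_functor C (Ch K) F \<and>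
     lax_symmetric_monoidal_functor C (Ch K) G \<and>
     (\<exists>\<eta>. monoidal_transformation C (Ch K) F G \<eta> \<and> (\<forall>X \<in> Obj C. quasi_iso K (\<eta> X)))"

definition weakly_equivalent ::
  "('k, 'z) ring_scheme \<Rightarrow> ('o, 'a) smc
    \<Rightarrow> ('o, 'a, (int, 'k, 'u) cpx, (int, 'k, 'u) cmap) lax_functor
    \<Rightarrow> ('o, 'a, (int, 'k, 'u) cpx, (int, 'k, 'u) cmap) lax_functor \<Rightarrow> bool" where
  "weakly_equivalent K C F G \<longleftrightarrow>
     lax_symmetric_monoidal_functor C (Ch K) F \<and>
     lax_symmetric_monoidal_functor C (Ch K) G \<and>
     equivclp (weq_step K C) F G"

definition formal ::
  "('k, 'z) ring_scheme \<Rightarrow> ('o, 'a) smc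
    \<Rightarrow> ('o, 'a, (int, 'k, 'u) cpx, (int, 'k, 'u) cmap) lax_functor \<Rightarrow> bool" where
  "formal K C F \<longleftrightarrow> weakly_equivalent K C F (lax_comp (Ch K) (H_functor K) F)"

end

theory Submission
  imports "HOL-Library.Countable" Defs
begin

text \<open>
  A lax symmetric monoidal functor to complexes is a functor with bilinear multiplications
  \<open>mul F X Y a b\<close> and a unit element \<open>one_elt F\<close> subject to laws between elements, and such laws
  can be pulled back along injective natural maps that preserve \<open>mul\<close> and \<open>one_elt\<close>.

  If \<open>F\<close> is formal, give \<open>H n (F X)\<close> the weight \<open>n\<close>. This turns \<open>H \<circ> F\<close> into a lax functor \<open>G\<close> to
  complexes with pure homology, and \<open>U \<circ> G\<close> is isomorphic to \<open>H \<circ> F\<close>. Conversely, let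
  \<open>F' = U \<circ> G\<close> with \<open>G\<close> pure. The part of weight \<open>p\<close> of \<open>G X\<close> only has homology in degree \<open>p\<close>, so its
  truncation in degrees \<open>\<ge> p\<close> (cycles in degree \<open>p\<close>, everything above) has the same homology
  and maps to it by taking classes in degree \<open>p\<close>. The truncations are closed under
  multiplication, hence form a lax functor \<open>T\<close> with quasi-isomorphisms from \<open>T\<close> to \<open>F'\<close> and from \<open>T\<close> to
  \<open>H \<circ> F'\<close>. Finally \<open>H\<close> preserves weak equivalences.
\<close>

section \<open>Linear maps and spanning sets\<close>

text \<open>A complex and its homology are rarely joined by a natural chain map: taking classes is
  only defined on cycles. Purity offers a subfunctor on which it is defined. In degree n, weights
  above n are dropped and in weight n only cycles are kept; a weight below n contributes no homology
  in degree n, so its components may be sent to 0. The bound weight \<le> degree is also what makes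
  this multiplicative: if p \<le> a, q \<le> b and p + q = a + b, then p = a and q = b, so the
  diagonal component of a product is the product of the diagonal components.

  The length of the proof comes from the encoding. Structure maps are definite descriptions
  \<open>the_linear\<close>, which denote something useful only when a linear map with the
  prescribed values exists and the generators concerned span. All modules are copied into
  \<open>'u\<close> by \<open>small_emb\<close>, which is injective only if some injection exists.
  Hence each construction needs a spanning set, a universal property and a cardinality bound before
  anything can be computed with it.\<close>

context cring
begin

lemma module_add_closed [simp]:
  "\<lbrakk>module R M; x \<in> carrier M; y \<in> carrier M\<rbrakk> \<Longrightarrow> x \<oplus>\<^bsub>M\<^esub> y \<in> carrier M"
  by (simp add: module.axioms(2) abelian_groupE(1))

lemma module_zero_closed [simp]: "module R M \<Longrightarrow> \<zero>\<^bsub>M\<^esub> \<in> carrier M"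
  by (simp add: module.axioms(2) abelian_groupE(2))

lemma module_smult_closed [simp]:
  "\<lbrakk>module R M; c \<in> carrier R; x \<in> carrier M\<rbrakk> \<Longrightarrow> c \<odot>\<^bsub>M\<^esub> x \<in> carrier M"
  by (rule module.smult_closed)

lemma module_minus_closed [simp]: "\<lbrakk>module R M; x \<in> carrier M\<rbrakk> \<Longrightarrow> \<ominus>\<^bsub>M\<^esub> x \<in> carrier M"
  by (meson module.axioms(2) abelian_group.a_inv_closed)

lemma module_diff_closed [simp]:
  "\<lbrakk>module R M; x \<in> carrier M; y \<in> carrier M\<rbrakk> \<Longrightarrow> x \<ominus>\<^bsub>M\<^esub> y \<in> carrier M"
  by (simp add: a_minus_def)

lemma module_l_zero [simp]: "\<lbrakk>module R M; x \<in> carrier M\<rbrakk> \<Longrightarrow> \<zero>\<^bsub>M\<^esub> \<oplus>\<^bsub>M\<^esub> x = x"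
  by (simp add: module.axioms(2) abelian_groupE(5))

lemma module_add_comm:
  "\<lbrakk>module R M; x \<in> carrier M; y \<in> carrier M\<rbrakk> \<Longrightarrow> x \<oplus>\<^bsub>M\<^esub> y = y \<oplus>\<^bsub>M\<^esub> x"
  by (simp add: module.axioms(2) abelian_groupE(4))

lemma module_r_zero [simp]: "\<lbrakk>module R M; x \<in> carrier M\<rbrakk> \<Longrightarrow> x \<oplus>\<^bsub>M\<^esub> \<zero>\<^bsub>M\<^esub> = x"
  using module_add_comm module_l_zero module_zero_closed by metis

lemma module_add_assoc:
  "\<lbrakk>module R M; x \<in> carrier M; y \<in> carrier M; z \<in> carrier M\<rbrakk>
    \<Longrightarrow> (x \<oplus>\<^bsub>M\<^esub> y) \<oplus>\<^bsub>M\<^esub> z = x \<oplus>\<^bsub>M\<^esub> (y \<oplus>\<^bsub>M\<^esub> z)"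
  by (simp add: module.axioms(2) abelian_groupE(3))

lemma module_add_left_comm:
  "\<lbrakk>module R M; x \<in> carrier M; y \<in> carrier M; z \<in> carrier M\<rbrakk>
    \<Longrightarrow> x \<oplus>\<^bsub>M\<^esub> (y \<oplus>\<^bsub>M\<^esub> z) = y \<oplus>\<^bsub>M\<^esub> (x \<oplus>\<^bsub>M\<^esub> z)"
  by (simp add: module_add_assoc[symmetric] module_add_comm[of M x y])

lemmas module_add_ac = module_add_assoc module_add_comm module_add_left_comm

lemma module_neg_unique:
  assumes "module R M" "x \<in> carrier M" "y \<in> carrier M" "y \<oplus>\<^bsub>M\<^esub> x = \<zero>\<^bsub>M\<^esub>"
  shows "\<ominus>\<^bsub>M\<^esub> x = y"
  by (rule abelian_group.minus_equality[OF module.axioms(2)[OF assms(1)] assms(4,2,3)])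

lemma module_neg_eq_smult:
  "\<lbrakk>module R M; x \<in> carrier M\<rbrakk> \<Longrightarrow> \<ominus>\<^bsub>M\<^esub> x = (\<ominus> \<one>) \<odot>\<^bsub>M\<^esub> x"
  by (simp add: module.smult_l_minus module.smult_one)

lemma module_add_neg [simp]: "\<lbrakk>module R M; x \<in> carrier M\<rbrakk> \<Longrightarrow> x \<oplus>\<^bsub>M\<^esub> \<ominus>\<^bsub>M\<^esub> x = \<zero>\<^bsub>M\<^esub>"
  by (meson module.axioms(2) abelian_group.r_neg)

lemma module_diff_self [simp]: "\<lbrakk>module R M; x \<in> carrier M\<rbrakk> \<Longrightarrow> x \<ominus>\<^bsub>M\<^esub> x = \<zero>\<^bsub>M\<^esub>"
  by (simp add: a_minus_def)

lemma module_diff_add: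
  "\<lbrakk>module R M; x \<in> carrier M; y \<in> carrier M\<rbrakk> \<Longrightarrow> (x \<ominus>\<^bsub>M\<^esub> y) \<oplus>\<^bsub>M\<^esub> y = x"
  by (simp add: a_minus_def module_add_assoc module_add_comm[of M "\<ominus>\<^bsub>M\<^esub> y" y])

lemma module_diff_eq_zero_iff:
  "\<lbrakk>module R M; x \<in> carrier M; y \<in> carrier M\<rbrakk> \<Longrightarrow> x \<ominus>\<^bsub>M\<^esub> y = \<zero>\<^bsub>M\<^esub> \<longleftrightarrow> x = y"
  using module_diff_add[of M x y] by auto

lemma module_smult_zero [simp]: "\<lbrakk>module R M; c \<in> carrier R\<rbrakk> \<Longrightarrow> c \<odot>\<^bsub>M\<^esub> \<zero>\<^bsub>M\<^esub> = \<zero>\<^bsub>M\<^esub>"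
  by (rule module.smult_r_null)

lemma module_zero_smult [simp]: "\<lbrakk>module R M; x \<in> carrier M\<rbrakk> \<Longrightarrow> \<zero> \<odot>\<^bsub>M\<^esub> x = \<zero>\<^bsub>M\<^esub>"
  by (rule module.smult_l_null)

lemma module_one_smult [simp]: "\<lbrakk>module R M; x \<in> carrier M\<rbrakk> \<Longrightarrow> \<one> \<odot>\<^bsub>M\<^esub> x = x"
  by (rule module.smult_one)

lemma linear_mapsI:
  assumes "\<And>x. x \<in> carrier V \<Longrightarrow> f x \<in> carrier W"
    and "\<And>x y. \<lbrakk>x \<in> carrier V; y \<in> carrier V\<rbrakk> \<Longrightarrow> f (x \<oplus>\<^bsub>V\<^esub> y) = f x \<oplus>\<^bsub>W\<^esub> f y"
    and "\<And>c x. \<lbrakk>c \<in> carrier R; x \<in> carrier V\<rbrakk> \<Longrightarrow> f (c \<odot>\<^bsub>V\<^esub> x) = c \<odot>\<^bsub>W\<^esub> f x"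
  shows "f \<in> linear_maps R V W"
  using assms by (simp add: linear_maps_def)

lemma linear_closed: "\<lbrakk>f \<in> linear_maps R V W; x \<in> carrier V\<rbrakk> \<Longrightarrow> f x \<in> carrier W"
  by (simp add: linear_maps_def)

lemma linear_add:
  "\<lbrakk>f \<in> linear_maps R V W; x \<in> carrier V; y \<in> carrier V\<rbrakk> \<Longrightarrow> f (x \<oplus>\<^bsub>V\<^esub> y) = f x \<oplus>\<^bsub>W\<^esub> f y"
  by (simp add: linear_maps_def)

lemma linear_smult:
  "\<lbrakk>f \<in> linear_maps R V W; c \<in> carrier R; x \<in> carrier V\<rbrakk> \<Longrightarrow> f (c \<odot>\<^bsub>V\<^esub> x) = c \<odot>\<^bsub>W\<^esub> f x"
  by (simp add: linear_maps_def)

lemma linear_zero: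
  assumes "f \<in> linear_maps R V W" "module R V" "module R W"
  shows "f \<zero>\<^bsub>V\<^esub> = \<zero>\<^bsub>W\<^esub>"
  using linear_smult[OF assms(1) zero_closed module_zero_closed[OF assms(2)]]
    linear_closed[OF assms(1) module_zero_closed[OF assms(2)]] assms
  by simp

lemma linear_neg:
  assumes "f \<in> linear_maps R V W" "module R V" "module R W" "x \<in> carrier V"
  shows "f (\<ominus>\<^bsub>V\<^esub> x) = \<ominus>\<^bsub>W\<^esub> f x"
  using assms by (simp add: module_neg_eq_smult linear_closed[OF assms(1)] linear_smult[OF assms(1)])

lemma linear_diff:
  assumes "f \<in> linear_maps R V W" "module R V" "module R W" "x \<in> carrier V" "y \<in> carrier V"
  shows "f (x \<ominus>\<^bsub>V\<^esub> y) = f x \<ominus>\<^bsub>W\<^esub> f y"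
  using assms by (simp add: a_minus_def linear_add[OF assms(1)] linear_neg[OF assms(1)])

lemma linear_comp:
  "\<lbrakk>f \<in> linear_maps R V W; g \<in> linear_maps R W X\<rbrakk> \<Longrightarrow> (\<lambda>x. g (f x)) \<in> linear_maps R V X"
  by (simp add: linear_maps_def)

lemma linear_cong:
  assumes "f \<in> linear_maps R V W" "module R V" "\<And>x. x \<in> carrier V \<Longrightarrow> g x = f x"
  shows "g \<in> linear_maps R V W"
  using assms by (simp add: linear_maps_def)

lemma linear_restrict:
  "\<lbrakk>f \<in> linear_maps R V W; module R V\<rbrakk> \<Longrightarrow> restrict f (carrier V) \<in> linear_maps R V W"
  by (simp add: linear_maps_def)

lemma linear_zero_map: "module R W \<Longrightarrow> (\<lambda>x. \<zero>\<^bsub>W\<^esub>) \<in> linear_maps R V W"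
  by (simp add: linear_maps_def)

lemma linear_id: "(\<lambda>x. x) \<in> linear_maps R V V"
  by (simp add: linear_maps_def)

lemma linear_sum:
  assumes W: "module R W" and "f \<in> linear_maps R V W" "g \<in> linear_maps R V W"
  shows "(\<lambda>x. f x \<oplus>\<^bsub>W\<^esub> g x) \<in> linear_maps R V W"
  using assms by (intro linear_mapsI) (auto simp: linear_maps_def module_add_ac module.smult_r_distr)

lemma linear_scale:
  assumes W: "module R W" and f: "f \<in> linear_maps R V W" and c: "c \<in> carrier R"
  shows "(\<lambda>x. c \<odot>\<^bsub>W\<^esub> f x) \<in> linear_maps R V W"
proof (rule linear_mapsI)
  fix d x assume "d \<in> carrier R" "x \<in> carrier V"
  then show "c \<odot>\<^bsub>W\<^esub> f (d \<odot>\<^bsub>V\<^esub> x) = d \<odot>\<^bsub>W\<^esub> (c \<odot>\<^bsub>W\<^esub> f x)"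
    using W c by (simp add: linear_smult[OF f] linear_closed[OF f] module.smult_assoc1[symmetric] m_comm)
qed (use assms in \<open>auto simp: linear_maps_def module.smult_r_distr\<close>)

text \<open>Phrased as an induction principle, with no linear combinations: arguments about
  generators become rule inductions, and spanning sets can be replaced one layer at a time without
  handling finite sums.\<close>

definition spans :: "('a, 'x) module \<Rightarrow> 'x set \<Rightarrow> bool" where
  "spans M S \<longleftrightarrow> S \<subseteq> carrier M \<and>
     (\<forall>N \<subseteq> carrier M. S \<subseteq> N \<and> \<zero>\<^bsub>M\<^esub> \<in> N \<and> (\<forall>x \<in> N. \<forall>y \<in> N. x \<oplus>\<^bsub>M\<^esub> y \<in> N) \<and>
        (\<forall>c \<in> carrier R. \<forall>x \<in> N. c \<odot>\<^bsub>M\<^esub> x \<in> N) \<longrightarrow> N = carrier M)"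

lemma spans_subset: "spans M S \<Longrightarrow> S \<subseteq> carrier M"
  by (simp add: spans_def)

lemma spans_induct [consumes 3, case_names zero add smult gen]:
  assumes "spans M S" and M: "module R M" and x: "x \<in> carrier M"
    and "P \<zero>\<^bsub>M\<^esub>"
    and "\<And>x y. \<lbrakk>x \<in> carrier M; y \<in> carrier M; P x; P y\<rbrakk> \<Longrightarrow> P (x \<oplus>\<^bsub>M\<^esub> y)"
    and "\<And>c x. \<lbrakk>c \<in> carrier R; x \<in> carrier M; P x\<rbrakk> \<Longrightarrow> P (c \<odot>\<^bsub>M\<^esub> x)"
    and "\<And>s. s \<in> S \<Longrightarrow> P s"
  shows "P x"
proof -
  have "{x \<in> carrier M. P x} = carrier M"
    using assms(1) unfolding spans_def
    by (elim conjE allE[where x = "{x \<in> carrier M. P x}"] impE) (use assms in auto)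
  then show ?thesis using x by blast
qed

text \<open>Induction over \<open>M\<close> for the property of being mapped into \<open>L\<close>;
  surjectivity turns this into a statement about all of \<open>N\<close>. It carries generators of
  free modules and direct sums over to their quotients and their copies in
  \<open>'u\<close>.\<close>

lemma spans_image:
  assumes S: "spans M S" and f: "f \<in> linear_maps R M N" and M: "module R M" and N: "module R N"
    and surj: "f ` carrier M = carrier N"
  shows "spans N (f ` S)"
  unfolding spans_def
proof (intro conjI allI impI)
  show "f ` S \<subseteq> carrier N"
    using spans_subset[OF S] linear_closed[OF f] by blast
  fix L assume L: "L \<subseteq> carrier N" and *: "f ` S \<subseteq> L \<and> \<zero>\<^bsub>N\<^esub> \<in> L \<and> (\<forall>x\<in>L. \<forall>y\<in>L. x \<oplus>\<^bsub>N\<^esub> y \<in> L) \<and>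
        (\<forall>c \<in> carrier R. \<forall>x \<in> L. c \<odot>\<^bsub>N\<^esub> x \<in> L)"
  have "f x \<in> L" if "x \<in> carrier M" for x
    using S M that
    by (induction rule: spans_induct)
      (use * M in \<open>auto simp: linear_add[OF f] linear_smult[OF f] linear_zero[OF f M N]\<close>)
  then have "f ` carrier M \<subseteq> L" by blast
  with L show "L = carrier N"
    unfolding surj by blast
qed

text \<open>Serves to reduce equations between linear maps to elementary tensors, to homogeneous
  elements or to the generator of the unit.\<close>

lemma linear_eq_on_spans:
  assumes S: "spans V S" and V: "module R V" and W: "module R W"
    and f: "f \<in> linear_maps R V W" and g: "g \<in> linear_maps R V W"
    and eq: "\<And>s. s \<in> S \<Longrightarrow> f s = g s" and x: "x \<in> carrier V"
  shows "f x = g x"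
  using S V x
  by (induction rule: spans_induct)
    (use V eq in \<open>auto simp: linear_add[OF f] linear_smult[OF f] linear_zero[OF f V W]
        linear_add[OF g] linear_smult[OF g] linear_zero[OF g V W]\<close>)

lemma extensional_linear_eq_on_spans:
  assumes S: "spans V S" and V: "module R V" and W: "module R W"
    and f: "f \<in> linear_maps R V W \<inter> extensional (carrier V)"
    and g: "g \<in> linear_maps R V W \<inter> extensional (carrier V)"
    and eq: "\<And>s. s \<in> S \<Longrightarrow> f s = g s"
  shows "f = g"
proof (rule extensionalityI)
  show "f \<in> extensional (carrier V)" "g \<in> extensional (carrier V)"
    using f g by auto
qed (use linear_eq_on_spans[OF S V W] f g eq in blast)

text \<open>Turns a definite description into a computable map. The map \<open>f\<close> supplies
  existence, \<open>spans\<close> supplies uniqueness among extensional linear maps, and the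
  hypothesis on \<open>P\<close> says that the description prescribes exactly the values of
  \<open>f\<close> on \<open>S\<close>.\<close>

lemma the_linear_spans:
  assumes S: "spans V S" and V: "module R V" and W: "module R W"
    and f: "f \<in> linear_maps R V W"
    and P: "\<And>h. P h \<longleftrightarrow> (\<forall>s \<in> S. h s = f s)"
  shows "the_linear R V W P \<in> linear_maps R V W"
    and "the_linear R V W P \<in> extensional (carrier V)"
    and "x \<in> carrier V \<Longrightarrow> the_linear R V W P x = f x"
proof -
  let ?g = "restrict f (carrier V)"
  have S': "S \<subseteq> carrier V"
    using S by (rule spans_subset)
  have g: "?g \<in> linear_maps R V W \<inter> extensional (carrier V)"
    using linear_restrict[OF f V] by simp
  have "the_linear R V W P = ?g"
    unfolding the_linear_def
  proof (rule the_equality)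
    show "?g \<in> linear_maps R V W \<inter> extensional (carrier V) \<and> P ?g"
      using g S' by (auto simp: P)
    fix h assume "h \<in> linear_maps R V W \<inter> extensional (carrier V) \<and> P h"
    then show "h = ?g"
      using S' by (intro extensional_linear_eq_on_spans[OF S V W _ g]) (auto simp: P subset_iff)
  qed
  then show "the_linear R V W P \<in> linear_maps R V W"
    "the_linear R V W P \<in> extensional (carrier V)"
    "x \<in> carrier V \<Longrightarrow> the_linear R V W P x = f x"
    using g by auto
qed

lemma linear_factor:
  assumes V: "module R V" and Q: "module R Q" and W: "module R W"
    and p: "p \<in> linear_maps R V Q" and surj: "p ` carrier V = carrier Q"
    and f: "f \<in> linear_maps R V W"
    and ker: "\<And>x. \<lbrakk>x \<in> carrier V; p x = \<zero>\<^bsub>Q\<^esub>\<rbrakk> \<Longrightarrow> f x = \<zero>\<^bsub>W\<^esub>"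
  obtains g where "g \<in> linear_maps R Q W" "\<And>x. x \<in> carrier V \<Longrightarrow> g (p x) = f x"
proof -
  \<comment> \<open>An arbitrary preimage is taken; two preimages differ by an element of the kernel
    of \<open>p\<close>, on which \<open>f\<close> vanishes, so the choice does not matter on
    \<open>carrier Q\<close>.\<close>
  define g where "g q = f (SOME x. x \<in> carrier V \<and> p x = q)" for q
  have g: "g (p x) = f x" if x: "x \<in> carrier V" for x
  proof -
    define y where "y = (SOME y. y \<in> carrier V \<and> p y = p x)"
    have y: "y \<in> carrier V \<and> p y = p x"
      unfolding y_def by (rule someI[where x = x]) (use x in simp)
    have "f (y \<ominus>\<^bsub>V\<^esub> x) = \<zero>\<^bsub>W\<^esub>"
      using x y V Q by (intro ker) (auto simp: linear_diff[OF p] linear_closed[OF p])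
    then show ?thesis
      using x y V W by (simp add: g_def y_def[symmetric] linear_diff[OF f] linear_closed[OF f]
          module_diff_eq_zero_iff)
  qed
  have Q': "\<exists>x. x \<in> carrier V \<and> q = p x" if "q \<in> carrier Q" for q
    using that surj by blast
  have "g \<in> linear_maps R Q W"
  proof (rule linear_mapsI)
    show "g q \<in> carrier W" if "q \<in> carrier Q" for q
      using Q'[OF that] g by (auto simp: linear_closed[OF f])
    show "g (q \<oplus>\<^bsub>Q\<^esub> r) = g q \<oplus>\<^bsub>W\<^esub> g r" if "q \<in> carrier Q" "r \<in> carrier Q" for q r
      using Q'[OF that(1)] Q'[OF that(2)] g V
      by (auto simp flip: linear_add[OF p] simp: linear_add[OF f])
    show "g (c \<odot>\<^bsub>Q\<^esub> q) = c \<odot>\<^bsub>W\<^esub> g q" if "c \<in> carrier R" "q \<in> carrier Q" for c q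
      using Q'[OF that(2)] g V that(1)
      by (auto simp flip: linear_smult[OF p] simp: linear_smult[OF f])
  qed
  with g show ?thesis by (rule that[rotated])
qed

text \<open>\<open>N\<close> need not be known to be a group: its axioms come from \<open>M\<close> through \<open>f\<close>.\<close>

lemma module_surj:
  assumes M: "module R M" and surj: "f ` carrier M = carrier N"
    and add: "\<And>x y. \<lbrakk>x \<in> carrier M; y \<in> carrier M\<rbrakk> \<Longrightarrow> f (x \<oplus>\<^bsub>M\<^esub> y) = f x \<oplus>\<^bsub>N\<^esub> f y"
    and smult: "\<And>c x. \<lbrakk>c \<in> carrier R; x \<in> carrier M\<rbrakk> \<Longrightarrow> f (c \<odot>\<^bsub>M\<^esub> x) = c \<odot>\<^bsub>N\<^esub> f x"
    and zero: "f \<zero>\<^bsub>M\<^esub> = \<zero>\<^bsub>N\<^esub>"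
  shows "module R N"
proof -
  have N: "\<exists>x' \<in> carrier M. x = f x'" if "x \<in> carrier N" for x
    using that surj by blast
  have closed: "f x \<in> carrier N" if "x \<in> carrier M" for x
    using that surj by blast
  note r = add[symmetric] smult[symmetric] zero[symmetric]
  show ?thesis
  proof (rule moduleI)
    show "cring R" by (rule is_cring)
    show "abelian_group N"
    proof (rule abelian_groupI)
      show "x \<oplus>\<^bsub>N\<^esub> y \<in> carrier N" if "x \<in> carrier N" "y \<in> carrier N" for x y
        using N[OF that(1)] N[OF that(2)] by (auto simp: r M closed)
      show "\<zero>\<^bsub>N\<^esub> \<in> carrier N" by (simp add: r M closed)
      show "x \<oplus>\<^bsub>N\<^esub> y \<oplus>\<^bsub>N\<^esub> z = x \<oplus>\<^bsub>N\<^esub> (y \<oplus>\<^bsub>N\<^esub> z)"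
        if "x \<in> carrier N" "y \<in> carrier N" "z \<in> carrier N" for x y z
        using N[OF that(1)] N[OF that(2)] N[OF that(3)] by (auto simp: r M module_add_assoc)
      show "x \<oplus>\<^bsub>N\<^esub> y = y \<oplus>\<^bsub>N\<^esub> x" if "x \<in> carrier N" "y \<in> carrier N" for x y
        using N[OF that(1)] N[OF that(2)] by (auto simp: r M module_add_comm[OF M])
      show "\<zero>\<^bsub>N\<^esub> \<oplus>\<^bsub>N\<^esub> x = x" if "x \<in> carrier N" for x
        using N[OF that] by (auto simp: r M)
      show "\<exists>y \<in> carrier N. y \<oplus>\<^bsub>N\<^esub> x = \<zero>\<^bsub>N\<^esub>" if x: "x \<in> carrier N" for x
      proof -
        obtain x' where x': "x' \<in> carrier M" "x = f x'"
          using N[OF x] by blast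
        have "f (\<ominus>\<^bsub>M\<^esub> x') \<oplus>\<^bsub>N\<^esub> f x' = \<zero>\<^bsub>N\<^esub>"
          using x' M by (simp add: r module_add_comm[of M "\<ominus>\<^bsub>M\<^esub> x'" x'])
        then show ?thesis
          using x' closed[OF module_minus_closed[OF M x'(1)]] by blast
      qed
    qed
    show "c \<odot>\<^bsub>N\<^esub> x \<in> carrier N" if "c \<in> carrier R" "x \<in> carrier N" for c x
      using N[OF that(2)] that(1) by (auto simp: r M closed)
    show "(a \<oplus> b) \<odot>\<^bsub>N\<^esub> x = a \<odot>\<^bsub>N\<^esub> x \<oplus>\<^bsub>N\<^esub> b \<odot>\<^bsub>N\<^esub> x"
      if "a \<in> carrier R" "b \<in> carrier R" "x \<in> carrier N" for a b x
      using N[OF that(3)] that(1,2) by (auto simp: r M module.smult_l_distr[OF M])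
    show "a \<odot>\<^bsub>N\<^esub> (x \<oplus>\<^bsub>N\<^esub> y) = a \<odot>\<^bsub>N\<^esub> x \<oplus>\<^bsub>N\<^esub> a \<odot>\<^bsub>N\<^esub> y"
      if "a \<in> carrier R" "x \<in> carrier N" "y \<in> carrier N" for a x y
      using N[OF that(2)] N[OF that(3)] that(1) by (auto simp: r M module.smult_r_distr[OF M])
    show "(a \<otimes> b) \<odot>\<^bsub>N\<^esub> x = a \<odot>\<^bsub>N\<^esub> (b \<odot>\<^bsub>N\<^esub> x)"
      if "a \<in> carrier R" "b \<in> carrier R" "x \<in> carrier N" for a b x
      using N[OF that(3)] that(1,2) by (auto simp: r M module.smult_assoc1[OF M])
    show "\<one> \<odot>\<^bsub>N\<^esub> x = x" if "x \<in> carrier N" for x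
      using N[OF that] by (auto simp: r M)
  qed
qed

text \<open>Closure under negation comes for free, as the negative of x is the multiple of x by the
  negative of 1.\<close>

lemma module_restrict_carrier:
  assumes M: "module R M" and N: "N \<subseteq> carrier M" "\<zero>\<^bsub>M\<^esub> \<in> N"
    and add: "\<And>x y. \<lbrakk>x \<in> N; y \<in> N\<rbrakk> \<Longrightarrow> x \<oplus>\<^bsub>M\<^esub> y \<in> N"
    and smult: "\<And>c x. \<lbrakk>c \<in> carrier R; x \<in> N\<rbrakk> \<Longrightarrow> c \<odot>\<^bsub>M\<^esub> x \<in> N"
  shows "module R (M\<lparr>carrier := N\<rparr>)" and "submodule N R M"
proof -
  show *: "submodule N R M"
  proof (rule module.submoduleI[OF M N])
    fix x assume "x \<in> N"
    then show "\<ominus>\<^bsub>M\<^esub> x \<in> N"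
      using N M smult[of "\<ominus> \<one>" x] by (simp add: module_neg_eq_smult subset_iff)
  qed (use add smult in auto)
  show "module R (M\<lparr>carrier := N\<rparr>)"
    by (rule submodule.submodule_is_module[OF * M])
qed

end

section \<open>Quotients, copies and direct sums\<close>

context cring
begin

lemma submodule_abelian_subgroup:
  assumes "submodule B R M" "module R M"
  shows "abelian_subgroup B M"
  by (intro abelian_subgroupI3 additive_subgroupI submodule.axioms(1)[OF assms(1)]
      module.axioms(2)[OF assms(2)])

lemma submodule_closed:
  assumes "submodule B R M" "module R M"
  shows "B \<subseteq> carrier M" "\<zero>\<^bsub>M\<^esub> \<in> B"
    and "\<lbrakk>x \<in> B; y \<in> B\<rbrakk> \<Longrightarrow> x \<oplus>\<^bsub>M\<^esub> y \<in> B"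
    and "\<lbrakk>x \<in> B; y \<in> B\<rbrakk> \<Longrightarrow> x \<ominus>\<^bsub>M\<^esub> y \<in> B"
    and "\<lbrakk>c \<in> carrier R; x \<in> B\<rbrakk> \<Longrightarrow> c \<odot>\<^bsub>M\<^esub> x \<in> B"
proof -
  note E = module.submoduleE[OF assms(2,1)]
  show "B \<subseteq> carrier M" by (rule E)
  show "\<zero>\<^bsub>M\<^esub> \<in> B"
    using subgroup.one_closed[OF submodule.axioms(1)[OF assms(1)]] by simp
  show "\<lbrakk>x \<in> B; y \<in> B\<rbrakk> \<Longrightarrow> x \<oplus>\<^bsub>M\<^esub> y \<in> B" by (rule E)
  show "\<lbrakk>x \<in> B; y \<in> B\<rbrakk> \<Longrightarrow> x \<ominus>\<^bsub>M\<^esub> y \<in> B" by (simp add: a_minus_def E)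
  show "\<lbrakk>c \<in> carrier R; x \<in> B\<rbrakk> \<Longrightarrow> c \<odot>\<^bsub>M\<^esub> x \<in> B" by (rule E)
qed

lemma coset_eq_iff:
  assumes B: "submodule B R M" and M: "module R M" and x: "x \<in> carrier M" and y: "y \<in> carrier M"
  shows "B +>\<^bsub>M\<^esub> x = B +>\<^bsub>M\<^esub> y \<longleftrightarrow> x \<ominus>\<^bsub>M\<^esub> y \<in> B"
proof -
  interpret B: abelian_subgroup B M by (rule submodule_abelian_subgroup[OF B M])
  have *: "x \<in> B +>\<^bsub>M\<^esub> y \<longleftrightarrow> x \<ominus>\<^bsub>M\<^esub> y \<in> B"
    using B.a_rcos_module[OF y x] by (simp add: a_minus_def)
  show ?thesis
    using * B.a_rcos_self[OF x] B.a_repr_independence[OF _ y, of x]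
      additive_subgroup.a_subgroup[OF B.additive_subgroup_axioms]
    by auto
qed

lemma quot_module:
  assumes B: "submodule B R M" and M: "module R M"
  shows "module R (quot_module M B)"
    and "(\<lambda>x. B +>\<^bsub>M\<^esub> x) \<in> linear_maps R M (quot_module M B)"
    and "(\<lambda>x. B +>\<^bsub>M\<^esub> x) ` carrier M = carrier (quot_module M B)"
    and "x \<in> carrier M \<Longrightarrow> B +>\<^bsub>M\<^esub> x = \<zero>\<^bsub>quot_module M B\<^esub> \<longleftrightarrow> x \<in> B"
proof -
  interpret B: abelian_subgroup B M by (rule submodule_abelian_subgroup[OF B M])
  let ?Q = "quot_module M B" and ?p = "\<lambda>x. B +>\<^bsub>M\<^esub> x"
  have add: "?p (x \<oplus>\<^bsub>M\<^esub> y) = ?p x \<oplus>\<^bsub>?Q\<^esub> ?p y" if "x \<in> carrier M" "y \<in> carrier M" for x y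
    using B.a_rcos_sum[OF that] by (simp add: quot_module_def)
  have smult: "?p (c \<odot>\<^bsub>M\<^esub> x) = c \<odot>\<^bsub>?Q\<^esub> ?p x" if c: "c \<in> carrier R" and x: "x \<in> carrier M" for c x
  proof -
    \<comment> \<open>In \<open>quot_module\<close> a scalar acts on a coset as a union over all its
      members. This step shows that the cosets united are all equal, so that the union collapses to
      the coset of the multiple of \<open>x\<close> by \<open>c\<close>.\<close>
    have "?p (c \<odot>\<^bsub>M\<^esub> y) = ?p (c \<odot>\<^bsub>M\<^esub> x)" if y: "y \<in> ?p x" for y
    proof -
      have y': "y \<in> carrier M"
        using y x B.a_rcosetsI B.a_subset a_r_coset_def' M submodule_closed(1)[OF B M]
        by (fastforce simp: a_r_coset_def')
      have "?p x = ?p y"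
        using B.a_repr_independence[OF y x] additive_subgroup.a_subgroup[OF B.additive_subgroup_axioms]
        by simp
      then have "y \<ominus>\<^bsub>M\<^esub> x \<in> B"
        using coset_eq_iff[OF B M y' x] by simp
      moreover have "c \<odot>\<^bsub>M\<^esub> y \<ominus>\<^bsub>M\<^esub> c \<odot>\<^bsub>M\<^esub> x = c \<odot>\<^bsub>M\<^esub> (y \<ominus>\<^bsub>M\<^esub> x)"
        using c x y' M
        by (simp add: a_minus_def module.smult_r_distr[OF M] module.smult_r_minus[OF M])
      ultimately show ?thesis
        using c x y' M submodule_closed(5)[OF B M] by (simp add: coset_eq_iff[OF B M])
    qed
    then have "(\<Union>y\<in>?p x. ?p (c \<odot>\<^bsub>M\<^esub> y)) = (\<Union>y\<in>?p x. ?p (c \<odot>\<^bsub>M\<^esub> x))"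
      by (intro SUP_cong refl)
    also have "\<dots> = ?p (c \<odot>\<^bsub>M\<^esub> x)"
      using B.a_rcos_self[OF x] by blast
    finally show ?thesis by (simp add: quot_module_def)
  qed
  have zero: "?p \<zero>\<^bsub>M\<^esub> = \<zero>\<^bsub>?Q\<^esub>"
    using submodule_closed(1)[OF B M] M
    by (auto simp: quot_module_def a_r_coset_def' subset_iff)
  show surj: "?p ` carrier M = carrier ?Q"
    by (auto simp: quot_module_def A_RCOSETS_def')
  show Q: "module R ?Q"
    by (rule module_surj[OF M surj]) (use add smult zero in auto)
  show "?p \<in> linear_maps R M ?Q"
    by (rule linear_mapsI) (use add smult surj in auto)
  show "?p x = \<zero>\<^bsub>?Q\<^esub> \<longleftrightarrow> x \<in> B" if x: "x \<in> carrier M"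
    unfolding zero[symmetric] using coset_eq_iff[OF B M x module_zero_closed[OF M]] x M
      module_neg_unique[OF M, of "\<zero>\<^bsub>M\<^esub>" "\<zero>\<^bsub>M\<^esub>"]
    by (simp add: a_minus_def)
qed

text \<open>\<open>small_emb\<close> is an arbitrary choice, and it is injective as soon as there is
  any injection at all. The cardinality arguments below exist to provide such an \<open>e\<close>
  for each construction.\<close>

lemma small_emb_inj:
  fixes e :: "'x \<Rightarrow> 'u"
  assumes "inj_on e (carrier M)"
  shows "inj_on (small_emb M :: 'x \<Rightarrow> 'u) (carrier M)"
  unfolding small_emb_def by (rule someI[where P = "\<lambda>e. inj_on e (carrier M)", OF assms])

text \<open>The copy inherits the module axioms through \<open>module_surj\<close>, with the copying
  map as the surjection.\<close>

lemma small_module: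
  fixes M :: "('a, 'x) module" and e :: "'x \<Rightarrow> 'u"
  assumes M: "module R M" and e: "inj_on e (carrier M)"
  shows "module R (small M :: ('a, 'u) module)"
    and "(small_emb M :: 'x \<Rightarrow> 'u) \<in> linear_maps R M (small M)"
    and "(small_emb M :: 'x \<Rightarrow> 'u) ` carrier M = carrier (small M)"
proof -
  let ?e = "small_emb M :: 'x \<Rightarrow> 'u" and ?S = "small M :: ('a, 'u) module"
  have inj: "inj_on ?e (carrier M)"
    by (rule small_emb_inj[OF e])
  have add: "?e (x \<oplus>\<^bsub>M\<^esub> y) = ?e x \<oplus>\<^bsub>?S\<^esub> ?e y" if "x \<in> carrier M" "y \<in> carrier M" for x y
    using that by (simp add: small_def Let_def the_inv_into_f_f[OF inj])
  have smult: "?e (c \<odot>\<^bsub>M\<^esub> x) = c \<odot>\<^bsub>?S\<^esub> ?e x" if "x \<in> carrier M" for c x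
    using that by (simp add: small_def Let_def the_inv_into_f_f[OF inj])
  show surj: "?e ` carrier M = carrier ?S"
    by (simp add: small_def Let_def)
  show S: "module R ?S"
    by (rule module_surj[OF M surj]) (use add smult in \<open>auto simp: small_def Let_def\<close>)
  show "?e \<in> linear_maps R M ?S"
    by (rule linear_mapsI) (use add smult surj in auto)
qed

lemma small_inverse:
  fixes M :: "('a, 'x) module" and e :: "'x \<Rightarrow> 'u"
  assumes M: "module R M" and e: "inj_on e (carrier M)"
  obtains r where "r \<in> linear_maps R (small M :: ('a, 'u) module) M"
    "\<And>x. x \<in> carrier M \<Longrightarrow> r (small_emb M x :: 'u) = x"
proof -
  have "x = \<zero>\<^bsub>M\<^esub>" if x: "x \<in> carrier M" and "(small_emb M x :: 'u) = \<zero>\<^bsub>small M\<^esub>" for x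
  proof -
    have "(small_emb M x :: 'u) = small_emb M \<zero>\<^bsub>M\<^esub>"
      using that by (simp add: small_def Let_def)
    then show ?thesis
      using inj_onD[OF small_emb_inj[OF e]] x M by (metis module_zero_closed)
  qed
  then show ?thesis
    using linear_factor[OF M small_module(1)[OF M e] M small_module(2)[OF M e]
        small_module(3)[OF M e] linear_id] that by blast
qed

lemma ext_dsum_carrier_iff:
  "f \<in> carrier (ext_dsum I V) \<longleftrightarrow>
     f \<in> extensional I \<and> (\<forall>i \<in> I. f i \<in> carrier (V i)) \<and> finite {i \<in> I. f i \<noteq> \<zero>\<^bsub>V i\<^esub>}"
  by (auto simp: ext_dsum_def PiE_iff)

lemma ext_dsum_module:
  assumes V: "\<And>i. i \<in> I \<Longrightarrow> module R (V i)"
  shows "module R (ext_dsum I V)"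
proof -
  let ?D = "ext_dsum I V"
  have add: "(f \<oplus>\<^bsub>?D\<^esub> g) = (\<lambda>i\<in>I. f i \<oplus>\<^bsub>V i\<^esub> g i)" for f g
    by (simp add: ext_dsum_def)
  have smult: "c \<odot>\<^bsub>?D\<^esub> f = (\<lambda>i\<in>I. c \<odot>\<^bsub>V i\<^esub> f i)" for c f
    by (simp add: ext_dsum_def)
  have zero: "\<zero>\<^bsub>?D\<^esub> = (\<lambda>i\<in>I. \<zero>\<^bsub>V i\<^esub>)"
    by (simp add: ext_dsum_def)
  have C: "f i \<in> carrier (V i)" if "f \<in> carrier ?D" "i \<in> I" for f i
    using that by (simp add: ext_dsum_carrier_iff)
  have cl_add: "f \<oplus>\<^bsub>?D\<^esub> g \<in> carrier ?D" if f: "f \<in> carrier ?D" and g: "g \<in> carrier ?D" for f g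
  proof -
    have "{i \<in> I. (f \<oplus>\<^bsub>?D\<^esub> g) i \<noteq> \<zero>\<^bsub>V i\<^esub>} \<subseteq> {i \<in> I. f i \<noteq> \<zero>\<^bsub>V i\<^esub>} \<union> {i \<in> I. g i \<noteq> \<zero>\<^bsub>V i\<^esub>}"
      using V by (auto simp: add)
    then show ?thesis
      using that V C[OF f] C[OF g] finite_subset unfolding ext_dsum_carrier_iff add
      by (simp cong: conj_cong) blast
  qed
  have cl_smult: "c \<odot>\<^bsub>?D\<^esub> f \<in> carrier ?D" if f: "f \<in> carrier ?D" and c: "c \<in> carrier R" for c f
  proof -
    have "{i \<in> I. (c \<odot>\<^bsub>?D\<^esub> f) i \<noteq> \<zero>\<^bsub>V i\<^esub>} \<subseteq> {i \<in> I. f i \<noteq> \<zero>\<^bsub>V i\<^esub>}"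
      using V c by (auto simp: smult)
    then show ?thesis
      using that V C[OF f] finite_subset unfolding ext_dsum_carrier_iff smult
      by (simp cong: conj_cong) blast
  qed
  have cl_zero: "\<zero>\<^bsub>?D\<^esub> \<in> carrier ?D"
    using V by (simp add: ext_dsum_carrier_iff zero cong: conj_cong)
  have eqI: "f = g" if "f \<in> extensional I" "g \<in> extensional I" "\<And>i. i \<in> I \<Longrightarrow> f i = g i" for f g :: "_ \<Rightarrow> _"
    using that by (rule extensionalityI)
  show ?thesis
  proof (rule moduleI)
    show "abelian_group ?D"
    proof (rule abelian_groupI)
      fix f assume f: "f \<in> carrier ?D"
      show "\<exists>g \<in> carrier ?D. g \<oplus>\<^bsub>?D\<^esub> f = \<zero>\<^bsub>?D\<^esub>"
      proof
        show "(\<ominus> \<one>) \<odot>\<^bsub>?D\<^esub> f \<in> carrier ?D" using f by (simp add: cl_smult)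
        show "(\<ominus> \<one>) \<odot>\<^bsub>?D\<^esub> f \<oplus>\<^bsub>?D\<^esub> f = \<zero>\<^bsub>?D\<^esub>"
          by (rule eqI)
            (use V C[OF f] in \<open>auto simp: add smult zero module_neg_eq_smult[symmetric]
              module_add_comm[OF V, of _ "\<ominus>\<^bsub>V _\<^esub> f _" "f _"]\<close>)
      qed
      show "\<zero>\<^bsub>?D\<^esub> \<oplus>\<^bsub>?D\<^esub> f = f"
        by (rule eqI) (use f V C[OF f] in \<open>auto simp: add zero ext_dsum_carrier_iff\<close>)
    next
      fix f g h assume f: "f \<in> carrier ?D" and g: "g \<in> carrier ?D" and h: "h \<in> carrier ?D"
      show "f \<oplus>\<^bsub>?D\<^esub> g \<oplus>\<^bsub>?D\<^esub> h = f \<oplus>\<^bsub>?D\<^esub> (g \<oplus>\<^bsub>?D\<^esub> h)"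
        by (rule eqI) (use V C[OF f] C[OF g] C[OF h] in \<open>auto simp: add module_add_assoc\<close>)
    next
      fix f g assume f: "f \<in> carrier ?D" and g: "g \<in> carrier ?D"
      show "f \<oplus>\<^bsub>?D\<^esub> g = g \<oplus>\<^bsub>?D\<^esub> f"
        by (rule eqI) (use V C[OF f] C[OF g] in \<open>auto simp: add module_add_comm\<close>)
    qed (use cl_add cl_zero in auto)
  next
    fix a f assume a: "a \<in> carrier R" and f: "f \<in> carrier ?D"
    fix b assume b: "b \<in> carrier R"
    show "(a \<oplus> b) \<odot>\<^bsub>?D\<^esub> f = a \<odot>\<^bsub>?D\<^esub> f \<oplus>\<^bsub>?D\<^esub> b \<odot>\<^bsub>?D\<^esub> f"
      by (rule eqI) (use V C[OF f] a b in \<open>auto simp: add smult module.smult_l_distr\<close>)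
    show "(a \<otimes> b) \<odot>\<^bsub>?D\<^esub> f = a \<odot>\<^bsub>?D\<^esub> (b \<odot>\<^bsub>?D\<^esub> f)"
      by (rule eqI) (use V C[OF f] a b in \<open>auto simp: smult module.smult_assoc1\<close>)
  next
    fix a f g assume a: "a \<in> carrier R" and f: "f \<in> carrier ?D" and g: "g \<in> carrier ?D"
    show "a \<odot>\<^bsub>?D\<^esub> (f \<oplus>\<^bsub>?D\<^esub> g) = a \<odot>\<^bsub>?D\<^esub> f \<oplus>\<^bsub>?D\<^esub> a \<odot>\<^bsub>?D\<^esub> g"
      by (rule eqI) (use V C[OF f] C[OF g] a in \<open>auto simp: add smult module.smult_r_distr[OF V]\<close>)
  next
    fix f assume f: "f \<in> carrier ?D"
    show "\<one> \<odot>\<^bsub>?D\<^esub> f = f"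
      by (rule eqI) (use V f C[OF f] in \<open>auto simp: smult ext_dsum_carrier_iff\<close>)
  qed (use cl_smult is_cring in auto)
qed

lemma single_linear:
  assumes V: "\<And>i. i \<in> I \<Longrightarrow> module R (V i)" and i: "i \<in> I"
  shows "single I V i \<in> linear_maps R (V i) (ext_dsum I V)"
proof (rule linear_mapsI)
  fix x assume x: "x \<in> carrier (V i)"
  have "{j \<in> I. single I V i x j \<noteq> \<zero>\<^bsub>V j\<^esub>} \<subseteq> {i}"
    by (auto simp: single_def)
  then show "single I V i x \<in> carrier (ext_dsum I V)"
    using x V i finite_subset unfolding ext_dsum_carrier_iff by (fastforce simp: single_def)
qed (use V in \<open>auto simp: single_def ext_dsum_def fun_eq_iff\<close>)

lemma ext_dsum_spans:
  assumes V: "\<And>i. i \<in> I \<Longrightarrow> module R (V i)"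
  shows "spans (ext_dsum I V) (\<Union>i\<in>I. single I V i ` carrier (V i))"
  unfolding spans_def
proof (intro conjI allI impI)
  let ?D = "ext_dsum I V"
  have sl: "single I V i x \<in> carrier ?D" if "i \<in> I" "x \<in> carrier (V i)" for i x
    using linear_closed[OF single_linear[of I V, OF V]] that by blast
  then show "(\<Union>i\<in>I. single I V i ` carrier (V i)) \<subseteq> carrier ?D" by blast
  fix N assume N: "N \<subseteq> carrier ?D" and
    *: "(\<Union>i\<in>I. single I V i ` carrier (V i)) \<subseteq> N \<and> \<zero>\<^bsub>?D\<^esub> \<in> N \<and> (\<forall>x\<in>N. \<forall>y\<in>N. x \<oplus>\<^bsub>?D\<^esub> y \<in> N) \<and>
        (\<forall>c \<in> carrier R. \<forall>x \<in> N. c \<odot>\<^bsub>?D\<^esub> x \<in> N)"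
  \<comment> \<open>Induction on a finite set \<open>A\<close> bounding the support. Removing one
    coordinate \<open>a\<close> leaves the function \<open>?g\<close> with support in the smaller
    set, and \<open>f\<close> is the sum of \<open>?g\<close> and a \<open>single\<close>.\<close>
  have "f \<in> N" if "finite A" "A \<subseteq> I" "f \<in> carrier ?D" "{i \<in> I. f i \<noteq> \<zero>\<^bsub>V i\<^esub>} \<subseteq> A" for A f
    using that
  proof (induction arbitrary: f rule: finite_induct)
    case empty
    then have "f = \<zero>\<^bsub>?D\<^esub>"
      by (auto simp: ext_dsum_def PiE_iff extensional_def fun_eq_iff)
    then show ?case using * by simp
  next
    case (insert a A)
    let ?g = "\<lambda>i\<in>I. if i = a then \<zero>\<^bsub>V i\<^esub> else f i"
    have a: "a \<in> I" and fc: "\<And>i. i \<in> I \<Longrightarrow> f i \<in> carrier (V i)" and fe: "f \<in> extensional I"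
      using insert.prems by (auto simp: ext_dsum_carrier_iff)
    have sub: "{i \<in> I. ?g i \<noteq> \<zero>\<^bsub>V i\<^esub>} \<subseteq> A"
      using insert.prems by auto
    have g: "?g \<in> carrier ?D"
      using fc V finite_subset[OF sub insert.hyps(1)] by (auto simp: ext_dsum_carrier_iff)
    have "?g \<in> N"
      using insert.IH[OF _ g sub] insert.prems(1) by blast
    moreover have "single I V a (f a) \<in> N"
      using * a fc by auto
    ultimately have "single I V a (f a) \<oplus>\<^bsub>?D\<^esub> ?g \<in> N"
      using * by blast
    moreover have "f = single I V a (f a) \<oplus>\<^bsub>?D\<^esub> ?g"
      using fe fc V a by (auto simp: single_def ext_dsum_def extensional_def fun_eq_iff)
    ultimately show ?case by (rule back_subst[where P = "\<lambda>x. x \<in> N", OF _ sym])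
  qed
  from this[of "{i \<in> I. _ i \<noteq> \<zero>\<^bsub>V i\<^esub>}"] have "f \<in> N" if "f \<in> carrier ?D" for f
    using that by (auto simp: ext_dsum_carrier_iff)
  then show "N = carrier ?D" using N by blast
qed

lemma ext_dsum_lift:
  assumes V: "\<And>i. i \<in> I \<Longrightarrow> module R (V i)" and W: "module R W"
    and \<phi>: "\<And>i. i \<in> I \<Longrightarrow> \<phi> i \<in> linear_maps R (V i) W"
  obtains h where "h \<in> linear_maps R (ext_dsum I V) W"
    "\<And>i x. \<lbrakk>i \<in> I; x \<in> carrier (V i)\<rbrakk> \<Longrightarrow> h (single I V i x) = \<phi> i x"
proof -
  let ?D = "ext_dsum I V"
  interpret W: module R W by (rule W)
  define supp where "supp f = {i \<in> I. f i \<noteq> \<zero>\<^bsub>V i\<^esub>}" for f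
  define h where "h f = finsum W (\<lambda>i. \<phi> i (f i)) (supp f)" for f
  have C: "\<phi> i (f i) \<in> carrier W" if "f \<in> carrier ?D" "i \<in> I" for f i
    using that linear_closed[OF \<phi>] by (simp add: ext_dsum_carrier_iff)
  \<comment> \<open>\<open>h\<close> sums over the support, which changes with \<open>f\<close>. The
    sum may be taken over any larger finite set, because linear maps send zero coordinates to zero;
    this lets the supports of \<open>f\<close> and \<open>g\<close> be replaced by their union when
    additivity is shown.\<close>
  have h: "h f = finsum W (\<lambda>i. \<phi> i (f i)) A"
    if f: "f \<in> carrier ?D" and A: "finite A" "supp f \<subseteq> A" "A \<subseteq> I" for f A
    unfolding h_def
  proof (rule W.add.finprod_mono_neutral_cong_left)
    fix i assume "i \<in> A - supp f"
    then show "\<phi> i (f i) = \<zero>\<^bsub>W\<^esub>"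
      using A linear_zero[OF \<phi> V W] by (auto simp: supp_def)
  qed (use A C[OF f] in auto)
  have fin: "finite (supp f)" "supp f \<subseteq> I" if "f \<in> carrier ?D" for f
    using that by (auto simp: ext_dsum_carrier_iff supp_def)
  note D = ext_dsum_module[of I V, OF V]
  have "h \<in> linear_maps R ?D W"
  proof (rule linear_mapsI)
    show "h f \<in> carrier W" if "f \<in> carrier ?D" for f
      unfolding h_def using C[OF that] fin[OF that] by (auto intro: W.finsum_closed)
  next
    fix f g assume f: "f \<in> carrier ?D" and g: "g \<in> carrier ?D"
    have fg: "f \<oplus>\<^bsub>?D\<^esub> g \<in> carrier ?D" using f g D by simp
    let ?A = "supp f \<union> supp g"
    have A: "finite ?A" "?A \<subseteq> I" using fin[OF f] fin[OF g] by auto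
    have sub: "supp (f \<oplus>\<^bsub>?D\<^esub> g) \<subseteq> ?A"
      using V by (auto simp: supp_def ext_dsum_def)
    have eq: "\<phi> i ((f \<oplus>\<^bsub>?D\<^esub> g) i) = \<phi> i (f i) \<oplus>\<^bsub>W\<^esub> \<phi> i (g i)" if "i \<in> I" for i
      using f g that linear_add[OF \<phi>[OF that]] by (auto simp: ext_dsum_def)
    have "h (f \<oplus>\<^bsub>?D\<^esub> g) = finsum W (\<lambda>i. \<phi> i (f i) \<oplus>\<^bsub>W\<^esub> \<phi> i (g i)) ?A"
      unfolding h[OF fg A(1) sub A(2)]
      by (rule W.finsum_cong') (use A(2) C[OF f] C[OF g] eq in auto)
    also have "\<dots> = h f \<oplus>\<^bsub>W\<^esub> h g"
      unfolding h[OF f A(1) Un_upper1 A(2)] h[OF g A(1) Un_upper2 A(2)]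
      by (rule W.finsum_addf) (use A C[OF f] C[OF g] in auto)
    finally show "h (f \<oplus>\<^bsub>?D\<^esub> g) = h f \<oplus>\<^bsub>W\<^esub> h g" .
  next
    fix c f assume c: "c \<in> carrier R" and f: "f \<in> carrier ?D"
    have cf: "c \<odot>\<^bsub>?D\<^esub> f \<in> carrier ?D" using f c D by simp
    have sub: "supp (c \<odot>\<^bsub>?D\<^esub> f) \<subseteq> supp f"
      using V c by (auto simp: supp_def ext_dsum_def)
    have eq: "\<phi> i ((c \<odot>\<^bsub>?D\<^esub> f) i) = c \<odot>\<^bsub>W\<^esub> \<phi> i (f i)" if "i \<in> I" for i
      using f c that linear_smult[OF \<phi>[OF that]] by (auto simp: ext_dsum_def)
    have "h (c \<odot>\<^bsub>?D\<^esub> f) = finsum W (\<lambda>i. c \<odot>\<^bsub>W\<^esub> \<phi> i (f i)) (supp f)"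
      unfolding h[OF cf fin(1)[OF f] sub fin(2)[OF f]]
      by (rule W.finsum_cong') (use fin(2)[OF f] C[OF f] eq c in auto)
    also have "\<dots> = c \<odot>\<^bsub>W\<^esub> h f"
      unfolding h_def by (rule W.finsum_smult_ldistr[symmetric]) (use fin[OF f] C[OF f] c in auto)
    finally show "h (c \<odot>\<^bsub>?D\<^esub> f) = c \<odot>\<^bsub>W\<^esub> h f" .
  qed
  moreover have "h (single I V i x) = \<phi> i x" if i: "i \<in> I" and x: "x \<in> carrier (V i)" for i x
  proof -
    have s: "single I V i x \<in> carrier ?D"
      using linear_closed[OF single_linear[of I V, OF V i] x] .
    have "h (single I V i x) = finsum W (\<lambda>j. \<phi> j (single I V i x j)) {i}"
      by (rule h[OF s]) (use i in \<open>auto simp: supp_def single_def\<close>)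
    also have "\<dots> = \<phi> i x"
      using C[OF s i] i by (simp add: single_def)
    finally show ?thesis .
  qed
  ultimately show ?thesis by (rule that)
qed

end

section \<open>Fitting the constructions into the fixed type\<close>

text \<open>By the axiom of choice, an infinite set is equinumerous with its square.\<close>

lemma infinite_inj_prod:
  includes cardinal_syntax
  assumes "infinite (UNIV :: 'u set)"
  obtains f :: "'u \<times> 'u \<Rightarrow> 'u" where "inj f"
proof -
  have "|(UNIV :: 'u set) \<times> (UNIV :: 'u set)| =o |UNIV :: 'u set|"
    using card_of_Times_same_infinite[OF assms] .
  then obtain f :: "'u \<times> 'u \<Rightarrow> 'u" where "bij_betw f (UNIV \<times> UNIV) UNIV"
    unfolding card_of_ordIso[symmetric] by blast
  then show ?thesis
    using that by (auto simp: bij_betw_def)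
qed

lemma infinite_inj_list:
  assumes inf: "infinite (UNIV :: 'u set)"
  obtains f :: "'u list \<Rightarrow> 'u" where "inj f"
proof -
  obtain p :: "'u \<times> 'u \<Rightarrow> 'u" where p: "inj p"
    by (rule infinite_inj_prod[OF inf])
  obtain \<nu> :: "nat \<Rightarrow> 'u" where \<nu>: "inj \<nu>"
    using infinite_countable_subset[OF inf] by blast
  define enc where "enc = rec_list (\<nu> 0) (\<lambda>x _ y. p (x, y))"
  have enc: "enc [] = \<nu> 0" "enc (x # xs) = p (x, enc xs)" for x xs
    by (simp_all add: enc_def)
  have *: "length xs = length ys \<Longrightarrow> enc xs = enc ys \<Longrightarrow> xs = ys" for xs ys
    by (induction xs ys rule: list_induct2) (auto simp: enc dest: injD[OF p])
  \<comment> \<open>\<open>enc\<close> alone separates only lists of equal length: the code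
    \<open>\<nu> 0\<close> of the empty list may also be the code of a nonempty one. Storing the
    length removes this ambiguity.\<close>
  have "inj (\<lambda>xs. p (\<nu> (length xs), enc xs))"
  proof (rule injI)
    fix xs ys assume "p (\<nu> (length xs), enc xs) = p (\<nu> (length ys), enc ys)"
    then show "xs = ys"
      using injD[OF p] injD[OF \<nu>] * by blast
  qed
  then show ?thesis by (rule that)
qed

lemma infinite_inj_finite_sets:
  assumes inf: "infinite (UNIV :: 'u set)"
  obtains f :: "'u set \<Rightarrow> 'u" where "inj_on f {X. finite X}"
proof -
  obtain g :: "'u list \<Rightarrow> 'u" where g: "inj g"
    by (rule infinite_inj_list[OF inf])
  define l where "l X = (SOME xs. set xs = X)" for X :: "'u set"
  have "set (l X) = X" if "finite X" for X
    unfolding l_def by (rule someI_ex) (use finite_list[OF that] in blast)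
  then have "inj_on (\<lambda>X. g (l X)) {X. finite X}"
    by (intro inj_onI) (metis g injD mem_Collect_eq)
  then show ?thesis by (rule that)
qed

text \<open>An element of a direct sum is determined by its graph over its support. This graph is a
  finite set of pairs, so it is encoded by \<open>g\<close> followed by an injection defined on the
  finite subsets of \<open>'u\<close>.\<close>

lemma ext_dsum_inj:
  fixes g :: "'i \<times> 'x \<Rightarrow> 'u"
  assumes inf: "infinite (UNIV :: 'u set)" and g: "inj_on g (SIGMA i:I. carrier (V i))"
  obtains e :: "('i \<Rightarrow> 'x) \<Rightarrow> 'u" where "inj_on e (carrier (ext_dsum I V))"
proof -
  obtain F :: "'u set \<Rightarrow> 'u" where F: "inj_on F {X. finite X}"
    by (rule infinite_inj_finite_sets[OF inf])
  define gr where "gr f = (\<lambda>i. (i, f i)) ` {i \<in> I. f i \<noteq> \<zero>\<^bsub>V i\<^esub>}" for f :: "'i \<Rightarrow> 'x"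
  have mem: "(i, x) \<in> gr f \<longleftrightarrow> i \<in> I \<and> x = f i \<and> f i \<noteq> \<zero>\<^bsub>V i\<^esub>" for i x f
    by (auto simp: gr_def)
  have fin: "finite (gr f)" "gr f \<subseteq> (SIGMA i:I. carrier (V i))" if "f \<in> carrier (ext_dsum I V)" for f
    using that by (auto simp: gr_def ext_dsum_def PiE_iff)
  have "inj_on (\<lambda>f. F (g ` gr f)) (carrier (ext_dsum I V))"
  proof (rule inj_onI)
    fix f f' assume f: "f \<in> carrier (ext_dsum I V)" and f': "f' \<in> carrier (ext_dsum I V)"
      and "F (g ` gr f) = F (g ` gr f')"
    then have "g ` gr f = g ` gr f'"
      using inj_onD[OF F] fin(1)[OF f] fin(1)[OF f'] by simp
    then have eq: "gr f = gr f'"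
      using inj_on_image_eq_iff[OF g fin(2)[OF f] fin(2)[OF f']] by simp
    show "f = f'"
    proof (rule extensionalityI)
      fix i assume i: "i \<in> I"
      have "x = f i \<and> f i \<noteq> \<zero>\<^bsub>V i\<^esub> \<longleftrightarrow> x = f' i \<and> f' i \<noteq> \<zero>\<^bsub>V i\<^esub>" for x
        using mem[of i x f] mem[of i x f'] i eq by simp
      from this[of "f i"] this[of "f' i"] show "f i = f' i"
        by metis
    qed (use f f' in \<open>auto simp: ext_dsum_def PiE_iff\<close>)
  qed
  then show ?thesis by (rule that)
qed

text \<open>The two conditions are the size requirements on \<open>'u\<close>: an infinite type
  absorbs products, lists and finite subsets of itself, and \<open>emb\<close> makes room for the
  coefficients in tensor products and for the unit.\<close>

locale small_ring = cring K for K :: "('k, 'z) ring_scheme" (structure) +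
  fixes emb :: "'k \<Rightarrow> 'u"
  assumes emb_inj: "inj_on emb (carrier K)"
    and infinite_univ: "infinite (UNIV :: 'u set)"
begin

text \<open>Indices are encoded by natural numbers placed inside \<open>'u\<close>. The sums over
  degrees and weights range over \<open>int\<close> or \<open>int \<times> int\<close>, which
  explains the sort \<open>countable\<close> on grading groups.\<close>

lemma countable_ext_dsum_inj:
  fixes V :: "'i::countable \<Rightarrow> ('k, 'u) module"
  obtains e :: "('i \<Rightarrow> 'u) \<Rightarrow> 'u" where "inj_on e (carrier (ext_dsum UNIV V))"
proof -
  obtain p :: "'u \<times> 'u \<Rightarrow> 'u" where p: "inj p"
    by (rule infinite_inj_prod[OF infinite_univ])
  obtain \<nu> :: "nat \<Rightarrow> 'u" where \<nu>: "inj \<nu>"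
    using infinite_countable_subset[OF infinite_univ] by blast
  have "inj_on (\<lambda>(i :: 'i, x). p (\<nu> (to_nat i), x)) (SIGMA i:UNIV. carrier (V i))"
    by (rule inj_onI) (auto dest!: injD[OF p] injD[OF \<nu>])
  then show ?thesis
    using ext_dsum_inj[OF infinite_univ] that by blast
qed

text \<open>Undoes the copy into \<open>'u\<close>. Elements of \<open>dsum V\<close> are mere
  codes, and their coordinates become available again only through this inverse.\<close>

definition dsum_comp :: "('i \<Rightarrow> ('k, 'u) module) \<Rightarrow> 'u \<Rightarrow> 'i \<Rightarrow> 'u" where
  "dsum_comp V = the_inv_into (carrier (ext_dsum UNIV V)) (small_emb (ext_dsum UNIV V))"

context
  fixes V :: "'i::countable \<Rightarrow> ('k, 'u) module"
  assumes V: "\<And>i. module K (V i)"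
begin

lemma ext_dsum_UNIV_module: "module K (ext_dsum UNIV V)"
  by (rule ext_dsum_module) (rule V)

lemma dsum_module: "module K (dsum V)"
  unfolding dsum_def
  by (rule countable_ext_dsum_inj[of V]) (rule small_module(1)[OF ext_dsum_UNIV_module])

lemma small_ext_dsum:
  "(small_emb (ext_dsum UNIV V) :: _ \<Rightarrow> 'u) \<in> linear_maps K (ext_dsum UNIV V) (dsum V)"
  "(small_emb (ext_dsum UNIV V) :: _ \<Rightarrow> 'u) ` carrier (ext_dsum UNIV V) = carrier (dsum V)"
  "inj_on (small_emb (ext_dsum UNIV V) :: _ \<Rightarrow> 'u) (carrier (ext_dsum UNIV V))"
  unfolding dsum_def
  by (rule countable_ext_dsum_inj[of V]; erule small_module[OF ext_dsum_UNIV_module] small_emb_inj)+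

lemma dsum_in_linear: "dsum_in V i \<in> linear_maps K (V i) (dsum V)"
  unfolding dsum_in_def[abs_def]
  by (rule linear_comp[OF single_linear small_ext_dsum(1)]) (auto simp: V)

lemma dsum_spans: "spans (dsum V) (\<Union>i. dsum_in V i ` carrier (V i))"
proof -
  have "(\<Union>i. dsum_in V i ` carrier (V i)) =
      small_emb (ext_dsum UNIV V) ` (\<Union>i\<in>UNIV. single UNIV V i ` carrier (V i))"
    by (auto simp: dsum_in_def image_UN image_image)
  then show ?thesis
    using spans_image[OF ext_dsum_spans small_ext_dsum(1) ext_dsum_UNIV_module dsum_module
        small_ext_dsum(2)] V by simp
qed

text \<open>The universal property passes from \<open>ext_dsum\<close> to its copy because the
  copying map is an injective linear map: only zero is copied to zero, so
  \<open>linear_factor\<close> applies.\<close>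

lemma dsum_lift:
  assumes W: "module K W" and \<phi>: "\<And>i. \<phi> i \<in> linear_maps K (V i) W"
  obtains h where "h \<in> linear_maps K (dsum V) W"
    "\<And>i x. x \<in> carrier (V i) \<Longrightarrow> h (dsum_in V i x) = \<phi> i x"
proof -
  obtain h where h: "h \<in> linear_maps K (ext_dsum UNIV V) W"
    "\<And>i x. \<lbrakk>i \<in> UNIV; x \<in> carrier (V i)\<rbrakk> \<Longrightarrow> h (single UNIV V i x) = \<phi> i x"
    using ext_dsum_lift[of UNIV V W \<phi>, OF V W \<phi>] by blast
  note D = ext_dsum_UNIV_module
  have "h f = \<zero>\<^bsub>W\<^esub>" if "f \<in> carrier (ext_dsum UNIV V)" "(small_emb (ext_dsum UNIV V) f :: 'u) = \<zero>\<^bsub>dsum V\<^esub>" for f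
  proof -
    have "(small_emb (ext_dsum UNIV V) f :: 'u) = small_emb (ext_dsum UNIV V) \<zero>\<^bsub>ext_dsum UNIV V\<^esub>"
      using that linear_zero[OF small_ext_dsum(1) D dsum_module] by simp
    then have "f = \<zero>\<^bsub>ext_dsum UNIV V\<^esub>"
      using inj_onD[OF small_ext_dsum(3)] that(1) D by simp
    then show ?thesis using linear_zero[OF h(1) D W] by simp
  qed
  then obtain g where g: "g \<in> linear_maps K (dsum V) W"
    "\<And>f. f \<in> carrier (ext_dsum UNIV V) \<Longrightarrow> g (small_emb (ext_dsum UNIV V) f) = h f"
    using linear_factor[OF D dsum_module W small_ext_dsum(1,2) h(1)] by blast
  have "g (dsum_in V i x) = \<phi> i x" if "x \<in> carrier (V i)" for i x
    using that g(2) h(2) linear_closed[OF single_linear[of UNIV V i]] V by (simp add: dsum_in_def)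
  with g(1) show ?thesis by (rule that)
qed

lemma dsum_comp_small_emb:
  "f \<in> carrier (ext_dsum UNIV V) \<Longrightarrow> dsum_comp V (small_emb (ext_dsum UNIV V) f) = f"
  unfolding dsum_comp_def by (rule the_inv_into_f_f[OF small_ext_dsum(3)])

lemma dsum_cases:
  assumes "x \<in> carrier (dsum V)"
  obtains f where "f \<in> carrier (ext_dsum UNIV V)" "x = small_emb (ext_dsum UNIV V) f"
    "dsum_comp V x = f"
  using assms dsum_comp_small_emb unfolding small_ext_dsum(2)[symmetric] by blast

lemma dsum_comp_linear: "(\<lambda>x. dsum_comp V x i) \<in> linear_maps K (dsum V) (V i)"
proof (rule linear_mapsI)
  note D = ext_dsum_UNIV_module
  fix x assume x: "x \<in> carrier (dsum V)"
  then obtain f where f: "f \<in> carrier (ext_dsum UNIV V)" "x = small_emb (ext_dsum UNIV V) f" "dsum_comp V x = f"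
    by (rule dsum_cases)
  show "dsum_comp V x i \<in> carrier (V i)"
    using f by (simp add: ext_dsum_carrier_iff)
  {
    fix c assume c: "c \<in> carrier K"
    have "c \<odot>\<^bsub>dsum V\<^esub> x = small_emb (ext_dsum UNIV V) (c \<odot>\<^bsub>ext_dsum UNIV V\<^esub> f)"
      using f c linear_smult[OF small_ext_dsum(1)] by simp
    then show "dsum_comp V (c \<odot>\<^bsub>dsum V\<^esub> x) i = c \<odot>\<^bsub>V i\<^esub> dsum_comp V x i"
      using f(1,3) c D by (simp add: dsum_comp_small_emb) (simp add: ext_dsum_def)
  }
  fix y assume "y \<in> carrier (dsum V)"
  then obtain g where g: "g \<in> carrier (ext_dsum UNIV V)" "y = small_emb (ext_dsum UNIV V) g" "dsum_comp V y = g"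
    by (rule dsum_cases)
  have "x \<oplus>\<^bsub>dsum V\<^esub> y = small_emb (ext_dsum UNIV V) (f \<oplus>\<^bsub>ext_dsum UNIV V\<^esub> g)"
    using f g linear_add[OF small_ext_dsum(1)] by simp
  then show "dsum_comp V (x \<oplus>\<^bsub>dsum V\<^esub> y) i = dsum_comp V x i \<oplus>\<^bsub>V i\<^esub> dsum_comp V y i"
    using f(1,3) g(1,3) D by (simp add: dsum_comp_small_emb) (simp add: ext_dsum_def)
qed

lemma dsum_comp_in:
  "x \<in> carrier (V i) \<Longrightarrow> dsum_comp V (dsum_in V i x) j = (if j = i then x else \<zero>\<^bsub>V j\<^esub>)"
  using linear_closed[OF single_linear[of UNIV V i]] V
  by (simp add: dsum_in_def dsum_comp_small_emb) (simp add: single_def)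

lemma dsum_comp_finite: "x \<in> carrier (dsum V) \<Longrightarrow> finite {i. dsum_comp V x i \<noteq> \<zero>\<^bsub>V i\<^esub>}"
  by (erule dsum_cases) (simp add: ext_dsum_carrier_iff)

lemma dsum_eqI:
  assumes "x \<in> carrier (dsum V)" "y \<in> carrier (dsum V)"
    and "\<And>i. dsum_comp V x i = dsum_comp V y i"
  shows "x = y"
proof -
  have "dsum_comp V x = dsum_comp V y" using assms(3) by blast
  then show ?thesis using dsum_cases[OF assms(1)] dsum_cases[OF assms(2)] by metis
qed

lemma dsum_exists:
  assumes "\<And>i. f i \<in> carrier (V i)" "finite {i. f i \<noteq> \<zero>\<^bsub>V i\<^esub>}"
  obtains x where "x \<in> carrier (dsum V)" "\<And>i. dsum_comp V x i = f i"
proof -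
  have f: "f \<in> carrier (ext_dsum UNIV V)"
    using assms by (simp add: ext_dsum_carrier_iff)
  then have "small_emb (ext_dsum UNIV V) f \<in> carrier (dsum V)"
    unfolding small_ext_dsum(2)[symmetric] by (rule imageI)
  then show ?thesis
    using dsum_comp_small_emb[OF f] that by metis
qed

end

section \<open>Tensor products of modules\<close>

definition bilinear_maps :: "('k, 'v) module \<Rightarrow> ('k, 'w) module \<Rightarrow> ('k, 'x) module \<Rightarrow> ('v \<Rightarrow> 'w \<Rightarrow> 'x) set" where
  "bilinear_maps V W X =
     {\<beta>. (\<forall>x \<in> carrier V. \<beta> x \<in> linear_maps K W X) \<and> (\<forall>y \<in> carrier W. (\<lambda>x. \<beta> x y) \<in> linear_maps K V X)}"

lemma bilinear_mapsI:
  assumes "\<And>x. x \<in> carrier V \<Longrightarrow> \<beta> x \<in> linear_maps K W X"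
    and "\<And>y. y \<in> carrier W \<Longrightarrow> (\<lambda>x. \<beta> x y) \<in> linear_maps K V X"
  shows "\<beta> \<in> bilinear_maps V W X"
  using assms by (simp add: bilinear_maps_def)

lemma bilinear_right: "\<lbrakk>\<beta> \<in> bilinear_maps V W X; x \<in> carrier V\<rbrakk> \<Longrightarrow> \<beta> x \<in> linear_maps K W X"
  by (simp add: bilinear_maps_def)

lemma bilinear_left: "\<lbrakk>\<beta> \<in> bilinear_maps V W X; y \<in> carrier W\<rbrakk> \<Longrightarrow> (\<lambda>x. \<beta> x y) \<in> linear_maps K V X"
  by (simp add: bilinear_maps_def)

lemma bilinear_closed:
  "\<lbrakk>\<beta> \<in> bilinear_maps V W X; x \<in> carrier V; y \<in> carrier W\<rbrakk> \<Longrightarrow> \<beta> x y \<in> carrier X"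
  by (rule linear_closed[OF bilinear_right])

lemma ground_module_module: "module K (ground_module K)"
  by (rule moduleI)
    (auto intro!: abelian_groupI is_cring simp: ground_module_def a_ac l_distr r_distr m_assoc
      intro: exI[where x = "\<ominus> _"] l_neg)

context
  fixes V W :: "('k, 'u) module"
  assumes V: "module K V" and W: "module K W"
begin

lemma pair_free_module: "module K (pair_free K V W)"
  unfolding pair_free_def by (rule ext_dsum_module) (rule ground_module_module)

lemma single_pair_linear:
  "\<lbrakk>x \<in> carrier V; y \<in> carrier W\<rbrakk> \<Longrightarrow>
     single (carrier V \<times> carrier W) (\<lambda>_. ground_module K) (x, y)
       \<in> linear_maps K (ground_module K) (pair_free K V W)"
  unfolding pair_free_def by (rule single_linear) (auto simp: ground_module_module)

lemma pair_gen_closed: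
  "\<lbrakk>x \<in> carrier V; y \<in> carrier W\<rbrakk> \<Longrightarrow> pair_gen K V W x y \<in> carrier (pair_free K V W)"
  unfolding pair_gen_def by (rule linear_closed[OF single_pair_linear]) (auto simp: ground_module_def)

lemma bilinear_relations_closed: "bilinear_relations K V W \<subseteq> carrier (pair_free K V W)"
  using V W pair_free_module by (auto simp: bilinear_relations_def Let_def pair_gen_closed)

lemma gen_submodule_least:
  assumes "submodule N K M" "S \<subseteq> N"
  shows "gen_submodule K M S \<subseteq> N"
  using assms by (auto simp: gen_submodule_def)

lemma gen_submodule_superset: "S \<subseteq> gen_submodule K M S"
  by (auto simp: gen_submodule_def)

lemma gen_submodule_submodule:
  assumes M: "module K M" and S: "S \<subseteq> carrier M"
  shows "submodule (gen_submodule K M S) K M"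
proof (rule module_restrict_carrier(2)[OF M])
  show "gen_submodule K M S \<subseteq> carrier M"
    by (rule gen_submodule_least[OF module.carrier_is_submodule[OF M] S])
qed (auto simp: gen_submodule_def submodule_closed[OF _ M])

abbreviation (input) relations where
  "relations \<equiv> gen_submodule K (pair_free K V W) (bilinear_relations K V W)"

lemma relations_submodule: "submodule relations K (pair_free K V W)"
  by (rule gen_submodule_submodule[OF pair_free_module bilinear_relations_closed])

text \<open>A coset is recovered from a chosen representative. Representatives are finitely
  supported functions on pairs, and they fit into \<open>'u\<close> by \<open>ext_dsum_inj\<close>
  once a pair together with a coefficient does.\<close>

lemma ext_tensor_inj:
  obtains e :: "('u \<times> 'u \<Rightarrow> 'k) set \<Rightarrow> 'u" where "inj_on e (carrier (ext_tensor K V W))"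
proof -
  obtain p :: "'u \<times> 'u \<Rightarrow> 'u" where p: "inj p"
    by (rule infinite_inj_prod[OF infinite_univ])
  have "inj_on (\<lambda>((x, y), c). p (p (x, y), emb c))
      (SIGMA i:carrier V \<times> carrier W. carrier (ground_module K))"
    by (rule inj_onI) (auto dest!: injD[OF p] simp: ground_module_def inj_on_eq_iff[OF emb_inj])
  then obtain e :: "('u \<times> 'u \<Rightarrow> 'k) \<Rightarrow> 'u" where e: "inj_on e (carrier (pair_free K V W))"
    unfolding pair_free_def by (rule ext_dsum_inj[OF infinite_univ])
  define r where "r X = (SOME z. z \<in> carrier (pair_free K V W) \<and> X = relations +>\<^bsub>pair_free K V W\<^esub> z)" for X
  have r: "r X \<in> carrier (pair_free K V W) \<and> X = relations +>\<^bsub>pair_free K V W\<^esub> r X"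
    if "X \<in> carrier (ext_tensor K V W)" for X
  proof -
    have "\<exists>z. z \<in> carrier (pair_free K V W) \<and> X = relations +>\<^bsub>pair_free K V W\<^esub> z"
      using that unfolding ext_tensor_def quot_module(3)[OF relations_submodule pair_free_module, symmetric]
      by blast
    then show ?thesis
      unfolding r_def by (rule someI_ex)
  qed
  have "inj_on (\<lambda>X. e (r X)) (carrier (ext_tensor K V W))"
    by (rule inj_onI) (metis r inj_onD[OF e])
  then show ?thesis by (rule that)
qed

lemma ext_tensor_module: "module K (ext_tensor K V W)"
  unfolding ext_tensor_def by (rule quot_module(1)[OF relations_submodule pair_free_module])

lemma tensor_module: "module K (tensor K V W)"
  unfolding tensor_def by (rule ext_tensor_inj) (rule small_module(1)[OF ext_tensor_module])

text \<open>The quotient map followed by the copying map. It is a linear surjection from the free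
  module with kernel \<open>relations\<close>, so that universal properties follow from
  \<open>linear_factor\<close> with no separate treatment of the copy.\<close>

definition tensor_proj :: "('u \<times> 'u \<Rightarrow> 'k) \<Rightarrow> 'u" where
  "tensor_proj z = small_emb (ext_tensor K V W) (relations +>\<^bsub>pair_free K V W\<^esub> z)"

lemma tensor_proj_pair_gen: "tensor_proj (pair_gen K V W x y) = pure_tensor K V W x y"
  by (simp add: tensor_proj_def pure_tensor_def)

lemma small_ext_tensor:
  "(small_emb (ext_tensor K V W) :: _ \<Rightarrow> 'u) \<in> linear_maps K (ext_tensor K V W) (tensor K V W)"
  "(small_emb (ext_tensor K V W) :: _ \<Rightarrow> 'u) ` carrier (ext_tensor K V W) = carrier (tensor K V W)"
  "inj_on (small_emb (ext_tensor K V W) :: _ \<Rightarrow> 'u) (carrier (ext_tensor K V W))"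
  unfolding tensor_def
  by (rule ext_tensor_inj; erule small_module[OF ext_tensor_module] small_emb_inj)+

lemma tensor_proj_linear: "tensor_proj \<in> linear_maps K (pair_free K V W) (tensor K V W)"
  unfolding tensor_proj_def[abs_def]
  by (rule linear_comp[OF _ small_ext_tensor(1)])
    (unfold ext_tensor_def, rule quot_module(2)[OF relations_submodule pair_free_module])

lemma tensor_proj_surj: "tensor_proj ` carrier (pair_free K V W) = carrier (tensor K V W)"
  unfolding tensor_proj_def[abs_def] small_ext_tensor(2)[symmetric] ext_tensor_def
    quot_module(3)[OF relations_submodule pair_free_module, symmetric] by (simp add: image_image)

lemma tensor_proj_zero_iff:
  assumes z: "z \<in> carrier (pair_free K V W)"
  shows "tensor_proj z = \<zero>\<^bsub>tensor K V W\<^esub> \<longleftrightarrow> z \<in> relations"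
proof -
  let ?c = "relations +>\<^bsub>pair_free K V W\<^esub> z"
  have c: "?c \<in> carrier (ext_tensor K V W)"
    unfolding ext_tensor_def
    using linear_closed[OF quot_module(2)[OF relations_submodule pair_free_module] z] .
  have "tensor_proj z = \<zero>\<^bsub>tensor K V W\<^esub> \<longleftrightarrow> ?c = \<zero>\<^bsub>ext_tensor K V W\<^esub>"
    unfolding tensor_proj_def linear_zero[OF small_ext_tensor(1) ext_tensor_module tensor_module, symmetric]
    using inj_on_eq_iff[OF small_ext_tensor(3) c module_zero_closed[OF ext_tensor_module]] by simp
  also have "\<dots> \<longleftrightarrow> z \<in> relations"
    unfolding ext_tensor_def by (rule quot_module(4)[OF relations_submodule pair_free_module z])
  finally show ?thesis .
qed

lemma tensor_relation:
  assumes "z \<ominus>\<^bsub>pair_free K V W\<^esub> z' \<in> bilinear_relations K V W"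
    and "z \<in> carrier (pair_free K V W)" "z' \<in> carrier (pair_free K V W)"
  shows "tensor_proj z = tensor_proj z'"
proof -
  have "z \<ominus>\<^bsub>pair_free K V W\<^esub> z' \<in> relations"
    by (rule subsetD[OF gen_submodule_superset assms(1)])
  then have "tensor_proj (z \<ominus>\<^bsub>pair_free K V W\<^esub> z') = \<zero>\<^bsub>tensor K V W\<^esub>"
    using assms(2,3) pair_free_module by (simp add: tensor_proj_zero_iff)
  then show ?thesis
    using assms(2,3) linear_closed[OF tensor_proj_linear] tensor_module pair_free_module
    by (simp add: linear_diff[OF tensor_proj_linear pair_free_module tensor_module] module_diff_eq_zero_iff)
qed

lemma pure_tensor_bilinear: "pure_tensor K V W \<in> bilinear_maps V W (tensor K V W)"
proof (rule bilinear_mapsI)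
  let ?P = "pair_free K V W" and ?\<delta> = "pair_gen K V W"
  note P = pair_free_module and l = tensor_proj_linear and d = pair_gen_closed
  fix x assume x: "x \<in> carrier V"
  show "pure_tensor K V W x \<in> linear_maps K W (tensor K V W)"
  proof (rule linear_mapsI)
    show "pure_tensor K V W x y \<in> carrier (tensor K V W)" if "y \<in> carrier W" for y
      using linear_closed[OF l d[OF x that]] by (simp add: tensor_proj_pair_gen)
    fix y assume y: "y \<in> carrier W"
    show "pure_tensor K V W x (y \<oplus>\<^bsub>W\<^esub> y') = pure_tensor K V W x y \<oplus>\<^bsub>tensor K V W\<^esub> pure_tensor K V W x y'"
      if y': "y' \<in> carrier W" for y'
    proof -
      have "?\<delta> x (y \<oplus>\<^bsub>W\<^esub> y') \<ominus>\<^bsub>?P\<^esub> (?\<delta> x y \<oplus>\<^bsub>?P\<^esub> ?\<delta> x y') \<in> bilinear_relations K V W"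
        unfolding bilinear_relations_def Let_def using x y y' by blast
      from tensor_relation[OF this] show ?thesis
        using x y y' P W d by (simp add: linear_add[OF l] flip: tensor_proj_pair_gen)
    qed
    show "pure_tensor K V W x (c \<odot>\<^bsub>W\<^esub> y) = c \<odot>\<^bsub>tensor K V W\<^esub> pure_tensor K V W x y"
      if c: "c \<in> carrier K" for c
    proof -
      have "?\<delta> x (c \<odot>\<^bsub>W\<^esub> y) \<ominus>\<^bsub>?P\<^esub> c \<odot>\<^bsub>?P\<^esub> ?\<delta> x y \<in> bilinear_relations K V W"
        unfolding bilinear_relations_def Let_def using x y c by blast
      from tensor_relation[OF this] show ?thesis
        using x y c P W d by (simp add: linear_smult[OF l] flip: tensor_proj_pair_gen)
    qed
  qed
next
  let ?P = "pair_free K V W" and ?\<delta> = "pair_gen K V W"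
  note P = pair_free_module and l = tensor_proj_linear and d = pair_gen_closed
  fix y assume y: "y \<in> carrier W"
  show "(\<lambda>x. pure_tensor K V W x y) \<in> linear_maps K V (tensor K V W)"
  proof (rule linear_mapsI)
    show "pure_tensor K V W x y \<in> carrier (tensor K V W)" if "x \<in> carrier V" for x
      using linear_closed[OF l d[OF that y]] by (simp add: tensor_proj_pair_gen)
    fix x assume x: "x \<in> carrier V"
    show "pure_tensor K V W (x \<oplus>\<^bsub>V\<^esub> x') y = pure_tensor K V W x y \<oplus>\<^bsub>tensor K V W\<^esub> pure_tensor K V W x' y"
      if x': "x' \<in> carrier V" for x'
    proof -
      have "?\<delta> (x \<oplus>\<^bsub>V\<^esub> x') y \<ominus>\<^bsub>?P\<^esub> (?\<delta> x y \<oplus>\<^bsub>?P\<^esub> ?\<delta> x' y) \<in> bilinear_relations K V W"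
        unfolding bilinear_relations_def Let_def using x y x' by blast
      from tensor_relation[OF this] show ?thesis
        using x y x' P V d by (simp add: linear_add[OF l] flip: tensor_proj_pair_gen)
    qed
    show "pure_tensor K V W (c \<odot>\<^bsub>V\<^esub> x) y = c \<odot>\<^bsub>tensor K V W\<^esub> pure_tensor K V W x y"
      if c: "c \<in> carrier K" for c
    proof -
      have "?\<delta> (c \<odot>\<^bsub>V\<^esub> x) y \<ominus>\<^bsub>?P\<^esub> c \<odot>\<^bsub>?P\<^esub> ?\<delta> x y \<in> bilinear_relations K V W"
        unfolding bilinear_relations_def Let_def using x y c by blast
      from tensor_relation[OF this] show ?thesis
        using x y c P V d by (simp add: linear_smult[OF l] flip: tensor_proj_pair_gen)
    qed
  qed
qed

lemma single_pair_eq: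
  assumes "x \<in> carrier V" "y \<in> carrier W" "c \<in> carrier K"
  shows "single (carrier V \<times> carrier W) (\<lambda>_. ground_module K) (x, y) c
    = c \<odot>\<^bsub>pair_free K V W\<^esub> pair_gen K V W x y"
  using linear_smult[OF single_pair_linear[OF assms(1,2)] assms(3), of \<one>] assms(3)
  by (simp add: pair_gen_def ground_module_def)

lemma tensor_spans:
  "spans (tensor K V W) {pure_tensor K V W x y | x y. x \<in> carrier V \<and> y \<in> carrier W}"
proof -
  let ?S = "\<Union>i\<in>carrier V \<times> carrier W.
    single (carrier V \<times> carrier W) (\<lambda>_. ground_module K) i ` carrier (ground_module K)"
  have "spans (tensor K V W) (tensor_proj ` ?S)"
    by (rule spans_image[OF _ tensor_proj_linear pair_free_module tensor_module tensor_proj_surj])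
      (unfold pair_free_def, rule ext_dsum_spans, rule ground_module_module)
  also have "tensor_proj ` ?S = {pure_tensor K V W x y | x y. x \<in> carrier V \<and> y \<in> carrier W}"
  proof (intro equalityI subsetI)
    fix t assume "t \<in> tensor_proj ` ?S"
    then obtain x y c where xyc: "x \<in> carrier V" "y \<in> carrier W" "c \<in> carrier K"
      and t: "t = tensor_proj (single (carrier V \<times> carrier W) (\<lambda>_. ground_module K) (x, y) c)"
      by (auto simp: ground_module_def)
    \<comment> \<open>A coefficient is absorbed into the first factor; pure tensors without scalars
      in front are therefore enough.\<close>
    have "t = pure_tensor K V W (c \<odot>\<^bsub>V\<^esub> x) y"
      using xyc unfolding t single_pair_eq[OF xyc]
      by (simp add: linear_smult[OF tensor_proj_linear] linear_smult[OF bilinear_left[OF pure_tensor_bilinear]]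
          pair_gen_closed tensor_proj_pair_gen)
    then show "t \<in> {pure_tensor K V W x y | x y. x \<in> carrier V \<and> y \<in> carrier W}"
      using xyc module_smult_closed[OF V] by blast
  next
    fix t assume "t \<in> {pure_tensor K V W x y | x y. x \<in> carrier V \<and> y \<in> carrier W}"
    then obtain x y where "x \<in> carrier V" "y \<in> carrier W" "t = tensor_proj (pair_gen K V W x y)"
      by (auto simp: tensor_proj_pair_gen)
    then show "t \<in> tensor_proj ` ?S"
      unfolding pair_gen_def by (auto simp: ground_module_def)
  qed
  finally show ?thesis .
qed

lemma tensor_lift:
  assumes X: "module K X" and \<beta>: "\<beta> \<in> bilinear_maps V W X"
  obtains h where "h \<in> linear_maps K (tensor K V W) X"
    "\<And>x y. \<lbrakk>x \<in> carrier V; y \<in> carrier W\<rbrakk> \<Longrightarrow> h (pure_tensor K V W x y) = \<beta> x y"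
proof -
  let ?P = "pair_free K V W" and ?\<delta> = "pair_gen K V W"
  note P = pair_free_module and d = pair_gen_closed
  have \<phi>: "(\<lambda>c. c \<odot>\<^bsub>X\<^esub> \<beta> (fst i) (snd i)) \<in> linear_maps K (ground_module K) X"
    if "i \<in> carrier V \<times> carrier W" for i
    using that bilinear_closed[OF \<beta>] X
    by (intro linear_mapsI) (auto simp: ground_module_def module.smult_l_distr[OF X] module.smult_assoc1[OF X])
  note lift = ext_dsum_lift[of "carrier V \<times> carrier W" "\<lambda>_. ground_module K" X
    "\<lambda>i c. c \<odot>\<^bsub>X\<^esub> \<beta> (fst i) (snd i)", OF ground_module_module X \<phi>, folded pair_free_def]
  obtain g where g: "g \<in> linear_maps K ?P X"
    and gs: "\<And>i c. \<lbrakk>i \<in> carrier V \<times> carrier W; c \<in> carrier (ground_module K)\<rbrakk> \<Longrightarrow>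
       g (single (carrier V \<times> carrier W) (\<lambda>_. ground_module K) i c) = c \<odot>\<^bsub>X\<^esub> \<beta> (fst i) (snd i)"
    using lift by blast
  have g_\<delta>: "g (?\<delta> x y) = \<beta> x y" if "x \<in> carrier V" "y \<in> carrier W" for x y
    using gs[of "(x, y)" \<one>] that bilinear_closed[OF \<beta> that] X
    by (simp add: pair_gen_def ground_module_def)
  \<comment> \<open>The kernel of \<open>g\<close> is a submodule containing the bilinearity
    relations, hence everything they generate. This is what \<open>linear_factor\<close> needs to
    pass from the free module to the tensor product.\<close>
  have "submodule {z \<in> carrier ?P. g z = \<zero>\<^bsub>X\<^esub>} K ?P"
    by (rule module_restrict_carrier(2)[OF P])
      (use P X in \<open>auto simp: linear_add[OF g] linear_smult[OF g] linear_zero[OF g P X]\<close>)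
  moreover have "bilinear_relations K V W \<subseteq> {z \<in> carrier ?P. g z = \<zero>\<^bsub>X\<^esub>}"
  proof
    fix z assume z: "z \<in> bilinear_relations K V W"
    then have "g z = \<zero>\<^bsub>X\<^esub>"
      unfolding bilinear_relations_def Let_def
      by (elim UnE CollectE exE conjE; hypsubst; simp add: linear_diff[OF g P X] linear_add[OF g] linear_smult[OF g] d V W P g_\<delta>
          linear_add[OF bilinear_right[OF \<beta>]] linear_smult[OF bilinear_right[OF \<beta>]]
          linear_add[OF bilinear_left[OF \<beta>]] linear_smult[OF bilinear_left[OF \<beta>]] bilinear_closed[OF \<beta>] X)
    with z show "z \<in> {z \<in> carrier ?P. g z = \<zero>\<^bsub>X\<^esub>}"
      using bilinear_relations_closed by blast
  qed
  ultimately have "relations \<subseteq> {z \<in> carrier ?P. g z = \<zero>\<^bsub>X\<^esub>}"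
    by (rule gen_submodule_least)
  then obtain h where h: "h \<in> linear_maps K (tensor K V W) X" "\<And>z. z \<in> carrier ?P \<Longrightarrow> h (tensor_proj z) = g z"
    using linear_factor[OF P tensor_module X tensor_proj_linear tensor_proj_surj g]
      tensor_proj_zero_iff by blast
  have "h (pure_tensor K V W x y) = \<beta> x y" if "x \<in> carrier V" "y \<in> carrier W" for x y
    using h(2)[OF d[OF that]] g_\<delta>[OF that] by (simp add: tensor_proj_pair_gen)
  with h(1) show ?thesis by (rule that)
qed

end

end

section \<open>Tensor products of complexes\<close>

context cring
begin

text \<open>Spanning sets are refined in layers: summands of a direct sum, then pure tensors in each
  summand, then tensors of chosen generators. Each layer only has to be shown to lie in every closed
  \<open>N\<close> that contains the next one.\<close>

lemma spans_trans:
  assumes S: "spans M S" and T: "T \<subseteq> carrier M"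
    and "\<And>N s. \<lbrakk>s \<in> S; T \<subseteq> N; \<zero>\<^bsub>M\<^esub> \<in> N; \<And>x y. \<lbrakk>x \<in> N; y \<in> N\<rbrakk> \<Longrightarrow> x \<oplus>\<^bsub>M\<^esub> y \<in> N;
      \<And>c x. \<lbrakk>c \<in> carrier R; x \<in> N\<rbrakk> \<Longrightarrow> c \<odot>\<^bsub>M\<^esub> x \<in> N\<rbrakk> \<Longrightarrow> s \<in> N"
  shows "spans M T"
  unfolding spans_def
proof (intro conjI allI impI)
  fix N assume N: "N \<subseteq> carrier M" and *: "T \<subseteq> N \<and> \<zero>\<^bsub>M\<^esub> \<in> N \<and> (\<forall>x \<in> N. \<forall>y \<in> N. x \<oplus>\<^bsub>M\<^esub> y \<in> N) \<and>
        (\<forall>c \<in> carrier R. \<forall>x \<in> N. c \<odot>\<^bsub>M\<^esub> x \<in> N)"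
  then have "S \<subseteq> N" using assms(3)[of _ N] by blast
  then show "N = carrier M" using S N * unfolding spans_def by blast
qed (rule T)

lemma spans_mono: "\<lbrakk>spans M S; S \<subseteq> T; T \<subseteq> carrier M\<rbrakk> \<Longrightarrow> spans M T"
  by (rule spans_trans) blast+

lemma spans_carrier: "spans M (carrier M)"
  by (auto simp: spans_def)

lemma koszul_closed [simp]: "koszul R n \<in> carrier R"
  by (simp add: koszul_def)

lemma koszul_diff_one: "koszul R (n - 1) = \<ominus> koszul R n"
  by (simp add: koszul_def)

lemma koszul_self [simp]: "koszul R n \<otimes> koszul R n = \<one>"
  by (simp add: koszul_def l_minus)

end

context small_ring
begin

lemma chain_complex_module: "chain_complex K V \<Longrightarrow> module K (sp V n)"
  by (simp add: chain_complex_def)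

lemma chain_complex_bd: "chain_complex K V \<Longrightarrow> bd V n \<in> linear_maps K (sp V n) (sp V (n + bdeg))"
  by (simp add: chain_complex_def)

lemma chain_complex_bd_bd:
  "\<lbrakk>chain_complex K V; x \<in> carrier (sp V n)\<rbrakk> \<Longrightarrow> bd V (n + bdeg) (bd V n x) = \<zero>\<^bsub>sp V (n + bdeg + bdeg)\<^esub>"
  by (simp add: chain_complex_def)

section \<open>Operations on bilinear maps\<close>

lemma bilinear_comp_left:
  assumes \<beta>: "\<beta> \<in> bilinear_maps V' W X" and f: "f \<in> linear_maps K V V'"
  shows "(\<lambda>x. \<beta> (f x)) \<in> bilinear_maps V W X"
proof (rule bilinear_mapsI)
  show "\<beta> (f x) \<in> linear_maps K W X" if "x \<in> carrier V" for x
    by (rule bilinear_right[OF \<beta> linear_closed[OF f that]])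
  show "(\<lambda>x. \<beta> (f x) y) \<in> linear_maps K V X" if "y \<in> carrier W" for y
    by (rule linear_comp[OF f bilinear_left[OF \<beta> that]])
qed

lemma bilinear_swap: "\<beta> \<in> bilinear_maps V W X \<Longrightarrow> (\<lambda>y x. \<beta> x y) \<in> bilinear_maps W V X"
  by (simp add: bilinear_maps_def)

lemma bilinear_comp_right:
  assumes \<beta>: "\<beta> \<in> bilinear_maps V W' X" and g: "g \<in> linear_maps K W W'"
  shows "(\<lambda>x y. \<beta> x (g y)) \<in> bilinear_maps V W X"
  by (rule bilinear_swap[OF bilinear_comp_left[OF bilinear_swap[OF \<beta>] g]])

lemma bilinear_comp_out:
  assumes \<beta>: "\<beta> \<in> bilinear_maps V W X" and h: "h \<in> linear_maps K X Y"
  shows "(\<lambda>x y. h (\<beta> x y)) \<in> bilinear_maps V W Y"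
proof (rule bilinear_mapsI)
  show "(\<lambda>y. h (\<beta> x y)) \<in> linear_maps K W Y" if "x \<in> carrier V" for x
    by (rule linear_comp[OF bilinear_right[OF \<beta> that] h])
  show "(\<lambda>x. h (\<beta> x y)) \<in> linear_maps K V Y" if "y \<in> carrier W" for y
    by (rule linear_comp[OF bilinear_left[OF \<beta> that] h])
qed

lemma bilinear_add:
  assumes X: "module K X" and \<beta>: "\<beta> \<in> bilinear_maps V W X" and \<gamma>: "\<gamma> \<in> bilinear_maps V W X"
  shows "(\<lambda>x y. \<beta> x y \<oplus>\<^bsub>X\<^esub> \<gamma> x y) \<in> bilinear_maps V W X"
proof (rule bilinear_mapsI)
  show "(\<lambda>y. \<beta> x y \<oplus>\<^bsub>X\<^esub> \<gamma> x y) \<in> linear_maps K W X" if "x \<in> carrier V" for x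
    by (rule linear_sum[OF X bilinear_right[OF \<beta> that] bilinear_right[OF \<gamma> that]])
  show "(\<lambda>x. \<beta> x y \<oplus>\<^bsub>X\<^esub> \<gamma> x y) \<in> linear_maps K V X" if "y \<in> carrier W" for y
    by (rule linear_sum[OF X bilinear_left[OF \<beta> that] bilinear_left[OF \<gamma> that]])
qed

lemma bilinear_zero: "module K X \<Longrightarrow> (\<lambda>x y. \<zero>\<^bsub>X\<^esub>) \<in> bilinear_maps V W X"
  by (rule bilinear_mapsI) (rule linear_zero_map, assumption)+

lemma bilinear_scale:
  assumes X: "module K X" and c: "c \<in> carrier K" and \<beta>: "\<beta> \<in> bilinear_maps V W X"
  shows "(\<lambda>x y. c \<odot>\<^bsub>X\<^esub> \<beta> x y) \<in> bilinear_maps V W X"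
proof (rule bilinear_mapsI)
  show "(\<lambda>y. c \<odot>\<^bsub>X\<^esub> \<beta> x y) \<in> linear_maps K W X" if "x \<in> carrier V" for x
    by (rule linear_scale[OF X bilinear_right[OF \<beta> that] c])
  show "(\<lambda>x. c \<odot>\<^bsub>X\<^esub> \<beta> x y) \<in> linear_maps K V X" if "y \<in> carrier W" for y
    by (rule linear_scale[OF X bilinear_left[OF \<beta> that] c])
qed

context
  fixes V W :: "('g::{complex_grading,countable}, 'k, 'u) cpx"
  assumes V: "\<And>n. module K (sp V n)" and W: "\<And>n. module K (sp W n)"
begin

lemma tens_sp_module: "module K (tens_sp K V W m)"
  unfolding tens_sp_def by (rule dsum_module) (rule tensor_module[OF V W])

lemma ten_bilinear:
  assumes "a + b = m"
  shows "ten K V W a b \<in> bilinear_maps (sp V a) (sp W b) (tens_sp K V W m)"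
proof -
  have "(\<lambda>x y. dsum_in (\<lambda>n. tensor K (sp V n) (sp W (a + b - n))) a (pure_tensor K (sp V a) (sp W b) x y))
      \<in> bilinear_maps (sp V a) (sp W b) (dsum (\<lambda>n. tensor K (sp V n) (sp W (a + b - n))))"
    using bilinear_comp_out[OF pure_tensor_bilinear[OF V W]]
      dsum_in_linear[of "\<lambda>n. tensor K (sp V n) (sp W (a + b - n))" a, OF tensor_module[OF V W]]
    by simp
  then show ?thesis
    using assms by (simp add: tens_sp_def ten_def[abs_def])
qed

lemma ten_closed:
  "\<lbrakk>a + b = m; x \<in> carrier (sp V a); y \<in> carrier (sp W b)\<rbrakk> \<Longrightarrow> ten K V W a b x y \<in> carrier (tens_sp K V W m)"
  by (rule bilinear_closed[OF ten_bilinear])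

lemma tens_spans_carrier:
  "spans (tens_sp K V W m)
    {ten K V W a b x y | a b x y. a + b = m \<and> x \<in> carrier (sp V a) \<and> y \<in> carrier (sp W b)}"
proof (rule spans_trans)
  let ?T = "\<lambda>n. tensor K (sp V n) (sp W (m - n))"
  let ?G = "{ten K V W a b x y | a b x y. a + b = m \<and> x \<in> carrier (sp V a) \<and> y \<in> carrier (sp W b)}"
  show "spans (tens_sp K V W m) (\<Union>n. dsum_in ?T n ` carrier (?T n))"
    unfolding tens_sp_def by (rule dsum_spans) (rule tensor_module[OF V W])
  show "?G \<subseteq> carrier (tens_sp K V W m)"
    using ten_closed by blast
  fix N s
  assume "s \<in> (\<Union>n. dsum_in ?T n ` carrier (?T n))"
    and G: "?G \<subseteq> N" and z: "\<zero>\<^bsub>tens_sp K V W m\<^esub> \<in> N"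
    and a: "\<And>x y. \<lbrakk>x \<in> N; y \<in> N\<rbrakk> \<Longrightarrow> x \<oplus>\<^bsub>tens_sp K V W m\<^esub> y \<in> N"
    and c: "\<And>c x. \<lbrakk>c \<in> carrier K; x \<in> N\<rbrakk> \<Longrightarrow> c \<odot>\<^bsub>tens_sp K V W m\<^esub> x \<in> N"
  then obtain n t where s: "s = dsum_in ?T n t" and t: "t \<in> carrier (?T n)" by blast
  note T = tensor_module[OF V[of n] W[of "m - n"]]
  have l: "dsum_in ?T n \<in> linear_maps K (?T n) (tens_sp K V W m)"
    unfolding tens_sp_def by (rule dsum_in_linear) (rule tensor_module[OF V W])
  show "s \<in> N"
    unfolding s using tensor_spans[OF V W] T t
  proof (induction rule: spans_induct)
    case (gen u)
    then obtain x y where xy: "x \<in> carrier (sp V n)" "y \<in> carrier (sp W (m - n))"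
      and u: "u = pure_tensor K (sp V n) (sp W (m - n)) x y" by blast
    have "dsum_in ?T n u = ten K V W n (m - n) x y"
      unfolding u ten_def by simp
    then show ?case using G xy by force
  qed (use z a c in \<open>simp_all add: linear_add[OF l] linear_smult[OF l] linear_zero[OF l T tens_sp_module]\<close>)
qed

lemma tens_spans:
  assumes S: "\<And>a. spans (sp V a) (S a)" and T: "\<And>b. spans (sp W b) (T b)"
  shows "spans (tens_sp K V W m) {ten K V W a b x y | a b x y. a + b = m \<and> x \<in> S a \<and> y \<in> T b}"
    (is "spans ?M ?G")
proof (rule spans_trans[OF tens_spans_carrier])
  show "?G \<subseteq> carrier ?M"
    using ten_closed spans_subset[OF S] spans_subset[OF T] by fast
  fix N s
  assume "s \<in> {ten K V W a b x y | a b x y. a + b = m \<and> x \<in> carrier (sp V a) \<and> y \<in> carrier (sp W b)}"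
    and G: "?G \<subseteq> N" and z: "\<zero>\<^bsub>?M\<^esub> \<in> N"
    and add: "\<And>x y. \<lbrakk>x \<in> N; y \<in> N\<rbrakk> \<Longrightarrow> x \<oplus>\<^bsub>?M\<^esub> y \<in> N"
    and c: "\<And>c x. \<lbrakk>c \<in> carrier K; x \<in> N\<rbrakk> \<Longrightarrow> c \<odot>\<^bsub>?M\<^esub> x \<in> N"
  then obtain a b x y where s: "s = ten K V W a b x y" and ab: "a + b = m"
    and x: "x \<in> carrier (sp V a)" and y: "y \<in> carrier (sp W b)" by blast
  note M = tens_sp_module[of m]
  have l: "ten K V W a b u \<in> linear_maps K (sp W b) ?M" if "u \<in> S a" for u
    using bilinear_right[OF ten_bilinear[OF ab]] spans_subset[OF S] that by blast
  \<comment> \<open>The induction over \<open>y\<close> is carried out for a generator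
    \<open>u\<close> in the left factor; the induction over the left factor follows, with
    \<open>y\<close> fixed.\<close>
  have *: "ten K V W a b u y \<in> N" if u: "u \<in> S a" for u
    using T W y
  proof (induction rule: spans_induct)
    case (gen t) then show ?case using G ab u by blast
  qed (use z add c in \<open>simp_all add: linear_add[OF l[OF u]] linear_smult[OF l[OF u]] linear_zero[OF l[OF u] W M]\<close>)
  note l = bilinear_left[OF ten_bilinear[OF ab] y]
  show "s \<in> N"
    unfolding s using S V x
    by (induction rule: spans_induct)
      (use z add c * in \<open>simp_all add: linear_add[OF l] linear_smult[OF l] linear_zero[OF l V M]\<close>)
qed

text \<open>Combines the universal property of the direct sum with that of each summand. The
  summands are indexed by the degree of the left factor alone, the other degree being m - n; a
  family over all pairs with a + b = m hides this asymmetry.\<close>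

lemma tens_lift:
  assumes X: "module K X" and \<beta>: "\<And>a b. a + b = m \<Longrightarrow> \<beta> a b \<in> bilinear_maps (sp V a) (sp W b) X"
  obtains h where "h \<in> linear_maps K (tens_sp K V W m) X"
    "\<And>a b x y. \<lbrakk>a + b = m; x \<in> carrier (sp V a); y \<in> carrier (sp W b)\<rbrakk> \<Longrightarrow> h (ten K V W a b x y) = \<beta> a b x y"
proof -
  let ?T = "\<lambda>n. tensor K (sp V n) (sp W (m - n))"
  have "\<exists>h. h \<in> linear_maps K (?T n) X \<and> (\<forall>x \<in> carrier (sp V n). \<forall>y \<in> carrier (sp W (m - n)).
      h (pure_tensor K (sp V n) (sp W (m - n)) x y) = \<beta> n (m - n) x y)" for n
  proof -
    have "\<beta> n (m - n) \<in> bilinear_maps (sp V n) (sp W (m - n)) X" by (rule \<beta>) simp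
    then show ?thesis using tensor_lift[OF V W X] by metis
  qed
  then obtain g where g: "\<And>n. g n \<in> linear_maps K (?T n) X"
    "\<And>n x y. \<lbrakk>x \<in> carrier (sp V n); y \<in> carrier (sp W (m - n))\<rbrakk> \<Longrightarrow>
      g n (pure_tensor K (sp V n) (sp W (m - n)) x y) = \<beta> n (m - n) x y"
    by metis
  obtain h where h: "h \<in> linear_maps K (dsum ?T) X" "\<And>n t. t \<in> carrier (?T n) \<Longrightarrow> h (dsum_in ?T n t) = g n t"
    using dsum_lift[of ?T X g, OF tensor_module[OF V W] X g(1)] by blast
  have "h (ten K V W a b x y) = \<beta> a b x y"
    if ab: "a + b = m" and x: "x \<in> carrier (sp V a)" and y: "y \<in> carrier (sp W b)" for a b x y
  proof -
    have b: "b = m - a" using ab by (simp add: algebra_simps)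
    have "pure_tensor K (sp V a) (sp W b) x y \<in> carrier (tensor K (sp V a) (sp W b))"
      by (rule bilinear_closed[OF pure_tensor_bilinear[OF V W] x y])
    then show ?thesis
      using h(2)[of _ a] g(2)[OF x] y unfolding ten_def b by simp
  qed
  with h(1) show ?thesis unfolding tens_sp_def[symmetric] by (rule that)
qed

text \<open>The description has the form used in \<open>tens_cpx\<close>, \<open>tens_cmap\<close>
  and \<open>braid_cmap\<close>, so that each of these is evaluated by supplying the right family
  \<open>\<beta>\<close> and its bilinearity.\<close>

lemma the_linear_tens:
  assumes X: "module K X" and \<beta>: "\<And>a b. a + b = m \<Longrightarrow> \<beta> a b \<in> bilinear_maps (sp V a) (sp W b) X"
  defines "h \<equiv> the_linear K (tens_sp K V W m) X (\<lambda>h. \<forall>a b. \<forall>x \<in> carrier (sp V a). \<forall>y \<in> carrier (sp W b).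
    a + b = m \<longrightarrow> h (ten K V W a b x y) = \<beta> a b x y)"
  shows "h \<in> linear_maps K (tens_sp K V W m) X" "h \<in> extensional (carrier (tens_sp K V W m))"
    and "\<lbrakk>a + b = m; x \<in> carrier (sp V a); y \<in> carrier (sp W b)\<rbrakk> \<Longrightarrow> h (ten K V W a b x y) = \<beta> a b x y"
proof -
  obtain f where f: "f \<in> linear_maps K (tens_sp K V W m) X"
    and fv: "\<And>a b x y. \<lbrakk>a + b = m; x \<in> carrier (sp V a); y \<in> carrier (sp W b)\<rbrakk> \<Longrightarrow> f (ten K V W a b x y) = \<beta> a b x y"
    using tens_lift[OF X \<beta>] by blast
  have "(\<forall>a b. \<forall>x \<in> carrier (sp V a). \<forall>y \<in> carrier (sp W b). a + b = m \<longrightarrow> h (ten K V W a b x y) = \<beta> a b x y)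
    \<longleftrightarrow> (\<forall>s \<in> {ten K V W a b x y | a b x y. a + b = m \<and> x \<in> carrier (sp V a) \<and> y \<in> carrier (sp W b)}. h s = f s)" for h
    using fv by fastforce
  note * = the_linear_spans[OF tens_spans_carrier tens_sp_module X f this, folded h_def]
  show "h \<in> linear_maps K (tens_sp K V W m) X" by (rule *(1))
  show "h \<in> extensional (carrier (tens_sp K V W m))" by (rule *(2))
  show "h (ten K V W a b x y) = \<beta> a b x y"
    if ab: "a + b = m" and x: "x \<in> carrier (sp V a)" and y: "y \<in> carrier (sp W b)"
    using *(3)[OF ten_closed[OF that]] fv[OF that] by simp
qed

end

context
  fixes V W :: "('g::{complex_grading,countable}, 'k, 'u) cpx"
  assumes V: "chain_complex K V" and W: "chain_complex K W"
begin

private lemmas Vm = chain_complex_module[OF V] and Wm = chain_complex_module[OF W]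

lemma tens_bd_bilinear:
  assumes ab: "a + b = m"
  shows "(\<lambda>x y. ten K V W (a + bdeg) b (bd V a x) y \<oplus>\<^bsub>tens_sp K V W (m + bdeg)\<^esub>
      koszul K (hdeg a) \<odot>\<^bsub>tens_sp K V W (m + bdeg)\<^esub> ten K V W a (b + bdeg) x (bd W b y))
    \<in> bilinear_maps (sp V a) (sp W b) (tens_sp K V W (m + bdeg))"
proof -
  have "a + bdeg + b = m + bdeg" "a + (b + bdeg) = m + bdeg"
    using ab by (auto simp: ac_simps)
  note t = this[THEN ten_bilinear[of V W, OF Vm Wm]]
  show ?thesis
    by (rule bilinear_add[OF _ bilinear_comp_left[OF t(1) chain_complex_bd[OF V]]
        bilinear_scale[OF _ koszul_closed bilinear_comp_right[OF t(2) chain_complex_bd[OF W]]]])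
      (rule tens_sp_module[OF Vm Wm])+
qed

lemma tens_sp_cpx [simp]: "sp (tens_cpx K V W) = tens_sp K V W"
  by (simp add: tens_cpx_def)

lemma tens_bd_linear: "bd (tens_cpx K V W) m \<in> linear_maps K (tens_sp K V W m) (tens_sp K V W (m + bdeg))"
  unfolding tens_cpx_def cpx.simps
  by (rule the_linear_tens(1)[OF Vm Wm tens_sp_module[OF Vm Wm] tens_bd_bilinear])

lemma tens_bd_ten:
  "\<lbrakk>a + b = m; x \<in> carrier (sp V a); y \<in> carrier (sp W b)\<rbrakk> \<Longrightarrow>
    bd (tens_cpx K V W) m (ten K V W a b x y) =
      ten K V W (a + bdeg) b (bd V a x) y \<oplus>\<^bsub>tens_sp K V W (m + bdeg)\<^esub>
      koszul K (hdeg a) \<odot>\<^bsub>tens_sp K V W (m + bdeg)\<^esub> ten K V W a (b + bdeg) x (bd W b y)"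
  unfolding tens_cpx_def cpx.simps
  by (rule the_linear_tens(3)[OF Vm Wm tens_sp_module[OF Vm Wm] tens_bd_bilinear])

lemma tens_chain_complex: "chain_complex K (tens_cpx K V W)"
  unfolding chain_complex_def tens_sp_cpx
proof (intro conjI allI ballI)
  let ?S = "tens_sp K V W"
  note M = tens_sp_module[OF Vm Wm]
  show "module K (?S n)" for n by (rule M)
  show "bd (tens_cpx K V W) n \<in> linear_maps K (?S n) (?S (n + bdeg))" for n by (rule tens_bd_linear)
  fix n t assume t: "t \<in> carrier (?S n)"
  show "bd (tens_cpx K V W) (n + bdeg) (bd (tens_cpx K V W) n t) = \<zero>\<^bsub>?S (n + bdeg + bdeg)\<^esub>"
  proof (rule linear_eq_on_spans[OF tens_spans_carrier[OF Vm Wm] M M linear_comp[OF tens_bd_linear tens_bd_linear]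
        linear_zero_map[OF M] _ t])
    fix s assume "s \<in> {ten K V W a b x y | a b x y. a + b = n \<and> x \<in> carrier (sp V a) \<and> y \<in> carrier (sp W b)}"
    then obtain a b x y where s: "s = ten K V W a b x y" and ab: "a + b = n"
      and x: "x \<in> carrier (sp V a)" and y: "y \<in> carrier (sp W b)" by blast
    let ?N = "?S (n + bdeg + bdeg)" and ?k = "koszul K (hdeg a)"
    have dx: "bd V a x \<in> carrier (sp V (a + bdeg))" and dy: "bd W b y \<in> carrier (sp W (b + bdeg))"
      using linear_closed[OF chain_complex_bd[OF V] x] linear_closed[OF chain_complex_bd[OF W] y] .
    have e: "a + bdeg + b = n + bdeg" "a + (b + bdeg) = n + bdeg" "a + bdeg + (b + bdeg) = n + bdeg + bdeg"
      "a + bdeg + bdeg + b = n + bdeg + bdeg" "a + (b + bdeg + bdeg) = n + bdeg + bdeg"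
      using ab by (auto simp: ac_simps)
    have c1: "ten K V W (a + bdeg) b (bd V a x) y \<in> carrier (?S (n + bdeg))"
      and c2: "ten K V W a (b + bdeg) x (bd W b y) \<in> carrier (?S (n + bdeg))"
      and c3: "ten K V W (a + bdeg) (b + bdeg) (bd V a x) (bd W b y) \<in> carrier ?N"
      using ten_closed[OF Vm Wm] dx dy x y e by auto
    have z1: "ten K V W (a + bdeg + bdeg) b \<zero>\<^bsub>sp V (a + bdeg + bdeg)\<^esub> y = \<zero>\<^bsub>?N\<^esub>"
      using linear_zero[OF bilinear_left[OF ten_bilinear[OF Vm Wm e(4)] y] Vm M] .
    have z2: "ten K V W a (b + bdeg + bdeg) x \<zero>\<^bsub>sp W (b + bdeg + bdeg)\<^esub> = \<zero>\<^bsub>?N\<^esub>"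
      using linear_zero[OF bilinear_right[OF ten_bilinear[OF Vm Wm e(5)] x] Wm M] .
    \<comment> \<open>The differential lowers the homological degree by one and so reverses the
      sign; the two mixed terms, in which both factors are differentiated, then cancel.\<close>
    have k: "koszul K (hdeg (a + bdeg)) = \<ominus> ?k"
      using koszul_diff_one[of "hdeg a"] by (simp add: hdeg_add hdeg_bdeg)
    have "bd (tens_cpx K V W) (n + bdeg) (bd (tens_cpx K V W) n s) =
      bd (tens_cpx K V W) (n + bdeg) (ten K V W (a + bdeg) b (bd V a x) y) \<oplus>\<^bsub>?N\<^esub>
      ?k \<odot>\<^bsub>?N\<^esub> bd (tens_cpx K V W) (n + bdeg) (ten K V W a (b + bdeg) x (bd W b y))"
      unfolding s tens_bd_ten[OF ab x y]
      using c1 c2 M by (simp add: linear_add[OF tens_bd_linear] linear_smult[OF tens_bd_linear])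
    also have "\<dots> = \<zero>\<^bsub>?N\<^esub>"
      using c3 M
      by (simp add: tens_bd_ten[OF e(1) dx y] tens_bd_ten[OF e(2) x dy]
          chain_complex_bd_bd[OF V x] chain_complex_bd_bd[OF W y] z1 z2 k module.smult_l_minus[OF M]
          module_add_comm[OF M, of "\<ominus>\<^bsub>?N\<^esub> _"])
    finally show "bd (tens_cpx K V W) (n + bdeg) (bd (tens_cpx K V W) n s) = \<zero>\<^bsub>?N\<^esub>" .
  qed
qed

end

text \<open>Compatibility with the differentials is left out on purpose. Equality of two composites
  depends only on linearity, extensionality and values on generators, so the laws can be analysed
  before the maps are known to be chain maps.\<close>

definition linear_cmap :: "('g::complex_grading, 'k, 'u) cmap \<Rightarrow> bool" where
  "linear_cmap f \<longleftrightarrow> (\<forall>n. fn f n \<in> linear_maps K (sp (src f) n) (sp (tgt f) n)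
     \<inter> extensional (carrier (sp (src f) n)))"

lemma cmap_fn_linear: "linear_cmap f \<Longrightarrow> fn f n \<in> linear_maps K (sp (src f) n) (sp (tgt f) n)"
  by (simp add: linear_cmap_def)

lemma chain_map_linear: "chain_map K f \<Longrightarrow> linear_cmap f"
  by (simp add: linear_cmap_def chain_map_def)

lemma cmap_eqI:
  fixes f g :: "('g::complex_grading, 'k, 'u) cmap"
  assumes f: "linear_cmap f" and g: "linear_cmap g" and "src f = V" "src g = V" "tgt f = W" "tgt g = W"
    and V: "\<And>n. module K (sp V n)" and W: "\<And>n. module K (sp W n)"
    and S: "\<And>n. spans (sp V n) (S n)" and eq: "\<And>n s. s \<in> S n \<Longrightarrow> fn f n s = fn g n s"
  shows "f = g"
proof -
  have "fn f n = fn g n" for n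
    by (rule extensional_linear_eq_on_spans[OF S V W]) (use assms in \<open>auto simp: linear_cmap_def\<close>)
  then have "fn f = fn g" by blast
  then show ?thesis using assms by (intro cmap.equality) auto
qed

lemma linear_cmap_comp:
  assumes "linear_cmap f" "linear_cmap g" "tgt f = src g" "\<And>n. module K (sp (src f) n)"
  shows "linear_cmap (cmap_comp g f)"
  unfolding linear_cmap_def
proof
  fix n
  have "(\<lambda>x. fn g n (fn f n x)) \<in> linear_maps K (sp (src f) n) (sp (tgt g) n)"
    using linear_comp[OF cmap_fn_linear[OF assms(1), of n], of "fn g n" "sp (tgt g) n"]
      cmap_fn_linear[OF assms(2), of n] assms(3) by simp
  from linear_restrict[OF this assms(4)]
  show "fn (cmap_comp g f) n \<in> linear_maps K (sp (src (cmap_comp g f)) n) (sp (tgt (cmap_comp g f)) n) \<inter>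
    extensional (carrier (sp (src (cmap_comp g f)) n))"
    by (simp add: cmap_comp_def)
qed

lemma cmap_comp_simps [simp]:
  "src (cmap_comp g f) = src f" "tgt (cmap_comp g f) = tgt g"
  "x \<in> carrier (sp (src f) n) \<Longrightarrow> fn (cmap_comp g f) n x = fn g n (fn f n x)"
  by (simp_all add: cmap_comp_def)

lemma cmap_id_simps [simp]:
  "src (cmap_id V) = V" "tgt (cmap_id V) = V"
  "x \<in> carrier (sp V n) \<Longrightarrow> fn (cmap_id V) n x = x"
  by (simp_all add: cmap_id_def)

lemma linear_cmap_id:
  assumes "\<And>n. module K (sp V n)"
  shows "linear_cmap (cmap_id V)"
  using linear_restrict[OF linear_id assms] by (simp add: linear_cmap_def cmap_id_def)

lemma tens_cmap_simps [simp]: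
  "src (tens_cmap K f g) = tens_cpx K (src f) (src g)" "tgt (tens_cmap K f g) = tens_cpx K (tgt f) (tgt g)"
  by (simp_all add: tens_cmap_def Let_def)

context
  fixes f g :: "('g::{complex_grading,countable}, 'k, 'u) cmap"
  assumes f: "linear_cmap f" and g: "linear_cmap g"
    and fm: "chain_complex K (src f)" "chain_complex K (tgt f)"
    and gm: "chain_complex K (src g)" "chain_complex K (tgt g)"
begin

lemma tens_cmap_bilinear:
  "a + b = m \<Longrightarrow> (\<lambda>x y. ten K (tgt f) (tgt g) a b (fn f a x) (fn g b y))
    \<in> bilinear_maps (sp (src f) a) (sp (src g) b) (tens_sp K (tgt f) (tgt g) m)"
  by (rule bilinear_comp_left[OF bilinear_comp_right[OF
        ten_bilinear[OF chain_complex_module[OF fm(2)] chain_complex_module[OF gm(2)]]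
        cmap_fn_linear[OF g]] cmap_fn_linear[OF f]])

lemma tens_cmap_linear: "linear_cmap (tens_cmap K f g)"
  using the_linear_tens(1,2)[OF chain_complex_module[OF fm(1)] chain_complex_module[OF gm(1)]
      tens_sp_module[OF chain_complex_module[OF fm(2)] chain_complex_module[OF gm(2)]] tens_cmap_bilinear]
  by (simp add: linear_cmap_def tens_cmap_def Let_def tens_sp_cpx[OF fm(1) gm(1)] tens_sp_cpx[OF fm(2) gm(2)])

lemma tens_cmap_ten:
  "\<lbrakk>a + b = m; x \<in> carrier (sp (src f) a); y \<in> carrier (sp (src g) b)\<rbrakk> \<Longrightarrow>
    fn (tens_cmap K f g) m (ten K (src f) (src g) a b x y) = ten K (tgt f) (tgt g) a b (fn f a x) (fn g b y)"
  using the_linear_tens(3)[OF chain_complex_module[OF fm(1)] chain_complex_module[OF gm(1)]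
      tens_sp_module[OF chain_complex_module[OF fm(2)] chain_complex_module[OF gm(2)]] tens_cmap_bilinear]
  by (simp add: tens_cmap_def Let_def)

end

end

section \<open>The structure maps of the category of complexes\<close>

context small_ring
begin

definition linear_cmaps :: "('g::complex_grading, 'k, 'u) cpx \<Rightarrow> ('g, 'k, 'u) cpx \<Rightarrow> ('g, 'k, 'u) cmap set" where
  "linear_cmaps V W = {f. linear_cmap f \<and> src f = V \<and> tgt f = W}"

lemma linear_cmapsD:
  assumes "f \<in> linear_cmaps V W"
  shows "linear_cmap f" "src f = V" "tgt f = W" "fn f n \<in> linear_maps K (sp V n) (sp W n)"
    "fn f n \<in> extensional (carrier (sp V n))"
  using assms by (auto simp: linear_cmaps_def linear_cmap_def)

text \<open>The bridge from equations between composites of structure maps to equations between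
  elements; \<open>S\<close> will be the tensors of homogeneous elements, the single generator of
  the unit, or the whole carrier.\<close>

lemma linear_cmaps_eq_iff:
  fixes f g :: "('g::complex_grading, 'k, 'u) cmap"
  assumes f: "f \<in> linear_cmaps V W" and g: "g \<in> linear_cmaps V W"
    and V: "chain_complex K V" and W: "chain_complex K W" and S: "\<And>n. spans (sp V n) (S n)"
  shows "f = g \<longleftrightarrow> (\<forall>n. \<forall>s \<in> S n. fn f n s = fn g n s)"
proof
  assume *: "\<forall>n. \<forall>s \<in> S n. fn f n s = fn g n s"
  show "f = g"
    using linear_cmapsD[OF f] linear_cmapsD[OF g] *
    by (intro cmap_eqI[OF _ _ _ _ _ _ chain_complex_module[OF V] chain_complex_module[OF W] S]) auto
qed simp

lemma comp_in_linear_cmaps: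
  assumes f: "f \<in> linear_cmaps V W" and g: "g \<in> linear_cmaps W X" and V: "chain_complex K V"
  shows "cmap_comp g f \<in> linear_cmaps V X"
  using linear_cmap_comp[of f g] linear_cmapsD[OF f] linear_cmapsD[OF g] chain_complex_module[OF V]
  by (simp add: linear_cmaps_def)

lemma comp_fn:
  "\<lbrakk>f \<in> linear_cmaps V W; x \<in> carrier (sp V n)\<rbrakk> \<Longrightarrow> fn (cmap_comp g f) n x = fn g n (fn f n x)"
  by (simp add: linear_cmaps_def)

lemma id_in_linear_cmaps: "chain_complex K V \<Longrightarrow> cmap_id V \<in> linear_cmaps V V"
  by (simp add: linear_cmaps_def linear_cmap_id chain_complex_module)

lemma tens_in_linear_cmaps:
  fixes V V' W W' :: "('g::{complex_grading,countable}, 'k, 'u) cpx"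
  assumes "f \<in> linear_cmaps V V'" "g \<in> linear_cmaps W W'"
    and "chain_complex K V" "chain_complex K V'" "chain_complex K W" "chain_complex K W'"
  shows "tens_cmap K f g \<in> linear_cmaps (tens_cpx K V W) (tens_cpx K V' W')"
    and "\<lbrakk>a + b = m; x \<in> carrier (sp V a); y \<in> carrier (sp W b)\<rbrakk> \<Longrightarrow>
      fn (tens_cmap K f g) m (ten K V W a b x y) = ten K V' W' a b (fn f a x) (fn g b y)"
  using tens_cmap_linear[of f g] tens_cmap_ten[of f g a b m x y] assms
  by (auto simp: linear_cmaps_def)

lemma chain_map_in_linear_cmaps: "\<lbrakk>chain_map K f; src f = V; tgt f = W\<rbrakk> \<Longrightarrow> f \<in> linear_cmaps V W"
  by (simp add: linear_cmaps_def chain_map_linear)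

section \<open>The unit complex\<close>

lemma unit_module_module: "module K (unit_module K n)"
  unfolding unit_module_def
  by (rule module_restrict_carrier(1)[OF ground_module_module]) (auto simp: ground_module_def split: if_splits)

lemma unit_module_inj: "inj_on emb (carrier (unit_module K n))"
  by (rule inj_on_subset[OF emb_inj]) (auto simp: unit_module_def)

lemmas unit_sp_module = small_module(1)[OF unit_module_module unit_module_inj]

lemma sp_unit_cpx: "sp (unit_cpx K) n = small (unit_module K n)"
  by (simp add: unit_cpx_def)

lemma unit_chain_complex: "chain_complex K (unit_cpx K :: ('g::complex_grading, 'k, 'u) cpx)"
  unfolding chain_complex_def
  by (simp add: unit_cpx_def unit_sp_module linear_zero_map)

lemma unit_elt_linear:
  "unit_elt K TYPE('g::complex_grading) \<in> linear_maps K (ground_module K) (sp (unit_cpx K :: ('g, 'k, 'u) cpx) 0)"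
proof -
  have "unit_module K (0 :: 'g) = ground_module K"
    by (simp add: unit_module_def ground_module_def)
  then show ?thesis
    using small_module(2)[OF unit_module_module unit_module_inj, of "0 :: 'g"]
    by (simp add: unit_elt_def[abs_def] sp_unit_cpx)
qed

lemma unit_elt_closed:
  "c \<in> carrier K \<Longrightarrow> unit_elt K TYPE('g::complex_grading) c \<in> carrier (sp (unit_cpx K :: ('g, 'k, 'u) cpx) 0)"
  using linear_closed[OF unit_elt_linear] by (simp add: ground_module_def)

lemma carrier_unit_cpx:
  "carrier (sp (unit_cpx K :: ('g::complex_grading, 'k, 'u) cpx) n) =
    (if n = 0 then unit_elt K TYPE('g) ` carrier K else {\<zero>\<^bsub>sp (unit_cpx K :: ('g, 'k, 'u) cpx) n\<^esub>})"
proof -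
  note s = small_module[OF unit_module_module unit_module_inj, of n]
  have "carrier (sp (unit_cpx K :: ('g, 'k, 'u) cpx) n) = small_emb (unit_module K n) ` carrier (unit_module K n)"
    by (simp add: sp_unit_cpx s(3))
  moreover have "(small_emb (unit_module K n) \<zero> :: 'u) = \<zero>\<^bsub>small (unit_module K n)\<^esub>"
    using linear_zero[OF s(2) unit_module_module s(1)] by (simp add: unit_module_def ground_module_def)
  ultimately show ?thesis
    by (auto simp: unit_elt_def[abs_def] unit_module_def sp_unit_cpx)
qed

lemma unit_elt_eq:
  "c \<in> carrier K \<Longrightarrow> unit_elt K TYPE('g::complex_grading) c =
    c \<odot>\<^bsub>sp (unit_cpx K :: ('g, 'k, 'u) cpx) 0\<^esub> unit_elt K TYPE('g) \<one>"
  using linear_smult[OF unit_elt_linear, of c \<one>] by (simp add: ground_module_def)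

lemma unit_spans:
  "spans (sp (unit_cpx K :: ('g::complex_grading, 'k, 'u) cpx) n) (if n = 0 then {unit_elt K TYPE('g) \<one>} else {})"
    (is "spans ?M ?S")
proof (rule spans_trans[OF spans_carrier])
  show "?S \<subseteq> carrier ?M" by (simp add: unit_elt_closed)
  fix N s
  assume s: "s \<in> carrier ?M" and N: "?S \<subseteq> N" "\<zero>\<^bsub>?M\<^esub> \<in> N"
    and c: "\<And>c x. \<lbrakk>c \<in> carrier K; x \<in> N\<rbrakk> \<Longrightarrow> c \<odot>\<^bsub>?M\<^esub> x \<in> N"
  show "s \<in> N"
  proof (cases "n = 0")
    case True
    then obtain d where d: "d \<in> carrier K" "s = unit_elt K TYPE('g) d"
      using s by (auto simp: carrier_unit_cpx)
    show ?thesis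
      unfolding d(2) unit_elt_eq[OF d(1)] using c d(1) N True by simp
  qed (use s N in \<open>simp add: carrier_unit_cpx\<close>)
qed

text \<open>The unitors multiply by a scalar that is present only as its copy in the unit complex;
  \<open>r\<close> reads it off again.\<close>

lemma unit_elt_inverse:
  obtains r where "r \<in> linear_maps K (sp (unit_cpx K :: ('g::complex_grading, 'k, 'u) cpx) 0) (ground_module K)"
    "\<And>c. c \<in> carrier K \<Longrightarrow> r (unit_elt K TYPE('g) c) = c"
proof -
  have u: "unit_module K (0 :: 'g) = ground_module K"
    by (simp add: unit_module_def ground_module_def)
  obtain r where "r \<in> linear_maps K (small (unit_module K (0 :: 'g)) :: ('k, 'u) module) (unit_module K (0 :: 'g))"
    "\<And>x. x \<in> carrier (unit_module K (0 :: 'g)) \<Longrightarrow> r (small_emb (unit_module K (0 :: 'g)) x :: 'u) = x"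
    using small_inverse[OF unit_module_module[of "0 :: 'g"] unit_module_inj[of "0 :: 'g"]] by blast
  then show ?thesis
    using that unfolding u sp_unit_cpx unit_elt_def by (simp add: ground_module_def)
qed

lemma scalar_bilinear:
  assumes V: "module K V"
  shows "(\<lambda>c x. c \<odot>\<^bsub>V\<^esub> x) \<in> bilinear_maps (ground_module K) V V"
proof (rule bilinear_mapsI)
  show "(\<odot>\<^bsub>V\<^esub>) c \<in> linear_maps K V V" if "c \<in> carrier (ground_module K)" for c
    using linear_scale[OF V linear_id, of c] that by (simp add: ground_module_def)
  show "(\<lambda>c. c \<odot>\<^bsub>V\<^esub> x) \<in> linear_maps K (ground_module K) V" if "x \<in> carrier V" for x
    by (rule linear_mapsI)
      (use that V in \<open>simp_all add: ground_module_def module.smult_l_distr[OF V] module.smult_assoc1[OF V]\<close>)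
qed

text \<open>The maps \<open>h z\<close> are typically obtained one at a time by choice, with nothing
  relating them for different \<open>z\<close>. Linearity in \<open>z\<close> nevertheless spreads
  from the generators to all \<open>t\<close>, because zero, sums and multiples of linear maps are
  linear.\<close>

lemma linear_family_bilinear:
  assumes S: "spans M S" and M: "module K M" and T: "module K T"
    and l: "\<And>z. z \<in> carrier Z \<Longrightarrow> h z \<in> linear_maps K M T"
    and s: "\<And>s. s \<in> S \<Longrightarrow> (\<lambda>z. h z s) \<in> linear_maps K Z T" and Z: "module K Z"
  shows "(\<lambda>t z. h z t) \<in> bilinear_maps M Z T"
proof (rule bilinear_mapsI)
  fix t assume "t \<in> carrier M"
  with S M show "(\<lambda>z. h z t) \<in> linear_maps K Z T"
  proof (induction rule: spans_induct)
    case zero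
    show ?case
      by (rule linear_cong[OF linear_zero_map[OF T] Z]) (simp add: linear_zero[OF l M T])
  next
    case (add x y)
    show ?case
      by (rule linear_cong[OF linear_sum[OF T add(3,4)] Z]) (simp add: linear_add[OF l] add(1,2))
  next
    case (smult c x)
    show ?case
      by (rule linear_cong[OF linear_scale[OF T smult(3,1)] Z]) (simp add: linear_smult[OF l] smult(1,2))
  qed (rule s)
qed (rule l)

section \<open>The unitors\<close>

context
  fixes V :: "('g::{complex_grading,countable}, 'k, 'u) cpx"
  assumes V: "chain_complex K V"
begin

private abbreviation (input) "I \<equiv> unit_cpx K :: ('g, 'k, 'u) cpx"

lemmas unit_tens = unit_chain_complex[where ?'g = 'g] V

lemma lunit_spans:
  "spans (tens_sp K I V m) {ten K I V 0 m (unit_elt K TYPE('g) \<one>) x | x. x \<in> carrier (sp V m)}"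
proof -
  have "{ten K I V a b x y | a b x y. a + b = m \<and> x \<in> (if a = 0 then {unit_elt K TYPE('g) \<one>} else {}) \<and>
      y \<in> carrier (sp V b)} = {ten K I V 0 m (unit_elt K TYPE('g) \<one>) x | x. x \<in> carrier (sp V m)}"
    by (auto split: if_splits)
  then show ?thesis
    using tens_spans[OF chain_complex_module[OF unit_chain_complex] chain_complex_module[OF V]
        unit_spans spans_carrier, of m] by simp
qed

lemma runit_spans:
  "spans (tens_sp K V I m) {ten K V I m 0 x (unit_elt K TYPE('g) \<one>) | x. x \<in> carrier (sp V m)}"
proof -
  have "{ten K V I a b x y | a b x y. a + b = m \<and> x \<in> carrier (sp V a) \<and>
      y \<in> (if b = 0 then {unit_elt K TYPE('g) \<one>} else {})} = {ten K V I m 0 x (unit_elt K TYPE('g) \<one>) | x. x \<in> carrier (sp V m)}"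
    by (auto split: if_splits)
  then show ?thesis
    using tens_spans[OF chain_complex_module[OF V] chain_complex_module[OF unit_chain_complex]
        spans_carrier unit_spans, of m] by simp
qed

lemma lunit_cmap:
  "lunit_cmap K V \<in> linear_cmaps (tens_cpx K I V) V"
  "x \<in> carrier (sp V m) \<Longrightarrow> fn (lunit_cmap K V) m (ten K I V 0 m (unit_elt K TYPE('g) \<one>) x) = x"
proof -
  obtain r where r: "r \<in> linear_maps K (sp I 0) (ground_module K)"
    "\<And>c. c \<in> carrier K \<Longrightarrow> r (unit_elt K TYPE('g) c) = c"
    using unit_elt_inverse[where ?'g = 'g] by blast
  have *: "fn (lunit_cmap K V) m \<in> linear_maps K (tens_sp K I V m) (sp V m) \<and>
    fn (lunit_cmap K V) m \<in> extensional (carrier (tens_sp K I V m)) \<and>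
    (\<forall>x \<in> carrier (sp V m). fn (lunit_cmap K V) m (ten K I V 0 m (unit_elt K TYPE('g) \<one>) x) = x)" for m
  proof -
    note M = tens_sp_module[OF chain_complex_module[OF unit_chain_complex] chain_complex_module[OF V], of m]
    note Vm = chain_complex_module[OF V, of m]
    \<comment> \<open>Only the summand with the unit in degree 0 contributes. In the other degrees
      the unit complex is zero, and the zero map completes the family.\<close>
    define \<beta> where "\<beta> a (b::'g) = (if a = (0::'g) then \<lambda>u x. r u \<odot>\<^bsub>sp V m\<^esub> x else (\<lambda>u x. \<zero>\<^bsub>sp V m\<^esub>))" for a b
    have "\<beta> a b \<in> bilinear_maps (sp I a) (sp V b) (sp V m)" if "a + b = m" for a b
      using that bilinear_comp_left[OF scalar_bilinear[OF Vm] r(1)] bilinear_zero[OF Vm]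
      by (cases "a = 0") (auto simp: \<beta>_def)
    from tens_lift[OF chain_complex_module[OF unit_chain_complex] chain_complex_module[OF V] Vm this]
    obtain h where h: "h \<in> linear_maps K (tens_sp K I V m) (sp V m)"
      "\<And>a b x y. \<lbrakk>a + b = m; x \<in> carrier (sp I a); y \<in> carrier (sp V b)\<rbrakk> \<Longrightarrow> h (ten K I V a b x y) = \<beta> a b x y"
      by blast
    have hv: "h (ten K I V 0 m (unit_elt K TYPE('g) c) x) = c \<odot>\<^bsub>sp V m\<^esub> x"
      if "c \<in> carrier K" "x \<in> carrier (sp V m)" for c x
      using h(2)[of 0 m "unit_elt K TYPE('g) c" x] that unit_elt_closed[of c] r(2) by (simp add: \<beta>_def)
    have tc: "ten K I V 0 m (unit_elt K TYPE('g) c) x \<in> carrier (tens_sp K I V m)" if "c \<in> carrier K" "x \<in> carrier (sp V m)" for c x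
      using ten_closed[OF chain_complex_module[OF unit_chain_complex] chain_complex_module[OF V], of 0 m m] unit_elt_closed[OF that(1), where ?'g = 'g] that(2) by simp
    have sp: "spans (tens_sp K I V m) {ten K I V 0 m (unit_elt K TYPE('g) c) x | c x. c \<in> carrier K \<and> x \<in> carrier (sp V m)}"
      by (rule spans_mono[OF lunit_spans]) (use tc one_closed in blast)+
    have P: "(\<forall>c \<in> carrier K. \<forall>x \<in> carrier (sp V m). g (ten K I V 0 m (unit_elt K TYPE('g) c) x) = c \<odot>\<^bsub>sp V m\<^esub> x)
      \<longleftrightarrow> (\<forall>s \<in> {ten K I V 0 m (unit_elt K TYPE('g) c) x | c x. c \<in> carrier K \<and> x \<in> carrier (sp V m)}. g s = h s)" for g
      using hv by fastforce
    note t = the_linear_spans[OF sp M Vm h(1) P]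
    show ?thesis
      using t tc[OF one_closed] hv[OF one_closed] Vm by (simp add: lunit_cmap_def)
  qed
  then show "lunit_cmap K V \<in> linear_cmaps (tens_cpx K I V) V"
    by (simp add: linear_cmaps_def linear_cmap_def) (simp add: lunit_cmap_def tens_sp_cpx[OF unit_tens])
  show "x \<in> carrier (sp V m) \<Longrightarrow> fn (lunit_cmap K V) m (ten K I V 0 m (unit_elt K TYPE('g) \<one>) x) = x"
    using * by blast
qed

lemma runit_cmap:
  "runit_cmap K V \<in> linear_cmaps (tens_cpx K V I) V"
  "x \<in> carrier (sp V m) \<Longrightarrow> fn (runit_cmap K V) m (ten K V I m 0 x (unit_elt K TYPE('g) \<one>)) = x"
proof -
  obtain r where r: "r \<in> linear_maps K (sp I 0) (ground_module K)"
    "\<And>c. c \<in> carrier K \<Longrightarrow> r (unit_elt K TYPE('g) c) = c"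
    using unit_elt_inverse[where ?'g = 'g] by blast
  have *: "fn (runit_cmap K V) m \<in> linear_maps K (tens_sp K V I m) (sp V m) \<and>
    fn (runit_cmap K V) m \<in> extensional (carrier (tens_sp K V I m)) \<and>
    (\<forall>x \<in> carrier (sp V m). fn (runit_cmap K V) m (ten K V I m 0 x (unit_elt K TYPE('g) \<one>)) = x)" for m
  proof -
    note M = tens_sp_module[OF chain_complex_module[OF V] chain_complex_module[OF unit_chain_complex], of m]
    note Vm = chain_complex_module[OF V, of m]
    define \<beta> where "\<beta> (a::'g) b = (if b = (0::'g) then \<lambda>x u. r u \<odot>\<^bsub>sp V m\<^esub> x else (\<lambda>x u. \<zero>\<^bsub>sp V m\<^esub>))" for a b
    have "\<beta> a b \<in> bilinear_maps (sp V a) (sp I b) (sp V m)" if "a + b = m" for a b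
      using that bilinear_swap[OF bilinear_comp_left[OF scalar_bilinear[OF Vm] r(1)]] bilinear_zero[OF Vm]
      by (cases "b = 0") (auto simp: \<beta>_def)
    from tens_lift[OF chain_complex_module[OF V] chain_complex_module[OF unit_chain_complex] Vm this]
    obtain h where h: "h \<in> linear_maps K (tens_sp K V I m) (sp V m)"
      "\<And>a b x y. \<lbrakk>a + b = m; x \<in> carrier (sp V a); y \<in> carrier (sp I b)\<rbrakk> \<Longrightarrow> h (ten K V I a b x y) = \<beta> a b x y"
      by blast
    have hv: "h (ten K V I m 0 x (unit_elt K TYPE('g) c)) = c \<odot>\<^bsub>sp V m\<^esub> x"
      if "c \<in> carrier K" "x \<in> carrier (sp V m)" for c x
      using h(2)[of m 0 x "unit_elt K TYPE('g) c"] that unit_elt_closed[of c] r(2) by (simp add: \<beta>_def)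
    have tc: "ten K V I m 0 x (unit_elt K TYPE('g) c) \<in> carrier (tens_sp K V I m)" if "c \<in> carrier K" "x \<in> carrier (sp V m)" for c x
      using ten_closed[OF chain_complex_module[OF V] chain_complex_module[OF unit_chain_complex], of m 0 m] unit_elt_closed[OF that(1), where ?'g = 'g] that(2) by simp
    have sp: "spans (tens_sp K V I m) {ten K V I m 0 x (unit_elt K TYPE('g) c) | c x. c \<in> carrier K \<and> x \<in> carrier (sp V m)}"
      by (rule spans_mono[OF runit_spans]) (use tc one_closed in blast)+
    have P: "(\<forall>c \<in> carrier K. \<forall>x \<in> carrier (sp V m). g (ten K V I m 0 x (unit_elt K TYPE('g) c)) = c \<odot>\<^bsub>sp V m\<^esub> x)
      \<longleftrightarrow> (\<forall>s \<in> {ten K V I m 0 x (unit_elt K TYPE('g) c) | c x. c \<in> carrier K \<and> x \<in> carrier (sp V m)}. g s = h s)" for g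
      using hv by fastforce
    note t = the_linear_spans[OF sp M Vm h(1) P]
    show ?thesis
      using t tc[OF one_closed] hv[OF one_closed] Vm by (simp add: runit_cmap_def)
  qed
  then show "runit_cmap K V \<in> linear_cmaps (tens_cpx K V I) V"
    by (simp add: linear_cmaps_def linear_cmap_def)
      (simp add: runit_cmap_def tens_sp_cpx[OF V unit_chain_complex])
  show "x \<in> carrier (sp V m) \<Longrightarrow> fn (runit_cmap K V) m (ten K V I m 0 x (unit_elt K TYPE('g) \<one>)) = x"
    using * by blast
qed

end

section \<open>Braiding and associator\<close>

lemma braid_cmap:
  fixes V W :: "('g::{complex_grading,countable}, 'k, 'u) cpx"
  assumes V: "chain_complex K V" and W: "chain_complex K W"
  shows "braid_cmap K V W \<in> linear_cmaps (tens_cpx K V W) (tens_cpx K W V)"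
    and "\<lbrakk>a + b = m; x \<in> carrier (sp V a); y \<in> carrier (sp W b)\<rbrakk> \<Longrightarrow>
      fn (braid_cmap K V W) m (ten K V W a b x y) =
        koszul K (hdeg a * hdeg b) \<odot>\<^bsub>tens_sp K W V m\<^esub> ten K W V b a y x"
proof -
  note Vm = chain_complex_module[OF V] and Wm = chain_complex_module[OF W]
  have \<beta>: "(\<lambda>x y. koszul K (hdeg a * hdeg b) \<odot>\<^bsub>tens_sp K W V m\<^esub> ten K W V b a y x)
      \<in> bilinear_maps (sp V a) (sp W b) (tens_sp K W V m)" if "a + b = m" for a b m
    using that by (intro bilinear_scale[OF tens_sp_module[OF Wm Vm] koszul_closed] bilinear_swap[OF ten_bilinear[OF Wm Vm]])
      (simp add: add.commute)
  note t = the_linear_tens[OF Vm Wm tens_sp_module[OF Wm Vm] \<beta>]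
  show "braid_cmap K V W \<in> linear_cmaps (tens_cpx K V W) (tens_cpx K W V)"
    using t(1,2) by (simp add: linear_cmaps_def linear_cmap_def braid_cmap_def tens_sp_cpx[OF V W] tens_sp_cpx[OF W V])
  show "\<lbrakk>a + b = m; x \<in> carrier (sp V a); y \<in> carrier (sp W b)\<rbrakk> \<Longrightarrow>
      fn (braid_cmap K V W) m (ten K V W a b x y) =
        koszul K (hdeg a * hdeg b) \<odot>\<^bsub>tens_sp K W V m\<^esub> ten K W V b a y x"
    using t(3) by (simp add: braid_cmap_def)
qed

lemma assoc_spans:
  fixes V W X :: "('g::{complex_grading,countable}, 'k, 'u) cpx"
  assumes V: "chain_complex K V" and W: "chain_complex K W" and X: "chain_complex K X"
  shows "spans (tens_sp K (tens_cpx K V W) X m)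
    {ten K (tens_cpx K V W) X (a + b) c (ten K V W a b x y) z | a b c x y z.
      a + b + c = m \<and> x \<in> carrier (sp V a) \<and> y \<in> carrier (sp W b) \<and> z \<in> carrier (sp X c)}"
proof -
  note Vm = chain_complex_module[OF V] and Wm = chain_complex_module[OF W] and Xm = chain_complex_module[OF X]
  note VW = tens_chain_complex[OF V W]
  have "spans (sp (tens_cpx K V W) p)
      {ten K V W a b x y | a b x y. a + b = p \<and> x \<in> carrier (sp V a) \<and> y \<in> carrier (sp W b)}" for p
    unfolding tens_sp_cpx[OF V W] by (rule tens_spans_carrier[OF Vm Wm])
  from tens_spans[OF chain_complex_module[OF VW] Xm this spans_carrier, of m]
  show ?thesis
    by (rule back_subst[where P = "spans _"]) blast
qed

text \<open>The three-fold universal property is assembled from the two-fold one: for fixed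
  \<open>z\<close> a map on the tensor product of \<open>V\<close> and \<open>W\<close> is lifted,
  \<open>linear_family_bilinear\<close> makes the result bilinear in both arguments, and a second
  lift gives the map on the outer tensor product.\<close>

lemma assoc_cmap:
  fixes V W X :: "('g::{complex_grading,countable}, 'k, 'u) cpx"
  assumes V: "chain_complex K V" and W: "chain_complex K W" and X: "chain_complex K X"
  shows "assoc_cmap K V W X \<in> linear_cmaps (tens_cpx K (tens_cpx K V W) X) (tens_cpx K V (tens_cpx K W X))"
    and "\<lbrakk>a + b + c = m; x \<in> carrier (sp V a); y \<in> carrier (sp W b); z \<in> carrier (sp X c)\<rbrakk> \<Longrightarrow>
      fn (assoc_cmap K V W X) m (ten K (tens_cpx K V W) X (a + b) c (ten K V W a b x y) z) =
        ten K V (tens_cpx K W X) a (b + c) x (ten K W X b c y z)"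
proof -
  note Vm = chain_complex_module[OF V] and Wm = chain_complex_module[OF W] and Xm = chain_complex_module[OF X]
  note VW = tens_chain_complex[OF V W] and WX = tens_chain_complex[OF W X]
  note VWm = chain_complex_module[OF VW] and WXm = chain_complex_module[OF WX]
  note VWX = tens_chain_complex[OF VW X] and V_WX = tens_chain_complex[OF V WX]
  let ?VW = "tens_cpx K V W" and ?WX = "tens_cpx K W X"
  let ?S = "\<lambda>m. tens_sp K ?VW X m" and ?T = "\<lambda>m. tens_sp K V ?WX m"
  note Tm = tens_sp_module[OF Vm WXm] and Sm = tens_sp_module[OF VWm Xm]
  let ?e = "\<lambda>a b c x y z. ten K V ?WX a (b + c) x (ten K W X b c y z)"
  have e1: "(\<lambda>x y. ?e a b c x y z) \<in> bilinear_maps (sp V a) (sp W b) (?T m)"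
    if abc: "a + b + c = m" and z: "z \<in> carrier (sp X c)" for a b c m z
  proof -
    have l: "(\<lambda>y. ten K W X b c y z) \<in> linear_maps K (sp W b) (sp ?WX (b + c))"
      unfolding tens_sp_cpx[OF W X] by (rule bilinear_left[OF ten_bilinear[OF Wm Xm refl] z])
    show ?thesis
      by (rule bilinear_comp_right[OF ten_bilinear[OF Vm WXm] l]) (use abc in \<open>simp add: add.assoc\<close>)
  qed
  have e2: "(\<lambda>z. ?e a b c x y z) \<in> linear_maps K (sp X c) (?T m)"
    if abc: "a + b + c = m" and x: "x \<in> carrier (sp V a)" and y: "y \<in> carrier (sp W b)" for a b c m x y
  proof -
    have l: "ten K W X b c y \<in> linear_maps K (sp X c) (sp ?WX (b + c))"
      unfolding tens_sp_cpx[OF W X] by (rule bilinear_right[OF ten_bilinear[OF Wm Xm refl] y])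
    have "ten K V ?WX a (b + c) x \<in> linear_maps K (sp ?WX (b + c)) (?T m)"
      by (rule bilinear_right[OF ten_bilinear[OF Vm WXm] x]) (use abc in \<open>simp add: add.assoc\<close>)
    from linear_comp[OF l this] show ?thesis .
  qed
  define Q where "Q p c m \<gamma> \<longleftrightarrow> \<gamma> \<in> bilinear_maps (sp ?VW p) (sp X c) (?T m) \<and>
      (\<forall>a b. \<forall>x \<in> carrier (sp V a). \<forall>y \<in> carrier (sp W b). \<forall>z \<in> carrier (sp X c).
        a + b = p \<longrightarrow> \<gamma> (ten K V W a b x y) z = ?e a b c x y z)" for p c m \<gamma>
  have ex: "Ex (Q p c m)" if pc: "p + c = m" for p c m
  proof -
    have "\<exists>h. h \<in> linear_maps K (tens_sp K V W p) (?T m) \<and>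
        (\<forall>a b x y. a + b = p \<longrightarrow> x \<in> carrier (sp V a) \<longrightarrow> y \<in> carrier (sp W b) \<longrightarrow>
          h (ten K V W a b x y) = ?e a b c x y z)" if z: "z \<in> carrier (sp X c)" for z
    proof -
      have "(\<lambda>x y. ?e a b c x y z) \<in> bilinear_maps (sp V a) (sp W b) (?T m)" if "a + b = p" for a b
        using e1[of a b c m z] that pc z by simp
      from tens_lift[OF Vm Wm Tm this] show ?thesis by metis
    qed
    then obtain h where h: "\<And>z. z \<in> carrier (sp X c) \<Longrightarrow> h z \<in> linear_maps K (tens_sp K V W p) (?T m)"
      and hv: "\<And>z a b x y. \<lbrakk>z \<in> carrier (sp X c); a + b = p; x \<in> carrier (sp V a); y \<in> carrier (sp W b)\<rbrakk> \<Longrightarrow>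
          h z (ten K V W a b x y) = ?e a b c x y z"
      by metis
    have "(\<lambda>t z. h z t) \<in> bilinear_maps (tens_sp K V W p) (sp X c) (?T m)"
    proof (rule linear_family_bilinear[OF tens_spans_carrier[OF Vm Wm] tens_sp_module[OF Vm Wm] Tm h _ Xm])
      fix s assume "s \<in> {ten K V W a b x y | a b x y. a + b = p \<and> x \<in> carrier (sp V a) \<and> y \<in> carrier (sp W b)}"
      then obtain a b x y where s: "s = ten K V W a b x y" "a + b = p" "x \<in> carrier (sp V a)" "y \<in> carrier (sp W b)"
        by blast
      show "(\<lambda>z. h z s) \<in> linear_maps K (sp X c) (?T m)"
        by (rule linear_cong[OF e2[of a b c m x y] Xm]) (use s pc hv in auto)
    qed
    then show ?thesis
      unfolding Q_def tens_sp_cpx[OF V W] using hv by (intro exI[where x = "\<lambda>t z. h z t"]) blast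
  qed
  define \<gamma> where "\<gamma> p c m = (SOME g. Q p c m g)" for p c m
  have Q: "Q p c m (\<gamma> p c m)" if "p + c = m" for p c m
    unfolding \<gamma>_def by (rule someI_ex[OF ex[OF that]])
  have \<gamma>: "\<gamma> p c m \<in> bilinear_maps (sp ?VW p) (sp X c) (?T m)" if "p + c = m" for p c m
    using Q[OF that] by (simp add: Q_def)
  have \<gamma>v: "\<gamma> p c m (ten K V W a b x y) z = ?e a b c x y z"
    if "p + c = m" "x \<in> carrier (sp V a)" "y \<in> carrier (sp W b)" "z \<in> carrier (sp X c)" "a + b = p"
    for p c m a b x y z
    using Q[OF that(1)] that(2-) by (simp add: Q_def)
  have *: "fn (assoc_cmap K V W X) m \<in> linear_maps K (?S m) (?T m) \<and>
      fn (assoc_cmap K V W X) m \<in> extensional (carrier (?S m)) \<and>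
      (\<forall>a b c x y z. a + b + c = m \<longrightarrow> x \<in> carrier (sp V a) \<longrightarrow> y \<in> carrier (sp W b) \<longrightarrow> z \<in> carrier (sp X c) \<longrightarrow>
        fn (assoc_cmap K V W X) m (ten K ?VW X (a + b) c (ten K V W a b x y) z) = ?e a b c x y z)" for m
  proof -
    obtain h where h: "h \<in> linear_maps K (?S m) (?T m)"
      and hv: "\<And>p c t z. \<lbrakk>p + c = m; t \<in> carrier (sp ?VW p); z \<in> carrier (sp X c)\<rbrakk> \<Longrightarrow> h (ten K ?VW X p c t z) = \<gamma> p c m t z"
      using tens_lift[OF VWm Xm Tm \<gamma>, of m m] by blast
    have hv': "h (ten K ?VW X (a + b) c (ten K V W a b x y) z) = ?e a b c x y z"
      if "a + b + c = m" "x \<in> carrier (sp V a)" "y \<in> carrier (sp W b)" "z \<in> carrier (sp X c)" for a b c x y z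
      using that hv[of "a + b" c "ten K V W a b x y" z] \<gamma>v[of "a + b" c m x a y b z] ten_closed[OF Vm Wm refl]
      by (simp add: tens_sp_cpx[OF V W])
    let ?G = "{ten K ?VW X (a + b) c (ten K V W a b x y) z | a b c x y z.
      a + b + c = m \<and> x \<in> carrier (sp V a) \<and> y \<in> carrier (sp W b) \<and> z \<in> carrier (sp X c)}"
    have P: "(\<forall>a b c. \<forall>x \<in> carrier (sp V a). \<forall>y \<in> carrier (sp W b). \<forall>z \<in> carrier (sp X c).
           a + b + c = m \<longrightarrow> g (ten K ?VW X (a + b) c (ten K V W a b x y) z) = ?e a b c x y z)
        \<longleftrightarrow> (\<forall>s \<in> ?G. g s = h s)" for g
      using hv' by fastforce
    note t = the_linear_spans[OF assoc_spans[OF V W X] Sm Tm h P]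
    have f: "fn (assoc_cmap K V W X) m = the_linear K (?S m) (?T m)
        (\<lambda>g. \<forall>a b c. \<forall>x \<in> carrier (sp V a). \<forall>y \<in> carrier (sp W b). \<forall>z \<in> carrier (sp X c).
           a + b + c = m \<longrightarrow> g (ten K ?VW X (a + b) c (ten K V W a b x y) z) = ?e a b c x y z)"
      by (simp add: assoc_cmap_def Let_def tens_sp_cpx[OF VW X] tens_sp_cpx[OF V WX])
    have "ten K ?VW X (a + b) c (ten K V W a b x y) z \<in> carrier (?S m)"
      if "a + b + c = m" "x \<in> carrier (sp V a)" "y \<in> carrier (sp W b)" "z \<in> carrier (sp X c)" for a b c x y z
      using that ten_closed[OF Vm Wm refl] by (intro ten_closed[OF VWm Xm]) (auto simp: tens_sp_cpx[OF V W])
    then show ?thesis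
      unfolding f using t hv' by (intro conjI allI impI) auto
  qed
  show "assoc_cmap K V W X \<in> linear_cmaps (tens_cpx K ?VW X) (tens_cpx K V ?WX)"
    using * by (simp add: linear_cmaps_def linear_cmap_def)
      (simp add: assoc_cmap_def Let_def tens_sp_cpx[OF VW X] tens_sp_cpx[OF V WX])
  show "\<lbrakk>a + b + c = m; x \<in> carrier (sp V a); y \<in> carrier (sp W b); z \<in> carrier (sp X c)\<rbrakk> \<Longrightarrow>
      fn (assoc_cmap K V W X) m (ten K ?VW X (a + b) c (ten K V W a b x y) z) = ?e a b c x y z"
    using * by blast
qed

end

section \<open>Lax monoidal functors in terms of elements\<close>

text \<open>A generator determines its degree, so \<open>n\<close> can be eliminated. The result
  quantifies over homogeneous elements, which is the form of the laws in
  \<open>lax_elements\<close>.\<close>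

lemma ball_setcompr2:
  "(\<forall>n. \<forall>s \<in> {f a b x y | a b x y. a + b = n \<and> x \<in> A a \<and> y \<in> B b}. P n s) \<longleftrightarrow>
   (\<forall>a b. \<forall>x \<in> A a. \<forall>y \<in> B b. P (a + b) (f a b x y))"
  by blast

lemma ball_setcompr3:
  "(\<forall>n. \<forall>s \<in> {f a b c x y z | a b c x y z. a + b + c = n \<and> x \<in> A a \<and> y \<in> B b \<and> z \<in> D c}. P n s) \<longleftrightarrow>
   (\<forall>a b c. \<forall>x \<in> A a. \<forall>y \<in> B b. \<forall>z \<in> D c. P (a + b + c) (f a b c x y z))"
  by blast

lemma ball_setcompr1:
  "(\<forall>n. \<forall>s \<in> {f n x | x. x \<in> A n}. P n s) \<longleftrightarrow> (\<forall>n. \<forall>x \<in> A n. P n (f n x))"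
  by blast

context small_ring
begin

text \<open>Since elementary tensors span, \<open>mul\<close> determines \<open>Mu\<close>, but it
  can be handled as a product of elements.\<close>

definition mul ::
  "('o, 'a, ('g::complex_grading, 'k, 'u) cpx, ('g, 'k, 'u) cmap) lax_functor \<Rightarrow> 'o \<Rightarrow> 'o \<Rightarrow> 'g \<Rightarrow> 'g \<Rightarrow> 'u \<Rightarrow> 'u \<Rightarrow> 'u" where
  "mul F X Y a b x y = fn (Mu F X Y) (a + b) (ten K (FO F X) (FO F Y) a b x y)"

definition one_elt :: "('o, 'a, ('g::complex_grading, 'k, 'u) cpx, ('g, 'k, 'u) cmap) lax_functor \<Rightarrow> 'u" where
  "one_elt F = fn (Eps F) 0 (unit_elt K TYPE('g) \<one>)"

lemma Hom_complexes:
  "f \<in> Hom (complexes K) V W \<longleftrightarrow> chain_map K f \<and> src f = V \<and> tgt f = W"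
  by (auto simp: Hom_def complexes_def)

lemma chain_map_iff:
  assumes f: "f \<in> linear_cmaps V W" and V: "chain_complex K V" and W: "chain_complex K W"
  shows "chain_map K f \<longleftrightarrow> (\<forall>n. \<forall>x \<in> carrier (sp V n). bd W n (fn f n x) = fn f (n + bdeg) (bd V n x))"
  by (simp add: chain_map_def V W linear_cmapsD[OF f])

lemma chain_map_bd:
  "\<lbrakk>chain_map K f; x \<in> carrier (sp (src f) n)\<rbrakk> \<Longrightarrow> bd (tgt f) n (fn f n x) = fn f (n + bdeg) (bd (src f) n x)"
  by (simp add: chain_map_def)

end

text \<open>Data of the right type without the laws: morphisms go to chain maps, while
  \<open>Mu\<close> and \<open>Eps\<close> are merely linear. In this setting each law involving
  \<open>Mu\<close> or \<open>Eps\<close> is equivalent to one about elements, and this is what the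
  lemmas ending in \<open>_iff\<close> provide.\<close>

locale pre_lax = small_ring K emb + C: symmetric_monoidal_category C
  for K :: "('k, 'z) ring_scheme" (structure) and emb :: "'k \<Rightarrow> 'u" and C :: "('o, 'a) smc" +
  fixes F :: "('o, 'a, ('g::{complex_grading,countable}, 'k, 'u) cpx, ('g, 'k, 'u) cmap) lax_functor"
  assumes FO_complex: "X \<in> Obj C \<Longrightarrow> chain_complex K (FO F X)"
    and FA_chain_map: "f \<in> Hom C X Y \<Longrightarrow> FA F f \<in> Hom (complexes K) (FO F X) (FO F Y)"
    and Mu_cmap: "\<lbrakk>X \<in> Obj C; Y \<in> Obj C\<rbrakk> \<Longrightarrow>
      Mu F X Y \<in> linear_cmaps (tens_cpx K (FO F X) (FO F Y)) (FO F (X \<boxtimes>\<^bsub>C\<^esub> Y))"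
    and Eps_cmap: "Eps F \<in> linear_cmaps (unit_cpx K) (FO F (Unit C))"
begin

lemma FO_module: "X \<in> Obj C \<Longrightarrow> module K (sp (FO F X) n)"
  by (rule chain_complex_module[OF FO_complex])

lemma FA_cmap: "f \<in> Hom C X Y \<Longrightarrow> FA F f \<in> linear_cmaps (FO F X) (FO F Y)"
  using FA_chain_map by (auto simp: Hom_complexes intro: chain_map_in_linear_cmaps)

lemma FA_linear: "f \<in> Hom C X Y \<Longrightarrow> fn (FA F f) n \<in> linear_maps K (sp (FO F X) n) (sp (FO F Y) n)"
  by (rule linear_cmapsD[OF FA_cmap])

lemma FO_tens_complex: "\<lbrakk>X \<in> Obj C; Y \<in> Obj C\<rbrakk> \<Longrightarrow> chain_complex K (tens_cpx K (FO F X) (FO F Y))"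
  by (rule tens_chain_complex[OF FO_complex FO_complex])

lemma Mu_linear: "\<lbrakk>X \<in> Obj C; Y \<in> Obj C\<rbrakk> \<Longrightarrow>
    fn (Mu F X Y) n \<in> linear_maps K (tens_sp K (FO F X) (FO F Y) n) (sp (FO F (X \<boxtimes>\<^bsub>C\<^esub> Y)) n)"
  using linear_cmapsD(4)[OF Mu_cmap] by (simp add: tens_sp_cpx[OF FO_complex FO_complex])

lemma mul_bilinear:
  assumes "X \<in> Obj C" "Y \<in> Obj C"
  shows "mul F X Y a b \<in> bilinear_maps (sp (FO F X) a) (sp (FO F Y) b) (sp (FO F (X \<boxtimes>\<^bsub>C\<^esub> Y)) (a + b))"
  unfolding mul_def[abs_def]
  by (rule bilinear_comp_out[OF ten_bilinear[OF FO_module[OF assms(1)] FO_module[OF assms(2)] refl] Mu_linear[OF assms]])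

lemma mul_closed:
  "\<lbrakk>X \<in> Obj C; Y \<in> Obj C; x \<in> carrier (sp (FO F X) a); y \<in> carrier (sp (FO F Y) b)\<rbrakk> \<Longrightarrow>
    mul F X Y a b x y \<in> carrier (sp (FO F (X \<boxtimes>\<^bsub>C\<^esub> Y)) (a + b))"
  by (rule bilinear_closed[OF mul_bilinear])

lemma one_closed': "one_elt F \<in> carrier (sp (FO F (Unit C)) 0)"
  unfolding one_elt_def by (rule linear_closed[OF linear_cmapsD(4)[OF Eps_cmap] unit_elt_closed]) simp

lemma tens_spans_FO:
  "\<lbrakk>X \<in> Obj C; Y \<in> Obj C\<rbrakk> \<Longrightarrow> spans (sp (tens_cpx K (FO F X) (FO F Y)) m)
    {ten K (FO F X) (FO F Y) a b x y | a b x y. a + b = m \<and> x \<in> carrier (sp (FO F X) a) \<and> y \<in> carrier (sp (FO F Y) b)}"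
  using tens_spans_carrier[OF FO_module FO_module] by (simp add: tens_sp_cpx[OF FO_complex FO_complex])

lemma ten_closed_FO:
  "\<lbrakk>X \<in> Obj C; Y \<in> Obj C; a + b = m; x \<in> carrier (sp (FO F X) a); y \<in> carrier (sp (FO F Y) b)\<rbrakk> \<Longrightarrow>
    ten K (FO F X) (FO F Y) a b x y \<in> carrier (sp (tens_cpx K (FO F X) (FO F Y)) m)"
  using ten_closed[OF FO_module FO_module] by (simp add: tens_sp_cpx[OF FO_complex FO_complex])

text \<open>Both sides of the chain map condition are linear on the tensor product, so it can be
  tested on elementary tensors, where the differential of the tensor product turns it into the
  Leibniz rule with its Koszul sign.\<close>

lemma Mu_chain_map_iff:
  assumes X: "X \<in> Obj C" and Y: "Y \<in> Obj C"
  shows "chain_map K (Mu F X Y) \<longleftrightarrow>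
    (\<forall>a b. \<forall>x \<in> carrier (sp (FO F X) a). \<forall>y \<in> carrier (sp (FO F Y) b).
      bd (FO F (X \<boxtimes>\<^bsub>C\<^esub> Y)) (a + b) (mul F X Y a b x y) =
        mul F X Y (a + bdeg) b (bd (FO F X) a x) y \<oplus>\<^bsub>sp (FO F (X \<boxtimes>\<^bsub>C\<^esub> Y)) (a + b + bdeg)\<^esub>
        koszul K (hdeg a) \<odot>\<^bsub>sp (FO F (X \<boxtimes>\<^bsub>C\<^esub> Y)) (a + b + bdeg)\<^esub> mul F X Y a (b + bdeg) x (bd (FO F Y) b y))"
    (is "_ \<longleftrightarrow> (\<forall>a b. \<forall>x \<in> _ a. \<forall>y \<in> _ b. ?L a b x y = ?R a b x y)")
proof -
  note XY = C.tens_obj[OF X Y]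
  note cX = FO_complex[OF X] and cY = FO_complex[OF Y] and cXY = FO_complex[OF XY] and T = FO_tens_complex[OF X Y]
  let ?T = "tens_cpx K (FO F X) (FO F Y)" and ?Z = "FO F (X \<boxtimes>\<^bsub>C\<^esub> Y)"
  have l1: "(\<lambda>t. bd ?Z n (fn (Mu F X Y) n t)) \<in> linear_maps K (sp ?T n) (sp ?Z (n + bdeg))" for n
    by (rule linear_comp[OF linear_cmapsD(4)[OF Mu_cmap[OF X Y]] chain_complex_bd[OF cXY]])
  have l2: "(\<lambda>t. fn (Mu F X Y) (n + bdeg) (bd ?T n t)) \<in> linear_maps K (sp ?T n) (sp ?Z (n + bdeg))" for n
    by (rule linear_comp[OF chain_complex_bd[OF T] linear_cmapsD(4)[OF Mu_cmap[OF X Y]]])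
  have ten2: "fn (Mu F X Y) (a + b + bdeg) (bd ?T (a + b) (ten K (FO F X) (FO F Y) a b x y)) = ?R a b x y"
    if x: "x \<in> carrier (sp (FO F X) a)" and y: "y \<in> carrier (sp (FO F Y) b)" for a b x y
  proof -
    have dx: "bd (FO F X) a x \<in> carrier (sp (FO F X) (a + bdeg))" and dy: "bd (FO F Y) b y \<in> carrier (sp (FO F Y) (b + bdeg))"
      using linear_closed[OF chain_complex_bd[OF cX] x] linear_closed[OF chain_complex_bd[OF cY] y] .
    have e: "a + bdeg + b = a + b + bdeg" "a + (b + bdeg) = a + b + bdeg"
      by (simp_all add: ac_simps)
    note l = Mu_linear[OF X Y, of "a + b + bdeg"]
    note M = tens_sp_module[OF FO_module[OF X] FO_module[OF Y]]
    show ?thesis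
      unfolding tens_bd_ten[OF cX cY refl x y] mul_def e
      using ten_closed[OF FO_module[OF X] FO_module[OF Y] e(1) dx y]
        ten_closed[OF FO_module[OF X] FO_module[OF Y] e(2) x dy] M
      by (simp add: linear_add[OF l] linear_smult[OF l])
  qed
  have "chain_map K (Mu F X Y) \<longleftrightarrow> (\<forall>n. \<forall>t \<in> carrier (sp ?T n). bd ?Z n (fn (Mu F X Y) n t) = fn (Mu F X Y) (n + bdeg) (bd ?T n t))"
    by (rule chain_map_iff[OF Mu_cmap[OF X Y] T cXY])
  also have "\<dots> \<longleftrightarrow> (\<forall>n. \<forall>t \<in> {ten K (FO F X) (FO F Y) a b x y | a b x y. a + b = n \<and> x \<in> carrier (sp (FO F X) a) \<and> y \<in> carrier (sp (FO F Y) b)}.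
      bd ?Z n (fn (Mu F X Y) n t) = fn (Mu F X Y) (n + bdeg) (bd ?T n t))"
    (is "?A \<longleftrightarrow> ?B")
  proof
    assume ?A
    then show ?B using spans_subset[OF tens_spans_FO[OF X Y]] by blast
  next
    assume B: ?B
    show ?A
    proof (intro allI ballI)
      fix n t assume t: "t \<in> carrier (sp ?T n)"
      show "bd ?Z n (fn (Mu F X Y) n t) = fn (Mu F X Y) (n + bdeg) (bd ?T n t)"
        by (rule linear_eq_on_spans[OF tens_spans_FO[OF X Y] chain_complex_module[OF T] FO_module[OF XY] l1 l2 _ t],
            erule B[THEN spec, THEN bspec])
    qed
  qed
  also have "\<dots> \<longleftrightarrow> (\<forall>a b. \<forall>x \<in> carrier (sp (FO F X) a). \<forall>y \<in> carrier (sp (FO F Y) b). ?L a b x y = ?R a b x y)"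
    unfolding ball_setcompr2 mul_def[symmetric] by (intro iff_allI ball_cong refl) (simp only: ten2)
  finally show ?thesis .
qed

text \<open>The unit complex has zero differential and is generated by the copy of 1, so the
  condition concerns only the image of 1, which has to be a cycle.\<close>

lemma Eps_chain_map_iff: "chain_map K (Eps F) \<longleftrightarrow> bd (FO F (Unit C)) 0 (one_elt F) = \<zero>\<^bsub>sp (FO F (Unit C)) bdeg\<^esub>"
proof -
  let ?I = "unit_cpx K :: ('g, 'k, 'u) cpx" and ?Z = "FO F (Unit C)"
  note cZ = FO_complex[OF C.unit_obj] and cI = unit_chain_complex[where ?'g = 'g]
  note l = linear_cmapsD(4)[OF Eps_cmap]
  have bdI: "bd ?I n x = \<zero>\<^bsub>sp ?I (n + bdeg)\<^esub>" for n x
    by (simp add: unit_cpx_def)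
  have "fn (Eps F) (n + bdeg) (bd ?I n x) = \<zero>\<^bsub>sp ?Z (n + bdeg)\<^esub>" for n x
    unfolding bdI by (rule linear_zero[OF l chain_complex_module[OF cI] chain_complex_module[OF cZ]])
  then have "chain_map K (Eps F) \<longleftrightarrow> (\<forall>n. \<forall>x \<in> carrier (sp ?I n). bd ?Z n (fn (Eps F) n x) = \<zero>\<^bsub>sp ?Z (n + bdeg)\<^esub>)"
    by (simp add: chain_map_iff[OF Eps_cmap cI cZ])
  also have "\<dots> \<longleftrightarrow> bd ?Z 0 (one_elt F) = \<zero>\<^bsub>sp ?Z bdeg\<^esub>" (is "?A \<longleftrightarrow> ?B")
  proof
    assume ?A
    from this[rule_format, of "unit_elt K TYPE('g) \<one>" 0] show ?B
      by (simp add: one_elt_def unit_elt_closed)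
  next
    assume B: ?B
    show ?A
    proof (intro allI ballI)
      fix n x assume x: "x \<in> carrier (sp ?I n)"
      show "bd ?Z n (fn (Eps F) n x) = \<zero>\<^bsub>sp ?Z (n + bdeg)\<^esub>"
        by (rule linear_eq_on_spans[OF unit_spans chain_complex_module[OF cI] chain_complex_module[OF cZ]
              linear_comp[OF l chain_complex_bd[OF cZ]] linear_zero_map[OF chain_complex_module[OF cZ]] _ x])
          (use B in \<open>simp add: one_elt_def split: if_splits\<close>)
    qed
  qed
  finally show ?thesis .
qed

lemma Mu_natural_iff:
  assumes f: "f \<in> Hom C X X'" and g: "g \<in> Hom C Y Y'"
  shows "cmap_comp (FA F (f \<boxdot>\<^bsub>C\<^esub> g)) (Mu F X Y) = cmap_comp (Mu F X' Y') (tens_cmap K (FA F f) (FA F g)) \<longleftrightarrow>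
    (\<forall>a b. \<forall>x \<in> carrier (sp (FO F X) a). \<forall>y \<in> carrier (sp (FO F Y) b).
      fn (FA F (f \<boxdot>\<^bsub>C\<^esub> g)) (a + b) (mul F X Y a b x y) = mul F X' Y' a b (fn (FA F f) a x) (fn (FA F g) b y))"
proof -
  have X: "X \<in> Obj C" "X' \<in> Obj C" "Y \<in> Obj C" "Y' \<in> Obj C"
    using f g C.dom_obj C.cod_obj by (auto simp: Hom_def)
  note t = tens_in_linear_cmaps[OF FA_cmap[OF f] FA_cmap[OF g] FO_complex[OF X(1)] FO_complex[OF X(2)] FO_complex[OF X(3)] FO_complex[OF X(4)]]
  note T = FO_tens_complex[OF X(1,3)]
  show ?thesis
    unfolding linear_cmaps_eq_iff[OF comp_in_linear_cmaps[OF Mu_cmap[OF X(1,3)] FA_cmap[OF C.tens_hom[OF f g]] T]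
        comp_in_linear_cmaps[OF t(1) Mu_cmap[OF X(2,4)] T] T FO_complex[OF C.tens_obj[OF X(2,4)]] tens_spans_FO[OF X(1,3)]]
      ball_setcompr2
    by (simp add: mul_def ten_closed_FO[OF X(1,3)] comp_fn[OF Mu_cmap[OF X(1,3)]] comp_fn[OF t(1)] t(2))
qed

lemma Mu_assoc_iff:
  assumes X: "X \<in> Obj C" and Y: "Y \<in> Obj C" and Z: "Z \<in> Obj C"
  shows "cmap_comp (FA F (Assoc C X Y Z)) (cmap_comp (Mu F (X \<boxtimes>\<^bsub>C\<^esub> Y) Z) (tens_cmap K (Mu F X Y) (cmap_id (FO F Z)))) =
      cmap_comp (Mu F X (Y \<boxtimes>\<^bsub>C\<^esub> Z)) (cmap_comp (tens_cmap K (cmap_id (FO F X)) (Mu F Y Z)) (assoc_cmap K (FO F X) (FO F Y) (FO F Z)))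
    \<longleftrightarrow> (\<forall>a b c. \<forall>x \<in> carrier (sp (FO F X) a). \<forall>y \<in> carrier (sp (FO F Y) b). \<forall>z \<in> carrier (sp (FO F Z) c).
      fn (FA F (Assoc C X Y Z)) (a + b + c) (mul F (X \<boxtimes>\<^bsub>C\<^esub> Y) Z (a + b) c (mul F X Y a b x y) z) =
        mul F X (Y \<boxtimes>\<^bsub>C\<^esub> Z) a (b + c) x (mul F Y Z b c y z))"
proof -
  note XY = C.tens_obj[OF X Y] and YZ = C.tens_obj[OF Y Z]
  note cX = FO_complex[OF X] and cY = FO_complex[OF Y] and cZ = FO_complex[OF Z]
    and cXY = FO_complex[OF XY] and cYZ = FO_complex[OF YZ]
  note TXY = FO_tens_complex[OF X Y] and TYZ = FO_tens_complex[OF Y Z]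
  note S = tens_chain_complex[OF TXY cZ] and S' = tens_chain_complex[OF cX TYZ]
  have a: "Assoc C X Y Z \<in> Hom C ((X \<boxtimes>\<^bsub>C\<^esub> Y) \<boxtimes>\<^bsub>C\<^esub> Z) (X \<boxtimes>\<^bsub>C\<^esub> (Y \<boxtimes>\<^bsub>C\<^esub> Z))"
    using C.assoc_iso[OF X Y Z] by (simp add: Iso_def)
  note t1 = tens_in_linear_cmaps[OF Mu_cmap[OF X Y] id_in_linear_cmaps[OF cZ] TXY cXY cZ cZ]
  note t2 = tens_in_linear_cmaps[OF id_in_linear_cmaps[OF cX] Mu_cmap[OF Y Z] cX cX TYZ cYZ]
  note as = assoc_cmap[OF cX cY cZ]
  note m1 = comp_in_linear_cmaps[OF t1(1) Mu_cmap[OF XY Z] S]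
  note m2 = comp_in_linear_cmaps[OF as(1) t2(1) S]
  note L = comp_in_linear_cmaps[OF m1 FA_cmap[OF a] S]
  note R = comp_in_linear_cmaps[OF m2 Mu_cmap[OF X YZ] S]
  have sp: "spans (sp (tens_cpx K (tens_cpx K (FO F X) (FO F Y)) (FO F Z)) m)
    {ten K (tens_cpx K (FO F X) (FO F Y)) (FO F Z) (a + b) c (ten K (FO F X) (FO F Y) a b x y) z | a b c x y z.
      a + b + c = m \<and> x \<in> carrier (sp (FO F X) a) \<and> y \<in> carrier (sp (FO F Y) b) \<and> z \<in> carrier (sp (FO F Z) c)}" for m
    unfolding tens_sp_cpx[OF TXY cZ] by (rule assoc_spans[OF cX cY cZ])
  \<comment> \<open>Both composites are evaluated on a generator of the triple tensor product; what
    remains are the two bracketings of a product of three elements.\<close>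
  have "fn (cmap_comp (FA F (Assoc C X Y Z)) (cmap_comp (Mu F (X \<boxtimes>\<^bsub>C\<^esub> Y) Z) (tens_cmap K (Mu F X Y) (cmap_id (FO F Z))))) (a + b + c)
        (ten K (tens_cpx K (FO F X) (FO F Y)) (FO F Z) (a + b) c (ten K (FO F X) (FO F Y) a b x y) z) =
      fn (FA F (Assoc C X Y Z)) (a + b + c) (mul F (X \<boxtimes>\<^bsub>C\<^esub> Y) Z (a + b) c (mul F X Y a b x y) z) \<and>
     fn (cmap_comp (Mu F X (Y \<boxtimes>\<^bsub>C\<^esub> Z)) (cmap_comp (tens_cmap K (cmap_id (FO F X)) (Mu F Y Z)) (assoc_cmap K (FO F X) (FO F Y) (FO F Z)))) (a + b + c)
        (ten K (tens_cpx K (FO F X) (FO F Y)) (FO F Z) (a + b) c (ten K (FO F X) (FO F Y) a b x y) z) =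
      mul F X (Y \<boxtimes>\<^bsub>C\<^esub> Z) a (b + c) x (mul F Y Z b c y z)"
    if x: "x \<in> carrier (sp (FO F X) a)" and y: "y \<in> carrier (sp (FO F Y) b)" and z: "z \<in> carrier (sp (FO F Z) c)" for a b c x y z
  proof -
    let ?xy = "ten K (FO F X) (FO F Y) a b x y" and ?yz = "ten K (FO F Y) (FO F Z) b c y z"
    have xy: "?xy \<in> carrier (sp (tens_cpx K (FO F X) (FO F Y)) (a + b))" and yz: "?yz \<in> carrier (sp (tens_cpx K (FO F Y) (FO F Z)) (b + c))"
      using ten_closed_FO[OF X Y refl x y] ten_closed_FO[OF Y Z refl y z] .
    have xyz: "ten K (tens_cpx K (FO F X) (FO F Y)) (FO F Z) (a + b) c ?xy z
        \<in> carrier (sp (tens_cpx K (tens_cpx K (FO F X) (FO F Y)) (FO F Z)) (a + b + c))"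
      using ten_closed[OF chain_complex_module[OF TXY] chain_complex_module[OF cZ] refl xy z] by (simp add: tens_sp_cpx[OF TXY cZ])
    have e: "a + (b + c) = a + b + c" by (simp add: add.assoc)
    show ?thesis
      using t1(2)[OF refl xy z] t2(2)[OF e x yz] as(2)[OF refl x y z] z x
      by (simp add: comp_fn[OF m1 xyz] comp_fn[OF m2 xyz] comp_fn[OF t1(1) xyz] comp_fn[OF as(1) xyz] mul_def e)
  qed
  then show ?thesis
    unfolding linear_cmaps_eq_iff[OF L R S FO_complex[OF C.tens_obj[OF X YZ]] sp] ball_setcompr3
    by simp
qed

lemma Mu_lunit_iff:
  assumes X: "X \<in> Obj C"
  shows "cmap_comp (FA F (LUnit C X)) (cmap_comp (Mu F (Unit C) X) (tens_cmap K (Eps F) (cmap_id (FO F X)))) = lunit_cmap K (FO F X)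
    \<longleftrightarrow> (\<forall>m. \<forall>x \<in> carrier (sp (FO F X) m). fn (FA F (LUnit C X)) m (mul F (Unit C) X 0 m (one_elt F) x) = x)"
proof -
  note cX = FO_complex[OF X] and cI = unit_chain_complex[where ?'g = 'g] and cU = FO_complex[OF C.unit_obj]
  note S = tens_chain_complex[OF cI cX]
  have a: "LUnit C X \<in> Hom C (Unit C \<boxtimes>\<^bsub>C\<^esub> X) X"
    using C.lunit_iso[OF X] by (simp add: Iso_def)
  note t = tens_in_linear_cmaps[OF Eps_cmap id_in_linear_cmaps[OF cX] cI cU cX cX]
  note m = comp_in_linear_cmaps[OF t(1) Mu_cmap[OF C.unit_obj X] S]
  note L = comp_in_linear_cmaps[OF m FA_cmap[OF a] S]
  have x: "ten K (unit_cpx K) (FO F X) 0 m (unit_elt K TYPE('g) \<one>) x \<in> carrier (sp (tens_cpx K (unit_cpx K) (FO F X)) m)"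
    if "x \<in> carrier (sp (FO F X) m)" for x m
    unfolding tens_sp_cpx[OF cI cX]
    by (rule ten_closed[OF chain_complex_module[OF cI] chain_complex_module[OF cX] _ unit_elt_closed that]) simp_all
  have sp: "spans (sp (tens_cpx K (unit_cpx K) (FO F X)) m) {ten K (unit_cpx K) (FO F X) 0 m (unit_elt K TYPE('g) \<one>) x | x. x \<in> carrier (sp (FO F X) m)}" for m
    unfolding tens_sp_cpx[OF cI cX] by (rule lunit_spans[OF cX])
  show ?thesis
    unfolding linear_cmaps_eq_iff[OF L lunit_cmap(1)[OF cX] S cX sp] ball_setcompr1
    by (simp add: lunit_cmap(2)[OF cX] comp_fn[OF m x] comp_fn[OF t(1) x] t(2) unit_elt_closed mul_def one_elt_def)
qed

lemma Mu_runit_iff: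
  assumes X: "X \<in> Obj C"
  shows "cmap_comp (FA F (RUnit C X)) (cmap_comp (Mu F X (Unit C)) (tens_cmap K (cmap_id (FO F X)) (Eps F))) = runit_cmap K (FO F X)
    \<longleftrightarrow> (\<forall>m. \<forall>x \<in> carrier (sp (FO F X) m). fn (FA F (RUnit C X)) m (mul F X (Unit C) m 0 x (one_elt F)) = x)"
proof -
  note cX = FO_complex[OF X] and cI = unit_chain_complex[where ?'g = 'g] and cU = FO_complex[OF C.unit_obj]
  note S = tens_chain_complex[OF cX cI]
  have a: "RUnit C X \<in> Hom C (X \<boxtimes>\<^bsub>C\<^esub> Unit C) X"
    using C.runit_iso[OF X] by (simp add: Iso_def)
  note t = tens_in_linear_cmaps[OF id_in_linear_cmaps[OF cX] Eps_cmap cX cX cI cU]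
  note m = comp_in_linear_cmaps[OF t(1) Mu_cmap[OF X C.unit_obj] S]
  note L = comp_in_linear_cmaps[OF m FA_cmap[OF a] S]
  have x: "ten K (FO F X) (unit_cpx K) m 0 x (unit_elt K TYPE('g) \<one>) \<in> carrier (sp (tens_cpx K (FO F X) (unit_cpx K)) m)"
    if "x \<in> carrier (sp (FO F X) m)" for x m
    unfolding tens_sp_cpx[OF cX cI]
    by (rule ten_closed[OF chain_complex_module[OF cX] chain_complex_module[OF cI] _ that unit_elt_closed]) simp_all
  have sp: "spans (sp (tens_cpx K (FO F X) (unit_cpx K)) m) {ten K (FO F X) (unit_cpx K) m 0 x (unit_elt K TYPE('g) \<one>) | x. x \<in> carrier (sp (FO F X) m)}" for m
    unfolding tens_sp_cpx[OF cX cI] by (rule runit_spans[OF cX])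
  show ?thesis
    unfolding linear_cmaps_eq_iff[OF L runit_cmap(1)[OF cX] S cX sp] ball_setcompr1
    by (simp add: runit_cmap(2)[OF cX] comp_fn[OF m x] comp_fn[OF t(1) x] t(2) unit_elt_closed mul_def one_elt_def)
qed

lemma Mu_symmetric_iff:
  assumes X: "X \<in> Obj C" and Y: "Y \<in> Obj C"
  shows "cmap_comp (FA F (Braid C X Y)) (Mu F X Y) = cmap_comp (Mu F Y X) (braid_cmap K (FO F X) (FO F Y)) \<longleftrightarrow>
    (\<forall>a b. \<forall>x \<in> carrier (sp (FO F X) a). \<forall>y \<in> carrier (sp (FO F Y) b).
      fn (FA F (Braid C X Y)) (a + b) (mul F X Y a b x y) =
        koszul K (hdeg a * hdeg b) \<odot>\<^bsub>sp (FO F (Y \<boxtimes>\<^bsub>C\<^esub> X)) (a + b)\<^esub> mul F Y X b a y x)"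
proof -
  note cX = FO_complex[OF X] and cY = FO_complex[OF Y]
  note T = FO_tens_complex[OF X Y]
  note b = braid_cmap[OF cX cY]
  have a: "Braid C X Y \<in> Hom C (X \<boxtimes>\<^bsub>C\<^esub> Y) (Y \<boxtimes>\<^bsub>C\<^esub> X)"
    using C.braid_iso[OF X Y] by (simp add: Iso_def)
  have l: "fn (Mu F Y X) (a + b) (c \<odot>\<^bsub>tens_sp K (FO F Y) (FO F X) (a + b)\<^esub> ten K (FO F Y) (FO F X) b a y x) =
      c \<odot>\<^bsub>sp (FO F (Y \<boxtimes>\<^bsub>C\<^esub> X)) (a + b)\<^esub> mul F Y X b a y x"
    if "c \<in> carrier K" "x \<in> carrier (sp (FO F X) a)" "y \<in> carrier (sp (FO F Y) b)" for c a b x y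
    using linear_smult[OF Mu_linear[OF Y X] that(1) ten_closed[OF FO_module[OF Y] FO_module[OF X] add.commute that(3,2)]]
    by (simp add: mul_def add.commute[of b a])
  show ?thesis
    unfolding linear_cmaps_eq_iff[OF comp_in_linear_cmaps[OF Mu_cmap[OF X Y] FA_cmap[OF a] T]
        comp_in_linear_cmaps[OF b(1) Mu_cmap[OF Y X] T] T FO_complex[OF C.tens_obj[OF Y X]] tens_spans_FO[OF X Y]]
      ball_setcompr2
    by (simp add: ten_closed_FO[OF X Y] comp_fn[OF Mu_cmap[OF X Y]] comp_fn[OF b(1)] b(2) l mul_def[of F X Y, symmetric])
qed

end

text \<open>The laws of a graded commutative differential algebra, spread over the objects of
  \<open>C\<close>. Elements can be multiplied and compared here without touching tensor products or
  definite descriptions, and by \<open>lax\<close> and \<open>lax_elementsI\<close> this is the same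
  as a lax symmetric monoidal functor to \<open>complexes K\<close>.\<close>

locale lax_elements = pre_lax K emb C F
  for K :: "('k, 'z) ring_scheme" (structure) and emb :: "'k \<Rightarrow> 'u" and C :: "('o, 'a) smc"
    and F :: "('o, 'a, ('g::{complex_grading,countable}, 'k, 'u) cpx, ('g, 'k, 'u) cmap) lax_functor" +
  assumes FA_id: "\<lbrakk>X \<in> Obj C; x \<in> carrier (sp (FO F X) n)\<rbrakk> \<Longrightarrow> fn (FA F (Id C X)) n x = x"
    and FA_comp: "\<lbrakk>f \<in> Hom C X Y; g \<in> Hom C Y Z; x \<in> carrier (sp (FO F X) n)\<rbrakk> \<Longrightarrow>
      fn (FA F (g \<cdot>\<^bsub>C\<^esub> f)) n x = fn (FA F g) n (fn (FA F f) n x)"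
    and mul_bd: "\<lbrakk>X \<in> Obj C; Y \<in> Obj C; x \<in> carrier (sp (FO F X) a); y \<in> carrier (sp (FO F Y) b)\<rbrakk> \<Longrightarrow>
      bd (FO F (X \<boxtimes>\<^bsub>C\<^esub> Y)) (a + b) (mul F X Y a b x y) =
        mul F X Y (a + bdeg) b (bd (FO F X) a x) y \<oplus>\<^bsub>sp (FO F (X \<boxtimes>\<^bsub>C\<^esub> Y)) (a + b + bdeg)\<^esub>
        koszul K (hdeg a) \<odot>\<^bsub>sp (FO F (X \<boxtimes>\<^bsub>C\<^esub> Y)) (a + b + bdeg)\<^esub> mul F X Y a (b + bdeg) x (bd (FO F Y) b y)"
    and one_bd: "bd (FO F (Unit C)) 0 (one_elt F) = \<zero>\<^bsub>sp (FO F (Unit C)) bdeg\<^esub>"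
    and mul_natural: "\<lbrakk>f \<in> Hom C X X'; g \<in> Hom C Y Y'; x \<in> carrier (sp (FO F X) a); y \<in> carrier (sp (FO F Y) b)\<rbrakk> \<Longrightarrow>
      fn (FA F (f \<boxdot>\<^bsub>C\<^esub> g)) (a + b) (mul F X Y a b x y) = mul F X' Y' a b (fn (FA F f) a x) (fn (FA F g) b y)"
    and mul_assoc: "\<lbrakk>X \<in> Obj C; Y \<in> Obj C; Z \<in> Obj C;
        x \<in> carrier (sp (FO F X) a); y \<in> carrier (sp (FO F Y) b); z \<in> carrier (sp (FO F Z) c)\<rbrakk> \<Longrightarrow>
      fn (FA F (Assoc C X Y Z)) (a + b + c) (mul F (X \<boxtimes>\<^bsub>C\<^esub> Y) Z (a + b) c (mul F X Y a b x y) z) =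
        mul F X (Y \<boxtimes>\<^bsub>C\<^esub> Z) a (b + c) x (mul F Y Z b c y z)"
    and mul_lunit: "\<lbrakk>X \<in> Obj C; x \<in> carrier (sp (FO F X) m)\<rbrakk> \<Longrightarrow>
      fn (FA F (LUnit C X)) m (mul F (Unit C) X 0 m (one_elt F) x) = x"
    and mul_runit: "\<lbrakk>X \<in> Obj C; x \<in> carrier (sp (FO F X) m)\<rbrakk> \<Longrightarrow>
      fn (FA F (RUnit C X)) m (mul F X (Unit C) m 0 x (one_elt F)) = x"
    and mul_symmetric: "\<lbrakk>X \<in> Obj C; Y \<in> Obj C; x \<in> carrier (sp (FO F X) a); y \<in> carrier (sp (FO F Y) b)\<rbrakk> \<Longrightarrow>
      fn (FA F (Braid C X Y)) (a + b) (mul F X Y a b x y) =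
        koszul K (hdeg a * hdeg b) \<odot>\<^bsub>sp (FO F (Y \<boxtimes>\<^bsub>C\<^esub> X)) (a + b)\<^esub> mul F Y X b a y x"
begin

lemma lax: "lax_symmetric_monoidal_functor C (complexes K) F"
proof
  show "X \<in> Obj C \<Longrightarrow> FO F X \<in> Obj (complexes K)" for X
    using FO_complex by (simp add: complexes_def)
  show "f \<in> Hom C X Y \<Longrightarrow> FA F f \<in> Hom (complexes K) (FO F X) (FO F Y)" for f X Y
    by (rule FA_chain_map)
  show "FA F (Id C X) = Id (complexes K) (FO F X)" if X: "X \<in> Obj C" for X
  proof -
    note c = FO_complex[OF X]
    have "FA F (Id C X) = cmap_id (FO F X)"
      unfolding linear_cmaps_eq_iff[OF FA_cmap[OF C.id_hom[OF X]] id_in_linear_cmaps[OF c] c c spans_carrier]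
      using FA_id[OF X] by simp
    then show ?thesis by (simp add: complexes_def)
  qed
  show "FA F (g \<cdot>\<^bsub>C\<^esub> f) = FA F g \<cdot>\<^bsub>complexes K\<^esub> FA F f" if f: "f \<in> Hom C X Y" and g: "g \<in> Hom C Y Z" for f g X Y Z
  proof -
    have X: "X \<in> Obj C" "Z \<in> Obj C"
      using f g C.dom_obj C.cod_obj by (auto simp: Hom_def)
    note c = FO_complex[OF X(1)]
    have "FA F (g \<cdot>\<^bsub>C\<^esub> f) = cmap_comp (FA F g) (FA F f)"
      unfolding linear_cmaps_eq_iff[OF FA_cmap[OF C.comp_hom[OF f g]] comp_in_linear_cmaps[OF FA_cmap[OF f] FA_cmap[OF g] c]
          c FO_complex[OF X(2)] spans_carrier]
      using FA_comp[OF f g] by (simp add: comp_fn[OF FA_cmap[OF f]])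
    then show ?thesis by (simp add: complexes_def)
  qed
  show "Mu F X Y \<in> Hom (complexes K) (FO F X \<boxtimes>\<^bsub>complexes K\<^esub> FO F Y) (FO F (X \<boxtimes>\<^bsub>C\<^esub> Y))"
    if "X \<in> Obj C" "Y \<in> Obj C" for X Y
    using linear_cmapsD(2,3)[OF Mu_cmap[OF that]] mul_bd[OF that] Mu_chain_map_iff[OF that]
    by (simp add: Hom_complexes) (simp add: complexes_def)
  show "Eps F \<in> Hom (complexes K) (Unit (complexes K)) (FO F (Unit C))"
    using linear_cmapsD(2,3)[OF Eps_cmap] one_bd Eps_chain_map_iff
    by (simp add: Hom_complexes) (simp add: complexes_def)
  show "FA F (f \<boxdot>\<^bsub>C\<^esub> g) \<cdot>\<^bsub>complexes K\<^esub> Mu F X Y = Mu F X' Y' \<cdot>\<^bsub>complexes K\<^esub> (FA F f \<boxdot>\<^bsub>complexes K\<^esub> FA F g)"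
    if "f \<in> Hom C X X'" "g \<in> Hom C Y Y'" for f g X X' Y Y'
    using Mu_natural_iff[OF that] mul_natural[OF that] by (simp add: complexes_def)
  show "FA F (Assoc C X Y Z) \<cdot>\<^bsub>complexes K\<^esub> Mu F (X \<boxtimes>\<^bsub>C\<^esub> Y) Z \<cdot>\<^bsub>complexes K\<^esub> (Mu F X Y \<boxdot>\<^bsub>complexes K\<^esub> Id (complexes K) (FO F Z)) =
      Mu F X (Y \<boxtimes>\<^bsub>C\<^esub> Z) \<cdot>\<^bsub>complexes K\<^esub> (Id (complexes K) (FO F X) \<boxdot>\<^bsub>complexes K\<^esub> Mu F Y Z)
        \<cdot>\<^bsub>complexes K\<^esub> Assoc (complexes K) (FO F X) (FO F Y) (FO F Z)"
    if "X \<in> Obj C" "Y \<in> Obj C" "Z \<in> Obj C" for X Y Z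
    using Mu_assoc_iff[OF that] mul_assoc[OF that] by (simp add: complexes_def)
  show "FA F (LUnit C X) \<cdot>\<^bsub>complexes K\<^esub> Mu F (Unit C) X \<cdot>\<^bsub>complexes K\<^esub> (Eps F \<boxdot>\<^bsub>complexes K\<^esub> Id (complexes K) (FO F X)) =
      LUnit (complexes K) (FO F X)" if "X \<in> Obj C" for X
    using Mu_lunit_iff[OF that] mul_lunit[OF that] by (simp add: complexes_def)
  show "FA F (RUnit C X) \<cdot>\<^bsub>complexes K\<^esub> Mu F X (Unit C) \<cdot>\<^bsub>complexes K\<^esub> (Id (complexes K) (FO F X) \<boxdot>\<^bsub>complexes K\<^esub> Eps F) =
      RUnit (complexes K) (FO F X)" if "X \<in> Obj C" for X
    using Mu_runit_iff[OF that] mul_runit[OF that] by (simp add: complexes_def)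
  show "FA F (Braid C X Y) \<cdot>\<^bsub>complexes K\<^esub> Mu F X Y = Mu F Y X \<cdot>\<^bsub>complexes K\<^esub> Braid (complexes K) (FO F X) (FO F Y)"
    if "X \<in> Obj C" "Y \<in> Obj C" for X Y
    using Mu_symmetric_iff[OF that] mul_symmetric[OF that] by (simp add: complexes_def)
qed

end

context small_ring
begin

lemma lax_elementsI:
  fixes F :: "('o, 'a, ('g::{complex_grading,countable}, 'k, 'u) cpx, ('g, 'k, 'u) cmap) lax_functor"
  assumes C: "symmetric_monoidal_category C" and F: "lax_symmetric_monoidal_functor C (complexes K) F"
  shows "lax_elements K emb C F"
proof -
  interpret C: symmetric_monoidal_category C by (rule C)
  interpret F: lax_symmetric_monoidal_functor C "complexes K" F by (rule F)
  have H: "Mu F X Y \<in> Hom (complexes K) (tens_cpx K (FO F X) (FO F Y)) (FO F (X \<boxtimes>\<^bsub>C\<^esub> Y))"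
    if "X \<in> Obj C" "Y \<in> Obj C" for X Y
    using F.Mu_hom[OF that] by (simp add: complexes_def)
  have E: "Eps F \<in> Hom (complexes K) (unit_cpx K) (FO F (Unit C))"
    using F.Eps_hom by (simp add: complexes_def)
  interpret pre_lax K emb C F
  proof
    show "X \<in> Obj C \<Longrightarrow> chain_complex K (FO F X)" for X
      using F.F_obj by (simp add: complexes_def)
    show "f \<in> Hom C X Y \<Longrightarrow> FA F f \<in> Hom (complexes K) (FO F X) (FO F Y)" for f X Y
      by (rule F.F_hom)
    show "\<lbrakk>X \<in> Obj C; Y \<in> Obj C\<rbrakk> \<Longrightarrow> Mu F X Y \<in> linear_cmaps (tens_cpx K (FO F X) (FO F Y)) (FO F (X \<boxtimes>\<^bsub>C\<^esub> Y))" for X Y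
      using H by (auto simp: Hom_complexes intro: chain_map_in_linear_cmaps)
    show "Eps F \<in> linear_cmaps (unit_cpx K) (FO F (Unit C))"
      using E by (auto simp: Hom_complexes intro: chain_map_in_linear_cmaps)
  qed
  show ?thesis
  proof
    show "fn (FA F (Id C X)) n x = x" if "X \<in> Obj C" "x \<in> carrier (sp (FO F X) n)" for X n x
      using F.F_id[OF that(1)] that(2) by (simp add: complexes_def)
    show "fn (FA F (g \<cdot>\<^bsub>C\<^esub> f)) n x = fn (FA F g) n (fn (FA F f) n x)"
      if "f \<in> Hom C X Y" "g \<in> Hom C Y Z" "x \<in> carrier (sp (FO F X) n)" for f g X Y Z n x
      using F.F_comp[OF that(1,2)] comp_fn[OF FA_cmap[OF that(1)] that(3)] by (simp add: complexes_def)
    show "bd (FO F (X \<boxtimes>\<^bsub>C\<^esub> Y)) (a + b) (mul F X Y a b x y) =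
        mul F X Y (a + bdeg) b (bd (FO F X) a x) y \<oplus>\<^bsub>sp (FO F (X \<boxtimes>\<^bsub>C\<^esub> Y)) (a + b + bdeg)\<^esub>
        koszul K (hdeg a) \<odot>\<^bsub>sp (FO F (X \<boxtimes>\<^bsub>C\<^esub> Y)) (a + b + bdeg)\<^esub> mul F X Y a (b + bdeg) x (bd (FO F Y) b y)"
      if "X \<in> Obj C" "Y \<in> Obj C" "x \<in> carrier (sp (FO F X) a)" "y \<in> carrier (sp (FO F Y) b)" for X Y a b x y
      using Mu_chain_map_iff[OF that(1,2)] H[OF that(1,2)] that(3,4) by (simp add: Hom_complexes)
    show "bd (FO F (Unit C)) 0 (one_elt F) = \<zero>\<^bsub>sp (FO F (Unit C)) bdeg\<^esub>"
      using E Eps_chain_map_iff by (simp add: Hom_complexes)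
    show "fn (FA F (f \<boxdot>\<^bsub>C\<^esub> g)) (a + b) (mul F X Y a b x y) = mul F X' Y' a b (fn (FA F f) a x) (fn (FA F g) b y)"
      if "f \<in> Hom C X X'" "g \<in> Hom C Y Y'" "x \<in> carrier (sp (FO F X) a)" "y \<in> carrier (sp (FO F Y) b)"
      for f g X X' Y Y' a b x y
      using F.Mu_natural[OF that(1,2)] Mu_natural_iff[OF that(1,2)] that(3,4) by (simp add: complexes_def)
    show "fn (FA F (Assoc C X Y Z)) (a + b + c) (mul F (X \<boxtimes>\<^bsub>C\<^esub> Y) Z (a + b) c (mul F X Y a b x y) z) =
        mul F X (Y \<boxtimes>\<^bsub>C\<^esub> Z) a (b + c) x (mul F Y Z b c y z)"
      if "X \<in> Obj C" "Y \<in> Obj C" "Z \<in> Obj C"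
        "x \<in> carrier (sp (FO F X) a)" "y \<in> carrier (sp (FO F Y) b)" "z \<in> carrier (sp (FO F Z) c)" for X Y Z a b c x y z
      using F.Mu_assoc[OF that(1-3)] Mu_assoc_iff[OF that(1-3)] that(4-) by (simp add: complexes_def)
    show "fn (FA F (LUnit C X)) m (mul F (Unit C) X 0 m (one_elt F) x) = x"
      if "X \<in> Obj C" "x \<in> carrier (sp (FO F X) m)" for X m x
      using F.Mu_lunit[OF that(1)] Mu_lunit_iff[OF that(1)] that(2) by (simp add: complexes_def)
    show "fn (FA F (RUnit C X)) m (mul F X (Unit C) m 0 x (one_elt F)) = x"
      if "X \<in> Obj C" "x \<in> carrier (sp (FO F X) m)" for X m x
      using F.Mu_runit[OF that(1)] Mu_runit_iff[OF that(1)] that(2) by (simp add: complexes_def)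
    show "fn (FA F (Braid C X Y)) (a + b) (mul F X Y a b x y) =
        koszul K (hdeg a * hdeg b) \<odot>\<^bsub>sp (FO F (Y \<boxtimes>\<^bsub>C\<^esub> X)) (a + b)\<^esub> mul F Y X b a y x"
      if "X \<in> Obj C" "Y \<in> Obj C" "x \<in> carrier (sp (FO F X) a)" "y \<in> carrier (sp (FO F Y) b)" for X Y a b x y
      using F.Mu_symmetric[OF that(1,2)] Mu_symmetric_iff[OF that(1,2)] that(3,4) by (simp add: complexes_def)
  qed
qed

end

section \<open>Transporting laws along injections\<close>

context small_ring
begin

text \<open>Inverse to passing from \<open>Mu\<close> to \<open>mul\<close>: a linear map on the
  tensor product is built from a prescribed product of elements. Together with
  \<open>unit_fun\<close> it supplies the structure maps of \<open>sub_functor\<close>.\<close>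

definition tens_fun ::
  "('g::complex_grading, 'k, 'u) cpx \<Rightarrow> ('g, 'k, 'u) cpx \<Rightarrow> ('g, 'k, 'u) cpx \<Rightarrow> ('g \<Rightarrow> 'g \<Rightarrow> 'u \<Rightarrow> 'u \<Rightarrow> 'u)
    \<Rightarrow> ('g, 'k, 'u) cmap" where
  "tens_fun V W X \<beta> =
     \<lparr>src = tens_cpx K V W, tgt = X,
      fn = \<lambda>m. the_linear K (tens_sp K V W m) (sp X m) (\<lambda>h.
        \<forall>a b. \<forall>x \<in> carrier (sp V a). \<forall>y \<in> carrier (sp W b). a + b = m \<longrightarrow> h (ten K V W a b x y) = \<beta> a b x y)\<rparr>"

definition unit_fun :: "('g::complex_grading, 'k, 'u) cpx \<Rightarrow> 'u \<Rightarrow> ('g, 'k, 'u) cmap" where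
  "unit_fun X u =
     \<lparr>src = unit_cpx K, tgt = X,
      fn = \<lambda>n. the_linear K (sp (unit_cpx K) n) (sp X n) (\<lambda>h. n = 0 \<longrightarrow> h (unit_elt K TYPE('g) \<one>) = u)\<rparr>"

lemma tens_fun:
  fixes V W X :: "('g::{complex_grading,countable}, 'k, 'u) cpx"
  assumes V: "chain_complex K V" and W: "chain_complex K W" and X: "chain_complex K X"
    and \<beta>: "\<And>a b. \<beta> a b \<in> bilinear_maps (sp V a) (sp W b) (sp X (a + b))"
  shows "tens_fun V W X \<beta> \<in> linear_cmaps (tens_cpx K V W) X"
    and "\<lbrakk>a + b = m; x \<in> carrier (sp V a); y \<in> carrier (sp W b)\<rbrakk> \<Longrightarrow>
      fn (tens_fun V W X \<beta>) m (ten K V W a b x y) = \<beta> a b x y"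
proof -
  have "\<beta> a b \<in> bilinear_maps (sp V a) (sp W b) (sp X m)" if "a + b = m" for a b m
    using \<beta>[of a b] that by simp
  note t = the_linear_tens[OF chain_complex_module[OF V] chain_complex_module[OF W] chain_complex_module[OF X] this]
  show "tens_fun V W X \<beta> \<in> linear_cmaps (tens_cpx K V W) X"
    using t(1,2) by (simp add: linear_cmaps_def linear_cmap_def tens_fun_def tens_sp_cpx[OF V W])
  show "\<lbrakk>a + b = m; x \<in> carrier (sp V a); y \<in> carrier (sp W b)\<rbrakk> \<Longrightarrow>
      fn (tens_fun V W X \<beta>) m (ten K V W a b x y) = \<beta> a b x y"
    using t(3) by (simp add: tens_fun_def)
qed

lemma unit_linear_exists:
  fixes X :: "('g::complex_grading, 'k, 'u) cpx"
  assumes X: "module K (sp X n)" and u: "n = 0 \<Longrightarrow> u \<in> carrier (sp X n)"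
  obtains h where "h \<in> linear_maps K (sp (unit_cpx K :: ('g, 'k, 'u) cpx) n) (sp X n)"
    "\<And>c. \<lbrakk>n = 0; c \<in> carrier K\<rbrakk> \<Longrightarrow> h (unit_elt K TYPE('g) c) = c \<odot>\<^bsub>sp X n\<^esub> u"
proof (cases "n = 0")
  case True
  obtain r where r: "r \<in> linear_maps K (sp (unit_cpx K :: ('g, 'k, 'u) cpx) 0) (ground_module K)"
    "\<And>c. c \<in> carrier K \<Longrightarrow> r (unit_elt K TYPE('g) c) = c"
    using unit_elt_inverse[where ?'g = 'g] by blast
  have "(\<lambda>t. r t \<odot>\<^bsub>sp X n\<^esub> u) \<in> linear_maps K (sp (unit_cpx K :: ('g, 'k, 'u) cpx) n) (sp X n)"
    using linear_comp[OF r(1) bilinear_left[OF scalar_bilinear[OF X] u[OF True]]] True by simp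
  then show ?thesis by (rule that) (simp add: r(2))
next
  case False
  show ?thesis by (rule that[OF linear_zero_map[OF X]]) (use False in simp)
qed

lemma unit_fun:
  fixes X :: "('g::complex_grading, 'k, 'u) cpx"
  assumes X: "chain_complex K X" and u: "u \<in> carrier (sp X 0)"
  shows "unit_fun X u \<in> linear_cmaps (unit_cpx K) X" and "fn (unit_fun X u) 0 (unit_elt K TYPE('g) \<one>) = u"
proof -
  let ?I = "unit_cpx K :: ('g, 'k, 'u) cpx"
  note Xm = chain_complex_module[OF X] and Im = chain_complex_module[OF unit_chain_complex[where ?'g = 'g]]
  have *: "fn (unit_fun X u) n \<in> linear_maps K (sp ?I n) (sp X n) \<and>
      fn (unit_fun X u) n \<in> extensional (carrier (sp ?I n)) \<and>
      (n = 0 \<longrightarrow> fn (unit_fun X u) n (unit_elt K TYPE('g) \<one>) = u)" for n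
  proof -
    obtain h where h: "h \<in> linear_maps K (sp ?I n) (sp X n)"
      "\<And>c. \<lbrakk>n = 0; c \<in> carrier K\<rbrakk> \<Longrightarrow> h (unit_elt K TYPE('g) c) = c \<odot>\<^bsub>sp X n\<^esub> u"
      using unit_linear_exists[OF Xm[of n], of u] u by blast
    have h1: "n = 0 \<Longrightarrow> h (unit_elt K TYPE('g) \<one>) = u"
      using h(2)[of \<one>] u Xm[of 0] by simp
    have "(n = 0 \<longrightarrow> g (unit_elt K TYPE('g) \<one>) = u) \<longleftrightarrow>
        (\<forall>s \<in> (if n = 0 then {unit_elt K TYPE('g) \<one>} else {}). g s = h s)" for g
      using h1 by simp
    note t = the_linear_spans[OF unit_spans Im Xm h(1) this]
    show ?thesis
      using t h1 unit_elt_closed[of \<one>, where ?'g = 'g] by (auto simp: unit_fun_def)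
  qed
  show "unit_fun X u \<in> linear_cmaps (unit_cpx K) X"
    using * by (simp add: linear_cmaps_def linear_cmap_def) (simp add: unit_fun_def)
  show "fn (unit_fun X u) 0 (unit_elt K TYPE('g) \<one>) = u"
    using * by blast
qed

text \<open>Each law of \<open>F\<close> becomes a law of \<open>G\<close> after applying
  \<open>\<eta>\<close>, and \<open>\<eta>\<close> is injective. The additive map
  \<open>\<phi>\<close> compares different grading groups; it preserves \<open>hdeg\<close> so that
  the Koszul signs agree, and \<open>bdeg\<close> so that the differentials correspond.\<close>

lemma lax_elements_pullback:
  fixes F :: "('o, 'a, ('g::{complex_grading,countable}, 'k, 'u) cpx, ('g, 'k, 'u) cmap) lax_functor"
    and G :: "('o, 'a, ('h::{complex_grading,countable}, 'k, 'u) cpx, ('h, 'k, 'u) cmap) lax_functor"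
  assumes F: "pre_lax K emb C F" and G: "lax_elements K emb C G"
    and \<phi>: "\<And>a b. \<phi> (a + b) = \<phi> a + \<phi> b" "\<phi> bdeg = bdeg" "\<And>a. hdeg (\<phi> a) = hdeg a"
    and \<eta>: "\<And>X a. X \<in> Obj C \<Longrightarrow> \<eta> X a \<in> linear_maps K (sp (FO F X) a) (sp (FO G X) (\<phi> a))"
    and inj: "\<And>X a. X \<in> Obj C \<Longrightarrow> inj_on (\<eta> X a) (carrier (sp (FO F X) a))"
    and \<eta>_bd: "\<And>X a x. \<lbrakk>X \<in> Obj C; x \<in> carrier (sp (FO F X) a)\<rbrakk> \<Longrightarrow>
      \<eta> X (a + bdeg) (bd (FO F X) a x) = bd (FO G X) (\<phi> a) (\<eta> X a x)"
    and \<eta>_FA: "\<And>f X Y a x. \<lbrakk>f \<in> Hom C X Y; X \<in> Obj C; Y \<in> Obj C; x \<in> carrier (sp (FO F X) a)\<rbrakk> \<Longrightarrow>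
      \<eta> Y a (fn (FA F f) a x) = fn (FA G f) (\<phi> a) (\<eta> X a x)"
    and \<eta>_mul: "\<And>X Y a b x y. \<lbrakk>X \<in> Obj C; Y \<in> Obj C; x \<in> carrier (sp (FO F X) a); y \<in> carrier (sp (FO F Y) b)\<rbrakk> \<Longrightarrow>
      \<eta> (X \<boxtimes>\<^bsub>C\<^esub> Y) (a + b) (mul F X Y a b x y) = mul G X Y (\<phi> a) (\<phi> b) (\<eta> X a x) (\<eta> Y b y)"
    and \<eta>_one: "\<eta> (Unit C) 0 (one_elt F) = one_elt G"
  shows "lax_elements K emb C F"
proof -
  interpret F: pre_lax K emb C F by (rule F)
  interpret G: lax_elements K emb C G by (rule G)
  have \<phi>0: "\<phi> 0 = 0" using \<phi>(1)[of 0 0] by simp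
  have H: "X \<in> Obj C" "Y \<in> Obj C" if "f \<in> Hom C X Y" for f X Y
    using that F.C.dom_obj F.C.cod_obj by (auto simp: Hom_def)
  note c = linear_closed[OF \<eta>] and T = F.C.tens_obj
  note eqI = inj_onD[OF inj]
  have Fcl: "fn (FA F f) a x \<in> carrier (sp (FO F Y) a)" if "f \<in> Hom C X Y" "x \<in> carrier (sp (FO F X) a)" for f X Y a x
    by (rule linear_closed[OF F.FA_linear[OF that(1)] that(2)])
  have bcl: "bd (FO F X) a x \<in> carrier (sp (FO F X) (a + bdeg))" if "X \<in> Obj C" "x \<in> carrier (sp (FO F X) a)" for X a x
    by (rule linear_closed[OF chain_complex_bd[OF F.FO_complex[OF that(1)]] that(2)])
  show ?thesis
  proof
    fix X n x assume X: "X \<in> Obj C" and x: "x \<in> carrier (sp (FO F X) n)"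
    note i = F.C.id_hom[OF X]
    show "fn (FA F (Id C X)) n x = x"
      by (rule eqI[OF X _ Fcl[OF i x] x]) (simp add: \<eta>_FA[OF i X X x] G.FA_id[OF X c[OF X x]])
  next
    fix f g X Y Z n x assume f: "f \<in> Hom C X Y" and g: "g \<in> Hom C Y Z" and x: "x \<in> carrier (sp (FO F X) n)"
    note X = H(1)[OF f] and Y = H(2)[OF f] and Z = H(2)[OF g] and gf = F.C.comp_hom[OF f g]
    show "fn (FA F (g \<cdot>\<^bsub>C\<^esub> f)) n x = fn (FA F g) n (fn (FA F f) n x)"
      by (rule eqI[OF Z _ Fcl[OF gf x] Fcl[OF g Fcl[OF f x]]])
        (simp add: \<eta>_FA[OF gf X Z x] \<eta>_FA[OF g Y Z Fcl[OF f x]] \<eta>_FA[OF f X Y x] G.FA_comp[OF f g c[OF X x]])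
  next
    fix X Y a b x y assume X: "X \<in> Obj C" and Y: "Y \<in> Obj C"
      and x: "x \<in> carrier (sp (FO F X) a)" and y: "y \<in> carrier (sp (FO F Y) b)"
    let ?Z = "sp (FO F (X \<boxtimes>\<^bsub>C\<^esub> Y)) (a + b + bdeg)"
    note XY = T[OF X Y]
    have e: "a + bdeg + b = a + b + bdeg" "a + (b + bdeg) = a + b + bdeg"
      by (simp_all add: ac_simps)
    have e': "\<phi> a + bdeg + \<phi> b = \<phi> a + \<phi> b + bdeg" "\<phi> a + (\<phi> b + bdeg) = \<phi> a + \<phi> b + bdeg"
      by (simp_all add: ac_simps)
    have m1: "mul F X Y (a + bdeg) b (bd (FO F X) a x) y \<in> carrier ?Z"
      and m2: "mul F X Y a (b + bdeg) x (bd (FO F Y) b y) \<in> carrier ?Z"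
      using F.mul_closed[OF X Y bcl[OF X x] y] F.mul_closed[OF X Y x bcl[OF Y y]] by (simp_all add: e)
    note l = \<eta>[OF XY, of "a + b + bdeg"]
    note M = F.FO_module[OF XY, of "a + b + bdeg"]
    show "bd (FO F (X \<boxtimes>\<^bsub>C\<^esub> Y)) (a + b) (mul F X Y a b x y) =
        mul F X Y (a + bdeg) b (bd (FO F X) a x) y \<oplus>\<^bsub>?Z\<^esub> koszul K (hdeg a) \<odot>\<^bsub>?Z\<^esub> mul F X Y a (b + bdeg) x (bd (FO F Y) b y)"
    proof (rule eqI[OF XY _ bcl[OF XY F.mul_closed[OF X Y x y]]])
      have "\<eta> (X \<boxtimes>\<^bsub>C\<^esub> Y) (a + b + bdeg) (mul F X Y (a + bdeg) b (bd (FO F X) a x) y) =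
          mul G X Y (\<phi> a + bdeg) (\<phi> b) (bd (FO G X) (\<phi> a) (\<eta> X a x)) (\<eta> Y b y)"
        using \<eta>_mul[OF X Y bcl[OF X x] y] \<eta>_bd[OF X x] by (simp add: e \<phi>)
      moreover have "\<eta> (X \<boxtimes>\<^bsub>C\<^esub> Y) (a + b + bdeg) (mul F X Y a (b + bdeg) x (bd (FO F Y) b y)) =
          mul G X Y (\<phi> a) (\<phi> b + bdeg) (\<eta> X a x) (bd (FO G Y) (\<phi> b) (\<eta> Y b y))"
        using \<eta>_mul[OF X Y x bcl[OF Y y]] \<eta>_bd[OF Y y] by (simp add: e \<phi>)
      moreover have "\<eta> (X \<boxtimes>\<^bsub>C\<^esub> Y) (a + b + bdeg) (bd (FO F (X \<boxtimes>\<^bsub>C\<^esub> Y)) (a + b) (mul F X Y a b x y)) =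
          bd (FO G (X \<boxtimes>\<^bsub>C\<^esub> Y)) (\<phi> a + \<phi> b) (mul G X Y (\<phi> a) (\<phi> b) (\<eta> X a x) (\<eta> Y b y))"
        using \<eta>_bd[OF XY F.mul_closed[OF X Y x y]] \<eta>_mul[OF X Y x y] by (simp add: \<phi>)
      ultimately show "\<eta> (X \<boxtimes>\<^bsub>C\<^esub> Y) (a + b + bdeg) (bd (FO F (X \<boxtimes>\<^bsub>C\<^esub> Y)) (a + b) (mul F X Y a b x y)) =
          \<eta> (X \<boxtimes>\<^bsub>C\<^esub> Y) (a + b + bdeg) (mul F X Y (a + bdeg) b (bd (FO F X) a x) y \<oplus>\<^bsub>?Z\<^esub>
            koszul K (hdeg a) \<odot>\<^bsub>?Z\<^esub> mul F X Y a (b + bdeg) x (bd (FO F Y) b y))"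
        using m1 m2 M G.mul_bd[OF X Y c[OF X x] c[OF Y y]]
        by (simp add: linear_add[OF l] linear_smult[OF l] \<phi>)
    qed (use m1 m2 M in simp)
  next
    note U = F.C.unit_obj
    have o: "one_elt F \<in> carrier (sp (FO F (Unit C)) 0)" by (rule F.one_closed')
    have b: "bd (FO F (Unit C)) 0 (one_elt F) \<in> carrier (sp (FO F (Unit C)) bdeg)"
      using bcl[OF U o] by simp
    show "bd (FO F (Unit C)) 0 (one_elt F) = \<zero>\<^bsub>sp (FO F (Unit C)) bdeg\<^esub>"
    proof (rule eqI[OF U _ b])
      show "\<eta> (Unit C) bdeg (bd (FO F (Unit C)) 0 (one_elt F)) = \<eta> (Unit C) bdeg \<zero>\<^bsub>sp (FO F (Unit C)) bdeg\<^esub>"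
        using \<eta>_bd[OF U o] G.one_bd linear_zero[OF \<eta>[OF U] F.FO_module[OF U] G.FO_module[OF U], of bdeg]
        by (simp add: \<phi> \<phi>0 \<eta>_one)
    qed (simp add: F.FO_module[OF U])
  next
    fix f g X X' Y Y' a b x y
    assume f: "f \<in> Hom C X X'" and g: "g \<in> Hom C Y Y'"
      and x: "x \<in> carrier (sp (FO F X) a)" and y: "y \<in> carrier (sp (FO F Y) b)"
    note X = H[OF f] and Y = H[OF g]
    note fg = F.C.tens_hom[OF f g] and m = F.mul_closed[OF X(1) Y(1) x y]
    show "fn (FA F (f \<boxdot>\<^bsub>C\<^esub> g)) (a + b) (mul F X Y a b x y) = mul F X' Y' a b (fn (FA F f) a x) (fn (FA F g) b y)"
      by (rule eqI[OF T[OF X(2) Y(2)] _ Fcl[OF fg m] F.mul_closed[OF X(2) Y(2) Fcl[OF f x] Fcl[OF g y]]])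
        (simp add: \<eta>_FA[OF fg T[OF X(1) Y(1)] T[OF X(2) Y(2)] m] \<eta>_mul[OF X(1) Y(1) x y]
          \<eta>_mul[OF X(2) Y(2) Fcl[OF f x] Fcl[OF g y]] \<eta>_FA[OF f X x] \<eta>_FA[OF g Y y] \<phi>
          G.mul_natural[OF f g c[OF X(1) x] c[OF Y(1) y]])
  next
    fix X Y Z a b c' x y z
    assume X: "X \<in> Obj C" and Y: "Y \<in> Obj C" and Z: "Z \<in> Obj C" and x: "x \<in> carrier (sp (FO F X) a)"
      and y: "y \<in> carrier (sp (FO F Y) b)" and z: "z \<in> carrier (sp (FO F Z) c')"
    note XY = T[OF X Y] and YZ = T[OF Y Z]
    have as: "Assoc C X Y Z \<in> Hom C ((X \<boxtimes>\<^bsub>C\<^esub> Y) \<boxtimes>\<^bsub>C\<^esub> Z) (X \<boxtimes>\<^bsub>C\<^esub> (Y \<boxtimes>\<^bsub>C\<^esub> Z))"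
      using F.C.assoc_iso[OF X Y Z] by (simp add: Iso_def)
    note xy = F.mul_closed[OF X Y x y] and yz = F.mul_closed[OF Y Z y z]
    note xyz = F.mul_closed[OF XY Z xy z] and xyz' = F.mul_closed[OF X YZ x yz, folded add.assoc]
    have 1: "\<eta> (X \<boxtimes>\<^bsub>C\<^esub> (Y \<boxtimes>\<^bsub>C\<^esub> Z)) (a + b + c') (mul F X (Y \<boxtimes>\<^bsub>C\<^esub> Z) a (b + c') x (mul F Y Z b c' y z)) =
        mul G X (Y \<boxtimes>\<^bsub>C\<^esub> Z) (\<phi> a) (\<phi> b + \<phi> c') (\<eta> X a x) (mul G Y Z (\<phi> b) (\<phi> c') (\<eta> Y b y) (\<eta> Z c' z))"
      using \<eta>_mul[OF X YZ x yz] \<eta>_mul[OF Y Z y z] by (simp add: \<phi> add.assoc)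
    show "fn (FA F (Assoc C X Y Z)) (a + b + c') (mul F (X \<boxtimes>\<^bsub>C\<^esub> Y) Z (a + b) c' (mul F X Y a b x y) z) =
        mul F X (Y \<boxtimes>\<^bsub>C\<^esub> Z) a (b + c') x (mul F Y Z b c' y z)"
      by (rule eqI[OF T[OF X YZ] _ Fcl[OF as xyz] xyz'])
        (simp add: 1 \<eta>_FA[OF as T[OF XY Z] T[OF X YZ] xyz] \<eta>_mul[OF XY Z xy z] \<eta>_mul[OF X Y x y] \<phi>(1)
          G.mul_assoc[OF X Y Z c[OF X x] c[OF Y y] c[OF Z z]])
  next
    fix X m x assume X: "X \<in> Obj C" and x: "x \<in> carrier (sp (FO F X) m)"
    note U = F.C.unit_obj
    have l: "LUnit C X \<in> Hom C (Unit C \<boxtimes>\<^bsub>C\<^esub> X) X"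
      using F.C.lunit_iso[OF X] by (simp add: Iso_def)
    have ux: "mul F (Unit C) X 0 m (one_elt F) x \<in> carrier (sp (FO F (Unit C \<boxtimes>\<^bsub>C\<^esub> X)) m)"
      using F.mul_closed[OF U X F.one_closed' x] by simp
    show "fn (FA F (LUnit C X)) m (mul F (Unit C) X 0 m (one_elt F) x) = x"
      by (rule eqI[OF X _ Fcl[OF l ux] x])
        (use \<eta>_mul[OF U X F.one_closed' x] G.mul_lunit[OF X c[OF X x]] \<eta>_FA[OF l T[OF U X] X ux] in \<open>simp add: \<phi>0 \<eta>_one\<close>)
    have r: "RUnit C X \<in> Hom C (X \<boxtimes>\<^bsub>C\<^esub> Unit C) X"
      using F.C.runit_iso[OF X] by (simp add: Iso_def)
    have xu: "mul F X (Unit C) m 0 x (one_elt F) \<in> carrier (sp (FO F (X \<boxtimes>\<^bsub>C\<^esub> Unit C)) m)"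
      using F.mul_closed[OF X U x F.one_closed'] by simp
    show "fn (FA F (RUnit C X)) m (mul F X (Unit C) m 0 x (one_elt F)) = x"
      by (rule eqI[OF X _ Fcl[OF r xu] x])
        (use \<eta>_mul[OF X U x F.one_closed'] G.mul_runit[OF X c[OF X x]] \<eta>_FA[OF r T[OF X U] X xu] in \<open>simp add: \<phi>0 \<eta>_one\<close>)
  next
    fix X Y a b x y assume X: "X \<in> Obj C" and Y: "Y \<in> Obj C"
      and x: "x \<in> carrier (sp (FO F X) a)" and y: "y \<in> carrier (sp (FO F Y) b)"
    have br: "Braid C X Y \<in> Hom C (X \<boxtimes>\<^bsub>C\<^esub> Y) (Y \<boxtimes>\<^bsub>C\<^esub> X)"
      using F.C.braid_iso[OF X Y] by (simp add: Iso_def)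
    note xy = F.mul_closed[OF X Y x y] and yx = F.mul_closed[OF Y X y x, folded add.commute[of a b]]
    note YX = T[OF Y X]
    have 1: "\<eta> (Y \<boxtimes>\<^bsub>C\<^esub> X) (a + b) (mul F Y X b a y x) = mul G Y X (\<phi> b) (\<phi> a) (\<eta> Y b y) (\<eta> X a x)"
      using \<eta>_mul[OF Y X y x] by (simp add: add.commute)
    show "fn (FA F (Braid C X Y)) (a + b) (mul F X Y a b x y) =
        koszul K (hdeg a * hdeg b) \<odot>\<^bsub>sp (FO F (Y \<boxtimes>\<^bsub>C\<^esub> X)) (a + b)\<^esub> mul F Y X b a y x"
    proof (rule eqI[OF YX _ Fcl[OF br xy]])
      show "\<eta> (Y \<boxtimes>\<^bsub>C\<^esub> X) (a + b) (fn (FA F (Braid C X Y)) (a + b) (mul F X Y a b x y)) =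
        \<eta> (Y \<boxtimes>\<^bsub>C\<^esub> X) (a + b) (koszul K (hdeg a * hdeg b) \<odot>\<^bsub>sp (FO F (Y \<boxtimes>\<^bsub>C\<^esub> X)) (a + b)\<^esub> mul F Y X b a y x)"
        using G.mul_symmetric[OF X Y c[OF X x] c[OF Y y]]
        by (simp add: \<eta>_FA[OF br T[OF X Y] YX xy] \<eta>_mul[OF X Y x y] linear_smult[OF \<eta>[OF YX] koszul_closed yx] 1 \<phi>)
    qed (use yx F.FO_module[OF YX] in simp)
  qed
qed

section \<open>Subspaces closed under the operations of a lax functor\<close>

definition sub_cpx :: "('g \<Rightarrow> 'h) \<Rightarrow> ('h, 'k, 'u) cpx \<Rightarrow> ('g \<Rightarrow> 'u set) \<Rightarrow> ('g, 'k, 'u) cpx" where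
  "sub_cpx \<phi> V S = \<lparr>sp = \<lambda>a. (sp V (\<phi> a))\<lparr>carrier := S a\<rparr>, bd = \<lambda>a. bd V (\<phi> a)\<rparr>"

text \<open>The map \<open>\<phi>\<close> serves two purposes: it is the identity for truncations,
  and \<open>fst\<close> when the homology of degree n is placed in bidegree (n, n).\<close>

definition sub_functor ::
  "('o, 'a) smc \<Rightarrow> ('g::complex_grading \<Rightarrow> 'h::complex_grading)
    \<Rightarrow> ('o, 'a, ('h, 'k, 'u) cpx, ('h, 'k, 'u) cmap) lax_functor \<Rightarrow> ('o \<Rightarrow> 'g \<Rightarrow> 'u set)
    \<Rightarrow> ('o, 'a, ('g, 'k, 'u) cpx, ('g, 'k, 'u) cmap) lax_functor" where
  "sub_functor C \<phi> F S =
     (let sub = \<lambda>X. sub_cpx \<phi> (FO F X) (S X) in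
      \<lparr>FO = sub,
       FA = \<lambda>f. \<lparr>src = sub (Dom C f), tgt = sub (Cod C f), fn = \<lambda>a. restrict (fn (FA F f) (\<phi> a)) (S (Dom C f) a)\<rparr>,
       Mu = \<lambda>X Y. tens_fun (sub X) (sub Y) (sub (X \<boxtimes>\<^bsub>C\<^esub> Y)) (\<lambda>a b. mul F X Y (\<phi> a) (\<phi> b)),
       Eps = unit_fun (sub (Unit C)) (one_elt F)\<rparr>)"

lemma sub_functor_simps:
  "carrier (sp (FO (sub_functor C \<phi> F S) X) a) = S X a"
  "add (sp (FO (sub_functor C \<phi> F S) X) a) = add (sp (FO F X) (\<phi> a))"
  "zero (sp (FO (sub_functor C \<phi> F S) X) a) = zero (sp (FO F X) (\<phi> a))"
  "smult (sp (FO (sub_functor C \<phi> F S) X) a) = smult (sp (FO F X) (\<phi> a))"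
  "bd (FO (sub_functor C \<phi> F S) X) a = bd (FO F X) (\<phi> a)"
  by (simp_all add: sub_functor_def sub_cpx_def Let_def)

lemma linear_maps_sub:
  assumes "f \<in> linear_maps K V W" "S \<subseteq> carrier V" "\<And>x. x \<in> S \<Longrightarrow> f x \<in> T"
  shows "f \<in> linear_maps K (V\<lparr>carrier := S\<rparr>) (W\<lparr>carrier := T\<rparr>)"
  using assms(2,3) by (intro linear_mapsI) (auto simp: linear_add[OF assms(1)] linear_smult[OF assms(1)] subset_iff)

lemma sub_functor_lax:
  fixes F :: "('o, 'a, ('h::{complex_grading,countable}, 'k, 'u) cpx, ('h, 'k, 'u) cmap) lax_functor"
    and \<phi> :: "'g::{complex_grading,countable} \<Rightarrow> 'h"
  assumes F: "lax_elements K emb C F"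
    and \<phi>: "\<And>a b. \<phi> (a + b) = \<phi> a + \<phi> b" "\<phi> bdeg = bdeg" "\<And>a. hdeg (\<phi> a) = hdeg a"
    and S: "\<And>X a. X \<in> Obj C \<Longrightarrow> S X a \<subseteq> carrier (sp (FO F X) (\<phi> a))"
    and S_zero: "\<And>X a. X \<in> Obj C \<Longrightarrow> \<zero>\<^bsub>sp (FO F X) (\<phi> a)\<^esub> \<in> S X a"
    and S_add: "\<And>X a x y. \<lbrakk>X \<in> Obj C; x \<in> S X a; y \<in> S X a\<rbrakk> \<Longrightarrow> x \<oplus>\<^bsub>sp (FO F X) (\<phi> a)\<^esub> y \<in> S X a"
    and S_smult: "\<And>X a c x. \<lbrakk>X \<in> Obj C; c \<in> carrier K; x \<in> S X a\<rbrakk> \<Longrightarrow> c \<odot>\<^bsub>sp (FO F X) (\<phi> a)\<^esub> x \<in> S X a"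
    and S_bd: "\<And>X a x. \<lbrakk>X \<in> Obj C; x \<in> S X a\<rbrakk> \<Longrightarrow> bd (FO F X) (\<phi> a) x \<in> S X (a + bdeg)"
    and S_FA: "\<And>f X Y a x. \<lbrakk>f \<in> Hom C X Y; X \<in> Obj C; Y \<in> Obj C; x \<in> S X a\<rbrakk> \<Longrightarrow> fn (FA F f) (\<phi> a) x \<in> S Y a"
    and S_mul: "\<And>X Y a b x y. \<lbrakk>X \<in> Obj C; Y \<in> Obj C; x \<in> S X a; y \<in> S Y b\<rbrakk> \<Longrightarrow>
      mul F X Y (\<phi> a) (\<phi> b) x y \<in> S (X \<boxtimes>\<^bsub>C\<^esub> Y) (a + b)"
    and S_one: "one_elt F \<in> S (Unit C) 0"
  shows "lax_elements K emb C (sub_functor C \<phi> F S)"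
    and "\<lbrakk>X \<in> Obj C; Y \<in> Obj C; x \<in> S X a; y \<in> S Y b\<rbrakk> \<Longrightarrow>
      mul (sub_functor C \<phi> F S) X Y a b x y = mul F X Y (\<phi> a) (\<phi> b) x y"
    and "one_elt (sub_functor C \<phi> F S) = one_elt F"
    and "\<lbrakk>f \<in> Hom C X Y; x \<in> S X a\<rbrakk> \<Longrightarrow> fn (FA (sub_functor C \<phi> F S) f) a x = fn (FA F f) (\<phi> a) x"
proof -
  interpret F: lax_elements K emb C F by (rule F)
  let ?G = "sub_functor C \<phi> F S"
  let ?s = "\<lambda>X. sub_cpx \<phi> (FO F X) (S X)"
  have H: "X \<in> Obj C" "Y \<in> Obj C" "Dom C f = X" "Cod C f = Y" if "f \<in> Hom C X Y" for f X Y
    using that F.C.dom_obj F.C.cod_obj by (auto simp: Hom_def)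
  have spS: "sp (?s X) a = (sp (FO F X) (\<phi> a))\<lparr>carrier := S X a\<rparr>" for X a
    by (simp add: sub_cpx_def)
  have bdS: "bd (?s X) a = bd (FO F X) (\<phi> a)" for X a
    by (simp add: sub_cpx_def)
  have cx: "chain_complex K (?s X)" if X: "X \<in> Obj C" for X
    unfolding chain_complex_def
  proof (intro conjI allI ballI)
    show "module K (sp (?s X) n)" for n
      unfolding spS by (rule module_restrict_carrier(1)[OF F.FO_module[OF X] S[OF X] S_zero[OF X]])
        (use S_add S_smult X in auto)
    show "bd (?s X) n \<in> linear_maps K (sp (?s X) n) (sp (?s X) (n + bdeg))" for n
      unfolding spS bdS
      by (rule linear_maps_sub[OF _ S[OF X] S_bd[OF X]])
        (use chain_complex_bd[OF F.FO_complex[OF X], of "\<phi> n"] in \<open>simp_all add: \<phi>\<close>)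
    show "bd (?s X) (n + bdeg) (bd (?s X) n x) = \<zero>\<^bsub>sp (?s X) (n + bdeg + bdeg)\<^esub>" if "x \<in> carrier (sp (?s X) n)" for n x
      using chain_complex_bd_bd[OF F.FO_complex[OF X], of x "\<phi> n"] that S[OF X, of n] by (auto simp: spS bdS \<phi>)
  qed
  note T = F.C.tens_obj
  have bil: "mul F X Y (\<phi> a) (\<phi> b) \<in> bilinear_maps (sp (?s X) a) (sp (?s Y) b) (sp (?s (X \<boxtimes>\<^bsub>C\<^esub> Y)) (a + b))"
    if X: "X \<in> Obj C" and Y: "Y \<in> Obj C" for X Y a b
  proof (rule bilinear_mapsI)
    note b = F.mul_bilinear[OF X Y, of "\<phi> a" "\<phi> b", folded \<phi>(1)]
    fix x assume "x \<in> carrier (sp (?s X) a)"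
    then have x: "x \<in> S X a" by (simp add: spS)
    show "mul F X Y (\<phi> a) (\<phi> b) x \<in> linear_maps K (sp (?s Y) b) (sp (?s (X \<boxtimes>\<^bsub>C\<^esub> Y)) (a + b))"
      unfolding spS by (rule linear_maps_sub[OF bilinear_right[OF b subsetD[OF S[OF X] x]] S[OF Y] S_mul[OF X Y x]])
  next
    note b = F.mul_bilinear[OF X Y, of "\<phi> a" "\<phi> b", folded \<phi>(1)]
    fix y assume "y \<in> carrier (sp (?s Y) b)"
    then have y: "y \<in> S Y b" by (simp add: spS)
    show "(\<lambda>x. mul F X Y (\<phi> a) (\<phi> b) x y) \<in> linear_maps K (sp (?s X) a) (sp (?s (X \<boxtimes>\<^bsub>C\<^esub> Y)) (a + b))"
      unfolding spS by (rule linear_maps_sub[OF bilinear_left[OF b subsetD[OF S[OF Y] y]] S[OF X] S_mul[OF X Y _ y]])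
  qed
  have FO: "FO ?G X = ?s X" and Eps: "lax_functor.Eps ?G = unit_fun (?s (Unit C)) (one_elt F)"
    and Mu: "Mu ?G X Y = tens_fun (?s X) (?s Y) (?s (X \<boxtimes>\<^bsub>C\<^esub> Y)) (\<lambda>a b. mul F X Y (\<phi> a) (\<phi> b))" for X Y
    by (simp_all add: sub_functor_def Let_def)
  have \<phi>0: "\<phi> 0 = 0" using \<phi>(1)[of 0 0] by simp
  note u = unit_fun[OF cx[OF F.C.unit_obj], of "one_elt F"]
  have one: "one_elt F \<in> carrier (sp (?s (Unit C)) 0)"
    using S_one by (simp add: spS)
  show FAe: "\<lbrakk>f \<in> Hom C X Y; x \<in> S X a\<rbrakk> \<Longrightarrow> fn (FA ?G f) a x = fn (FA F f) (\<phi> a) x" for f X Y a x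
    using H by (auto simp: sub_functor_def Let_def)
  show mule: "mul ?G X Y a b x y = mul F X Y (\<phi> a) (\<phi> b) x y"
    if "X \<in> Obj C" "Y \<in> Obj C" "x \<in> S X a" "y \<in> S Y b" for X Y a b x y
    using tens_fun(2)[OF cx[OF that(1)] cx[OF that(2)] cx[OF T[OF that(1,2)]] bil[OF that(1,2)] refl] that(3,4)
    by (simp add: mul_def[of ?G] FO Mu spS)
  show onee: "one_elt ?G = one_elt F"
    by (simp add: one_elt_def[of ?G] Eps u(2)[OF one])
  have pre: "pre_lax K emb C ?G"
  proof
    show "chain_complex K (FO ?G X)" if "X \<in> Obj C" for X
      unfolding FO by (rule cx[OF that])
    show "FA ?G f \<in> Hom (complexes K) (FO ?G X) (FO ?G Y)" if f: "f \<in> Hom C X Y" for f X Y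
    proof -
      note X = H[OF f]
      have st: "src (FA ?G f) = ?s X" "tgt (FA ?G f) = ?s Y" and fn: "fn (FA ?G f) = (\<lambda>a. restrict (fn (FA F f) (\<phi> a)) (S X a))"
        using X by (auto simp: sub_functor_def Let_def)
      have l: "fn (FA F f) (\<phi> n) \<in> linear_maps K (sp (?s X) n) (sp (?s Y) n)" for n
        unfolding spS by (rule linear_maps_sub[OF F.FA_linear[OF f] S[OF X(1)] S_FA[OF f X(1,2)]])
      have "FA ?G f \<in> linear_cmaps (?s X) (?s Y)"
        using linear_restrict[OF l chain_complex_module[OF cx[OF X(1)]]]
        by (simp add: linear_cmaps_def linear_cmap_def st fn spS)
      moreover have "bd (?s Y) n (fn (FA ?G f) n x) = fn (FA ?G f) (n + bdeg) (bd (?s X) n x)"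
        if x: "x \<in> carrier (sp (?s X) n)" for n x
      proof -
        have x': "x \<in> S X n" using x by (simp add: spS)
        have "bd (FO F Y) (\<phi> n) (fn (FA F f) (\<phi> n) x) = fn (FA F f) (\<phi> n + bdeg) (bd (FO F X) (\<phi> n) x)"
          using F.FA_chain_map[OF f] chain_map_bd[of "FA F f" x "\<phi> n"] subsetD[OF S[OF X(1)] x']
          by (simp add: Hom_complexes)
        then show ?thesis
          using x' S_bd[OF X(1) x'] by (simp add: fn bdS \<phi>)
      qed
      ultimately have "chain_map K (FA ?G f)"
        by (simp add: chain_map_iff[OF _ cx[OF X(1)] cx[OF X(2)]])
      then show ?thesis by (simp add: Hom_complexes st FO)
    qed
    show "Mu ?G X Y \<in> linear_cmaps (tens_cpx K (FO ?G X) (FO ?G Y)) (FO ?G (X \<boxtimes>\<^bsub>C\<^esub> Y))"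
      if "X \<in> Obj C" "Y \<in> Obj C" for X Y
      unfolding FO Mu by (rule tens_fun(1)[OF cx[OF that(1)] cx[OF that(2)] cx[OF T[OF that]] bil[OF that]])
    show "lax_functor.Eps ?G \<in> linear_cmaps (unit_cpx K) (FO ?G (Unit C))"
      unfolding FO Eps by (rule u(1)[OF one])
  qed
  show "lax_elements K emb C ?G"
  \<comment> \<open>The inclusions are injective and preserve the differential, the product and the
    unit element, so all laws are pulled back along the identity on elements.\<close>
  proof (rule lax_elements_pullback[where \<phi> = \<phi> and \<eta> = "\<lambda>X a x. x", OF pre F \<phi>])
    show "(\<lambda>x. x) \<in> linear_maps K (sp (FO ?G X) a) (sp (FO F X) (\<phi> a))" if "X \<in> Obj C" for X a
      using S[OF that, of a] by (intro linear_mapsI) (auto simp: FO spS)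
  qed (simp_all add: sub_functor_simps FAe mule onee)
qed

text \<open>The three kinds of equations are tested on generators of their sources: all elements for
  naturality, elementary tensors for \<open>Mu\<close>, the copy of 1 for
  \<open>Eps\<close>.\<close>

lemma monoidal_transformation_iff:
  fixes F G :: "('o, 'a, ('g::{complex_grading,countable}, 'k, 'u) cpx, ('g, 'k, 'u) cmap) lax_functor"
  assumes F: "lax_elements K emb C F" and G: "lax_elements K emb C G"
    and \<eta>: "\<And>X. X \<in> Obj C \<Longrightarrow> \<eta> X \<in> Hom (complexes K) (FO F X) (FO G X)"
  shows "monoidal_transformation C (complexes K) F G \<eta> \<longleftrightarrow>
    (\<forall>X Y. \<forall>f \<in> Hom C X Y. \<forall>n. \<forall>x \<in> carrier (sp (FO F X) n). fn (\<eta> Y) n (fn (FA F f) n x) = fn (FA G f) n (fn (\<eta> X) n x)) \<and>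
    (\<forall>X \<in> Obj C. \<forall>Y \<in> Obj C. \<forall>a b. \<forall>x \<in> carrier (sp (FO F X) a). \<forall>y \<in> carrier (sp (FO F Y) b).
      fn (\<eta> (X \<boxtimes>\<^bsub>C\<^esub> Y)) (a + b) (mul F X Y a b x y) = mul G X Y a b (fn (\<eta> X) a x) (fn (\<eta> Y) b y)) \<and>
    fn (\<eta> (Unit C)) 0 (one_elt F) = one_elt G"
proof -
  interpret F: lax_elements K emb C F by (rule F)
  interpret G: lax_elements K emb C G by (rule G)
  have e: "\<eta> X \<in> linear_cmaps (FO F X) (FO G X)" if "X \<in> Obj C" for X
    using \<eta>[OF that] by (auto simp: Hom_complexes intro: chain_map_in_linear_cmaps)
  have H: "X \<in> Obj C" "Y \<in> Obj C" if "f \<in> Hom C X Y" for f X Y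
    using that F.C.dom_obj F.C.cod_obj by (auto simp: Hom_def)
  have nat: "cmap_comp (\<eta> Y) (FA F f) = cmap_comp (FA G f) (\<eta> X) \<longleftrightarrow>
      (\<forall>n. \<forall>x \<in> carrier (sp (FO F X) n). fn (\<eta> Y) n (fn (FA F f) n x) = fn (FA G f) n (fn (\<eta> X) n x))"
    if f: "f \<in> Hom C X Y" for f X Y
  proof -
    note X = H[OF f] and c = F.FO_complex[OF H(1)[OF f]]
    show ?thesis
      unfolding linear_cmaps_eq_iff[OF comp_in_linear_cmaps[OF F.FA_cmap[OF f] e[OF X(2)] c]
          comp_in_linear_cmaps[OF e[OF X(1)] G.FA_cmap[OF f] c] c G.FO_complex[OF X(2)] spans_carrier]
      by (simp add: comp_fn[OF F.FA_cmap[OF f]] comp_fn[OF e[OF X(1)]])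
  qed
  have mu: "cmap_comp (\<eta> (X \<boxtimes>\<^bsub>C\<^esub> Y)) (Mu F X Y) = cmap_comp (Mu G X Y) (tens_cmap K (\<eta> X) (\<eta> Y)) \<longleftrightarrow>
      (\<forall>a b. \<forall>x \<in> carrier (sp (FO F X) a). \<forall>y \<in> carrier (sp (FO F Y) b).
        fn (\<eta> (X \<boxtimes>\<^bsub>C\<^esub> Y)) (a + b) (mul F X Y a b x y) = mul G X Y a b (fn (\<eta> X) a x) (fn (\<eta> Y) b y))"
    if X: "X \<in> Obj C" and Y: "Y \<in> Obj C" for X Y
  proof -
    note XY = F.C.tens_obj[OF X Y] and c = F.FO_tens_complex[OF X Y]
    note t = tens_in_linear_cmaps[OF e[OF X] e[OF Y] F.FO_complex[OF X] G.FO_complex[OF X] F.FO_complex[OF Y] G.FO_complex[OF Y]]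
    show ?thesis
      unfolding linear_cmaps_eq_iff[OF comp_in_linear_cmaps[OF F.Mu_cmap[OF X Y] e[OF XY] c]
          comp_in_linear_cmaps[OF t(1) G.Mu_cmap[OF X Y] c] c G.FO_complex[OF XY] F.tens_spans_FO[OF X Y]] ball_setcompr2
      by (simp add: comp_fn[OF F.Mu_cmap[OF X Y]] comp_fn[OF t(1)] t(2) F.ten_closed_FO[OF X Y] mul_def)
  qed
  have eps: "cmap_comp (\<eta> (Unit C)) (lax_functor.Eps F) = lax_functor.Eps G \<longleftrightarrow> fn (\<eta> (Unit C)) 0 (one_elt F) = one_elt G"
  proof -
    note U = F.C.unit_obj
    show ?thesis
      unfolding linear_cmaps_eq_iff[OF comp_in_linear_cmaps[OF F.Eps_cmap e[OF U] unit_chain_complex] G.Eps_cmap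
          unit_chain_complex G.FO_complex[OF U] unit_spans]
      by (simp add: comp_fn[OF F.Eps_cmap] unit_elt_closed one_elt_def)
  qed
  show ?thesis
  proof
    assume "monoidal_transformation C (complexes K) F G \<eta>"
    then interpret monoidal_transformation C "complexes K" F G \<eta> .
    show "(\<forall>X Y. \<forall>f \<in> Hom C X Y. \<forall>n. \<forall>x \<in> carrier (sp (FO F X) n). fn (\<eta> Y) n (fn (FA F f) n x) = fn (FA G f) n (fn (\<eta> X) n x)) \<and>
      (\<forall>X \<in> Obj C. \<forall>Y \<in> Obj C. \<forall>a b. \<forall>x \<in> carrier (sp (FO F X) a). \<forall>y \<in> carrier (sp (FO F Y) b).
        fn (\<eta> (X \<boxtimes>\<^bsub>C\<^esub> Y)) (a + b) (mul F X Y a b x y) = mul G X Y a b (fn (\<eta> X) a x) (fn (\<eta> Y) b y)) \<and>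
      fn (\<eta> (Unit C)) 0 (one_elt F) = one_elt G"
      using nat natural mu monoidal_Mu eps monoidal_Eps by (simp add: complexes_def)
  next
    assume *: "(\<forall>X Y. \<forall>f \<in> Hom C X Y. \<forall>n. \<forall>x \<in> carrier (sp (FO F X) n). fn (\<eta> Y) n (fn (FA F f) n x) = fn (FA G f) n (fn (\<eta> X) n x)) \<and>
      (\<forall>X \<in> Obj C. \<forall>Y \<in> Obj C. \<forall>a b. \<forall>x \<in> carrier (sp (FO F X) a). \<forall>y \<in> carrier (sp (FO F Y) b).
        fn (\<eta> (X \<boxtimes>\<^bsub>C\<^esub> Y)) (a + b) (mul F X Y a b x y) = mul G X Y a b (fn (\<eta> X) a x) (fn (\<eta> Y) b y)) \<and>
      fn (\<eta> (Unit C)) 0 (one_elt F) = one_elt G"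
    show "monoidal_transformation C (complexes K) F G \<eta>"
    proof
      show "X \<in> Obj C \<Longrightarrow> \<eta> X \<in> Hom (complexes K) (FO F X) (FO G X)" for X by (rule \<eta>)
      show "f \<in> Hom C X Y \<Longrightarrow> \<eta> Y \<cdot>\<^bsub>complexes K\<^esub> FA F f = FA G f \<cdot>\<^bsub>complexes K\<^esub> \<eta> X" for f X Y
        using nat * by (simp add: complexes_def)
      show "\<lbrakk>X \<in> Obj C; Y \<in> Obj C\<rbrakk> \<Longrightarrow> \<eta> (X \<boxtimes>\<^bsub>C\<^esub> Y) \<cdot>\<^bsub>complexes K\<^esub> Mu F X Y =
          Mu G X Y \<cdot>\<^bsub>complexes K\<^esub> (\<eta> X \<boxdot>\<^bsub>complexes K\<^esub> \<eta> Y)" for X Y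
        using mu * by (simp add: complexes_def)
      show "\<eta> (Unit C) \<cdot>\<^bsub>complexes K\<^esub> lax_functor.Eps F = lax_functor.Eps G"
        using eps * by (simp add: complexes_def)
    qed
  qed
qed

end

section \<open>Homology\<close>

context small_ring
begin

text \<open>Needed for the Kuenneth morphism, where \<open>p\<close> and \<open>q\<close> pass from
  cycles to classes. \<open>linear_factor\<close> is applied first in the left variable for each
  \<open>y\<close>, then in the right variable for each \<open>t\<close>.\<close>

lemma bilinear_factor:
  assumes V: "module K V" and W: "module K W" and Q: "module K Q" and R: "module K R" and X: "module K X"
    and p: "p \<in> linear_maps K V Q" "p ` carrier V = carrier Q"
    and q: "q \<in> linear_maps K W R" "q ` carrier W = carrier R"
    and \<beta>: "\<beta> \<in> bilinear_maps V W X"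
    and zp: "\<And>x y. \<lbrakk>x \<in> carrier V; y \<in> carrier W; p x = \<zero>\<^bsub>Q\<^esub>\<rbrakk> \<Longrightarrow> \<beta> x y = \<zero>\<^bsub>X\<^esub>"
    and zq: "\<And>x y. \<lbrakk>x \<in> carrier V; y \<in> carrier W; q y = \<zero>\<^bsub>R\<^esub>\<rbrakk> \<Longrightarrow> \<beta> x y = \<zero>\<^bsub>X\<^esub>"
  obtains \<gamma> where "\<gamma> \<in> bilinear_maps Q R X"
    "\<And>x y. \<lbrakk>x \<in> carrier V; y \<in> carrier W\<rbrakk> \<Longrightarrow> \<gamma> (p x) (q y) = \<beta> x y"
proof -
  have "\<exists>g. g \<in> linear_maps K Q X \<and> (\<forall>x \<in> carrier V. g (p x) = \<beta> x y)" if y: "y \<in> carrier W" for y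
  proof (rule linear_factor[OF V Q X p bilinear_left[OF \<beta> y]])
    show "\<beta> x y = \<zero>\<^bsub>X\<^esub>" if "x \<in> carrier V" "p x = \<zero>\<^bsub>Q\<^esub>" for x
      by (rule zp[OF that(1) y that(2)])
    show ?thesis if "g \<in> linear_maps K Q X" "\<And>x. x \<in> carrier V \<Longrightarrow> g (p x) = \<beta> x y" for g
      by (rule exI[of _ g]) (use that in simp)
  qed
  then have "\<forall>y \<in> carrier W. \<exists>g. g \<in> linear_maps K Q X \<and> (\<forall>x \<in> carrier V. g (p x) = \<beta> x y)"
    by (rule ballI)
  from bchoice[OF this] obtain g where *: "\<forall>y \<in> carrier W. g y \<in> linear_maps K Q X \<and> (\<forall>x \<in> carrier V. g y (p x) = \<beta> x y)"
    by (rule exE)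
  note g = *[THEN bspec, THEN conjunct1] and gp = *[THEN bspec, THEN conjunct2, THEN bspec]
  \<comment> \<open>The maps \<open>g y\<close> were chosen independently for different
    \<open>y\<close>. Linearity in \<open>y\<close> is recovered by writing \<open>t\<close> as
    \<open>p x\<close>, where \<open>g y t\<close> is \<open>\<beta> x y\<close>.\<close>
  have gl: "(\<lambda>y. g y t) \<in> linear_maps K W X" if t: "t \<in> carrier Q" for t
  proof -
    obtain x where x: "x \<in> carrier V" "t = p x" using t unfolding p(2)[symmetric] by auto
    show ?thesis
      by (rule linear_cong[OF bilinear_right[OF \<beta> x(1)] W]) (simp add: gp x)
  qed
  have "\<exists>h. h \<in> linear_maps K R X \<and> (\<forall>y \<in> carrier W. h (q y) = g y t)" if t: "t \<in> carrier Q" for t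
  proof -
    obtain x where x: "x \<in> carrier V" "t = p x" using t unfolding p(2)[symmetric] by auto
    have "g y t = \<zero>\<^bsub>X\<^esub>" if "y \<in> carrier W" "q y = \<zero>\<^bsub>R\<^esub>" for y
      using gp[OF that(1) x(1)] zq[OF x(1) that] x(2) by simp
    then show ?thesis
    proof (rule linear_factor[OF W R X q gl[OF t]])
      show ?thesis if "h \<in> linear_maps K R X" "\<And>y. y \<in> carrier W \<Longrightarrow> h (q y) = g y t" for h
        by (rule exI[of _ h]) (use that in simp)
    qed
  qed
  then have "\<forall>t \<in> carrier Q. \<exists>h. h \<in> linear_maps K R X \<and> (\<forall>y \<in> carrier W. h (q y) = g y t)"
    by (rule ballI)
  from bchoice[OF this] obtain h where *: "\<forall>t \<in> carrier Q. h t \<in> linear_maps K R X \<and> (\<forall>y \<in> carrier W. h t (q y) = g y t)"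
    by (rule exE)
  note h = *[THEN bspec, THEN conjunct1] and hq = *[THEN bspec, THEN conjunct2, THEN bspec]
  have "h \<in> bilinear_maps Q R X"
  proof (rule bilinear_mapsI[OF h])
    fix s assume "s \<in> carrier R"
    then obtain y where y: "y \<in> carrier W" "s = q y" unfolding q(2)[symmetric] by auto
    show "(\<lambda>t. h t s) \<in> linear_maps K Q X"
      by (rule linear_cong[OF g[OF y(1)] Q]) (simp add: hq y)
  qed
  moreover have "h (p x) (q y) = \<beta> x y" if "x \<in> carrier V" "y \<in> carrier W" for x y
    using that linear_closed[OF p(1)] by (simp add: hq gp)
  ultimately show ?thesis by (rule that)
qed

text \<open>\<open>boundaries\<close> subtracts \<open>bdeg\<close>; naming the source degree
  \<open>n'\<close> and asking for \<open>n' + bdeg = n\<close> avoids computing with differences of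
  degrees.\<close>

lemma boundariesI:
  fixes V :: "('g::complex_grading, 'k, 'u) cpx"
  assumes "w \<in> carrier (sp V n')" "n' + bdeg = n"
  shows "bd V n' w \<in> boundaries V n"
  using assms by (auto simp: boundaries_def)

lemma boundariesE:
  fixes V :: "('g::complex_grading, 'k, 'u) cpx"
  assumes "x \<in> boundaries V n"
  obtains w n' where "w \<in> carrier (sp V n')" "n' + bdeg = n" "x = bd V n' w"
  using assms that[of _ "n - bdeg"] by (auto simp: boundaries_def)

lemma cycles_closed: "x \<in> cycles V n \<Longrightarrow> x \<in> carrier (sp V n)"
  by (simp add: cycles_def)

lemma cycles_bd: "x \<in> cycles V n \<Longrightarrow> bd V n x = \<zero>\<^bsub>sp V (n + bdeg)\<^esub>"
  by (simp add: cycles_def)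

definition cycle_module :: "('g::complex_grading, 'k, 'u) cpx \<Rightarrow> 'g \<Rightarrow> ('k, 'u) module" where
  "cycle_module V n = (sp V n)\<lparr>carrier := cycles V n\<rparr>"

lemma cycle_module_simps [simp]:
  "carrier (cycle_module V n) = cycles V n" "add (cycle_module V n) = add (sp V n)"
  "zero (cycle_module V n) = zero (sp V n)" "smult (cycle_module V n) = smult (sp V n)"
  "B +>\<^bsub>cycle_module V n\<^esub> x = B +>\<^bsub>sp V n\<^esub> x"
  by (simp_all add: cycle_module_def a_r_coset_def r_coset_def)

context
  fixes V :: "('g::complex_grading, 'k, 'u) cpx"
  assumes V: "chain_complex K V"
begin

lemma cycle_module_module: "module K (cycle_module V n)"
proof -
  note M = chain_complex_module[OF V] and l = chain_complex_bd[OF V, of n]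
  show ?thesis
    unfolding cycle_module_def
    by (rule module_restrict_carrier(1)[OF M])
      (use M in \<open>auto simp: cycles_def linear_add[OF l] linear_smult[OF l] linear_zero[OF l M M]\<close>)
qed

lemma bd_cycle: "x \<in> carrier (sp V n) \<Longrightarrow> bd V n x \<in> cycles V (n + bdeg)"
  using linear_closed[OF chain_complex_bd[OF V]] chain_complex_bd_bd[OF V] by (simp add: cycles_def)

lemma boundaries_subset: "boundaries V n \<subseteq> cycles V n"
  using bd_cycle[of _ "n - bdeg"] by (auto simp: boundaries_def)

lemma boundaries_submodule: "submodule (boundaries V n) K (cycle_module V n)"
proof (rule module_restrict_carrier(2)[OF cycle_module_module])
  note M = chain_complex_module[OF V]
  have l: "bd V (n - bdeg) \<in> linear_maps K (sp V (n - bdeg)) (sp V n)"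
    using chain_complex_bd[OF V, of "n - bdeg"] by simp
  show "boundaries V n \<subseteq> carrier (cycle_module V n)"
    using boundaries_subset by simp
  have "bd V (n - bdeg) \<zero>\<^bsub>sp V (n - bdeg)\<^esub> = \<zero>\<^bsub>sp V n\<^esub>"
    by (rule linear_zero[OF l M M])
  then show "\<zero>\<^bsub>cycle_module V n\<^esub> \<in> boundaries V n"
    unfolding boundaries_def cycle_module_simps using module_zero_closed[OF M] by (metis imageI)
  show "x \<oplus>\<^bsub>cycle_module V n\<^esub> y \<in> boundaries V n" if "x \<in> boundaries V n" "y \<in> boundaries V n" for x y
    using that M unfolding boundaries_def cycle_module_simps
    by (auto simp flip: linear_add[OF l] intro!: imageI)
  show "c \<odot>\<^bsub>cycle_module V n\<^esub> x \<in> boundaries V n" if "c \<in> carrier K" "x \<in> boundaries V n" for c x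
    using that M unfolding boundaries_def cycle_module_simps
    by (auto simp flip: linear_smult[OF l] intro!: imageI)
qed

lemma homology_quot: "homology V n = quot_module (cycle_module V n) (boundaries V n)"
  by (simp add: homology_def cycle_module_def)

lemmas homology_facts =
  quot_module[OF boundaries_submodule cycle_module_module, folded homology_quot, unfolded cycle_module_simps]

text \<open>A class is determined by a chosen representing cycle, and cycles already have type
  \<open>'u\<close>.\<close>

lemma homology_inj:
  obtains e :: "'u set \<Rightarrow> 'u" where "inj_on e (carrier (homology V n))"
proof -
  define r where "r X = (SOME x. x \<in> cycles V n \<and> X = boundaries V n +>\<^bsub>sp V n\<^esub> x)" for X
  have r: "r X \<in> cycles V n \<and> X = boundaries V n +>\<^bsub>sp V n\<^esub> r X" if "X \<in> carrier (homology V n)" for X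
  proof -
    have "\<exists>x. x \<in> cycles V n \<and> X = boundaries V n +>\<^bsub>sp V n\<^esub> x"
      using that unfolding homology_facts(3)[symmetric] by blast
    then show ?thesis unfolding r_def by (rule someI_ex)
  qed
  have "inj_on r (carrier (homology V n))"
    by (rule inj_onI) (metis r)
  then show ?thesis by (rule that)
qed

lemma small_homology:
  "module K (small (homology V n) :: ('k, 'u) module)"
  "(small_emb (homology V n) :: _ \<Rightarrow> 'u) \<in> linear_maps K (homology V n) (small (homology V n))"
  "(small_emb (homology V n) :: _ \<Rightarrow> 'u) ` carrier (homology V n) = carrier (small (homology V n))"
  "inj_on (small_emb (homology V n) :: _ \<Rightarrow> 'u) (carrier (homology V n))"
  by (rule homology_inj; erule small_module[OF homology_facts(1)] small_emb_inj)+

lemma sp_H_cpx: "sp (H_cpx V) n = small (homology V n)"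
  by (simp add: H_cpx_def)

lemma bd_H_cpx: "bd (H_cpx V) n x = \<zero>\<^bsub>sp (H_cpx V) (n + bdeg)\<^esub>"
  by (simp add: H_cpx_def)

lemma H_complex: "chain_complex K (H_cpx V)"
  unfolding chain_complex_def
  by (simp add: H_cpx_def small_homology(1) linear_zero_map)

lemma H_class_linear: "H_class V n \<in> linear_maps K (cycle_module V n) (sp (H_cpx V) n)"
  unfolding H_class_def[abs_def] sp_H_cpx
  by (rule linear_comp[OF homology_facts(2) small_homology(2)])

lemma H_class_surj: "H_class V n ` cycles V n = carrier (sp (H_cpx V) n)"
  unfolding sp_H_cpx small_homology(3)[symmetric] homology_facts(3)[symmetric]
  by (simp add: H_class_def image_image)

lemma H_class_closed: "x \<in> cycles V n \<Longrightarrow> H_class V n x \<in> carrier (sp (H_cpx V) n)"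
  using linear_closed[OF H_class_linear] by simp

lemma H_cases:
  assumes "t \<in> carrier (sp (H_cpx V) n)"
  obtains x where "x \<in> cycles V n" "t = H_class V n x"
  using assms unfolding H_class_surj[symmetric] by blast

lemma H_class_zero_iff:
  assumes x: "x \<in> cycles V n"
  shows "H_class V n x = \<zero>\<^bsub>sp (H_cpx V) n\<^esub> \<longleftrightarrow> x \<in> boundaries V n"
proof -
  have c: "boundaries V n +>\<^bsub>sp V n\<^esub> x \<in> carrier (homology V n)"
    using x unfolding homology_facts(3)[symmetric] by blast
  have "H_class V n x = \<zero>\<^bsub>sp (H_cpx V) n\<^esub> \<longleftrightarrow> boundaries V n +>\<^bsub>sp V n\<^esub> x = \<zero>\<^bsub>homology V n\<^esub>"
    unfolding H_class_def sp_H_cpx linear_zero[OF small_homology(2) homology_facts(1) small_homology(1), symmetric]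
    using inj_on_eq_iff[OF small_homology(4) c module_zero_closed[OF homology_facts(1)]] by simp
  with homology_facts(4)[OF x] show ?thesis by simp
qed

lemma H_class_add: "\<lbrakk>x \<in> cycles V n; y \<in> cycles V n\<rbrakk> \<Longrightarrow>
    H_class V n (x \<oplus>\<^bsub>sp V n\<^esub> y) = H_class V n x \<oplus>\<^bsub>sp (H_cpx V) n\<^esub> H_class V n y"
  using linear_add[OF H_class_linear] by simp

lemma H_class_smult: "\<lbrakk>c \<in> carrier K; x \<in> cycles V n\<rbrakk> \<Longrightarrow>
    H_class V n (c \<odot>\<^bsub>sp V n\<^esub> x) = c \<odot>\<^bsub>sp (H_cpx V) n\<^esub> H_class V n x"
  using linear_smult[OF H_class_linear] by simp

lemma cycles_diff: "\<lbrakk>x \<in> cycles V n; y \<in> cycles V n\<rbrakk> \<Longrightarrow> x \<ominus>\<^bsub>sp V n\<^esub> y \<in> cycles V n"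
  using chain_complex_module[OF V] linear_diff[OF chain_complex_bd[OF V]] by (auto simp: cycles_def)

lemma H_class_eq_iff:
  assumes x: "x \<in> cycles V n" and y: "y \<in> cycles V n"
  shows "H_class V n x = H_class V n y \<longleftrightarrow> x \<ominus>\<^bsub>sp V n\<^esub> y \<in> boundaries V n"
proof -
  note M = chain_complex_module[OF V, of n] and H = chain_complex_module[OF H_complex, of n]
  note d = cycles_diff[OF x y]
  have "H_class V n x = H_class V n (x \<ominus>\<^bsub>sp V n\<^esub> y) \<oplus>\<^bsub>sp (H_cpx V) n\<^esub> H_class V n y"
    using H_class_add[OF d y] module_diff_add[OF M cycles_closed[OF x] cycles_closed[OF y]] by simp
  then have "H_class V n x \<ominus>\<^bsub>sp (H_cpx V) n\<^esub> H_class V n y = H_class V n (x \<ominus>\<^bsub>sp V n\<^esub> y)"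
    using H_class_closed[OF d] H_class_closed[OF y] H
    by (simp add: a_minus_def module_add_assoc)
  then show ?thesis
    using H_class_zero_iff[OF d] module_diff_eq_zero_iff[OF H H_class_closed[OF x] H_class_closed[OF y]] by simp
qed

end

section \<open>Maps induced on homology\<close>

lemma chain_map_cycles:
  fixes f :: "('g::complex_grading, 'k, 'u) cmap"
  assumes f: "chain_map K f" and x: "x \<in> cycles (src f) n"
  shows "fn f n x \<in> cycles (tgt f) n"
proof -
  have c: "chain_complex K (src f)" "chain_complex K (tgt f)" and l: "fn f m \<in> linear_maps K (sp (src f) m) (sp (tgt f) m)" for m
    using f by (auto simp: chain_map_def)
  show ?thesis
    using chain_map_bd[OF f cycles_closed[OF x]] cycles_bd[OF x] linear_closed[OF l cycles_closed[OF x]]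
      linear_zero[OF l chain_complex_module[OF c(1)] chain_complex_module[OF c(2)]]
    by (simp add: cycles_def)
qed

lemma chain_map_boundaries:
  fixes f :: "('g::complex_grading, 'k, 'u) cmap"
  assumes f: "chain_map K f" and x: "x \<in> boundaries (src f) n"
  shows "fn f n x \<in> boundaries (tgt f) n"
proof -
  obtain w n' where w: "w \<in> carrier (sp (src f) n')" "n' + bdeg = n" "x = bd (src f) n' w"
    using x by (rule boundariesE)
  have l: "fn f m \<in> linear_maps K (sp (src f) m) (sp (tgt f) m)" for m
    using f by (auto simp: chain_map_def)
  have "fn f n x = bd (tgt f) n' (fn f n' w)"
    using chain_map_bd[OF f w(1)] w by simp
  then show ?thesis
    using boundariesI[OF linear_closed[OF l w(1)] w(2)] by simp
qed

lemma H_cmap: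
  fixes f :: "('g::complex_grading, 'k, 'u) cmap"
  assumes f: "chain_map K f"
  shows "chain_map K (H_cmap K f)" "src (H_cmap K f) = H_cpx (src f)" "tgt (H_cmap K f) = H_cpx (tgt f)"
    and "x \<in> cycles (src f) n \<Longrightarrow> fn (H_cmap K f) n (H_class (src f) n x) = H_class (tgt f) n (fn f n x)"
proof -
  have c: "chain_complex K (src f)" "chain_complex K (tgt f)" and l: "fn f n \<in> linear_maps K (sp (src f) n) (sp (tgt f) n)" for n
    using f by (auto simp: chain_map_def)
  note H = H_complex[OF c(1)] H_complex[OF c(2)]
  have *: "fn (H_cmap K f) n \<in> linear_maps K (sp (H_cpx (src f)) n) (sp (H_cpx (tgt f)) n) \<and>
      fn (H_cmap K f) n \<in> extensional (carrier (sp (H_cpx (src f)) n)) \<and>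
      (\<forall>x \<in> cycles (src f) n. fn (H_cmap K f) n (H_class (src f) n x) = H_class (tgt f) n (fn f n x))" for n
  proof -
    have "fn f n \<in> linear_maps K (cycle_module (src f) n) (cycle_module (tgt f) n)"
      unfolding cycle_module_def
      by (rule linear_maps_sub[OF l]) (auto simp: cycles_closed chain_map_cycles[OF f])
    note g = linear_comp[OF this H_class_linear[OF c(2)]]
    \<comment> \<open>Boundaries go to boundaries, so the map on cycles vanishes where the class
      does and factors through homology.\<close>
    have "H_class (tgt f) n (fn f n x) = \<zero>\<^bsub>sp (H_cpx (tgt f)) n\<^esub>"
      if "x \<in> carrier (cycle_module (src f) n)" "H_class (src f) n x = \<zero>\<^bsub>sp (H_cpx (src f)) n\<^esub>" for x
      using that H_class_zero_iff[OF c(1)] H_class_zero_iff[OF c(2)] chain_map_cycles[OF f] chain_map_boundaries[OF f]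
      by simp
    then obtain h where h: "h \<in> linear_maps K (sp (H_cpx (src f)) n) (sp (H_cpx (tgt f)) n)"
      "\<And>x. x \<in> cycles (src f) n \<Longrightarrow> h (H_class (src f) n x) = H_class (tgt f) n (fn f n x)"
      using linear_factor[OF cycle_module_module[OF c(1)] chain_complex_module[OF H(1)] chain_complex_module[OF H(2)]
          H_class_linear[OF c(1)] _ g] H_class_surj[OF c(1)] by (metis cycle_module_simps(1))
    have P: "(\<forall>x \<in> cycles (src f) n. k (H_class (src f) n x) = H_class (tgt f) n (fn f n x)) \<longleftrightarrow>
        (\<forall>s \<in> carrier (sp (H_cpx (src f)) n). k s = h s)" for k
      unfolding H_class_surj[OF c(1), symmetric] using h(2) by simp
    note t = the_linear_spans[OF spans_carrier chain_complex_module[OF H(1)] chain_complex_module[OF H(2)] h(1) P]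
    show ?thesis
      using t h(2) H_class_closed[OF c(1)] by (simp add: H_cmap_def)
  qed
  have z: "fn (H_cmap K f) n \<zero>\<^bsub>sp (H_cpx (src f)) n\<^esub> = \<zero>\<^bsub>sp (H_cpx (tgt f)) n\<^esub>" for n
    using * by (intro linear_zero[OF _ chain_complex_module[OF H(1)] chain_complex_module[OF H(2)]]) blast
  show st: "src (H_cmap K f) = H_cpx (src f)" "tgt (H_cmap K f) = H_cpx (tgt f)"
    by (simp_all add: H_cmap_def)
  show "x \<in> cycles (src f) n \<Longrightarrow> fn (H_cmap K f) n (H_class (src f) n x) = H_class (tgt f) n (fn f n x)"
    using * by blast
  show "chain_map K (H_cmap K f)"
    unfolding chain_map_def st
    using * H by (simp add: bd_H_cpx[OF c(1)] bd_H_cpx[OF c(2)] z)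
qed

text \<open>Injectivity on homology means that only boundaries become boundaries, surjectivity that
  each cycle is homologous to an image. In this form later verifications stay with cycles and
  boundaries and avoid the copied quotient modules.\<close>

lemma quasi_iso_iff:
  fixes f :: "('g::complex_grading, 'k, 'u) cmap"
  assumes f: "chain_map K f"
  shows "quasi_iso K f \<longleftrightarrow> (\<forall>n.
    (\<forall>x \<in> cycles (src f) n. fn f n x \<in> boundaries (tgt f) n \<longrightarrow> x \<in> boundaries (src f) n) \<and>
    (\<forall>y \<in> cycles (tgt f) n. \<exists>x \<in> cycles (src f) n. y \<ominus>\<^bsub>sp (tgt f) n\<^esub> fn f n x \<in> boundaries (tgt f) n))"
proof -
  have c: "chain_complex K (src f)" "chain_complex K (tgt f)" and l: "fn f n \<in> linear_maps K (sp (src f) n) (sp (tgt f) n)" for n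
    using f by (auto simp: chain_map_def)
  note M = chain_complex_module[OF c(1)] chain_complex_module[OF c(2)]
  note H = H_cmap[OF f] and cyc = chain_map_cycles[OF f]
  have "bij_betw (fn (H_cmap K f) n) (carrier (sp (H_cpx (src f)) n)) (carrier (sp (H_cpx (tgt f)) n)) \<longleftrightarrow>
    (\<forall>x \<in> cycles (src f) n. fn f n x \<in> boundaries (tgt f) n \<longrightarrow> x \<in> boundaries (src f) n) \<and>
    (\<forall>y \<in> cycles (tgt f) n. \<exists>x \<in> cycles (src f) n. y \<ominus>\<^bsub>sp (tgt f) n\<^esub> fn f n x \<in> boundaries (tgt f) n)" for n
  proof -
    let ?h = "fn (H_cmap K f) n" and ?c = "H_class (src f) n" and ?d = "H_class (tgt f) n"
    have "inj_on ?h (carrier (sp (H_cpx (src f)) n)) \<longleftrightarrow>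
        (\<forall>x \<in> cycles (src f) n. \<forall>y \<in> cycles (src f) n. ?d (fn f n x) = ?d (fn f n y) \<longrightarrow> ?c x = ?c y)"
      unfolding inj_on_def H_class_surj[OF c(1), symmetric] using H(4) by simp
    also have "\<dots> \<longleftrightarrow> (\<forall>x \<in> cycles (src f) n. fn f n x \<in> boundaries (tgt f) n \<longrightarrow> x \<in> boundaries (src f) n)"
      (is "?A \<longleftrightarrow> ?B")
    proof
      assume A: ?A
      show ?B
      proof (intro ballI impI)
        fix x assume x: "x \<in> cycles (src f) n" and fx: "fn f n x \<in> boundaries (tgt f) n"
        have z: "\<zero>\<^bsub>sp (src f) n\<^esub> \<in> cycles (src f) n"
          using module_zero_closed[OF cycle_module_module[OF c(1)]] by simp
        have "?d (fn f n x) = \<zero>\<^bsub>sp (H_cpx (tgt f)) n\<^esub>"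
          using H_class_zero_iff[OF c(2) cyc[OF x]] fx by simp
        also have "\<dots> = ?d (fn f n \<zero>\<^bsub>sp (src f) n\<^esub>)"
          using linear_zero[OF H_class_linear[OF c(2)] cycle_module_module[OF c(2)] chain_complex_module[OF H_complex[OF c(2)]]]
            linear_zero[OF l M] by simp
        finally have "?c x = ?c \<zero>\<^bsub>sp (src f) n\<^esub>" using A x z by blast
        then show "x \<in> boundaries (src f) n"
          using H_class_zero_iff[OF c(1) x]
            linear_zero[OF H_class_linear[OF c(1)] cycle_module_module[OF c(1)] chain_complex_module[OF H_complex[OF c(1)]]]
          by simp
      qed
    next
      assume B: ?B
      show ?A
      proof (intro ballI impI)
        fix x y assume x: "x \<in> cycles (src f) n" and y: "y \<in> cycles (src f) n" and "?d (fn f n x) = ?d (fn f n y)"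
        then have "fn f n (x \<ominus>\<^bsub>sp (src f) n\<^esub> y) \<in> boundaries (tgt f) n"
          using H_class_eq_iff[OF c(2) cyc[OF x] cyc[OF y]] linear_diff[OF l M cycles_closed[OF x] cycles_closed[OF y]] by simp
        then show "?c x = ?c y"
          using B cycles_diff[OF c(1) x y] H_class_eq_iff[OF c(1) x y] by blast
      qed
    qed
    finally have 1: "inj_on ?h (carrier (sp (H_cpx (src f)) n)) \<longleftrightarrow> ?B" .
    have "?h ` carrier (sp (H_cpx (src f)) n) = carrier (sp (H_cpx (tgt f)) n) \<longleftrightarrow>
        carrier (sp (H_cpx (tgt f)) n) \<subseteq> ?h ` carrier (sp (H_cpx (src f)) n)"
      using linear_closed[of ?h "sp (H_cpx (src f)) n" "sp (H_cpx (tgt f)) n"] H(1-3)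
      by (auto simp: chain_map_def)
    also have "\<dots> \<longleftrightarrow> (\<forall>y \<in> cycles (tgt f) n. \<exists>x \<in> cycles (src f) n. ?d y = ?h (?c x))"
      unfolding H_class_surj[OF c(1), symmetric] H_class_surj[OF c(2), symmetric] by blast
    also have "\<dots> \<longleftrightarrow> (\<forall>y \<in> cycles (tgt f) n. \<exists>x \<in> cycles (src f) n. y \<ominus>\<^bsub>sp (tgt f) n\<^esub> fn f n x \<in> boundaries (tgt f) n)"
      by (intro ball_cong bex_cong refl) (simp add: H(4) H_class_eq_iff[OF c(2)] cyc)
    finally show ?thesis
      using 1 by (simp add: bij_betw_def)
  qed
  with f show ?thesis by (simp add: quasi_iso_def)
qed

section \<open>The Kuenneth morphism\<close>

context
  fixes V W :: "('g::{complex_grading,countable}, 'k, 'u) cpx"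
  assumes V: "chain_complex K V" and W: "chain_complex K W"
begin

private lemmas Vmod = chain_complex_module[OF V]
private lemmas Wmod = chain_complex_module[OF W]
private lemmas T = tens_chain_complex[OF V W]

lemma ten_cycle:
  assumes ab: "a + b = m" and x: "x \<in> cycles V a" and y: "y \<in> cycles W b"
  shows "ten K V W a b x y \<in> cycles (tens_cpx K V W) m"
proof -
  note M = tens_sp_module[OF Vmod Wmod]
  note x' = cycles_closed[OF x] and y' = cycles_closed[OF y]
  have e: "a + bdeg + b = m + bdeg" "a + (b + bdeg) = m + bdeg" using ab by (auto simp: ac_simps)
  have "ten K V W (a + bdeg) b \<zero>\<^bsub>sp V (a + bdeg)\<^esub> y = \<zero>\<^bsub>tens_sp K V W (m + bdeg)\<^esub>"
    by (rule linear_zero[OF bilinear_left[OF ten_bilinear[OF Vmod Wmod e(1)] y'] Vmod M])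
  moreover have "ten K V W a (b + bdeg) x \<zero>\<^bsub>sp W (b + bdeg)\<^esub> = \<zero>\<^bsub>tens_sp K V W (m + bdeg)\<^esub>"
    by (rule linear_zero[OF bilinear_right[OF ten_bilinear[OF Vmod Wmod e(2)] x'] Wmod M])
  ultimately have "bd (tens_cpx K V W) m (ten K V W a b x y) = \<zero>\<^bsub>tens_sp K V W (m + bdeg)\<^esub>"
    using M by (simp add: tens_bd_ten[OF V W ab x' y'] cycles_bd[OF x] cycles_bd[OF y])
  then show ?thesis
    using ten_closed[OF Vmod Wmod ab x' y'] by (simp add: cycles_def tens_sp_cpx[OF V W])
qed

lemma ten_boundary_left:
  assumes ab: "a + b = m" and x: "x \<in> boundaries V a" and y: "y \<in> cycles W b"
  shows "ten K V W a b x y \<in> boundaries (tens_cpx K V W) m"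
proof -
  note M = tens_sp_module[OF Vmod Wmod]
  obtain w n where w: "w \<in> carrier (sp V n)" "n + bdeg = a" "x = bd V n w"
    using x by (rule boundariesE)
  note y' = cycles_closed[OF y]
  have e: "n + b + bdeg = m" "n + (b + bdeg) = n + b + bdeg" using ab w(2) by (auto simp: ac_simps)
  have z: "ten K V W n (b + bdeg) w \<zero>\<^bsub>sp W (b + bdeg)\<^esub> = \<zero>\<^bsub>tens_sp K V W (n + b + bdeg)\<^esub>"
    by (rule linear_zero[OF bilinear_right[OF ten_bilinear[OF Vmod Wmod e(2)] w(1)] Wmod M])
  have t: "ten K V W a b x y \<in> carrier (tens_sp K V W m)"
    by (rule ten_closed[OF Vmod Wmod ab cycles_closed[OF subsetD[OF boundaries_subset[OF V] x]] y'])
  have "bd (tens_cpx K V W) (n + b) (ten K V W n b w y) = ten K V W a b x y"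
    unfolding tens_bd_ten[OF V W refl w(1) y'] cycles_bd[OF y] z w(2) w(3)[symmetric] e(1)
    using t M by simp
  moreover have "ten K V W n b w y \<in> carrier (sp (tens_cpx K V W) (n + b))"
    using ten_closed[OF Vmod Wmod refl w(1) y'] by (simp add: tens_sp_cpx[OF V W])
  ultimately show ?thesis
    using boundariesI[of "ten K V W n b w y" "tens_cpx K V W" "n + b" m] e(1) by simp
qed

lemma ten_boundary_right:
  assumes ab: "a + b = m" and x: "x \<in> cycles V a" and y: "y \<in> boundaries W b"
  shows "ten K V W a b x y \<in> boundaries (tens_cpx K V W) m"
proof -
  note M = tens_sp_module[OF Vmod Wmod]
  obtain w n where w: "w \<in> carrier (sp W n)" "n + bdeg = b" "y = bd W n w"
    using y by (rule boundariesE)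
  note x' = cycles_closed[OF x]
  let ?k = "koszul K (hdeg a)"
  have e: "a + n + bdeg = m" "a + bdeg + n = a + n + bdeg" using ab w(2) by (auto simp: ac_simps)
  have z: "ten K V W (a + bdeg) n \<zero>\<^bsub>sp V (a + bdeg)\<^esub> w = \<zero>\<^bsub>tens_sp K V W (a + n + bdeg)\<^esub>"
    by (rule linear_zero[OF bilinear_left[OF ten_bilinear[OF Vmod Wmod e(2)] w(1)] Vmod M])
  have t: "ten K V W a b x y \<in> carrier (tens_sp K V W m)"
    by (rule ten_closed[OF Vmod Wmod ab x' cycles_closed[OF subsetD[OF boundaries_subset[OF W] y]]])
  have 1: "bd (tens_cpx K V W) (a + n) (ten K V W a n x w) = ?k \<odot>\<^bsub>tens_sp K V W m\<^esub> ten K V W a b x y"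
    unfolding tens_bd_ten[OF V W refl x' w(1)] cycles_bd[OF x] z w(2) w(3)[symmetric] e(1)
    using t M by simp
  have c: "ten K V W a n x w \<in> carrier (tens_sp K V W (a + n))"
    by (rule ten_closed[OF Vmod Wmod refl x' w(1)])
  \<comment> \<open>The differential of the tensor of \<open>x\<close> and \<open>w\<close> is the
    tensor of \<open>x\<close> and \<open>y\<close> only up to the sign \<open>?k\<close>. The
    square of this sign is 1, so scaling the primitive by \<open>?k\<close> removes it.\<close>
  have "bd (tens_cpx K V W) (a + n) (?k \<odot>\<^bsub>tens_sp K V W (a + n)\<^esub> ten K V W a n x w) =
      ?k \<odot>\<^bsub>tens_sp K V W m\<^esub> (?k \<odot>\<^bsub>tens_sp K V W m\<^esub> ten K V W a b x y)"
    using linear_smult[OF tens_bd_linear[OF V W] koszul_closed c] 1 e(1) by simp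
  also have "\<dots> = ten K V W a b x y"
    using t M by (simp add: module.smult_assoc1[OF M, symmetric])
  finally show ?thesis
    using boundariesI[of "?k \<odot>\<^bsub>tens_sp K V W (a + n)\<^esub> ten K V W a n x w" "tens_cpx K V W" "a + n" m] e(1) c M
    by (simp add: tens_sp_cpx[OF V W])
qed

lemma kunneth:
  "kunneth K V W \<in> linear_cmaps (tens_cpx K (H_cpx V) (H_cpx W)) (H_cpx (tens_cpx K V W))"
  "\<lbrakk>a + b = m; x \<in> cycles V a; y \<in> cycles W b\<rbrakk> \<Longrightarrow>
    fn (kunneth K V W) m (ten K (H_cpx V) (H_cpx W) a b (H_class V a x) (H_class W b y)) =
      H_class (tens_cpx K V W) m (ten K V W a b x y)"
proof -
  note HV = H_complex[OF V] and HW = H_complex[OF W] and HT = H_complex[OF T]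
  note HVm = chain_complex_module[OF HV] and HWm = chain_complex_module[OF HW] and HTm = chain_complex_module[OF HT]
  let ?T = "tens_cpx K V W" and ?HT = "H_cpx (tens_cpx K V W)"
  let ?c = "\<lambda>m a b x y. H_class ?T m (ten K V W a b x y)"
  define Q where "Q a b m \<gamma> \<longleftrightarrow> \<gamma> \<in> bilinear_maps (sp (H_cpx V) a) (sp (H_cpx W) b) (sp ?HT m) \<and>
      (\<forall>x \<in> cycles V a. \<forall>y \<in> cycles W b. \<gamma> (H_class V a x) (H_class W b y) = ?c m a b x y)" for a b m \<gamma>
  have ex: "Ex (Q a b m)" if ab: "a + b = m" for a b m
  proof -
    have bil: "?c m a b \<in> bilinear_maps (cycle_module V a) (cycle_module W b) (sp ?HT m)"
    proof (rule bilinear_comp_out[OF _ H_class_linear[OF T]], rule bilinear_mapsI)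
      fix x assume "x \<in> carrier (cycle_module V a)"
      then have x: "x \<in> cycles V a" by simp
      show "ten K V W a b x \<in> linear_maps K (cycle_module W b) (cycle_module ?T m)"
        unfolding cycle_module_def tens_sp_cpx[OF V W]
        by (rule linear_maps_sub[OF bilinear_right[OF ten_bilinear[OF Vmod Wmod ab] cycles_closed[OF x]]])
          (auto simp: cycles_closed ten_cycle[OF ab x])
    next
      fix y assume "y \<in> carrier (cycle_module W b)"
      then have y: "y \<in> cycles W b" by simp
      show "(\<lambda>x. ten K V W a b x y) \<in> linear_maps K (cycle_module V a) (cycle_module ?T m)"
        unfolding cycle_module_def tens_sp_cpx[OF V W]
        by (rule linear_maps_sub[OF bilinear_left[OF ten_bilinear[OF Vmod Wmod ab] cycles_closed[OF y]]])
          (auto simp: cycles_closed ten_cycle[OF ab _ y])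
    qed
    have z1: "?c m a b x y = \<zero>\<^bsub>sp ?HT m\<^esub>"
      if "x \<in> carrier (cycle_module V a)" "y \<in> carrier (cycle_module W b)" "H_class V a x = \<zero>\<^bsub>sp (H_cpx V) a\<^esub>" for x y
      using that ten_boundary_left[OF ab] ten_cycle[OF ab] H_class_zero_iff[OF V] H_class_zero_iff[OF T] by simp
    have z2: "?c m a b x y = \<zero>\<^bsub>sp ?HT m\<^esub>"
      if "x \<in> carrier (cycle_module V a)" "y \<in> carrier (cycle_module W b)" "H_class W b y = \<zero>\<^bsub>sp (H_cpx W) b\<^esub>" for x y
      using that ten_boundary_right[OF ab] ten_cycle[OF ab] H_class_zero_iff[OF W] H_class_zero_iff[OF T] by simp
    have s1: "H_class V a ` carrier (cycle_module V a) = carrier (sp (H_cpx V) a)"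
      and s2: "H_class W b ` carrier (cycle_module W b) = carrier (sp (H_cpx W) b)"
      using H_class_surj[OF V] H_class_surj[OF W] by simp_all
    show ?thesis
    proof (rule bilinear_factor[OF cycle_module_module[OF V] cycle_module_module[OF W] HVm HWm HTm H_class_linear[OF V] s1
          H_class_linear[OF W] s2 bil z1 z2])
      fix \<gamma>
      assume "\<gamma> \<in> bilinear_maps (sp (H_cpx V) a) (sp (H_cpx W) b) (sp ?HT m)"
        and "\<And>x y. \<lbrakk>x \<in> carrier (cycle_module V a); y \<in> carrier (cycle_module W b)\<rbrakk> \<Longrightarrow>
          \<gamma> (H_class V a x) (H_class W b y) = ?c m a b x y"
      then have "Q a b m \<gamma>" by (simp add: Q_def)
      then show ?thesis by blast
    qed
  qed
  define \<gamma> where "\<gamma> a b m = (SOME g. Q a b m g)" for a b m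
  have Q: "Q a b m (\<gamma> a b m)" if "a + b = m" for a b m
    unfolding \<gamma>_def by (rule someI_ex[OF ex[OF that]])
  have \<gamma>: "\<gamma> a b m \<in> bilinear_maps (sp (H_cpx V) a) (sp (H_cpx W) b) (sp ?HT m)" if "a + b = m" for a b m
    using Q[OF that] by (simp add: Q_def)
  have \<gamma>v: "\<gamma> a b m (H_class V a x) (H_class W b y) = ?c m a b x y"
    if "a + b = m" "x \<in> cycles V a" "y \<in> cycles W b" for a b m x y
    using Q[OF that(1)] that(2,3) by (simp add: Q_def)
  note t = the_linear_tens[OF HVm HWm HTm \<gamma>]
  \<comment> \<open>The definition of \<open>kunneth\<close> prescribes values on classes of cycles.
    As every homology element is such a class, this is the same as prescribing the bilinear map
    \<open>\<gamma>\<close> on all pairs, the form that \<open>the_linear_tens\<close>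
    expects.\<close>
  have P: "(\<forall>a b. \<forall>x \<in> cycles V a. \<forall>y \<in> cycles W b. a + b = m \<longrightarrow>
        h (ten K (H_cpx V) (H_cpx W) a b (H_class V a x) (H_class W b y)) = ?c m a b x y) \<longleftrightarrow>
      (\<forall>a b. \<forall>x \<in> carrier (sp (H_cpx V) a). \<forall>y \<in> carrier (sp (H_cpx W) b). a + b = m \<longrightarrow>
        h (ten K (H_cpx V) (H_cpx W) a b x y) = \<gamma> a b m x y)" for h m
    unfolding H_class_surj[OF V, symmetric] H_class_surj[OF W, symmetric] using \<gamma>v by simp
  have f: "fn (kunneth K V W) m = the_linear K (tens_sp K (H_cpx V) (H_cpx W) m) (sp ?HT m) (\<lambda>h.
      \<forall>a b. \<forall>x \<in> carrier (sp (H_cpx V) a). \<forall>y \<in> carrier (sp (H_cpx W) b). a + b = m \<longrightarrow>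
        h (ten K (H_cpx V) (H_cpx W) a b x y) = \<gamma> a b m x y)" for m
    unfolding P[symmetric] by (simp add: kunneth_def Let_def tens_sp_cpx[OF HV HW])
  show "kunneth K V W \<in> linear_cmaps (tens_cpx K (H_cpx V) (H_cpx W)) ?HT"
    using t(1,2) f by (simp add: linear_cmaps_def linear_cmap_def) (simp add: kunneth_def Let_def tens_sp_cpx[OF HV HW])
  show "\<lbrakk>a + b = m; x \<in> cycles V a; y \<in> cycles W b\<rbrakk> \<Longrightarrow>
    fn (kunneth K V W) m (ten K (H_cpx V) (H_cpx W) a b (H_class V a x) (H_class W b y)) = ?c m a b x y"
    using t(3) by (simp add: f \<gamma>v H_class_closed[OF V] H_class_closed[OF W])
qed

end

end

context lax_elements
begin

lemma Mu_chain_map: "\<lbrakk>X \<in> Obj C; Y \<in> Obj C\<rbrakk> \<Longrightarrow> chain_map K (Mu F X Y)"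
  using Mu_chain_map_iff mul_bd by blast

lemma Eps_chain_map: "chain_map K (lax_functor.Eps F)"
  using Eps_chain_map_iff one_bd by blast

lemma mul_cycle:
  assumes X: "X \<in> Obj C" and Y: "Y \<in> Obj C" and x: "x \<in> cycles (FO F X) a" and y: "y \<in> cycles (FO F Y) b"
  shows "mul F X Y a b x y \<in> cycles (FO F (X \<boxtimes>\<^bsub>C\<^esub> Y)) (a + b)"
  using chain_map_cycles[OF Mu_chain_map[OF X Y], of "ten K (FO F X) (FO F Y) a b x y" "a + b"]
    ten_cycle[OF FO_complex[OF X] FO_complex[OF Y] refl x y] linear_cmapsD(2,3)[OF Mu_cmap[OF X Y]]
  by (simp add: mul_def)

lemma one_cycle: "one_elt F \<in> cycles (FO F (Unit C)) 0"
  using one_bd one_closed' by (simp add: cycles_def)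

lemma FA_cycle:
  assumes f: "f \<in> Hom C X Y" and x: "x \<in> cycles (FO F X) n"
  shows "fn (FA F f) n x \<in> cycles (FO F Y) n"
  using chain_map_cycles[of "FA F f" x n] FA_chain_map[OF f] x by (simp add: Hom_complexes)

end

section \<open>Homology applied to a lax functor\<close>

context small_ring
begin

lemma cycles_unit: "cycles (unit_cpx K :: ('g::complex_grading, 'k, 'u) cpx) n = carrier (sp (unit_cpx K :: ('g, 'k, 'u) cpx) n)"
  by (auto simp: cycles_def unit_cpx_def)

text \<open>Every element of the unit complex is a cycle, so passing to classes is defined and
  linear on all of it.\<close>

lemma H_functor_Eps:
  "lax_functor.Eps (H_functor K) \<in> linear_cmaps (unit_cpx K) (H_cpx (unit_cpx K :: (int, 'k, 'u) cpx))"
  "x \<in> carrier (sp (unit_cpx K) n) \<Longrightarrow> fn (lax_functor.Eps (H_functor K)) n x = H_class (unit_cpx K :: (int, 'k, 'u) cpx) n x"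
proof -
  let ?I = "unit_cpx K :: (int, 'k, 'u) cpx"
  note I = unit_chain_complex[where ?'g = int]
  have l: "H_class ?I n \<in> linear_maps K (sp ?I n) (sp (H_cpx ?I) n)" for n
    using H_class_linear[OF I, of n] by (simp add: linear_maps_def cycles_unit)
  note t = the_linear_spans[OF spans_carrier chain_complex_module[OF I] chain_complex_module[OF H_complex[OF I]] l refl]
  show "lax_functor.Eps (H_functor K) \<in> linear_cmaps ?I (H_cpx ?I)"
    "x \<in> carrier (sp ?I n) \<Longrightarrow> fn (lax_functor.Eps (H_functor K)) n x = H_class ?I n x"
    using t by (simp_all add: H_functor_def linear_cmaps_def linear_cmap_def)
qed

abbreviation (input) HF ::
  "('o, 'a, (int, 'k, 'u) cpx, (int, 'k, 'u) cmap) lax_functor \<Rightarrow> ('o, 'a, (int, 'k, 'u) cpx, (int, 'k, 'u) cmap) lax_functor" where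
  "HF F \<equiv> lax_comp (complexes K) (H_functor K) F"

lemma HF_FO [simp]: "FO (HF F) X = H_cpx (FO F X)"
  by (simp add: lax_comp_def H_functor_def)

text \<open>Classes are a quotient of the cycles, so the laws cannot be pulled back along an
  injection. Instead representing cycles are chosen for the arguments and the laws of
  \<open>F\<close> are applied to them; the Leibniz rule is trivial because the differentials are
  zero.\<close>

lemma homology_functor_lax:
  fixes F :: "('o, 'a, (int, 'k, 'u) cpx, (int, 'k, 'u) cmap) lax_functor"
  assumes F: "lax_elements K emb C F"
  shows "lax_elements K emb C (HF F)"
    and "\<lbrakk>X \<in> Obj C; Y \<in> Obj C; x \<in> cycles (FO F X) a; y \<in> cycles (FO F Y) b\<rbrakk> \<Longrightarrow>
      mul (HF F) X Y a b (H_class (FO F X) a x) (H_class (FO F Y) b y) =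
        H_class (FO F (X \<boxtimes>\<^bsub>C\<^esub> Y)) (a + b) (mul F X Y a b x y)"
    and "one_elt (HF F) = H_class (FO F (Unit C)) 0 (one_elt F)"
    and "\<lbrakk>f \<in> Hom C X Y; x \<in> cycles (FO F X) n\<rbrakk> \<Longrightarrow>
      fn (FA (HF F) f) n (H_class (FO F X) n x) = H_class (FO F Y) n (fn (FA F f) n x)"
proof -
  interpret F: lax_elements K emb C F by (rule F)
  let ?H = "HF F"
  note cx = F.FO_complex and T = F.C.tens_obj and U = F.C.unit_obj
  have Hom: "X \<in> Obj C" "Y \<in> Obj C" if "f \<in> Hom C X Y" for f X Y
    using that F.C.dom_obj F.C.cod_obj by (auto simp: Hom_def)
  have FA: "FA ?H f = H_cmap K (FA F f)" and Mu: "Mu ?H X Y = cmap_comp (H_cmap K (Mu F X Y)) (kunneth K (FO F X) (FO F Y))"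
    and Eps: "lax_functor.Eps ?H = cmap_comp (H_cmap K (lax_functor.Eps F)) (lax_functor.Eps (H_functor K))" for f X Y
    by (simp_all add: lax_comp_def H_functor_def complexes_def)
  have HMu: "H_cmap K (Mu F X Y) \<in> linear_cmaps (H_cpx (tens_cpx K (FO F X) (FO F Y))) (H_cpx (FO F (X \<boxtimes>\<^bsub>C\<^esub> Y)))"
    if "X \<in> Obj C" "Y \<in> Obj C" for X Y
    using H_cmap(1-3)[OF F.Mu_chain_map[OF that]] linear_cmapsD(2,3)[OF F.Mu_cmap[OF that]]
    by (simp add: chain_map_in_linear_cmaps)
  have HEps: "H_cmap K (lax_functor.Eps F) \<in> linear_cmaps (H_cpx (unit_cpx K)) (H_cpx (FO F (Unit C)))"
    using H_cmap(1-3)[OF F.Eps_chain_map] linear_cmapsD(2,3)[OF F.Eps_cmap]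
    by (simp add: chain_map_in_linear_cmaps)
  show FAe: "fn (FA ?H f) n (H_class (FO F X) n x) = H_class (FO F Y) n (fn (FA F f) n x)"
    if f: "f \<in> Hom C X Y" and x: "x \<in> cycles (FO F X) n" for f X Y n x
    using H_cmap(4)[of "FA F f" x n] F.FA_chain_map[OF f] x by (simp add: FA Hom_complexes)
  show mule: "mul ?H X Y a b (H_class (FO F X) a x) (H_class (FO F Y) b y) =
        H_class (FO F (X \<boxtimes>\<^bsub>C\<^esub> Y)) (a + b) (mul F X Y a b x y)"
    if X: "X \<in> Obj C" and Y: "Y \<in> Obj C" and x: "x \<in> cycles (FO F X) a" and y: "y \<in> cycles (FO F Y) b" for X Y a b x y
  proof -
    note k = kunneth[OF cx[OF X] cx[OF Y]]
    have c: "ten K (H_cpx (FO F X)) (H_cpx (FO F Y)) a b (H_class (FO F X) a x) (H_class (FO F Y) b y)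
        \<in> carrier (sp (tens_cpx K (H_cpx (FO F X)) (H_cpx (FO F Y))) (a + b))"
      using ten_closed[OF chain_complex_module[OF H_complex[OF cx[OF X]]] chain_complex_module[OF H_complex[OF cx[OF Y]]] refl
          H_class_closed[OF cx[OF X] x] H_class_closed[OF cx[OF Y] y]]
      by (simp add: tens_sp_cpx[OF H_complex[OF cx[OF X]] H_complex[OF cx[OF Y]]])
    show ?thesis
      using H_cmap(4)[OF F.Mu_chain_map[OF X Y], of "ten K (FO F X) (FO F Y) a b x y" "a + b"]
        ten_cycle[OF cx[OF X] cx[OF Y] refl x y] linear_cmapsD(2,3)[OF F.Mu_cmap[OF X Y]]
      by (simp add: mul_def Mu comp_fn[OF k(1) c] k(2)[OF refl x y])
  qed
  show onee: "one_elt ?H = H_class (FO F (Unit C)) 0 (one_elt F)"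
  proof -
    have c: "unit_elt K TYPE(int) \<one> \<in> carrier (sp (unit_cpx K :: (int, 'k, 'u) cpx) 0)"
      by (simp add: unit_elt_closed)
    show ?thesis
      using H_cmap(4)[OF F.Eps_chain_map, of "unit_elt K TYPE(int) \<one>" 0] linear_cmapsD(2,3)[OF F.Eps_cmap] c
      by (simp add: one_elt_def Eps comp_fn[OF H_functor_Eps(1) c] H_functor_Eps(2)[OF c] cycles_unit)
  qed
  have pre: "pre_lax K emb C ?H"
  proof
    show "X \<in> Obj C \<Longrightarrow> chain_complex K (FO ?H X)" for X
      by (simp add: H_complex cx)
    show "FA ?H f \<in> Hom (complexes K) (FO ?H X) (FO ?H Y)" if f: "f \<in> Hom C X Y" for f X Y
      using H_cmap(1-3)[of "FA F f"] F.FA_chain_map[OF f] by (auto simp: FA Hom_complexes)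
    show "Mu ?H X Y \<in> linear_cmaps (tens_cpx K (FO ?H X) (FO ?H Y)) (FO ?H (X \<boxtimes>\<^bsub>C\<^esub> Y))"
      if X: "X \<in> Obj C" and Y: "Y \<in> Obj C" for X Y
      using comp_in_linear_cmaps[OF kunneth(1)[OF cx[OF X] cx[OF Y]] HMu[OF X Y]
          tens_chain_complex[OF H_complex[OF cx[OF X]] H_complex[OF cx[OF Y]]]]
      by (simp add: Mu)
    show "lax_functor.Eps ?H \<in> linear_cmaps (unit_cpx K) (FO ?H (Unit C))"
      using comp_in_linear_cmaps[OF H_functor_Eps(1) HEps unit_chain_complex] by (simp add: Eps)
  qed
  interpret H: pre_lax K emb C ?H by (rule pre)
  have cases: "\<exists>z \<in> cycles (FO F X) a. x = H_class (FO F X) a z" if "X \<in> Obj C" "x \<in> carrier (sp (FO ?H X) a)" for X x a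
    using that H_cases[OF cx] by (metis HF_FO)
  note Tm = H.FO_module[OF T]
  have z: "mul ?H X Y a b \<zero>\<^bsub>sp (FO ?H X) a\<^esub> y = \<zero>\<^bsub>sp (FO ?H (X \<boxtimes>\<^bsub>C\<^esub> Y)) (a + b)\<^esub>"
    if "X \<in> Obj C" "Y \<in> Obj C" "y \<in> carrier (sp (FO ?H Y) b)" for X Y a b y
    by (rule linear_zero[OF bilinear_left[OF H.mul_bilinear[OF that(1,2)] that(3)] H.FO_module[OF that(1)] Tm[OF that(1,2)]])
  have z': "mul ?H X Y a b x \<zero>\<^bsub>sp (FO ?H Y) b\<^esub> = \<zero>\<^bsub>sp (FO ?H (X \<boxtimes>\<^bsub>C\<^esub> Y)) (a + b)\<^esub>"
    if "X \<in> Obj C" "Y \<in> Obj C" "x \<in> carrier (sp (FO ?H X) a)" for X Y a b x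
    by (rule linear_zero[OF bilinear_right[OF H.mul_bilinear[OF that(1,2)] that(3)] H.FO_module[OF that(2)] Tm[OF that(1,2)]])
  note mc = F.mul_cycle and fc = F.FA_cycle and cc = cycles_closed
  show "lax_elements K emb C ?H"
  proof
    show "fn (FA ?H (Id C X)) n x = x" if X: "X \<in> Obj C" and x: "x \<in> carrier (sp (FO ?H X) n)" for X n x
      using cases[OF X x] FAe[OF F.C.id_hom[OF X]] F.FA_id[OF X] by (auto simp: cc)
    show "fn (FA ?H (g \<cdot>\<^bsub>C\<^esub> f)) n x = fn (FA ?H g) n (fn (FA ?H f) n x)"
      if f: "f \<in> Hom C X Y" and g: "g \<in> Hom C Y Z" and x: "x \<in> carrier (sp (FO ?H X) n)" for f g X Y Z n x
      using cases[OF Hom(1)[OF f] x] FAe[OF f] FAe[OF g] FAe[OF F.C.comp_hom[OF f g]] fc[OF f] F.FA_comp[OF f g]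
      by (auto simp: cc)
    show "bd (FO ?H (X \<boxtimes>\<^bsub>C\<^esub> Y)) (a + b) (mul ?H X Y a b x y) =
        mul ?H X Y (a + bdeg) b (bd (FO ?H X) a x) y \<oplus>\<^bsub>sp (FO ?H (X \<boxtimes>\<^bsub>C\<^esub> Y)) (a + b + bdeg)\<^esub>
        koszul K (hdeg a) \<odot>\<^bsub>sp (FO ?H (X \<boxtimes>\<^bsub>C\<^esub> Y)) (a + b + bdeg)\<^esub> mul ?H X Y a (b + bdeg) x (bd (FO ?H Y) b y)"
      if X: "X \<in> Obj C" and Y: "Y \<in> Obj C" and x: "x \<in> carrier (sp (FO ?H X) a)" and y: "y \<in> carrier (sp (FO ?H Y) b)" for X Y a b x y
    proof -
      have e: "a + bdeg + b = a + b + bdeg" "a + (b + bdeg) = a + b + bdeg" by (simp_all add: ac_simps)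
      show ?thesis
        using z[OF X Y y, of "a + bdeg"] z'[OF X Y x, of "b + bdeg"] Tm[OF X Y, of "a + b + bdeg"]
        unfolding e by (simp add: bd_H_cpx[OF cx[OF X]] bd_H_cpx[OF cx[OF Y]] bd_H_cpx[OF cx[OF T[OF X Y]]])
    qed
    show "bd (FO ?H (Unit C)) 0 (one_elt ?H) = \<zero>\<^bsub>sp (FO ?H (Unit C)) bdeg\<^esub>"
      using bd_H_cpx[OF cx[OF U], of 0] by simp
    show "fn (FA ?H (f \<boxdot>\<^bsub>C\<^esub> g)) (a + b) (mul ?H X Y a b x y) = mul ?H X' Y' a b (fn (FA ?H f) a x) (fn (FA ?H g) b y)"
      if f: "f \<in> Hom C X X'" and g: "g \<in> Hom C Y Y'" and x: "x \<in> carrier (sp (FO ?H X) a)"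
        and y: "y \<in> carrier (sp (FO ?H Y) b)" for f g X X' Y Y' a b x y
      using cases[OF Hom(1)[OF f] x] cases[OF Hom(1)[OF g] y] F.mul_natural[OF f g]
      by (auto simp: mule Hom[OF f] Hom[OF g] FAe[OF f] FAe[OF g] FAe[OF F.C.tens_hom[OF f g]] fc[OF f] fc[OF g] mc cc)
    show "fn (FA ?H (Assoc C X Y Z)) (a + b + c) (mul ?H (X \<boxtimes>\<^bsub>C\<^esub> Y) Z (a + b) c (mul ?H X Y a b x y) z) =
        mul ?H X (Y \<boxtimes>\<^bsub>C\<^esub> Z) a (b + c) x (mul ?H Y Z b c y z)"
      if X: "X \<in> Obj C" and Y: "Y \<in> Obj C" and Z: "Z \<in> Obj C" and x: "x \<in> carrier (sp (FO ?H X) a)"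
        and y: "y \<in> carrier (sp (FO ?H Y) b)" and z: "z \<in> carrier (sp (FO ?H Z) c)" for X Y Z a b c x y z
    proof -
      have A: "Assoc C X Y Z \<in> Hom C ((X \<boxtimes>\<^bsub>C\<^esub> Y) \<boxtimes>\<^bsub>C\<^esub> Z) (X \<boxtimes>\<^bsub>C\<^esub> (Y \<boxtimes>\<^bsub>C\<^esub> Z))"
        using F.C.assoc_iso[OF X Y Z] by (simp add: Iso_def)
      obtain x' y' z' where x': "x' \<in> cycles (FO F X) a" "x = H_class (FO F X) a x'"
        and y': "y' \<in> cycles (FO F Y) b" "y = H_class (FO F Y) b y'"
        and z': "z' \<in> cycles (FO F Z) c" "z = H_class (FO F Z) c z'"
        using cases[OF X x] cases[OF Y y] cases[OF Z z] by blast
      note 1 = mc[OF X Y x'(1) y'(1)] and 2 = mc[OF Y Z y'(1) z'(1)]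
      show ?thesis
        unfolding x'(2) y'(2) z'(2) mule[OF X Y x'(1) y'(1)] mule[OF Y Z y'(1) z'(1)] mule[OF T[OF X Y] Z 1 z'(1)]
          mule[OF X T[OF Y Z] x'(1) 2] FAe[OF A mc[OF T[OF X Y] Z 1 z'(1)]] F.mul_assoc[OF X Y Z cc[OF x'(1)] cc[OF y'(1)] cc[OF z'(1)]]
        by (simp add: add.assoc)
    qed
    show "fn (FA ?H (LUnit C X)) m (mul ?H (Unit C) X 0 m (one_elt ?H) x) = x"
      if X: "X \<in> Obj C" and x: "x \<in> carrier (sp (FO ?H X) m)" for X m x
    proof -
      have A: "LUnit C X \<in> Hom C (Unit C \<boxtimes>\<^bsub>C\<^esub> X) X"
        using F.C.lunit_iso[OF X] by (simp add: Iso_def)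
      obtain x' where x': "x' \<in> cycles (FO F X) m" "x = H_class (FO F X) m x'"
        using cases[OF X x] by blast
      show ?thesis
        using mc[OF U X F.one_cycle x'(1)] F.mul_lunit[OF X cc[OF x'(1)]]
        by (simp add: x'(2) onee mule[OF U X F.one_cycle x'(1)] FAe[OF A])
    qed
    show "fn (FA ?H (RUnit C X)) m (mul ?H X (Unit C) m 0 x (one_elt ?H)) = x"
      if X: "X \<in> Obj C" and x: "x \<in> carrier (sp (FO ?H X) m)" for X m x
    proof -
      have A: "RUnit C X \<in> Hom C (X \<boxtimes>\<^bsub>C\<^esub> Unit C) X"
        using F.C.runit_iso[OF X] by (simp add: Iso_def)
      obtain x' where x': "x' \<in> cycles (FO F X) m" "x = H_class (FO F X) m x'"
        using cases[OF X x] by blast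
      show ?thesis
        using mc[OF X U x'(1) F.one_cycle] F.mul_runit[OF X cc[OF x'(1)]]
        by (simp add: x'(2) onee mule[OF X U x'(1) F.one_cycle] FAe[OF A])
    qed
    show "fn (FA ?H (Braid C X Y)) (a + b) (mul ?H X Y a b x y) =
        koszul K (hdeg a * hdeg b) \<odot>\<^bsub>sp (FO ?H (Y \<boxtimes>\<^bsub>C\<^esub> X)) (a + b)\<^esub> mul ?H Y X b a y x"
      if X: "X \<in> Obj C" and Y: "Y \<in> Obj C" and x: "x \<in> carrier (sp (FO ?H X) a)" and y: "y \<in> carrier (sp (FO ?H Y) b)" for X Y a b x y
    proof -
      have A: "Braid C X Y \<in> Hom C (X \<boxtimes>\<^bsub>C\<^esub> Y) (Y \<boxtimes>\<^bsub>C\<^esub> X)"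
        using F.C.braid_iso[OF X Y] by (simp add: Iso_def)
      obtain x' y' where x': "x' \<in> cycles (FO F X) a" "x = H_class (FO F X) a x'"
        and y': "y' \<in> cycles (FO F Y) b" "y = H_class (FO F Y) b y'"
        using cases[OF X x] cases[OF Y y] by blast
      have 1: "mul F Y X b a y' x' \<in> cycles (FO F (Y \<boxtimes>\<^bsub>C\<^esub> X)) (a + b)"
        using mc[OF Y X y'(1) x'(1)] by (simp add: add.commute)
      show ?thesis
        unfolding x'(2) y'(2) mule[OF X Y x'(1) y'(1)] mule[OF Y X y'(1) x'(1)] FAe[OF A mc[OF X Y x'(1) y'(1)]]
          F.mul_symmetric[OF X Y cc[OF x'(1)] cc[OF y'(1)]] H_class_smult[OF cx[OF T[OF Y X]] koszul_closed 1]
        by (simp add: add.commute)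
    qed
  qed
qed

section \<open>Homology preserves weak equivalences\<close>

lemma cycles_H: "chain_complex K V \<Longrightarrow> cycles (H_cpx V) n = carrier (sp (H_cpx V) n)"
  for V :: "('g::complex_grading, 'k, 'u) cpx"
  by (auto simp: cycles_def bd_H_cpx)

lemma boundaries_H:
  fixes V :: "('g::complex_grading, 'k, 'u) cpx"
  assumes V: "chain_complex K V"
  shows "boundaries (H_cpx V) n = {\<zero>\<^bsub>sp (H_cpx V) n\<^esub>}"
  using module_zero_closed[OF chain_complex_module[OF H_complex[OF V], of "n - bdeg"]]
  by (auto simp: boundaries_def bd_H_cpx[OF V])

text \<open>Source and target have zero differential, so being a quasi-isomorphism amounts to
  bijectivity of the map itself, and this is the hypothesis on \<open>f\<close>.\<close>

lemma quasi_iso_H: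
  fixes f :: "('g::complex_grading, 'k, 'u) cmap"
  assumes f: "quasi_iso K f"
  shows "quasi_iso K (H_cmap K f)"
proof -
  have fc: "chain_map K f" and bij: "\<And>n. bij_betw (fn (H_cmap K f) n) (carrier (sp (H_cpx (src f)) n)) (carrier (sp (H_cpx (tgt f)) n))"
    using f by (auto simp: quasi_iso_def)
  then have c: "chain_complex K (src f)" "chain_complex K (tgt f)"
    by (auto simp: chain_map_def)
  note H = H_cmap(1-3)[OF fc]
  have l: "fn (H_cmap K f) n \<in> linear_maps K (sp (H_cpx (src f)) n) (sp (H_cpx (tgt f)) n)" for n
    using H by (auto simp: chain_map_def)
  note M = chain_complex_module[OF H_complex[OF c(1)]] chain_complex_module[OF H_complex[OF c(2)]]
  show ?thesis
    unfolding quasi_iso_iff[OF H(1)] H(2,3) cycles_H[OF c(1)] cycles_H[OF c(2)] boundaries_H[OF c(1)] boundaries_H[OF c(2)]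
  proof (intro allI conjI ballI impI)
    fix n x assume x: "x \<in> carrier (sp (H_cpx (src f)) n)" and "fn (H_cmap K f) n x \<in> {\<zero>\<^bsub>sp (H_cpx (tgt f)) n\<^esub>}"
    then have "fn (H_cmap K f) n x = fn (H_cmap K f) n \<zero>\<^bsub>sp (H_cpx (src f)) n\<^esub>"
      using linear_zero[OF l M] by simp
    then show "x \<in> {\<zero>\<^bsub>sp (H_cpx (src f)) n\<^esub>}"
      using inj_onD[OF bij_betw_imp_inj_on[OF bij] _ x module_zero_closed[OF M(1)]] by simp
  next
    fix n y assume y: "y \<in> carrier (sp (H_cpx (tgt f)) n)"
    then obtain x where x: "x \<in> carrier (sp (H_cpx (src f)) n)" "y = fn (H_cmap K f) n x"
      using bij_betw_imp_surj_on[OF bij] by blast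
    show "\<exists>x \<in> carrier (sp (H_cpx (src f)) n). y \<ominus>\<^bsub>sp (H_cpx (tgt f)) n\<^esub> fn (H_cmap K f) n x \<in> {\<zero>\<^bsub>sp (H_cpx (tgt f)) n\<^esub>}"
      using x y module_diff_self[OF M(2) y] by blast
  qed
qed

lemma weq_stepI:
  assumes F: "lax_elements K emb C F" and G: "lax_elements K emb C G"
    and \<eta>: "\<And>X. X \<in> Obj C \<Longrightarrow> \<eta> X \<in> Hom (complexes K) (FO F X) (FO G X)"
    and nat: "\<And>f X Y n x. \<lbrakk>f \<in> Hom C X Y; x \<in> carrier (sp (FO F X) n)\<rbrakk> \<Longrightarrow>
      fn (\<eta> Y) n (fn (FA F f) n x) = fn (FA G f) n (fn (\<eta> X) n x)"
    and mul: "\<And>X Y a b x y. \<lbrakk>X \<in> Obj C; Y \<in> Obj C; x \<in> carrier (sp (FO F X) a); y \<in> carrier (sp (FO F Y) b)\<rbrakk> \<Longrightarrow>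
      fn (\<eta> (X \<boxtimes>\<^bsub>C\<^esub> Y)) (a + b) (mul F X Y a b x y) = mul G X Y a b (fn (\<eta> X) a x) (fn (\<eta> Y) b y)"
    and one: "fn (\<eta> (Unit C)) 0 (one_elt F) = one_elt G"
    and qi: "\<And>X. X \<in> Obj C \<Longrightarrow> quasi_iso K (\<eta> X)"
  shows "weq_step K C F G"
proof -
  have "monoidal_transformation C (complexes K) F G \<eta>"
    by (subst monoidal_transformation_iff[OF F G]) (use \<eta> nat mul one in blast)+
  then show ?thesis
    unfolding weq_step_def Ch_def using lax_elements.lax[OF F] lax_elements.lax[OF G] qi by blast
qed

text \<open>Each equation required of \<open>H_cmap K (\<eta> X)\<close> is the class of the
  corresponding equation for \<open>\<eta>\<close> at representing cycles, which is why the monoidal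
  transformation is first unfolded into elements.\<close>

lemma weq_step_homology:
  assumes C: "symmetric_monoidal_category C" and FG: "weq_step K C F G"
  shows "weq_step K C (HF F) (HF G)"
proof -
  from FG obtain \<eta> where "lax_symmetric_monoidal_functor C (complexes K) F" "lax_symmetric_monoidal_functor C (complexes K) G"
    and m: "monoidal_transformation C (complexes K) F G \<eta>" and qi: "\<And>X. X \<in> Obj C \<Longrightarrow> quasi_iso K (\<eta> X)"
    unfolding weq_step_def Ch_def by blast
  then have F: "lax_elements K emb C F" and G: "lax_elements K emb C G"
    using lax_elementsI[OF C] by blast+
  interpret F: lax_elements K emb C F by (rule F)
  interpret G: lax_elements K emb C G by (rule G)
  interpret m: monoidal_transformation C "complexes K" F G \<eta> by (rule m)
  have Hom: "X \<in> Obj C" "Y \<in> Obj C" if "f \<in> Hom C X Y" for f X Y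
    using that F.C.dom_obj F.C.cod_obj by (auto simp: Hom_def)
  have \<eta>: "chain_map K (\<eta> X)" "src (\<eta> X) = FO F X" "tgt (\<eta> X) = FO G X" if "X \<in> Obj C" for X
    using m.component_hom[OF that] by (auto simp: Hom_complexes)
  have \<eta>H: "fn (H_cmap K (\<eta> X)) n (H_class (FO F X) n x) = H_class (FO G X) n (fn (\<eta> X) n x)"
    and \<eta>c: "fn (\<eta> X) n x \<in> cycles (FO G X) n" if "X \<in> Obj C" "x \<in> cycles (FO F X) n" for X n x
    using H_cmap(4)[OF \<eta>(1)[OF that(1)], of x n] chain_map_cycles[OF \<eta>(1)[OF that(1)], of x n] that(2)
    by (simp_all add: \<eta>[OF that(1)])
  have nat: "fn (\<eta> Y) n (fn (FA F f) n x) = fn (FA G f) n (fn (\<eta> X) n x)"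
    if "f \<in> Hom C X Y" "x \<in> carrier (sp (FO F X) n)" for f X Y n x
    using m that by (subst (asm) monoidal_transformation_iff[OF F G]) (blast intro: m.component_hom)+
  have mul: "fn (\<eta> (X \<boxtimes>\<^bsub>C\<^esub> Y)) (a + b) (mul F X Y a b x y) = mul G X Y a b (fn (\<eta> X) a x) (fn (\<eta> Y) b y)"
    if "X \<in> Obj C" "Y \<in> Obj C" "x \<in> carrier (sp (FO F X) a)" "y \<in> carrier (sp (FO F Y) b)" for X Y a b x y
    using m that by (subst (asm) monoidal_transformation_iff[OF F G]) (blast intro: m.component_hom)+
  have one: "fn (\<eta> (Unit C)) 0 (one_elt F) = one_elt G"
    using m by (subst (asm) monoidal_transformation_iff[OF F G]) (blast intro: m.component_hom)+
  note HF = homology_functor_lax[OF F] and HG = homology_functor_lax[OF G]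
  show ?thesis
  proof (rule weq_stepI[OF HF(1) HG(1), where \<eta> = "\<lambda>X. H_cmap K (\<eta> X)"])
    show "H_cmap K (\<eta> X) \<in> Hom (complexes K) (FO (HF F) X) (FO (HF G) X)" if "X \<in> Obj C" for X
      using H_cmap(1-3)[OF \<eta>(1)[OF that]] \<eta>[OF that] by (simp add: Hom_complexes)
    show "quasi_iso K (H_cmap K (\<eta> X))" if "X \<in> Obj C" for X
      by (rule quasi_iso_H[OF qi[OF that]])
    show "fn (H_cmap K (\<eta> (Unit C))) 0 (one_elt (HF F)) = one_elt (HF G)"
      using \<eta>H[OF F.C.unit_obj F.one_cycle] by (simp add: HF(3) HG(3) one)
    show "fn (H_cmap K (\<eta> Y)) n (fn (FA (HF F) f) n x) = fn (FA (HF G) f) n (fn (H_cmap K (\<eta> X)) n x)"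
      if f: "f \<in> Hom C X Y" and x: "x \<in> carrier (sp (FO (HF F) X) n)" for f X Y n x
    proof -
      note o = Hom[OF f]
      obtain z where z: "z \<in> cycles (FO F X) n" "x = H_class (FO F X) n z"
        using x H_cases[OF F.FO_complex[OF o(1)]] by (metis HF_FO)
      show ?thesis
        by (simp add: z(2) HF(4)[OF f z(1)] \<eta>H[OF o(1) z(1)] HG(4)[OF f \<eta>c[OF o(1) z(1)]]
            \<eta>H[OF o(2) F.FA_cycle[OF f z(1)]] nat[OF f cycles_closed[OF z(1)]])
    qed
    show "fn (H_cmap K (\<eta> (X \<boxtimes>\<^bsub>C\<^esub> Y))) (a + b) (mul (HF F) X Y a b x y) =
        mul (HF G) X Y a b (fn (H_cmap K (\<eta> X)) a x) (fn (H_cmap K (\<eta> Y)) b y)"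
      if X: "X \<in> Obj C" and Y: "Y \<in> Obj C" and x: "x \<in> carrier (sp (FO (HF F) X) a)"
        and y: "y \<in> carrier (sp (FO (HF F) Y) b)" for X Y a b x y
    proof -
      obtain x' where x': "x' \<in> cycles (FO F X) a" "x = H_class (FO F X) a x'"
        using x H_cases[OF F.FO_complex[OF X]] by (metis HF_FO)
      obtain y' where y': "y' \<in> cycles (FO F Y) b" "y = H_class (FO F Y) b y'"
        using y H_cases[OF F.FO_complex[OF Y]] by (metis HF_FO)
      show ?thesis
        by (simp add: x'(2) y'(2) HF(2)[OF X Y x'(1) y'(1)] \<eta>H[OF X x'(1)] \<eta>H[OF Y y'(1)]
            HG(2)[OF X Y \<eta>c[OF X x'(1)] \<eta>c[OF Y y'(1)]] \<eta>H[OF F.C.tens_obj[OF X Y] F.mul_cycle[OF X Y x'(1) y'(1)]]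
            mul[OF X Y cycles_closed[OF x'(1)] cycles_closed[OF y'(1)]])
    qed
  qed
qed

text \<open>Induction along the zig-zag. Its steps may point either way, but \<open>equivclp\<close>
  is symmetric on the side of the homology functors too, so the lemma for a single forward step
  suffices.\<close>

lemma weakly_equivalent_homology:
  assumes C: "symmetric_monoidal_category C" and FG: "weakly_equivalent K C F G"
  shows "weakly_equivalent K C (HF F) (HF G)"
proof -
  have "equivclp (weq_step K C) F G"
    using FG by (simp add: weakly_equivalent_def)
  then have "equivclp (weq_step K C) (HF F) (HF G)"
  proof (induction rule: equivclp_induct)
    case base
    show ?case by simp
  next
    case (step G G')
    then have "equivclp (weq_step K C) (HF G) (HF G')"
      using weq_step_homology[OF C] by (blast intro: r_into_equivclp equivclp_sym)
    with step show ?case by (blast intro: equivclp_trans)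
  qed
  then show ?thesis
    using FG lax_elements.lax[OF homology_functor_lax(1)[OF lax_elementsI[OF C]]]
    by (simp add: weakly_equivalent_def Ch_def)
qed

end

section \<open>Forgetting the weight\<close>

context small_ring
begin

definition U_comp :: "(int \<times> int, 'k, 'u) cpx \<Rightarrow> int \<Rightarrow> 'u \<Rightarrow> int \<Rightarrow> 'u" where
  "U_comp V n = dsum_comp (\<lambda>p. sp V (n, p))"

abbreviation (input) U_gens :: "(int \<times> int, 'k, 'u) cpx \<Rightarrow> int \<Rightarrow> 'u set" where
  "U_gens V n \<equiv> (\<Union>p. U_in V n p ` carrier (sp V (n, p)))"

lemma U_in_eq: "U_in V n p = dsum_in (\<lambda>q. sp V (n, q)) p"
  by (simp add: fun_eq_iff U_in_def)

lemma weight_add [simp]: "(n, p) + bdeg = (n + bdeg, p :: int)"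
  by (simp add: bdeg_prod_def)

context
  fixes V :: "(int \<times> int, 'k, 'u) cpx"
  assumes V: "chain_complex K V"
begin

private lemmas sp_module = chain_complex_module[OF V]

lemma U_sp_module: "module K (U_sp V n)"
  unfolding U_sp_def by (rule dsum_module[OF sp_module])

lemma U_in_linear: "U_in V n p \<in> linear_maps K (sp V (n, p)) (U_sp V n)"
  unfolding U_sp_def U_in_eq by (rule dsum_in_linear[OF sp_module])

lemma U_in_closed: "x \<in> carrier (sp V (n, p)) \<Longrightarrow> U_in V n p x \<in> carrier (U_sp V n)"
  by (rule linear_closed[OF U_in_linear])

lemma U_spans: "spans (U_sp V n) (U_gens V n)"
  unfolding U_sp_def U_in_eq by (rule dsum_spans[OF sp_module])

lemma U_lift:
  assumes W: "module K W" and \<phi>: "\<And>p. \<phi> p \<in> linear_maps K (sp V (n, p)) W"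
  obtains h where "h \<in> linear_maps K (U_sp V n) W"
    "\<And>p x. x \<in> carrier (sp V (n, p)) \<Longrightarrow> h (U_in V n p x) = \<phi> p x"
proof (rule dsum_lift[OF sp_module W \<phi>])
  fix h assume "h \<in> linear_maps K (dsum (\<lambda>p. sp V (n, p))) W"
    and "\<And>p x. x \<in> carrier (sp V (n, p)) \<Longrightarrow> h (dsum_in (\<lambda>p. sp V (n, p)) p x) = \<phi> p x"
  then show thesis by (rule that[unfolded U_sp_def U_in_eq])
qed

lemma the_linear_U:
  assumes W: "module K W" and \<phi>: "\<And>p. \<phi> p \<in> linear_maps K (sp V (n, p)) W"
  defines "h \<equiv> the_linear K (U_sp V n) W (\<lambda>h. \<forall>p. \<forall>x \<in> carrier (sp V (n, p)). h (U_in V n p x) = \<phi> p x)"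
  shows "h \<in> linear_maps K (U_sp V n) W" "h \<in> extensional (carrier (U_sp V n))"
    and "x \<in> carrier (sp V (n, p)) \<Longrightarrow> h (U_in V n p x) = \<phi> p x"
proof -
  obtain g where g: "g \<in> linear_maps K (U_sp V n) W"
    "\<And>p x. x \<in> carrier (sp V (n, p)) \<Longrightarrow> g (U_in V n p x) = \<phi> p x"
    using U_lift[OF W \<phi>] by blast
  have "(\<forall>p. \<forall>x \<in> carrier (sp V (n, p)). k (U_in V n p x) = \<phi> p x) \<longleftrightarrow> (\<forall>s \<in> U_gens V n. k s = g s)" for k
    using g(2) by auto
  note t = the_linear_spans[OF U_spans U_sp_module W g(1) this, folded h_def]
  show "h \<in> linear_maps K (U_sp V n) W" "h \<in> extensional (carrier (U_sp V n))"
    by (rule t)+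
  show "x \<in> carrier (sp V (n, p)) \<Longrightarrow> h (U_in V n p x) = \<phi> p x"
    using t(3)[OF U_in_closed] g(2) by simp
qed

lemma U_bd:
  "bd (U_cpx K V) n \<in> linear_maps K (U_sp V n) (U_sp V (n + bdeg))"
  "x \<in> carrier (sp V (n, p)) \<Longrightarrow> bd (U_cpx K V) n (U_in V n p x) = U_in V (n + bdeg) p (bd V (n, p) x)"
proof -
  have l: "(\<lambda>x. U_in V (n + bdeg) p (bd V (n, p) x)) \<in> linear_maps K (sp V (n, p)) (U_sp V (n + bdeg))" for p
    using linear_comp[OF chain_complex_bd[OF V, of "(n, p)", unfolded weight_add] U_in_linear] .
  show "bd (U_cpx K V) n \<in> linear_maps K (U_sp V n) (U_sp V (n + bdeg))"
    "x \<in> carrier (sp V (n, p)) \<Longrightarrow> bd (U_cpx K V) n (U_in V n p x) = U_in V (n + bdeg) p (bd V (n, p) x)"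
    using the_linear_U[OF U_sp_module l] by (simp_all add: U_cpx_def)
qed

lemma sp_U_cpx: "sp (U_cpx K V) = U_sp V"
  by (simp add: U_cpx_def)

lemma weight_bd_closed: "x \<in> carrier (sp V (n, p)) \<Longrightarrow> bd V (n, p) x \<in> carrier (sp V (n + bdeg, p))"
  using linear_closed[OF chain_complex_bd[OF V, of "(n, p)"]] by simp

lemma U_complex: "chain_complex K (U_cpx K V)"
  unfolding chain_complex_def sp_U_cpx
proof (intro conjI allI ballI)
  fix n x assume x: "x \<in> carrier (U_sp V n)"
  show "bd (U_cpx K V) (n + bdeg) (bd (U_cpx K V) n x) = \<zero>\<^bsub>U_sp V (n + bdeg + bdeg)\<^esub>"
  proof (rule linear_eq_on_spans[OF U_spans U_sp_module U_sp_module linear_comp[OF U_bd(1) U_bd(1)] linear_zero_map[OF U_sp_module] _ x])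
    fix s assume "s \<in> U_gens V n"
    then obtain p y where y: "y \<in> carrier (sp V (n, p))" "s = U_in V n p y" by blast
    have "bd V (n + bdeg, p) (bd V (n, p) y) = \<zero>\<^bsub>sp V (n + bdeg + bdeg, p)\<^esub>"
      using chain_complex_bd_bd[OF V y(1)] by simp
    then show "bd (U_cpx K V) (n + bdeg) (bd (U_cpx K V) n s) = \<zero>\<^bsub>U_sp V (n + bdeg + bdeg)\<^esub>"
      using linear_zero[OF U_in_linear sp_module U_sp_module]
      by (simp add: y(2) U_bd(2)[OF y(1)] U_bd(2)[OF weight_bd_closed[OF y(1)]])
  qed
qed (rule U_sp_module U_bd)+

lemma U_comp_linear: "(\<lambda>x. U_comp V n x p) \<in> linear_maps K (U_sp V n) (sp V (n, p))"
  unfolding U_comp_def U_sp_def by (rule dsum_comp_linear[OF sp_module])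

lemma U_comp_closed: "x \<in> carrier (U_sp V n) \<Longrightarrow> U_comp V n x p \<in> carrier (sp V (n, p))"
  by (rule linear_closed[OF U_comp_linear])

lemma U_comp_in:
  "x \<in> carrier (sp V (n, p)) \<Longrightarrow> U_comp V n (U_in V n p x) q = (if q = p then x else \<zero>\<^bsub>sp V (n, q)\<^esub>)"
  unfolding U_comp_def U_in_eq by (rule dsum_comp_in[OF sp_module])

lemma U_comp_finite: "x \<in> carrier (U_sp V n) \<Longrightarrow> finite {p. U_comp V n x p \<noteq> \<zero>\<^bsub>sp V (n, p)\<^esub>}"
  unfolding U_comp_def U_sp_def by (rule dsum_comp_finite[OF sp_module])

lemma U_eqI:
  "\<lbrakk>x \<in> carrier (U_sp V n); y \<in> carrier (U_sp V n); \<And>p. U_comp V n x p = U_comp V n y p\<rbrakk> \<Longrightarrow> x = y"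
  unfolding U_comp_def U_sp_def by (rule dsum_eqI[OF sp_module])

lemma U_exists:
  assumes "\<And>p. f p \<in> carrier (sp V (n, p))" "finite {p. f p \<noteq> \<zero>\<^bsub>sp V (n, p)\<^esub>}"
  obtains x where "x \<in> carrier (U_sp V n)" "\<And>p. U_comp V n x p = f p"
  using dsum_exists[OF sp_module assms] unfolding U_comp_def U_sp_def by blast

lemma U_comp_zero: "U_comp V n \<zero>\<^bsub>U_sp V n\<^esub> p = \<zero>\<^bsub>sp V (n, p)\<^esub>"
  by (rule linear_zero[OF U_comp_linear U_sp_module sp_module])

text \<open>The differential preserves weights. On a homogeneous element of weight different from
  \<open>p\<close> both sides are zero; on one of weight \<open>p\<close> both are its
  differential.\<close>

lemma U_comp_bd:
  assumes x: "x \<in> carrier (U_sp V n)"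
  shows "U_comp V (n + bdeg) (bd (U_cpx K V) n x) p = bd V (n, p) (U_comp V n x p)"
proof (rule linear_eq_on_spans[OF U_spans U_sp_module _ linear_comp[OF U_bd(1) U_comp_linear] linear_comp[OF U_comp_linear] _ x])
  show "module K (sp V (n + bdeg, p))" by (rule sp_module)
  show b: "bd V (n, p) \<in> linear_maps K (sp V (n, p)) (sp V (n + bdeg, p))" for p
    using chain_complex_bd[OF V, of "(n, p)"] by simp
  fix s assume "s \<in> U_gens V n"
  then obtain q y where y: "y \<in> carrier (sp V (n, q))" "s = U_in V n q y" by blast
  show "U_comp V (n + bdeg) (bd (U_cpx K V) n s) p = bd V (n, p) (U_comp V n s p)"
    using linear_zero[OF b sp_module sp_module, of p]
    by (simp add: y(2) U_bd(2)[OF y(1)] U_comp_in[OF y(1)] U_comp_in[OF weight_bd_closed[OF y(1)]])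
qed

end

lemma U_cmap:
  fixes f :: "(int \<times> int, 'k, 'u) cmap"
  assumes f: "f \<in> linear_cmaps V W" and V: "chain_complex K V" and W: "chain_complex K W"
  shows "U_cmap K f \<in> linear_cmaps (U_cpx K V) (U_cpx K W)"
    and "x \<in> carrier (sp V (n, p)) \<Longrightarrow> fn (U_cmap K f) n (U_in V n p x) = U_in W n p (fn f (n, p) x)"
    and "chain_map K f \<Longrightarrow> chain_map K (U_cmap K f)"
proof -
  note f' = linear_cmapsD[OF f]
  note t = the_linear_U[OF V U_sp_module[OF W] linear_comp[OF f'(4) U_in_linear[OF W]]]
  show l: "U_cmap K f \<in> linear_cmaps (U_cpx K V) (U_cpx K W)"
    using t(1,2) f'(2,3) by (simp add: U_cmap_def linear_cmaps_def linear_cmap_def sp_U_cpx[OF V] sp_U_cpx[OF W])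
  show v: "x \<in> carrier (sp V (n, p)) \<Longrightarrow> fn (U_cmap K f) n (U_in V n p x) = U_in W n p (fn f (n, p) x)" for n p x
    using t(3) f'(2,3) by (simp add: U_cmap_def)
  have l': "fn (U_cmap K f) n \<in> linear_maps K (U_sp V n) (U_sp W n)" for n
    using linear_cmapsD(4)[OF l] by (simp add: sp_U_cpx[OF V] sp_U_cpx[OF W])
  show "chain_map K (U_cmap K f)" if cf: "chain_map K f"
    unfolding chain_map_iff[OF l U_complex[OF V] U_complex[OF W]] sp_U_cpx[OF V]
  proof (intro allI ballI)
    fix n x assume x: "x \<in> carrier (U_sp V n)"
    show "bd (U_cpx K W) n (fn (U_cmap K f) n x) = fn (U_cmap K f) (n + bdeg) (bd (U_cpx K V) n x)"
    proof (rule linear_eq_on_spans[OF U_spans[OF V] U_sp_module[OF V] U_sp_module[OF W] linear_comp[OF l' U_bd(1)[OF W]]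
          linear_comp[OF U_bd(1)[OF V] l'] _ x])
      fix s assume "s \<in> U_gens V n"
      then obtain p y where y: "y \<in> carrier (sp V (n, p))" "s = U_in V n p y" by blast
      have fy: "fn f (n, p) y \<in> carrier (sp W (n, p))"
        by (rule linear_closed[OF f'(4) y(1)])
      show "bd (U_cpx K W) n (fn (U_cmap K f) n s) = fn (U_cmap K f) (n + bdeg) (bd (U_cpx K V) n s)"
        using chain_map_bd[OF cf, of y "(n, p)"] f'(2,3) y(1)
        by (simp add: y(2) v U_bd(2)[OF V] U_bd(2)[OF W fy] weight_bd_closed[OF V])
    qed
  qed
qed

text \<open>Sums over weights are lifted one variable at a time. After each lift
  \<open>linear_family_bilinear\<close> restores linearity in the other variable, which the choice
  of lifts does not give by itself.\<close>

lemma U_bilinear_exists: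
  fixes V W :: "(int \<times> int, 'k, 'u) cpx"
  assumes V: "chain_complex K V" and W: "chain_complex K W" and X: "module K X"
    and \<beta>: "\<And>p q. \<beta> p q \<in> bilinear_maps (sp V (a, p)) (sp W (b, q)) X"
  obtains \<gamma> where "\<gamma> \<in> bilinear_maps (U_sp V a) (U_sp W b) X"
    "\<And>p q x y. \<lbrakk>x \<in> carrier (sp V (a, p)); y \<in> carrier (sp W (b, q))\<rbrakk> \<Longrightarrow> \<gamma> (U_in V a p x) (U_in W b q y) = \<beta> p q x y"
proof -
  note Vm = chain_complex_module[OF V] and Wm = chain_complex_module[OF W]
  have ex_g: "\<exists>g. g \<in> linear_maps K (U_sp V a) X \<and> (\<forall>p. \<forall>x \<in> carrier (sp V (a, p)). g (U_in V a p x) = \<beta> p q x y)"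
    if y: "y \<in> carrier (sp W (b, q))" for q y
  proof -
    obtain g where "g \<in> linear_maps K (U_sp V a) X"
      "\<And>p x. x \<in> carrier (sp V (a, p)) \<Longrightarrow> g (U_in V a p x) = \<beta> p q x y"
      by (rule U_lift[OF V X bilinear_left[OF \<beta> y]]) blast
    then show ?thesis by blast
  qed
  define g where "g q y = (SOME g. g \<in> linear_maps K (U_sp V a) X \<and> (\<forall>p. \<forall>x \<in> carrier (sp V (a, p)). g (U_in V a p x) = \<beta> p q x y))" for q y
  have g: "g q y \<in> linear_maps K (U_sp V a) X"
    and gv: "x \<in> carrier (sp V (a, p)) \<Longrightarrow> g q y (U_in V a p x) = \<beta> p q x y" if "y \<in> carrier (sp W (b, q))" for q y p x
    using someI_ex[OF ex_g[OF that]] unfolding g_def by blast+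
  have gb: "(\<lambda>x y. g q y x) \<in> bilinear_maps (U_sp V a) (sp W (b, q)) X" for q
  proof (rule linear_family_bilinear[OF U_spans[OF V] U_sp_module[OF V] X g _ Wm])
    fix s assume "s \<in> U_gens V a"
    then obtain p x where x: "x \<in> carrier (sp V (a, p))" "s = U_in V a p x" by blast
    show "(\<lambda>y. g q y s) \<in> linear_maps K (sp W (b, q)) X"
      by (rule linear_cong[OF bilinear_right[OF \<beta> x(1)] Wm]) (simp add: x(2) gv[OF _ x(1)])
  qed
  have ex_k: "\<exists>k. k \<in> linear_maps K (U_sp W b) X \<and> (\<forall>q. \<forall>y \<in> carrier (sp W (b, q)). k (U_in W b q y) = g q y x)"
    if x: "x \<in> carrier (U_sp V a)" for x
  proof -
    obtain k where "k \<in> linear_maps K (U_sp W b) X"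
      "\<And>q y. y \<in> carrier (sp W (b, q)) \<Longrightarrow> k (U_in W b q y) = g q y x"
      by (rule U_lift[OF W X bilinear_right[OF gb x]]) blast
    then show ?thesis by blast
  qed
  define k where "k x = (SOME k. k \<in> linear_maps K (U_sp W b) X \<and> (\<forall>q. \<forall>y \<in> carrier (sp W (b, q)). k (U_in W b q y) = g q y x))" for x
  have k: "k x \<in> linear_maps K (U_sp W b) X"
    and kv: "y \<in> carrier (sp W (b, q)) \<Longrightarrow> k x (U_in W b q y) = g q y x" if "x \<in> carrier (U_sp V a)" for x q y
    using someI_ex[OF ex_k[OF that]] unfolding k_def by blast+
  have "(\<lambda>y x. k x y) \<in> bilinear_maps (U_sp W b) (U_sp V a) X"
  proof (rule linear_family_bilinear[OF U_spans[OF W] U_sp_module[OF W] X k _ U_sp_module[OF V]])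
    fix s assume "s \<in> U_gens W b"
    then obtain q y where y: "y \<in> carrier (sp W (b, q))" "s = U_in W b q y" by blast
    show "(\<lambda>x. k x s) \<in> linear_maps K (U_sp V a) X"
      by (rule linear_cong[OF g[OF y(1)] U_sp_module[OF V]]) (simp add: y(2) kv[OF _ y(1)])
  qed
  then have "k \<in> bilinear_maps (U_sp V a) (U_sp W b) X"
    by (rule bilinear_swap)
  then show ?thesis
    by (rule that) (simp add: kv U_in_closed[OF V] gv)
qed

lemma U_mu:
  fixes V W :: "(int \<times> int, 'k, 'u) cpx"
  assumes V: "chain_complex K V" and W: "chain_complex K W"
  shows "U_mu K V W \<in> linear_cmaps (tens_cpx K (U_cpx K V) (U_cpx K W)) (U_cpx K (tens_cpx K V W))"
    and "\<lbrakk>a + b = m; x \<in> carrier (sp V (a, p)); y \<in> carrier (sp W (b, q))\<rbrakk> \<Longrightarrow>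
      fn (U_mu K V W) m (ten K (U_cpx K V) (U_cpx K W) a b (U_in V a p x) (U_in W b q y)) =
        U_in (tens_cpx K V W) m (p + q) (ten K V W (a, p) (b, q) x y)"
proof -
  let ?S = "tens_cpx K (U_cpx K V) (U_cpx K W)" and ?T = "U_cpx K (tens_cpx K V W)"
  let ?t = "\<lambda>m a b p q x y. U_in (tens_cpx K V W) m (p + q) (ten K V W (a, p) (b, q) x y)"
  note Vm = chain_complex_module[OF V] and Wm = chain_complex_module[OF W]
  note T = tens_chain_complex[OF V W] and UV = U_complex[OF V] and UW = U_complex[OF W]
  note UVm = chain_complex_module[OF UV] and UWm = chain_complex_module[OF UW]
  note Tm = chain_complex_module[OF U_complex[OF T]]
  define Q where "Q a b m \<gamma> \<longleftrightarrow> \<gamma> \<in> bilinear_maps (sp (U_cpx K V) a) (sp (U_cpx K W) b) (sp ?T m) \<and>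
      (\<forall>p q. \<forall>x \<in> carrier (sp V (a, p)). \<forall>y \<in> carrier (sp W (b, q)). \<gamma> (U_in V a p x) (U_in W b q y) = ?t m a b p q x y)"
    for a b m \<gamma>
  have ex: "Ex (Q a b m)" if ab: "a + b = m" for a b m
  proof -
    have "?t m a b p q \<in> bilinear_maps (sp V (a, p)) (sp W (b, q)) (sp ?T m)" for p q
    proof -
      have "(a, p) + (b, q) = (m, p + q)" using ab by simp
      from bilinear_comp_out[OF ten_bilinear[OF Vm Wm this, folded tens_sp_cpx[OF V W]] U_in_linear[OF T]]
      show ?thesis by (simp add: sp_U_cpx[OF T])
    qed
    then obtain \<gamma> where "\<gamma> \<in> bilinear_maps (U_sp V a) (U_sp W b) (sp ?T m)"
      "\<And>p q x y. \<lbrakk>x \<in> carrier (sp V (a, p)); y \<in> carrier (sp W (b, q))\<rbrakk> \<Longrightarrow> \<gamma> (U_in V a p x) (U_in W b q y) = ?t m a b p q x y"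
      by (rule U_bilinear_exists[OF V W Tm, of "?t m a b" a b m]) blast
    then have "Q a b m \<gamma>" by (simp add: Q_def sp_U_cpx[OF V] sp_U_cpx[OF W])
    then show ?thesis by blast
  qed
  define \<gamma> where "\<gamma> a b m = (SOME g. Q a b m g)" for a b m
  have Q: "Q a b m (\<gamma> a b m)" if "a + b = m" for a b m
    unfolding \<gamma>_def by (rule someI_ex[OF ex[OF that]])
  have \<gamma>: "\<gamma> a b m \<in> bilinear_maps (sp (U_cpx K V) a) (sp (U_cpx K W) b) (sp ?T m)" if "a + b = m" for a b m
    using Q[OF that] by (simp add: Q_def)
  have \<gamma>v: "\<gamma> a b m (U_in V a p x) (U_in W b q y) = ?t m a b p q x y"
    if "a + b = m" "x \<in> carrier (sp V (a, p))" "y \<in> carrier (sp W (b, q))" for a b m p q x y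
    using Q[OF that(1)] that(2,3) by (simp add: Q_def)
  have *: "fn (U_mu K V W) m \<in> linear_maps K (sp ?S m) (sp ?T m) \<and> fn (U_mu K V W) m \<in> extensional (carrier (sp ?S m)) \<and>
    (\<forall>a b p q. \<forall>x \<in> carrier (sp V (a, p)). \<forall>y \<in> carrier (sp W (b, q)). a + b = m \<longrightarrow>
      fn (U_mu K V W) m (ten K (U_cpx K V) (U_cpx K W) a b (U_in V a p x) (U_in W b q y)) = ?t m a b p q x y)" for m
  proof -
    obtain h where h: "h \<in> linear_maps K (tens_sp K (U_cpx K V) (U_cpx K W) m) (sp ?T m)"
      and hv: "\<And>a b x y. \<lbrakk>a + b = m; x \<in> carrier (sp (U_cpx K V) a); y \<in> carrier (sp (U_cpx K W) b)\<rbrakk> \<Longrightarrow>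
        h (ten K (U_cpx K V) (U_cpx K W) a b x y) = \<gamma> a b m x y"
      using tens_lift[OF UVm UWm Tm \<gamma>] by blast
    \<comment> \<open>\<open>U_mu\<close> is described only through its values on tensors of
      homogeneous elements. These still span, as homogeneous elements span each factor, so the
      description is unambiguous.\<close>
    let ?G = "{ten K (U_cpx K V) (U_cpx K W) a b x y | a b x y. a + b = m \<and> x \<in> U_gens V a \<and> y \<in> U_gens W b}"
    have G: "spans (tens_sp K (U_cpx K V) (U_cpx K W) m) ?G"
      by (rule tens_spans[OF UVm UWm]) (simp_all add: sp_U_cpx[OF V] sp_U_cpx[OF W] U_spans[OF V] U_spans[OF W])
    have hv': "h (ten K (U_cpx K V) (U_cpx K W) a b (U_in V a p x) (U_in W b q y)) = ?t m a b p q x y"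
      if "a + b = m" "x \<in> carrier (sp V (a, p))" "y \<in> carrier (sp W (b, q))" for a b p q x y
      using hv[OF that(1)] that U_in_closed[OF V that(2)] U_in_closed[OF W that(3)]
      by (simp add: sp_U_cpx[OF V] sp_U_cpx[OF W] \<gamma>v)
    have P: "(\<forall>a b p q. \<forall>x \<in> carrier (sp V (a, p)). \<forall>y \<in> carrier (sp W (b, q)). a + b = m \<longrightarrow>
        g (ten K (U_cpx K V) (U_cpx K W) a b (U_in V a p x) (U_in W b q y)) = ?t m a b p q x y) \<longleftrightarrow> (\<forall>s \<in> ?G. g s = h s)" for g
    proof
      assume L: "\<forall>a b p q. \<forall>x \<in> carrier (sp V (a, p)). \<forall>y \<in> carrier (sp W (b, q)). a + b = m \<longrightarrow>
        g (ten K (U_cpx K V) (U_cpx K W) a b (U_in V a p x) (U_in W b q y)) = ?t m a b p q x y"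
      show "\<forall>s \<in> ?G. g s = h s"
      proof
        fix s assume "s \<in> ?G"
        then obtain a b p q x y where "a + b = m" "x \<in> carrier (sp V (a, p))" "y \<in> carrier (sp W (b, q))"
          "s = ten K (U_cpx K V) (U_cpx K W) a b (U_in V a p x) (U_in W b q y)" by blast
        then show "g s = h s" using L hv' by simp
      qed
    next
      assume R: "\<forall>s \<in> ?G. g s = h s"
      show "\<forall>a b p q. \<forall>x \<in> carrier (sp V (a, p)). \<forall>y \<in> carrier (sp W (b, q)). a + b = m \<longrightarrow>
        g (ten K (U_cpx K V) (U_cpx K W) a b (U_in V a p x) (U_in W b q y)) = ?t m a b p q x y"
      proof (intro allI ballI impI)
        fix a b p q x y assume *: "x \<in> carrier (sp V (a, p))" "y \<in> carrier (sp W (b, q))" "a + b = m"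
        then have "ten K (U_cpx K V) (U_cpx K W) a b (U_in V a p x) (U_in W b q y) \<in> ?G" by blast
        then show "g (ten K (U_cpx K V) (U_cpx K W) a b (U_in V a p x) (U_in W b q y)) = ?t m a b p q x y"
          using R hv'[OF *(3,1,2)] by simp
      qed
    qed
    note t = the_linear_spans[OF G tens_sp_module[OF UVm UWm] Tm h P]
    have f: "fn (U_mu K V W) m = the_linear K (tens_sp K (U_cpx K V) (U_cpx K W) m) (sp ?T m) (\<lambda>g.
      \<forall>a b p q. \<forall>x \<in> carrier (sp V (a, p)). \<forall>y \<in> carrier (sp W (b, q)). a + b = m \<longrightarrow>
        g (ten K (U_cpx K V) (U_cpx K W) a b (U_in V a p x) (U_in W b q y)) = ?t m a b p q x y)"
      by (simp add: U_mu_def Let_def tens_sp_cpx[OF UV UW])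
    have "ten K (U_cpx K V) (U_cpx K W) a b (U_in V a p x) (U_in W b q y) \<in> carrier (tens_sp K (U_cpx K V) (U_cpx K W) m)"
      if "a + b = m" "x \<in> carrier (sp V (a, p))" "y \<in> carrier (sp W (b, q))" for a b p q x y
      using ten_closed[OF UVm UWm that(1)] U_in_closed[OF V that(2)] U_in_closed[OF W that(3)]
      by (simp add: sp_U_cpx[OF V] sp_U_cpx[OF W])
    then show ?thesis
      unfolding f tens_sp_cpx[OF UV UW] using t hv' by simp
  qed
  show "U_mu K V W \<in> linear_cmaps ?S ?T"
    using * by (simp add: linear_cmaps_def linear_cmap_def) (simp add: U_mu_def Let_def)
  show "\<lbrakk>a + b = m; x \<in> carrier (sp V (a, p)); y \<in> carrier (sp W (b, q))\<rbrakk> \<Longrightarrow>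
      fn (U_mu K V W) m (ten K (U_cpx K V) (U_cpx K W) a b (U_in V a p x) (U_in W b q y)) = ?t m a b p q x y"
    using * by blast
qed

lemma U_eps:
  "U_eps K \<in> linear_cmaps (unit_cpx K) (U_cpx K (unit_cpx K :: (int \<times> int, 'k, 'u) cpx))"
  "fn (U_eps K) 0 (unit_elt K TYPE(int) \<one>) = U_in (unit_cpx K :: (int \<times> int, 'k, 'u) cpx) 0 0 (unit_elt K TYPE(int \<times> int) \<one>)"
proof -
  let ?I = "unit_cpx K :: (int, 'k, 'u) cpx" and ?J = "unit_cpx K :: (int \<times> int, 'k, 'u) cpx"
  note I = unit_chain_complex[where ?'g = int] and J = unit_chain_complex[where ?'g = "int \<times> int"]
  note Im = chain_complex_module[OF I] and UJm = chain_complex_module[OF U_complex[OF J]]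
  let ?u = "\<lambda>c. U_in ?J 0 0 (unit_elt K TYPE(int \<times> int) c)"
  have uc: "unit_elt K TYPE(int \<times> int) c \<in> carrier (sp ?J (0, 0))" if "c \<in> carrier K" for c
    using unit_elt_closed[OF that, where ?'g = "int \<times> int"] by (simp add: zero_prod_def)
  have u: "?u c \<in> carrier (sp (U_cpx K ?J) 0)" if "c \<in> carrier K" for c
    using U_in_closed[OF J uc[OF that]] by (simp add: sp_U_cpx[OF J])
  have us: "c \<odot>\<^bsub>sp (U_cpx K ?J) 0\<^esub> ?u \<one> = ?u c" if c: "c \<in> carrier K" for c
    using linear_smult[OF U_in_linear[OF J] c uc[OF one_closed]] unit_elt_eq[OF c, where ?'g = "int \<times> int"]
    by (simp add: sp_U_cpx[OF J] zero_prod_def)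
  \<comment> \<open>\<open>U_eps\<close> is prescribed in degree 0 only. In the other degrees the
    unit complex is zero and spanned by the empty set, which determines the map.\<close>
  let ?S = "\<lambda>n::int. if n = 0 then unit_elt K TYPE(int) ` carrier K else {}"
  have S: "spans (sp ?I n) (?S n)" for n
    by (rule spans_mono[OF unit_spans]) (auto simp: unit_elt_closed)
  have *: "fn (U_eps K) n \<in> linear_maps K (sp ?I n) (sp (U_cpx K ?J) n) \<and>
      fn (U_eps K) n \<in> extensional (carrier (sp ?I n)) \<and> (n = 0 \<longrightarrow> fn (U_eps K) n (unit_elt K TYPE(int) \<one>) = ?u \<one>)" for n
  proof -
    obtain h where h: "h \<in> linear_maps K (sp ?I n) (sp (U_cpx K ?J) n)"
      "\<And>c. \<lbrakk>n = 0; c \<in> carrier K\<rbrakk> \<Longrightarrow> h (unit_elt K TYPE(int) c) = c \<odot>\<^bsub>sp (U_cpx K ?J) n\<^esub> ?u \<one>"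
      using unit_linear_exists[OF UJm[of n], of "?u \<one>"] u[OF one_closed] by blast
    have P: "(n = 0 \<longrightarrow> (\<forall>c \<in> carrier K. g (unit_elt K TYPE(int) c) = ?u c)) \<longleftrightarrow> (\<forall>s \<in> ?S n. g s = h s)" for g
      using h(2) us by auto
    note t = the_linear_spans[OF S Im UJm h(1) P]
    show ?thesis
      using t h(2) us[OF one_closed] unit_elt_closed[OF one_closed, where ?'g = int]
      by (auto simp: U_eps_def sp_U_cpx[OF J])
  qed
  show "U_eps K \<in> linear_cmaps ?I (U_cpx K ?J)"
    using * by (simp add: linear_cmaps_def linear_cmap_def) (simp add: U_eps_def)
  show "fn (U_eps K) 0 (unit_elt K TYPE(int) \<one>) = ?u \<one>"
    using * by blast
qed

abbreviation (input) UG ::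
  "('o, 'a, (int \<times> int, 'k, 'u) cpx, (int \<times> int, 'k, 'u) cmap) lax_functor \<Rightarrow> ('o, 'a, (int, 'k, 'u) cpx, (int, 'k, 'u) cmap) lax_functor" where
  "UG G \<equiv> lax_comp (complexes K) (U_functor K) G"

lemma UG_FO [simp]: "FO (UG G) X = U_cpx K (FO G X)"
  by (simp add: lax_comp_def U_functor_def)

text \<open>On homogeneous elements the product of \<open>UG G\<close> adds weights and is computed
  in \<open>G\<close>. The laws of \<open>UG G\<close> enter separately: from the weak equivalence
  in one direction of the theorem, by pulling back along an injection in the other.\<close>

lemma weight_functor_pre_lax:
  fixes G :: "('o, 'a, (int \<times> int, 'k, 'u) cpx, (int \<times> int, 'k, 'u) cmap) lax_functor"
  assumes G: "lax_elements K emb C G"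
  shows "pre_lax K emb C (UG G)"
    and "\<lbrakk>X \<in> Obj C; Y \<in> Obj C; x \<in> carrier (sp (FO G X) (a, p)); y \<in> carrier (sp (FO G Y) (b, q))\<rbrakk> \<Longrightarrow>
      mul (UG G) X Y a b (U_in (FO G X) a p x) (U_in (FO G Y) b q y) =
        U_in (FO G (X \<boxtimes>\<^bsub>C\<^esub> Y)) (a + b) (p + q) (mul G X Y (a, p) (b, q) x y)"
    and "one_elt (UG G) = U_in (FO G (Unit C)) 0 0 (one_elt G)"
    and "\<lbrakk>f \<in> Hom C X Y; x \<in> carrier (sp (FO G X) (n, p))\<rbrakk> \<Longrightarrow>
      fn (FA (UG G) f) n (U_in (FO G X) n p x) = U_in (FO G Y) n p (fn (FA G f) (n, p) x)"
proof -
  interpret G: lax_elements K emb C G by (rule G)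
  let ?U = "UG G"
  note cx = G.FO_complex and T = G.C.tens_obj and U = G.C.unit_obj
  have Hom: "X \<in> Obj C" "Y \<in> Obj C" if "f \<in> Hom C X Y" for f X Y
    using that G.C.dom_obj G.C.cod_obj by (auto simp: Hom_def)
  have FA: "FA ?U f = U_cmap K (FA G f)" and Mu: "Mu ?U X Y = cmap_comp (U_cmap K (Mu G X Y)) (U_mu K (FO G X) (FO G Y))"
    and Eps: "lax_functor.Eps ?U = cmap_comp (U_cmap K (lax_functor.Eps G)) (U_eps K)" for f X Y
    by (simp_all add: lax_comp_def U_functor_def complexes_def)
  note UFA = U_cmap[OF G.FA_cmap cx cx]
  note UMu = U_cmap[OF G.Mu_cmap G.FO_tens_complex cx[OF T]]
  note UEps = U_cmap[OF G.Eps_cmap unit_chain_complex cx[OF U]]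
  show "fn (FA ?U f) n (U_in (FO G X) n p x) = U_in (FO G Y) n p (fn (FA G f) (n, p) x)"
    if f: "f \<in> Hom C X Y" and x: "x \<in> carrier (sp (FO G X) (n, p))" for f X Y n p x
    using UFA(2)[OF f Hom[OF f] x] by (simp add: FA)
  show "mul ?U X Y a b (U_in (FO G X) a p x) (U_in (FO G Y) b q y) =
        U_in (FO G (X \<boxtimes>\<^bsub>C\<^esub> Y)) (a + b) (p + q) (mul G X Y (a, p) (b, q) x y)"
    if X: "X \<in> Obj C" and Y: "Y \<in> Obj C" and x: "x \<in> carrier (sp (FO G X) (a, p))"
      and y: "y \<in> carrier (sp (FO G Y) (b, q))" for X Y a b p q x y
  proof -
    note m = U_mu[OF cx[OF X] cx[OF Y]]
    have c: "ten K (U_cpx K (FO G X)) (U_cpx K (FO G Y)) a b (U_in (FO G X) a p x) (U_in (FO G Y) b q y)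
        \<in> carrier (sp (tens_cpx K (U_cpx K (FO G X)) (U_cpx K (FO G Y))) (a + b))"
      using ten_closed[OF chain_complex_module[OF U_complex[OF cx[OF X]]] chain_complex_module[OF U_complex[OF cx[OF Y]]] refl]
        U_in_closed[OF cx[OF X] x] U_in_closed[OF cx[OF Y] y]
      by (simp add: tens_sp_cpx[OF U_complex[OF cx[OF X]] U_complex[OF cx[OF Y]]] sp_U_cpx cx X Y)
    have d: "ten K (FO G X) (FO G Y) (a, p) (b, q) x y \<in> carrier (sp (tens_cpx K (FO G X) (FO G Y)) (a + b, p + q))"
      by (rule G.ten_closed_FO[OF X Y _ x y]) simp
    show ?thesis
      using UMu(2)[OF X Y X Y X Y d] by (simp add: mul_def Mu comp_fn[OF m(1) c] m(2)[OF refl x y])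
  qed
  show "one_elt ?U = U_in (FO G (Unit C)) 0 0 (one_elt G)"
  proof -
    have c: "unit_elt K TYPE(int) \<one> \<in> carrier (sp (unit_cpx K :: (int, 'k, 'u) cpx) 0)"
      by (simp add: unit_elt_closed)
    have d: "unit_elt K TYPE(int \<times> int) \<one> \<in> carrier (sp (unit_cpx K :: (int \<times> int, 'k, 'u) cpx) (0, 0))"
      using unit_elt_closed[OF one_closed, where ?'g = "int \<times> int"] by (simp add: zero_prod_def)
    show ?thesis
      using UEps(2)[OF d] by (simp add: one_elt_def Eps comp_fn[OF U_eps(1) c] U_eps(2) zero_prod_def)
  qed
  show "pre_lax K emb C ?U"
  proof
    show "X \<in> Obj C \<Longrightarrow> chain_complex K (FO ?U X)" for X
      by (simp add: U_complex cx)
    show "FA ?U f \<in> Hom (complexes K) (FO ?U X) (FO ?U Y)" if f: "f \<in> Hom C X Y" for f X Y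
      using UFA(1,3)[OF f Hom[OF f]] G.FA_chain_map[OF f] by (auto simp: FA Hom_complexes dest: linear_cmapsD(2,3))
    show "Mu ?U X Y \<in> linear_cmaps (tens_cpx K (FO ?U X) (FO ?U Y)) (FO ?U (X \<boxtimes>\<^bsub>C\<^esub> Y))"
      if X: "X \<in> Obj C" and Y: "Y \<in> Obj C" for X Y
      using comp_in_linear_cmaps[OF U_mu(1)[OF cx[OF X] cx[OF Y]] UMu(1)[OF X Y X Y X Y]
          tens_chain_complex[OF U_complex[OF cx[OF X]] U_complex[OF cx[OF Y]]]]
      by (simp add: Mu)
    show "lax_functor.Eps ?U \<in> linear_cmaps (unit_cpx K) (FO ?U (Unit C))"
      using comp_in_linear_cmaps[OF U_eps(1) UEps(1) unit_chain_complex] by (simp add: Eps)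
  qed
qed

end

section \<open>Truncating complexes with pure homology\<close>

context small_ring
begin

text \<open>In weight \<open>p\<close> this is the truncation in degrees \<open>\<ge> p\<close>, with only the cycles in degree \<open>p\<close>.\<close>

definition trunc :: "(int \<times> int, 'k, 'u) cpx \<Rightarrow> int \<Rightarrow> 'u set" where
  "trunc V n = {x \<in> carrier (U_sp V n). (\<forall>p > n. U_comp V n x p = \<zero>\<^bsub>sp V (n, p)\<^esub>) \<and> U_comp V n x n \<in> cycles V (n, n)}"

abbreviation (input) trunc_cpx :: "(int \<times> int, 'k, 'u) cpx \<Rightarrow> (int, 'k, 'u) cpx" where
  "trunc_cpx V \<equiv> sub_cpx (\<lambda>n. n) (U_cpx K V) (trunc V)"

text \<open>Components of weight below \<open>n\<close> are discarded, since for pure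
  \<open>V\<close> they carry no homology in degree \<open>n\<close>. The component of weight
  \<open>n\<close>, a cycle for elements of \<open>trunc V n\<close>, is the one whose class
  matters.\<close>

definition top_class :: "(int \<times> int, 'k, 'u) cpx \<Rightarrow> int \<Rightarrow> 'u \<Rightarrow> 'u" where
  "top_class V n x = H_class (U_cpx K V) n (U_in V n n (U_comp V n x n))"

lemma cycles_module_closed:
  fixes V :: "('g::complex_grading, 'k, 'u) cpx"
  assumes V: "chain_complex K V"
  shows "\<zero>\<^bsub>sp V n\<^esub> \<in> cycles V n" "\<lbrakk>x \<in> cycles V n; y \<in> cycles V n\<rbrakk> \<Longrightarrow> x \<oplus>\<^bsub>sp V n\<^esub> y \<in> cycles V n"
    "\<lbrakk>c \<in> carrier K; x \<in> cycles V n\<rbrakk> \<Longrightarrow> c \<odot>\<^bsub>sp V n\<^esub> x \<in> cycles V n"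
  using module_zero_closed[OF cycle_module_module[OF V, of n]] module_add_closed[OF cycle_module_module[OF V, of n], of x y]
    module_smult_closed[OF cycle_module_module[OF V, of n], of c x]
  by simp_all

context
  fixes V :: "(int \<times> int, 'k, 'u) cpx"
  assumes V: "chain_complex K V"
begin

private lemmas M = chain_complex_module[OF V] and UM = U_sp_module[OF V] and U = U_complex[OF V]

lemma trunc_subset: "trunc V n \<subseteq> carrier (sp (U_cpx K V) n)"
  by (auto simp: trunc_def sp_U_cpx[OF V])

lemma trunc_closed: "x \<in> trunc V n \<Longrightarrow> x \<in> carrier (U_sp V n)"
  by (simp add: trunc_def)

lemma trunc_zero: "\<zero>\<^bsub>sp (U_cpx K V) n\<^esub> \<in> trunc V n"
  using UM by (simp add: trunc_def sp_U_cpx[OF V] U_comp_zero[OF V] cycles_module_closed(1)[OF V])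

lemma trunc_add: "\<lbrakk>x \<in> trunc V n; y \<in> trunc V n\<rbrakk> \<Longrightarrow> x \<oplus>\<^bsub>sp (U_cpx K V) n\<^esub> y \<in> trunc V n"
  using UM M by (simp add: trunc_def sp_U_cpx[OF V] linear_add[OF U_comp_linear[OF V]] cycles_module_closed(2)[OF V])

lemma trunc_smult: "\<lbrakk>c \<in> carrier K; x \<in> trunc V n\<rbrakk> \<Longrightarrow> c \<odot>\<^bsub>sp (U_cpx K V) n\<^esub> x \<in> trunc V n"
  using UM M by (simp add: trunc_def sp_U_cpx[OF V] linear_smult[OF U_comp_linear[OF V]] cycles_module_closed(3)[OF V])

lemma trunc_bd:
  assumes x: "x \<in> trunc V n"
  shows "bd (U_cpx K V) n x \<in> trunc V (n + bdeg)"
proof -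
  have xc: "x \<in> carrier (U_sp V n)" and x0: "\<And>p. p > n \<Longrightarrow> U_comp V n x p = \<zero>\<^bsub>sp V (n, p)\<^esub>"
    and xn: "U_comp V n x n \<in> cycles V (n, n)"
    using x by (auto simp: trunc_def)
  \<comment> \<open>As \<open>bdeg\<close> is -1, the condition p > n + bdeg includes p = n. There
    the component of \<open>x\<close> need not vanish, but it is a cycle by the definition of
    \<open>trunc\<close>.\<close>
  have "bd V (n, p) (U_comp V n x p) = \<zero>\<^bsub>sp V (n + bdeg, p)\<^esub>" if "p > n + bdeg" for p
  proof (cases "p = n")
    case True
    then show ?thesis using cycles_bd[OF xn] by simp
  next
    case False
    then have "p > n" using that by (simp add: bdeg_int_def)
    then show ?thesis
      using linear_zero[OF chain_complex_bd[OF V] M M, of "(n, p)"] x0 by simp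
  qed
  \<comment> \<open>In weight n - 1, the diagonal weight of the new degree, the component is a
    differential and hence a cycle.\<close>
  moreover have "bd V (n, n + bdeg) (U_comp V n x (n + bdeg)) \<in> cycles V (n + bdeg, n + bdeg)"
    using bd_cycle[OF V U_comp_closed[OF V xc, of "n + bdeg"]] by simp
  ultimately show ?thesis
    using linear_closed[OF U_bd(1)[OF V] xc] by (simp add: trunc_def U_comp_bd[OF V xc])
qed

lemma U_in_trunc:
  assumes x: "x \<in> cycles V (n, n)"
  shows "U_in V n n x \<in> trunc V n"
  using x U_in_closed[OF V cycles_closed[OF x]] by (simp add: trunc_def U_comp_in[OF V cycles_closed[OF x]])

lemma U_comp_cycle:
  assumes x: "x \<in> cycles (U_cpx K V) n"
  shows "U_comp V n x p \<in> cycles V (n, p)"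
  using U_comp_bd[OF V, of x n p] U_comp_zero[OF V, of "n + bdeg" p] cycles_closed[OF x] cycles_bd[OF x]
  by (simp add: cycles_def sp_U_cpx[OF V] U_comp_closed[OF V])

lemma U_in_cycle:
  assumes x: "x \<in> cycles V (n, p)"
  shows "U_in V n p x \<in> cycles (U_cpx K V) n"
  using U_bd(2)[OF V cycles_closed[OF x]] U_in_closed[OF V cycles_closed[OF x]] cycles_bd[OF x]
    linear_zero[OF U_in_linear[OF V] M UM]
  by (simp add: cycles_def sp_U_cpx[OF V])

lemma U_comp_boundary:
  assumes x: "x \<in> boundaries (U_cpx K V) n"
  shows "U_comp V n x p \<in> boundaries V (n, p)"
proof -
  obtain w m where w: "w \<in> carrier (U_sp V m)" "m + bdeg = n" "x = bd (U_cpx K V) m w"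
    using x by (rule boundariesE) (simp add: sp_U_cpx[OF V])
  have "(m, p) + bdeg = (n, p)" using w(2) by simp
  from boundariesI[OF U_comp_closed[OF V w(1)] this] show ?thesis
    using U_comp_bd[OF V w(1), of p] w(2,3) by simp
qed

lemma U_in_boundary:
  assumes x: "x \<in> boundaries V (n, p)"
  shows "U_in V n p x \<in> boundaries (U_cpx K V) n"
proof -
  obtain w m where w: "w \<in> carrier (sp V m)" "m + bdeg = (n, p)" "x = bd V m w"
    using x by (rule boundariesE)
  then have m: "m = (n - bdeg, p)" by (cases m) (simp add: eq_diff_eq)
  show ?thesis
    using boundariesI[of "U_in V (n - bdeg) p w" "U_cpx K V" "n - bdeg" n] U_bd(2)[OF V, of w "n - bdeg" p]
      U_in_closed[OF V, of w "n - bdeg" p] w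
    by (simp add: m sp_U_cpx[OF V])
qed

text \<open>Primitives are chosen weight by weight, and zero is chosen for a zero component. This
  keeps the support finite, so that the primitives form an element of the direct sum, and it later
  keeps this element inside the truncation.\<close>

lemma U_boundary_lift:
  assumes x: "x \<in> carrier (U_sp V n)" and b: "\<And>p. U_comp V n x p \<in> boundaries V (n, p)"
  obtains w where "w \<in> carrier (U_sp V (n - bdeg))" "bd (U_cpx K V) (n - bdeg) w = x"
    "\<And>p. U_comp V n x p = \<zero>\<^bsub>sp V (n, p)\<^esub> \<Longrightarrow> U_comp V (n - bdeg) w p = \<zero>\<^bsub>sp V (n - bdeg, p)\<^esub>"
proof -
  let ?m = "n - bdeg"
  let ?P = "\<lambda>p w. w \<in> carrier (sp V (?m, p)) \<and> bd V (?m, p) w = U_comp V n x p \<and>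
      (U_comp V n x p = \<zero>\<^bsub>sp V (n, p)\<^esub> \<longrightarrow> w = \<zero>\<^bsub>sp V (?m, p)\<^esub>)"
  have "\<exists>w. ?P p w" for p
  proof (cases "U_comp V n x p = \<zero>\<^bsub>sp V (n, p)\<^esub>")
    case True
    then show ?thesis
      using linear_zero[OF chain_complex_bd[OF V] M M, of "(?m, p)"] module_zero_closed[OF M[of "(?m, p)"]] by auto
  next
    case False
    obtain w m where w: "w \<in> carrier (sp V m)" "m + bdeg = (n, p)" "U_comp V n x p = bd V m w"
      using b by (rule boundariesE)
    then have "m = (?m, p)" by (cases m) (simp add: eq_diff_eq)
    with w False show ?thesis by auto
  qed
  then have "\<forall>p. \<exists>w. ?P p w" by blast
  from choice[OF this] obtain f where f: "\<And>p. ?P p (f p)" by blast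
  have "finite {p. f p \<noteq> \<zero>\<^bsub>sp V (?m, p)\<^esub>}"
    by (rule finite_subset[OF _ U_comp_finite[OF V x]]) (use f in blast)
  then obtain w where w: "w \<in> carrier (U_sp V ?m)" "\<And>p. U_comp V ?m w p = f p"
    by (rule U_exists[OF V, of f ?m, rotated]) (use f in blast)+
  have "bd (U_cpx K V) ?m w \<in> carrier (U_sp V n)"
    using linear_closed[OF U_bd(1)[OF V] w(1)] by simp
  moreover have "U_comp V n (bd (U_cpx K V) ?m w) p = U_comp V n x p" for p
    using U_comp_bd[OF V w(1), of p] f[of p, THEN conjunct2, THEN conjunct1] by (simp add: w(2))
  ultimately have "bd (U_cpx K V) ?m w = x"
    by (intro U_eqI[OF V _ x])
  moreover have "U_comp V ?m w p = \<zero>\<^bsub>sp V (?m, p)\<^esub>" if "U_comp V n x p = \<zero>\<^bsub>sp V (n, p)\<^esub>" for p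
    using f[of p] that unfolding w(2) by blast
  ultimately show ?thesis
    by (rule that[OF w(1)])
qed

lemma pure_boundary:
  assumes "pure_homology V" "p \<noteq> n" "x \<in> cycles V (n, p)"
  shows "x \<in> boundaries V (n, p)"
proof -
  have "boundaries V (n, p) +>\<^bsub>sp V (n, p)\<^esub> x \<in> carrier (homology V (n, p))"
    using homology_facts(3)[OF V, of "(n, p)"] assms(3) by blast
  then have "boundaries V (n, p) +>\<^bsub>sp V (n, p)\<^esub> x = \<zero>\<^bsub>homology V (n, p)\<^esub>"
    using assms(1,2) unfolding pure_homology_def by blast
  then show ?thesis
    using homology_facts(4)[OF V assms(3)] by simp
qed

lemma trunc_cpx_cycles: "cycles (trunc_cpx V) n = trunc V n \<inter> cycles (U_cpx K V) n"
  using trunc_subset by (auto simp: cycles_def sub_cpx_def)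

lemma trunc_boundary:
  assumes pure: "pure_homology V" and x: "x \<in> trunc V n" "x \<in> cycles (U_cpx K V) n" and xn: "U_comp V n x n \<in> boundaries V (n, n)"
  shows "x \<in> boundaries (trunc_cpx V) n"
proof -
  have "U_comp V n x p \<in> boundaries V (n, p)" for p
    using xn pure_boundary[OF pure _ U_comp_cycle[OF x(2)]] by (cases "p = n") auto
  then obtain w where w: "w \<in> carrier (U_sp V (n - bdeg))" "bd (U_cpx K V) (n - bdeg) w = x"
    and w0: "\<And>p. U_comp V n x p = \<zero>\<^bsub>sp V (n, p)\<^esub> \<Longrightarrow> U_comp V (n - bdeg) w p = \<zero>\<^bsub>sp V (n - bdeg, p)\<^esub>"
    using U_boundary_lift[OF trunc_closed[OF x(1)]] by blast
  \<comment> \<open>Here n - bdeg is n + 1. Since \<open>x\<close> has no components of weight above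
    n, neither does its primitive \<open>w\<close>; in particular the diagonal component of
    \<open>w\<close> is zero and so a cycle, as \<open>trunc\<close> demands.\<close>
  have "U_comp V (n - bdeg) w p = \<zero>\<^bsub>sp V (n - bdeg, p)\<^esub>" if "p \<ge> n - bdeg" for p
    using w0 x(1) that by (simp add: trunc_def bdeg_int_def)
  then have "w \<in> trunc V (n - bdeg)"
    using w(1) cycles_module_closed(1)[OF V] by (simp add: trunc_def)
  then show ?thesis
    using w(2) by (auto simp: boundaries_def sub_cpx_def)
qed

text \<open>Subtracting the component of weight \<open>n\<close> leaves only components of other
  weights. These are cycles and therefore boundaries by purity, and \<open>U_boundary_lift\<close>
  joins their primitives.\<close>

lemma cycle_homologous_top:
  assumes pure: "pure_homology V" and y: "y \<in> cycles (U_cpx K V) n"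
  shows "y \<ominus>\<^bsub>sp (U_cpx K V) n\<^esub> U_in V n n (U_comp V n y n) \<in> boundaries (U_cpx K V) n"
proof -
  let ?x = "U_in V n n (U_comp V n y n)"
  have yc: "y \<in> carrier (U_sp V n)" using cycles_closed[OF y] by (simp add: sp_U_cpx[OF V])
  note yn = U_comp_closed[OF V yc, of n]
  note x = U_in_closed[OF V yn]
  have c: "U_comp V n (y \<ominus>\<^bsub>U_sp V n\<^esub> ?x) p = (if p = n then \<zero>\<^bsub>sp V (n, p)\<^esub> else U_comp V n y p)" for p
    using M[of "(n, p)"] U_comp_closed[OF V yc, of p]
    by (auto simp: linear_diff[OF U_comp_linear[OF V] UM M yc x] U_comp_in[OF V yn])
      (simp add: a_minus_def module_neg_unique[of _ "\<zero>\<^bsub>sp V (n, p)\<^esub>" "\<zero>\<^bsub>sp V (n, p)\<^esub>"])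
  have "\<zero>\<^bsub>sp V (n, n)\<^esub> \<in> boundaries V (n, n)"
    using submodule_closed(2)[OF boundaries_submodule[OF V] cycle_module_module[OF V], of "(n, n)"] by simp
  then have "U_comp V n (y \<ominus>\<^bsub>U_sp V n\<^esub> ?x) p \<in> boundaries V (n, p)" for p
    using pure_boundary[OF pure _ U_comp_cycle[OF y], of p] by (simp add: c)
  moreover have "y \<ominus>\<^bsub>U_sp V n\<^esub> ?x \<in> carrier (U_sp V n)"
    using UM yc x by simp
  ultimately obtain w where "w \<in> carrier (U_sp V (n - bdeg))" "bd (U_cpx K V) (n - bdeg) w = y \<ominus>\<^bsub>U_sp V n\<^esub> ?x"
    using U_boundary_lift by blast
  then show ?thesis
    using boundariesI[of w "U_cpx K V" "n - bdeg" n] by (simp add: sp_U_cpx[OF V])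
qed

text \<open>Surjectivity on homology holds because a cycle is homologous to its component of weight
  n, which lies in the truncation. Injectivity rests on \<open>trunc_boundary\<close>: the primitive
  can be chosen inside the truncation.\<close>

lemma trunc_incl_quasi_iso:
  assumes pure: "pure_homology V" and T: "chain_complex K (trunc_cpx V)"
  defines "f \<equiv> \<lparr>src = trunc_cpx V, tgt = U_cpx K V, fn = \<lambda>n. \<lambda>x\<in>trunc V n. x\<rparr>"
  shows "chain_map K f" "quasi_iso K f"
proof -
  have spT: "sp (trunc_cpx V) n = (sp (U_cpx K V) n)\<lparr>carrier := trunc V n\<rparr>" "bd (trunc_cpx V) n = bd (U_cpx K V) n" for n
    by (simp_all add: sub_cpx_def)
  have l: "f \<in> linear_cmaps (trunc_cpx V) (U_cpx K V)"
    using trunc_subset trunc_zero trunc_add trunc_smult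
    by (auto simp: f_def linear_cmaps_def linear_cmap_def linear_maps_def spT)
  show c: "chain_map K f"
    unfolding chain_map_iff[OF l T U] by (auto simp: f_def spT trunc_bd)
  have fs: "src f = trunc_cpx V" "tgt f = U_cpx K V" "\<And>n x. x \<in> trunc V n \<Longrightarrow> fn f n x = x"
    by (simp_all add: f_def)
  show "quasi_iso K f"
    unfolding quasi_iso_iff[OF c] fs(1,2)
  proof (intro allI conjI ballI impI)
    fix n x assume x: "x \<in> cycles (trunc_cpx V) n" and "fn f n x \<in> boundaries (U_cpx K V) n"
    then have "x \<in> boundaries (U_cpx K V) n" by (simp add: trunc_cpx_cycles fs(3))
    with x show "x \<in> boundaries (trunc_cpx V) n"
      by (intro trunc_boundary[OF pure] U_comp_boundary) (auto simp: trunc_cpx_cycles)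
  next
    fix n y assume y: "y \<in> cycles (U_cpx K V) n"
    let ?x = "U_in V n n (U_comp V n y n)"
    have "?x \<in> trunc V n" "?x \<in> cycles (U_cpx K V) n"
      by (rule U_in_trunc U_in_cycle, rule U_comp_cycle[OF y])+
    then show "\<exists>x \<in> cycles (trunc_cpx V) n. y \<ominus>\<^bsub>sp (U_cpx K V) n\<^esub> fn f n x \<in> boundaries (U_cpx K V) n"
      using cycle_homologous_top[OF pure y] by (intro bexI[of _ ?x]) (simp_all add: trunc_cpx_cycles fs(3))
  qed
qed

lemma top_class_quasi_iso:
  assumes pure: "pure_homology V" and T: "chain_complex K (trunc_cpx V)"
  defines "f \<equiv> \<lparr>src = trunc_cpx V, tgt = H_cpx (U_cpx K V), fn = \<lambda>n. \<lambda>x\<in>trunc V n. top_class V n x\<rparr>"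
  shows "chain_map K f" "quasi_iso K f"
proof -
  have spT: "sp (trunc_cpx V) n = (U_sp V n)\<lparr>carrier := trunc V n\<rparr>" "bd (trunc_cpx V) n = bd (U_cpx K V) n" for n
    by (simp_all add: sub_cpx_def sp_U_cpx[OF V])
  have fs: "src f = trunc_cpx V" "tgt f = H_cpx (U_cpx K V)" "\<And>n x. x \<in> trunc V n \<Longrightarrow> fn f n x = top_class V n x"
    by (simp_all add: f_def)
  have xn: "U_comp V n x n \<in> cycles V (n, n)" if "x \<in> trunc V n" for x n
    using that by (simp add: trunc_def)
  have tl: "top_class V n \<in> linear_maps K (sp (trunc_cpx V) n) (sp (H_cpx (U_cpx K V)) n)" for n
  proof -
    have 1: "(\<lambda>x. U_comp V n x n) \<in> linear_maps K (sp (trunc_cpx V) n) (cycle_module V (n, n))"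
      unfolding spT cycle_module_def by (rule linear_maps_sub[OF U_comp_linear[OF V]]) (auto simp: trunc_closed xn)
    have 2: "U_in V n n \<in> linear_maps K (cycle_module V (n, n)) (cycle_module (U_cpx K V) n)"
      unfolding cycle_module_def sp_U_cpx[OF V]
      by (rule linear_maps_sub[OF U_in_linear[OF V]]) (auto simp: cycles_closed U_in_cycle)
    show ?thesis
      unfolding top_class_def by (rule linear_comp[OF linear_comp[OF 1 2] H_class_linear[OF U]])
  qed
  have l: "f \<in> linear_cmaps (trunc_cpx V) (H_cpx (U_cpx K V))"
    using linear_restrict[OF tl chain_complex_module[OF T]]
    by (simp add: f_def linear_cmaps_def linear_cmap_def sub_cpx_def)
  have zero: "top_class V n x = \<zero>\<^bsub>sp (H_cpx (U_cpx K V)) n\<^esub> \<longleftrightarrow> U_comp V n x n \<in> boundaries V (n, n)" if x: "x \<in> trunc V n" for n x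
    unfolding top_class_def H_class_zero_iff[OF U U_in_cycle[OF xn[OF x]]]
    using U_in_boundary[of "U_comp V n x n" n n] U_comp_boundary[of "U_in V n n (U_comp V n x n)" n n]
    by (auto simp: U_comp_in[OF V cycles_closed[OF xn[OF x]]])
  show c: "chain_map K f"
    unfolding chain_map_iff[OF l T H_complex[OF U]]
  proof (intro allI ballI)
    fix n x assume "x \<in> carrier (sp (trunc_cpx V) n)"
    then have x: "x \<in> trunc V n" by (simp add: spT)
    \<comment> \<open>The target has zero differential, so differentials must have zero top class.
      The component of weight n - 1 of the differential of \<open>x\<close> is the differential of a
      component of \<open>x\<close>, and so a boundary of \<open>V\<close>.\<close>
    have "(n, n + bdeg) + bdeg = (n + bdeg, n + bdeg)" by simp
    from boundariesI[OF U_comp_closed[OF V trunc_closed[OF x], of "n + bdeg"] this]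
    have "top_class V (n + bdeg) (bd (U_cpx K V) n x) = \<zero>\<^bsub>sp (H_cpx (U_cpx K V)) (n + bdeg)\<^esub>"
      using zero[OF trunc_bd[OF x]] U_comp_bd[OF V trunc_closed[OF x], of "n + bdeg"] by simp
    then show "bd (H_cpx (U_cpx K V)) n (fn f n x) = fn f (n + bdeg) (bd (trunc_cpx V) n x)"
      by (simp add: spT fs(3) x trunc_bd bd_H_cpx[OF U])
  qed
  show "quasi_iso K f"
    unfolding quasi_iso_iff[OF c] fs(1,2) cycles_H[OF U] boundaries_H[OF U]
  proof (intro allI conjI ballI impI)
    fix n x assume x: "x \<in> cycles (trunc_cpx V) n" and "fn f n x \<in> {\<zero>\<^bsub>sp (H_cpx (U_cpx K V)) n\<^esub>}"
    then show "x \<in> boundaries (trunc_cpx V) n"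
      using zero by (intro trunc_boundary[OF pure]) (auto simp: trunc_cpx_cycles fs(3))
  next
    fix n t assume t: "t \<in> carrier (sp (H_cpx (U_cpx K V)) n)"
    then obtain y where y: "y \<in> cycles (U_cpx K V) n" "t = H_class (U_cpx K V) n y"
      using H_cases[OF U] by blast
    let ?x = "U_in V n n (U_comp V n y n)"
    note yn = U_comp_cycle[OF y(1), of n]
    have x: "?x \<in> trunc V n" "?x \<in> cycles (U_cpx K V) n"
      by (rule U_in_trunc U_in_cycle, rule yn)+
    have "t = H_class (U_cpx K V) n ?x"
      unfolding y(2) H_class_eq_iff[OF U y(1) x(2)] by (rule cycle_homologous_top[OF pure y(1)])
    also have "\<dots> = fn f n ?x"
      by (simp add: fs(3) x(1) top_class_def U_comp_in[OF V cycles_closed[OF yn]])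
    finally show "\<exists>x \<in> cycles (trunc_cpx V) n. t \<ominus>\<^bsub>sp (H_cpx (U_cpx K V)) n\<^esub> fn f n x \<in> {\<zero>\<^bsub>sp (H_cpx (U_cpx K V)) n\<^esub>}"
      using x t module_diff_self[OF chain_complex_module[OF H_complex[OF U]] t]
      by (intro bexI[of _ ?x]) (simp_all add: trunc_cpx_cycles)
  qed
qed

end

end

section \<open>Weights of products, and formality of pure functors\<close>

context small_ring
begin

lemma U_bilinear_eq:
  fixes V W :: "(int \<times> int, 'k, 'u) cpx"
  assumes V: "chain_complex K V" and W: "chain_complex K W" and X: "module K X"
    and \<beta>: "\<beta> \<in> bilinear_maps (U_sp V a) (U_sp W b) X" and \<gamma>: "\<gamma> \<in> bilinear_maps (U_sp V a) (U_sp W b) X"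
    and eq: "\<And>p q x y. \<lbrakk>x \<in> carrier (sp V (a, p)); y \<in> carrier (sp W (b, q))\<rbrakk> \<Longrightarrow>
      \<beta> (U_in V a p x) (U_in W b q y) = \<gamma> (U_in V a p x) (U_in W b q y)"
    and x: "x \<in> carrier (U_sp V a)" and y: "y \<in> carrier (U_sp W b)"
  shows "\<beta> x y = \<gamma> x y"
proof (rule linear_eq_on_spans[OF U_spans[OF V] U_sp_module[OF V] X bilinear_left[OF \<beta> y] bilinear_left[OF \<gamma> y] _ x])
  fix s assume "s \<in> U_gens V a"
  then obtain p z where z: "z \<in> carrier (sp V (a, p))" "s = U_in V a p z" by blast
  have s: "s \<in> carrier (U_sp V a)"
    unfolding z(2) by (rule U_in_closed[OF V z(1)])
  show "\<beta> s y = \<gamma> s y"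
    by (rule linear_eq_on_spans[OF U_spans[OF W] U_sp_module[OF W] X bilinear_right[OF \<beta> s] bilinear_right[OF \<gamma> s] _ y])
      (use eq[OF z(1)] z(2) in blast)
qed

text \<open>The projection \<open>t\<close> discards the weights above \<open>n\<close>. Vanishing
  in these weights is thereby expressed as t x = x, and a claim about such x becomes one about t x
  for arbitrary x, which can be checked on homogeneous elements.\<close>

lemma U_truncate:
  fixes V :: "(int \<times> int, 'k, 'u) cpx"
  assumes V: "chain_complex K V"
  obtains t where "t \<in> linear_maps K (U_sp V n) (U_sp V n)"
    "\<And>p x. x \<in> carrier (sp V (n, p)) \<Longrightarrow> t (U_in V n p x) = (if p \<le> n then U_in V n p x else \<zero>\<^bsub>U_sp V n\<^esub>)"
    "\<And>x. \<lbrakk>x \<in> carrier (U_sp V n); \<And>p. p > n \<Longrightarrow> U_comp V n x p = \<zero>\<^bsub>sp V (n, p)\<^esub>\<rbrakk> \<Longrightarrow> t x = x"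
proof -
  note M = chain_complex_module[OF V] and UM = U_sp_module[OF V]
  have "(if p \<le> n then U_in V n p else (\<lambda>x. \<zero>\<^bsub>U_sp V n\<^esub>)) \<in> linear_maps K (sp V (n, p)) (U_sp V n)" for p
    by (auto intro: U_in_linear[OF V] linear_zero_map[OF UM])
  then obtain t where t: "t \<in> linear_maps K (U_sp V n) (U_sp V n)"
    and t': "\<And>p x. x \<in> carrier (sp V (n, p)) \<Longrightarrow> t (U_in V n p x) = (if p \<le> n then U_in V n p else (\<lambda>x. \<zero>\<^bsub>U_sp V n\<^esub>)) x"
    using U_lift[OF V UM, of "\<lambda>p. if p \<le> n then U_in V n p else (\<lambda>x. \<zero>\<^bsub>U_sp V n\<^esub>)"] by blast
  have tv: "t (U_in V n p x) = (if p \<le> n then U_in V n p x else \<zero>\<^bsub>U_sp V n\<^esub>)" if "x \<in> carrier (sp V (n, p))" for p x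
    using t'[OF that] by simp
  have tc: "U_comp V n (t x) p = (if p \<le> n then U_comp V n x p else \<zero>\<^bsub>sp V (n, p)\<^esub>)" if x: "x \<in> carrier (U_sp V n)" for x p
  proof (rule linear_eq_on_spans[OF U_spans[OF V] UM M linear_comp[OF t U_comp_linear[OF V]] _ _ x])
    show "(\<lambda>x. if p \<le> n then U_comp V n x p else \<zero>\<^bsub>sp V (n, p)\<^esub>) \<in> linear_maps K (U_sp V n) (sp V (n, p))"
      by (cases "p \<le> n") (simp_all add: U_comp_linear[OF V] linear_zero_map[OF M])
    fix s assume "s \<in> U_gens V n"
    then obtain q z where z: "z \<in> carrier (sp V (n, q))" "s = U_in V n q z" by blast
    show "U_comp V n (t s) p = (if p \<le> n then U_comp V n s p else \<zero>\<^bsub>sp V (n, p)\<^esub>)"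
      by (auto simp: z(2) tv[OF z(1)] U_comp_in[OF V z(1)] U_comp_zero[OF V])
  qed
  show thesis
  proof (rule that[OF t tv])
    fix x assume x: "x \<in> carrier (U_sp V n)" and 0: "\<And>p. p > n \<Longrightarrow> U_comp V n x p = \<zero>\<^bsub>sp V (n, p)\<^esub>"
    show "t x = x"
      by (rule U_eqI[OF V linear_closed[OF t x] x]) (simp add: tc[OF x] 0)
  qed
qed

context
  fixes C :: "('o, 'a) smc" and G :: "('o, 'a, (int \<times> int, 'k, 'u) cpx, (int \<times> int, 'k, 'u) cmap) lax_functor"
  assumes G: "lax_elements K emb C G"
begin

interpretation G: lax_elements K emb C G by (rule G)

private lemmas P = weight_functor_pre_lax[OF G]

interpretation U: pre_lax K emb C "UG G" by (rule P)

lemma UG_sp: "X \<in> Obj C \<Longrightarrow> sp (FO (UG G) X) = U_sp (FO G X)"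
  by (simp add: sp_U_cpx[OF G.FO_complex])

lemma U_comp_FA:
  assumes f: "f \<in> Hom C X Y" and X: "X \<in> Obj C" and Y: "Y \<in> Obj C" and x: "x \<in> carrier (U_sp (FO G X) n)"
  shows "U_comp (FO G Y) n (fn (FA (UG G) f) n x) p = fn (FA G f) (n, p) (U_comp (FO G X) n x p)"
proof -
  note cX = G.FO_complex[OF X] and cY = G.FO_complex[OF Y]
  have l: "fn (FA (UG G) f) n \<in> linear_maps K (U_sp (FO G X) n) (U_sp (FO G Y) n)"
    using U.FA_linear[OF f] by (simp only: UG_sp[OF X] UG_sp[OF Y])
  show ?thesis
  proof (rule linear_eq_on_spans[OF U_spans[OF cX] U_sp_module[OF cX] G.FO_module[OF Y] linear_comp[OF l U_comp_linear[OF cY]]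
        linear_comp[OF U_comp_linear[OF cX] G.FA_linear[OF f]] _ x])
    fix s assume "s \<in> U_gens (FO G X) n"
    then obtain q z where z: "z \<in> carrier (sp (FO G X) (n, q))" "s = U_in (FO G X) n q z" by blast
    show "U_comp (FO G Y) n (fn (FA (UG G) f) n s) p = fn (FA G f) (n, p) (U_comp (FO G X) n s p)"
      using linear_zero[OF G.FA_linear[OF f] G.FO_module[OF X] G.FO_module[OF Y]]
      by (simp add: z(2) P(4)[OF f z(1)] U_comp_in[OF cX z(1)] U_comp_in[OF cY linear_closed[OF G.FA_linear[OF f] z(1)]])
  qed
qed

text \<open>In degrees at most \<open>(a, a)\<close> and \<open>(b, b)\<close> weights add up to \<open>a + b\<close> only in one way.\<close>

lemma U_comp_mul:
  assumes X: "X \<in> Obj C" and Y: "Y \<in> Obj C" and x: "x \<in> carrier (U_sp (FO G X) a)" and y: "y \<in> carrier (U_sp (FO G Y) b)"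
    and x0: "\<And>p. p > a \<Longrightarrow> U_comp (FO G X) a x p = \<zero>\<^bsub>sp (FO G X) (a, p)\<^esub>"
    and y0: "\<And>q. q > b \<Longrightarrow> U_comp (FO G Y) b y q = \<zero>\<^bsub>sp (FO G Y) (b, q)\<^esub>"
    and r: "r \<ge> a + b"
  shows "U_comp (FO G (X \<boxtimes>\<^bsub>C\<^esub> Y)) (a + b) (mul (UG G) X Y a b x y) r =
    (if r = a + b then mul G X Y (a, a) (b, b) (U_comp (FO G X) a x a) (U_comp (FO G Y) b y b)
     else \<zero>\<^bsub>sp (FO G (X \<boxtimes>\<^bsub>C\<^esub> Y)) (a + b, r)\<^esub>)"
proof -
  note XY = G.C.tens_obj[OF X Y]
  note cX = G.FO_complex[OF X] and cY = G.FO_complex[OF Y] and cT = G.FO_complex[OF XY]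
  let ?T = "FO G (X \<boxtimes>\<^bsub>C\<^esub> Y)"
  obtain t where t: "t \<in> linear_maps K (U_sp (FO G X) a) (U_sp (FO G X) a)"
    "\<And>p x. x \<in> carrier (sp (FO G X) (a, p)) \<Longrightarrow> t (U_in (FO G X) a p x) = (if p \<le> a then U_in (FO G X) a p x else \<zero>\<^bsub>U_sp (FO G X) a\<^esub>)"
    and tx: "t x = x"
    using U_truncate[OF cX, of a] x x0 by metis
  obtain u where u: "u \<in> linear_maps K (U_sp (FO G Y) b) (U_sp (FO G Y) b)"
    "\<And>q y. y \<in> carrier (sp (FO G Y) (b, q)) \<Longrightarrow> u (U_in (FO G Y) b q y) = (if q \<le> b then U_in (FO G Y) b q y else \<zero>\<^bsub>U_sp (FO G Y) b\<^esub>)"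
    and uy: "u y = y"
    using U_truncate[OF cY, of b] y y0 by metis
  have m: "mul (UG G) X Y a b \<in> bilinear_maps (U_sp (FO G X) a) (U_sp (FO G Y) b) (U_sp ?T (a + b))"
    using U.mul_bilinear[OF X Y, of a b] by (simp only: UG_sp[OF X] UG_sp[OF Y] UG_sp[OF XY])
  \<comment> \<open>The truncations are built into the left side, so that both sides are bilinear on
    the full spaces and agree there. At the given \<open>x\<close> and \<open>y\<close> the
    truncations change nothing, by \<open>tx\<close> and \<open>uy\<close>.\<close>
  let ?\<beta> = "\<lambda>x y. U_comp ?T (a + b) (mul (UG G) X Y a b (t x) (u y)) r"
  let ?\<gamma> = "\<lambda>x y. if r = a + b then mul G X Y (a, a) (b, b) (U_comp (FO G X) a x a) (U_comp (FO G Y) b y b) else \<zero>\<^bsub>sp ?T (a + b, r)\<^esub>"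
  have \<beta>: "?\<beta> \<in> bilinear_maps (U_sp (FO G X) a) (U_sp (FO G Y) b) (sp ?T (a + b, r))"
    by (rule bilinear_comp_out[OF bilinear_comp_left[OF bilinear_comp_right[OF m u(1)] t(1)] U_comp_linear[OF cT]])
  have \<gamma>: "?\<gamma> \<in> bilinear_maps (U_sp (FO G X) a) (U_sp (FO G Y) b) (sp ?T (a + b, r))"
  proof (cases "r = a + b")
    case True
    have "mul G X Y (a, a) (b, b) \<in> bilinear_maps (sp (FO G X) (a, a)) (sp (FO G Y) (b, b)) (sp ?T (a + b, r))"
      using G.mul_bilinear[OF X Y, of "(a, a)" "(b, b)"] True by simp
    from bilinear_comp_left[OF bilinear_comp_right[OF this U_comp_linear[OF cY]] U_comp_linear[OF cX]] True
    show ?thesis by simp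
  qed (use bilinear_zero[OF G.FO_module[OF XY]] in simp)
  have zl: "mul G X Y c d \<zero>\<^bsub>sp (FO G X) c\<^esub> v = \<zero>\<^bsub>sp ?T (c + d)\<^esub>" if "v \<in> carrier (sp (FO G Y) d)" for c d v
    by (rule linear_zero[OF bilinear_left[OF G.mul_bilinear[OF X Y] that] G.FO_module[OF X] G.FO_module[OF XY]])
  have zr: "mul G X Y c d v \<zero>\<^bsub>sp (FO G Y) d\<^esub> = \<zero>\<^bsub>sp ?T (c + d)\<^esub>" if "v \<in> carrier (sp (FO G X) c)" for c d v
    by (rule linear_zero[OF bilinear_right[OF G.mul_bilinear[OF X Y] that] G.FO_module[OF Y] G.FO_module[OF XY]])
  have zl': "mul (UG G) X Y a b \<zero>\<^bsub>U_sp (FO G X) a\<^esub> v = \<zero>\<^bsub>U_sp ?T (a + b)\<^esub>" if "v \<in> carrier (U_sp (FO G Y) b)" for v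
    by (rule linear_zero[OF bilinear_left[OF m that] U_sp_module[OF cX] U_sp_module[OF cT]])
  have zr': "mul (UG G) X Y a b v \<zero>\<^bsub>U_sp (FO G Y) b\<^esub> = \<zero>\<^bsub>U_sp ?T (a + b)\<^esub>" if "v \<in> carrier (U_sp (FO G X) a)" for v
    by (rule linear_zero[OF bilinear_right[OF m that] U_sp_module[OF cY] U_sp_module[OF cT]])
  have eq: "?\<beta> (U_in (FO G X) a p v) (U_in (FO G Y) b q w) = ?\<gamma> (U_in (FO G X) a p v) (U_in (FO G Y) b q w)"
    if v: "v \<in> carrier (sp (FO G X) (a, p))" and w: "w \<in> carrier (sp (FO G Y) (b, q))" for p q v w
  proof -
    note vU = U_in_closed[OF cX v] and wU = U_in_closed[OF cY w]
    have uw: "u (U_in (FO G Y) b q w) \<in> carrier (U_sp (FO G Y) b)"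
      by (rule linear_closed[OF u(1) wU])
    have \<gamma>0: "?\<gamma> (U_in (FO G X) a p v) (U_in (FO G Y) b q w) = \<zero>\<^bsub>sp ?T (a + b, r)\<^esub>" if "p \<noteq> a \<or> q \<noteq> b"
      using that zl[OF U_comp_closed[OF cY wU], of "(a, a)" b] zr[OF U_comp_closed[OF cX vU], of a "(b, b)"]
      by (auto simp: U_comp_in[OF cX v] U_comp_in[OF cY w])
    \<comment> \<open>If neither factor is truncated away and p + q = r, then r \<ge> a + b together
      with p \<le> a and q \<le> b leaves only the last case.\<close>
    consider "p > a" | "p \<le> a" "q > b" | "p \<le> a" "q \<le> b" "p + q \<noteq> r" | "p = a" "q = b" "r = a + b"
      using r by linarith
    then show ?thesis
    proof cases
      case 1
      then show ?thesis using \<gamma>0 by (simp add: t(2)[OF v] zl'[OF uw] U_comp_zero[OF cT])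
    next
      case 2
      then show ?thesis using \<gamma>0 by (simp add: t(2)[OF v] u(2)[OF w] zr'[OF vU] U_comp_zero[OF cT])
    next
      case 3
      have c: "mul G X Y (a, p) (b, q) v w \<in> carrier (sp ?T (a + b, p + q))"
        using G.mul_closed[OF X Y v w] by simp
      have "?\<gamma> (U_in (FO G X) a p v) (U_in (FO G Y) b q w) = \<zero>\<^bsub>sp ?T (a + b, r)\<^esub>"
        using 3 \<gamma>0 by (cases "r = a + b") auto
      then show ?thesis
        using 3 by (simp add: t(2)[OF v] u(2)[OF w] P(2)[OF X Y v w] U_comp_in[OF cT c])
    next
      case 4
      have v': "v \<in> carrier (sp (FO G X) (a, a))" and w': "w \<in> carrier (sp (FO G Y) (b, b))"
        using v w 4 by simp_all
      have c: "mul G X Y (a, a) (b, b) v w \<in> carrier (sp ?T (a + b, a + b))"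
        using G.mul_closed[OF X Y v' w'] by simp
      show ?thesis
        by (simp add: 4 t(2)[OF v'] u(2)[OF w'] P(2)[OF X Y v' w'] U_comp_in[OF cT c] U_comp_in[OF cX v'] U_comp_in[OF cY w'])
    qed
  qed
  show ?thesis
    using U_bilinear_eq[OF cX cY G.FO_module[OF XY] \<beta> \<gamma> _ x y] eq by (simp only: tx uy)
qed

lemma U_comp_one:
  "U_comp (FO G (Unit C)) 0 (one_elt (UG G)) p = (if p = 0 then one_elt G else \<zero>\<^bsub>sp (FO G (Unit C)) (0, p)\<^esub>)"
  using U_comp_in[OF G.FO_complex[OF G.C.unit_obj], of "one_elt G" 0 0 p] G.one_closed' by (simp add: P(3) zero_prod_def)

lemma pure_formal:
  assumes U: "lax_elements K emb C (UG G)" and pure: "\<And>X. X \<in> Obj C \<Longrightarrow> pure_homology (FO G X)"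
  shows "equivclp (weq_step K C) (UG G) (HF (UG G))"
proof -
  interpret UL: lax_elements K emb C "UG G" by (rule U)
  note cx = G.FO_complex and H = homology_functor_lax[OF U]
  have Hom: "X \<in> Obj C" "Y \<in> Obj C" if "f \<in> Hom C X Y" for f X Y
    using that G.C.dom_obj G.C.cod_obj by (auto simp: Hom_def)
  let ?S = "\<lambda>X. trunc (FO G X)"
  let ?T = "sub_functor C (\<lambda>n. n) (UG G) ?S"
  have S_FA: "fn (FA (UG G) f) n x \<in> ?S Y n" if f: "f \<in> Hom C X Y" and X: "X \<in> Obj C" and Y: "Y \<in> Obj C" and x: "x \<in> ?S X n" for f X Y n x
  proof -
    have xc: "x \<in> carrier (U_sp (FO G X) n)" using x by (simp add: trunc_def)
    have "fn (FA (UG G) f) n x \<in> carrier (U_sp (FO G Y) n)"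
      using linear_closed[OF U.FA_linear[OF f], of x n] xc by (simp only: UG_sp[OF X] UG_sp[OF Y])
    then show ?thesis
      using x G.FA_cycle[OF f, of "U_comp (FO G X) n x n" "(n, n)"] linear_zero[OF G.FA_linear[OF f] G.FO_module[OF X] G.FO_module[OF Y]]
      by (simp add: trunc_def U_comp_FA[OF f X Y xc])
  qed
  have S_mul: "mul (UG G) X Y a b x y \<in> ?S (X \<boxtimes>\<^bsub>C\<^esub> Y) (a + b)"
    and U_comp_mul': "U_comp (FO G (X \<boxtimes>\<^bsub>C\<^esub> Y)) (a + b) (mul (UG G) X Y a b x y) (a + b) =
      mul G X Y (a, a) (b, b) (U_comp (FO G X) a x a) (U_comp (FO G Y) b y b)"
    if X: "X \<in> Obj C" and Y: "Y \<in> Obj C" and x: "x \<in> ?S X a" and y: "y \<in> ?S Y b" for X Y a b x y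
  proof -
    have xc: "x \<in> carrier (U_sp (FO G X) a)" and yc: "y \<in> carrier (U_sp (FO G Y) b)"
      using x y by (simp_all add: trunc_def)
    have c: "U_comp (FO G (X \<boxtimes>\<^bsub>C\<^esub> Y)) (a + b) (mul (UG G) X Y a b x y) r =
      (if r = a + b then mul G X Y (a, a) (b, b) (U_comp (FO G X) a x a) (U_comp (FO G Y) b y b)
       else \<zero>\<^bsub>sp (FO G (X \<boxtimes>\<^bsub>C\<^esub> Y)) (a + b, r)\<^esub>)" if "r \<ge> a + b" for r
      by (rule U_comp_mul[OF X Y xc yc _ _ that]) (use x y in \<open>simp_all add: trunc_def\<close>)
    then show "U_comp (FO G (X \<boxtimes>\<^bsub>C\<^esub> Y)) (a + b) (mul (UG G) X Y a b x y) (a + b) =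
        mul G X Y (a, a) (b, b) (U_comp (FO G X) a x a) (U_comp (FO G Y) b y b)"
      by simp
    have "mul (UG G) X Y a b x y \<in> carrier (U_sp (FO G (X \<boxtimes>\<^bsub>C\<^esub> Y)) (a + b))"
      using U.mul_closed[OF X Y, of x a y b] xc yc by (simp only: UG_sp[OF X] UG_sp[OF Y] UG_sp[OF G.C.tens_obj[OF X Y]])
    moreover have "mul G X Y (a, a) (b, b) (U_comp (FO G X) a x a) (U_comp (FO G Y) b y b) \<in> cycles (FO G (X \<boxtimes>\<^bsub>C\<^esub> Y)) (a + b, a + b)"
      using G.mul_cycle[OF X Y, of "U_comp (FO G X) a x a" "(a, a)" "U_comp (FO G Y) b y b" "(b, b)"] x y by (simp add: trunc_def)
    \<comment> \<open>\<open>c\<close> gives both conditions of \<open>trunc\<close>: zero in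
      weights above a + b, and a product of cycles in weight a + b.\<close>
    ultimately show "mul (UG G) X Y a b x y \<in> ?S (X \<boxtimes>\<^bsub>C\<^esub> Y) (a + b)"
      by (simp add: trunc_def c)
  qed
  have S_one: "one_elt (UG G) \<in> ?S (Unit C) 0"
    using U.one_closed' G.one_cycle U_comp_one by (simp add: trunc_def UG_sp[OF G.C.unit_obj, simplified] zero_prod_def)
  have S: "?S X a \<subseteq> carrier (sp (FO (UG G) X) a)" "\<zero>\<^bsub>sp (FO (UG G) X) a\<^esub> \<in> ?S X a"
    "\<lbrakk>x \<in> ?S X a; y \<in> ?S X a\<rbrakk> \<Longrightarrow> x \<oplus>\<^bsub>sp (FO (UG G) X) a\<^esub> y \<in> ?S X a"
    "\<lbrakk>c \<in> carrier K; x \<in> ?S X a\<rbrakk> \<Longrightarrow> c \<odot>\<^bsub>sp (FO (UG G) X) a\<^esub> x \<in> ?S X a"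
    "x \<in> ?S X a \<Longrightarrow> bd (FO (UG G) X) a x \<in> ?S X (a + bdeg)"
    if "X \<in> Obj C" for X a x y c
    unfolding UG_FO by (rule trunc_subset trunc_zero trunc_add trunc_smult trunc_bd, rule cx[OF that], assumption?, assumption?)+
  have T: "lax_elements K emb C ?T"
    "\<lbrakk>X \<in> Obj C; Y \<in> Obj C; x \<in> ?S X a; y \<in> ?S Y b\<rbrakk> \<Longrightarrow> mul ?T X Y a b x y = mul (UG G) X Y a b x y"
    "one_elt ?T = one_elt (UG G)"
    "\<lbrakk>f \<in> Hom C X Y; x \<in> ?S X a\<rbrakk> \<Longrightarrow> fn (FA ?T f) a x = fn (FA (UG G) f) a x" for X Y a b x y f
    by (rule sub_functor_lax[where \<phi> = "\<lambda>n. n", OF U refl refl refl], (rule S S_FA S_mul S_one | assumption)+)+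
  have FOT: "FO ?T X = trunc_cpx (FO G X)" for X
    by (simp add: sub_functor_def Let_def)
  have xT: "x \<in> ?S X n" if "x \<in> carrier (sp (FO ?T X) n)" for X x n
    using that by (simp add: sub_functor_simps)
  have Tc: "chain_complex K (trunc_cpx (FO G X))" if "X \<in> Obj C" for X
    using pre_lax.FO_complex[OF lax_elements.axioms(1)[OF T(1)] that] by (simp add: FOT)
  have step1: "weq_step K C ?T (UG G)"
  proof (rule weq_stepI[OF T(1) U, where \<eta> = "\<lambda>X. \<lparr>src = trunc_cpx (FO G X), tgt = U_cpx K (FO G X), fn = \<lambda>n. \<lambda>x\<in>trunc (FO G X) n. x\<rparr>"])
    fix X assume X: "X \<in> Obj C"
    note q = trunc_incl_quasi_iso[OF cx[OF X] pure[OF X] Tc[OF X]]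
    show "\<lparr>src = trunc_cpx (FO G X), tgt = U_cpx K (FO G X), fn = \<lambda>n. \<lambda>x\<in>trunc (FO G X) n. x\<rparr> \<in> Hom (complexes K) (FO ?T X) (FO (UG G) X)"
      using q(1) by (simp add: Hom_complexes FOT)
    show "quasi_iso K \<lparr>src = trunc_cpx (FO G X), tgt = U_cpx K (FO G X), fn = \<lambda>n. \<lambda>x\<in>trunc (FO G X) n. x\<rparr>"
      by (rule q(2))
  qed (use xT T(2-4) S_one S_mul S_FA Hom in auto)
  \<comment> \<open>On the truncation the diagonal component of a product is the product of the
    diagonal components, so taking top classes is multiplicative although it discards all lower
    weights.\<close>
  have top_mul: "top_class (FO G (X \<boxtimes>\<^bsub>C\<^esub> Y)) (a + b) (mul (UG G) X Y a b x y) =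
      mul (HF (UG G)) X Y a b (top_class (FO G X) a x) (top_class (FO G Y) b y)"
    if X: "X \<in> Obj C" and Y: "Y \<in> Obj C" and x: "x \<in> ?S X a" and y: "y \<in> ?S Y b" for X Y a b x y
  proof -
    have xa: "U_comp (FO G X) a x a \<in> cycles (FO G X) (a, a)" and yb: "U_comp (FO G Y) b y b \<in> cycles (FO G Y) (b, b)"
      using x y by (simp_all add: trunc_def)
    show ?thesis
      using H(2)[OF X Y, of "U_in (FO G X) a a (U_comp (FO G X) a x a)" a "U_in (FO G Y) b b (U_comp (FO G Y) b y b)" b]
        U_in_cycle[OF cx[OF X] xa] U_in_cycle[OF cx[OF Y] yb] P(2)[OF X Y cycles_closed[OF xa] cycles_closed[OF yb]]
      by (simp add: top_class_def U_comp_mul'[OF X Y x y])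
  qed
  have step2: "weq_step K C ?T (HF (UG G))"
  proof (rule weq_stepI[OF T(1) H(1), where \<eta> = "\<lambda>X. \<lparr>src = trunc_cpx (FO G X), tgt = H_cpx (U_cpx K (FO G X)), fn = \<lambda>n. \<lambda>x\<in>trunc (FO G X) n. top_class (FO G X) n x\<rparr>"])
    fix X assume X: "X \<in> Obj C"
    note q = top_class_quasi_iso[OF cx[OF X] pure[OF X] Tc[OF X]]
    show "\<lparr>src = trunc_cpx (FO G X), tgt = H_cpx (U_cpx K (FO G X)), fn = \<lambda>n. \<lambda>x\<in>trunc (FO G X) n. top_class (FO G X) n x\<rparr>
        \<in> Hom (complexes K) (FO ?T X) (FO (HF (UG G)) X)"
      using q(1) by (simp add: Hom_complexes FOT)
    show "quasi_iso K \<lparr>src = trunc_cpx (FO G X), tgt = H_cpx (U_cpx K (FO G X)), fn = \<lambda>n. \<lambda>x\<in>trunc (FO G X) n. top_class (FO G X) n x\<rparr>"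
      by (rule q(2))
  next
    fix f X Y n x assume f: "f \<in> Hom C X Y" and "x \<in> carrier (sp (FO ?T X) n)"
    note X = Hom(1)[OF f] and Y = Hom(2)[OF f]
    have x: "x \<in> ?S X n" by (rule xT) fact
    then have xc: "x \<in> carrier (U_sp (FO G X) n)" and xn: "U_comp (FO G X) n x n \<in> cycles (FO G X) (n, n)"
      by (simp_all add: trunc_def)
    have "top_class (FO G Y) n (fn (FA (UG G) f) n x) = fn (FA (HF (UG G)) f) n (top_class (FO G X) n x)"
      using H(4)[OF f, of "U_in (FO G X) n n (U_comp (FO G X) n x n)" n] U_in_cycle[OF cx[OF X] xn] P(4)[OF f cycles_closed[OF xn]]
      by (simp add: top_class_def U_comp_FA[OF f X Y xc])
    then show "fn \<lparr>src = trunc_cpx (FO G Y), tgt = H_cpx (U_cpx K (FO G Y)), fn = \<lambda>n. \<lambda>x\<in>trunc (FO G Y) n. top_class (FO G Y) n x\<rparr> n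
          (fn (FA ?T f) n x) = fn (FA (HF (UG G)) f) n
          (fn \<lparr>src = trunc_cpx (FO G X), tgt = H_cpx (U_cpx K (FO G X)), fn = \<lambda>n. \<lambda>x\<in>trunc (FO G X) n. top_class (FO G X) n x\<rparr> n x)"
      using x T(4)[OF f x] S_FA[OF f X Y x] by simp
  next
    fix X Y a b x y assume X: "X \<in> Obj C" and Y: "Y \<in> Obj C" and "x \<in> carrier (sp (FO ?T X) a)" "y \<in> carrier (sp (FO ?T Y) b)"
    then have x: "x \<in> ?S X a" and y: "y \<in> ?S Y b" using xT by blast+
    show "fn \<lparr>src = trunc_cpx (FO G (X \<boxtimes>\<^bsub>C\<^esub> Y)), tgt = H_cpx (U_cpx K (FO G (X \<boxtimes>\<^bsub>C\<^esub> Y))),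
            fn = \<lambda>n. \<lambda>x\<in>trunc (FO G (X \<boxtimes>\<^bsub>C\<^esub> Y)) n. top_class (FO G (X \<boxtimes>\<^bsub>C\<^esub> Y)) n x\<rparr> (a + b) (mul ?T X Y a b x y) =
        mul (HF (UG G)) X Y a b
          (fn \<lparr>src = trunc_cpx (FO G X), tgt = H_cpx (U_cpx K (FO G X)), fn = \<lambda>n. \<lambda>x\<in>trunc (FO G X) n. top_class (FO G X) n x\<rparr> a x)
          (fn \<lparr>src = trunc_cpx (FO G Y), tgt = H_cpx (U_cpx K (FO G Y)), fn = \<lambda>n. \<lambda>x\<in>trunc (FO G Y) n. top_class (FO G Y) n x\<rparr> b y)"
      using x y S_mul[OF X Y x y] by (simp add: T(2)[OF X Y x y] top_mul[OF X Y x y])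
  next
    have "top_class (FO G (Unit C)) 0 (one_elt (UG G)) = one_elt (HF (UG G))"
      unfolding top_class_def H(3) U_comp_one by (simp add: P(3))
    then show "fn \<lparr>src = trunc_cpx (FO G (Unit C)), tgt = H_cpx (U_cpx K (FO G (Unit C))),
          fn = \<lambda>n. \<lambda>x\<in>trunc (FO G (Unit C)) n. top_class (FO G (Unit C)) n x\<rparr> 0 (one_elt ?T) = one_elt (HF (UG G))"
      using S_one by (simp add: T(3))
  qed
  show ?thesis
    using step1 step2 by (blast intro: r_into_equivclp equivclp_sym equivclp_trans)
qed

end

end

section \<open>Complexes concentrated on the diagonal\<close>

context small_ring
begin

text \<open>Stronger than pure homology for complexes, and easily seen to pass to tensor products.
  This matters because \<open>Mu\<close> has to be a morphism of the full subcategory, which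
  requires its source, a tensor product, to be pure.\<close>

definition diagonal :: "(int \<times> int, 'k, 'u) cpx \<Rightarrow> bool" where
  "diagonal V \<longleftrightarrow> (\<forall>n p. p \<noteq> n \<longrightarrow> carrier (sp V (n, p)) = {\<zero>\<^bsub>sp V (n, p)\<^esub>})"

lemma diagonalD: "\<lbrakk>diagonal V; snd a \<noteq> fst a; x \<in> carrier (sp V a)\<rbrakk> \<Longrightarrow> x = \<zero>\<^bsub>sp V a\<^esub>"
  by (cases a) (auto simp: diagonal_def)

lemma diagonal_pure:
  assumes V: "chain_complex K V" and d: "diagonal V"
  shows "pure_homology V"
  unfolding pure_homology_def
proof (intro allI impI)
  fix n p :: int assume "p \<noteq> n"
  then have "cycles V (n, p) = {\<zero>\<^bsub>sp V (n, p)\<^esub>}"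
    using d cycles_module_closed(1)[OF V, of "(n, p)"] by (auto simp: diagonal_def dest: cycles_closed)
  then have "carrier (homology V (n, p)) = {boundaries V (n, p) +>\<^bsub>sp V (n, p)\<^esub> \<zero>\<^bsub>sp V (n, p)\<^esub>}"
    using homology_facts(3)[OF V, of "(n, p)"] by simp
  moreover have "\<zero>\<^bsub>homology V (n, p)\<^esub> \<in> carrier (homology V (n, p))"
    by (rule module_zero_closed[OF homology_facts(1)[OF V]])
  ultimately show "carrier (homology V (n, p)) = {\<zero>\<^bsub>homology V (n, p)\<^esub>}"
    by simp
qed

text \<open>The sum of two diagonal bidegrees is diagonal. An elementary tensor in an off-diagonal
  bidegree therefore has a factor off the diagonal, and this factor is zero.\<close>

lemma diagonal_tens:
  assumes V: "chain_complex K V" and W: "chain_complex K W" and dV: "diagonal V" and dW: "diagonal W"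
  shows "diagonal (tens_cpx K V W)"
  unfolding diagonal_def
proof (intro allI impI)
  fix n p :: int assume np: "p \<noteq> n"
  note Vm = chain_complex_module[OF V] and Wm = chain_complex_module[OF W]
  note M = tens_sp_module[OF Vm Wm, of "(n, p)"]
  have "x = \<zero>\<^bsub>tens_sp K V W (n, p)\<^esub>" if x: "x \<in> carrier (tens_sp K V W (n, p))" for x
  proof (rule linear_eq_on_spans[OF tens_spans_carrier[OF Vm Wm] M M linear_id linear_zero_map[OF M] _ x])
    fix s assume "s \<in> {ten K V W a b x y | a b x y. a + b = (n, p) \<and> x \<in> carrier (sp V a) \<and> y \<in> carrier (sp W b)}"
    then obtain a b x y where ab: "a + b = (n, p)" and x: "x \<in> carrier (sp V a)" and y: "y \<in> carrier (sp W b)"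
      and s: "s = ten K V W a b x y" by blast
    have "snd a \<noteq> fst a \<or> snd b \<noteq> fst b"
      using ab np by (cases a; cases b) auto
    then have "x = \<zero>\<^bsub>sp V a\<^esub> \<or> y = \<zero>\<^bsub>sp W b\<^esub>"
      using diagonalD[OF dV _ x] diagonalD[OF dW _ y] by blast
    then show "s = \<zero>\<^bsub>tens_sp K V W (n, p)\<^esub>"
      using linear_zero[OF bilinear_left[OF ten_bilinear[OF Vm Wm ab] y] Vm M]
        linear_zero[OF bilinear_right[OF ten_bilinear[OF Vm Wm ab] x] Wm M] s by auto
  qed
  then show "carrier (sp (tens_cpx K V W) (n, p)) = {\<zero>\<^bsub>sp (tens_cpx K V W) (n, p)\<^esub>}"
    unfolding tens_sp_cpx[OF V W] using module_zero_closed[OF M] by blast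
qed

lemma diagonal_unit: "diagonal (unit_cpx K)"
  by (simp add: diagonal_def carrier_unit_cpx zero_prod_def)

section \<open>Functors into complexes with pure homology\<close>

lemma Hom_pure: "f \<in> Hom (Ch_grVect_pure K) V W \<longleftrightarrow> f \<in> Hom (complexes K) V W \<and> pure_homology V \<and> pure_homology W"
  by (auto simp: Hom_def Ch_grVect_pure_def Ch_grVect_def full_subcategory_def complexes_def)

lemma pure_category_simps:
  "Obj (Ch_grVect_pure K) = {V \<in> Obj (complexes K). pure_homology V}"
  "Id (Ch_grVect_pure K) = Id (complexes K)" "Comp (Ch_grVect_pure K) = Comp (complexes K)"
  "TensO (Ch_grVect_pure K) = TensO (complexes K)" "TensA (Ch_grVect_pure K) = TensA (complexes K)"
  "Unit (Ch_grVect_pure K) = Unit (complexes K)" "Assoc (Ch_grVect_pure K) = Assoc (complexes K)"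
  "LUnit (Ch_grVect_pure K) = LUnit (complexes K)" "RUnit (Ch_grVect_pure K) = RUnit (complexes K)"
  "Braid (Ch_grVect_pure K) = Braid (complexes K)"
  by (simp_all add: Ch_grVect_pure_def Ch_grVect_def full_subcategory_def)

text \<open>The subcategory is full and shares all operations with \<open>complexes K\<close>, so
  the extra information lies in the objects alone.\<close>

lemma lax_pureD:
  assumes "lax_symmetric_monoidal_functor C (Ch_grVect_pure K) G"
  shows "lax_symmetric_monoidal_functor C (complexes K) G" and "X \<in> Obj C \<Longrightarrow> pure_homology (FO G X)"
proof -
  interpret lax_symmetric_monoidal_functor C "Ch_grVect_pure K" G by (rule assms)
  show "lax_symmetric_monoidal_functor C (complexes K) G"
    using F_obj F_hom F_id F_comp Mu_hom Eps_hom Mu_natural Mu_assoc Mu_lunit Mu_runit Mu_symmetric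
    by unfold_locales (simp_all add: pure_category_simps Hom_pure)
  show "X \<in> Obj C \<Longrightarrow> pure_homology (FO G X)"
    using F_obj by (simp add: pure_category_simps)
qed

text \<open>In a full subcategory a morphism needs a source and a target among its objects. For
  \<open>Mu\<close> and \<open>Eps\<close> the sources are tensor products and the unit, which are
  covered by \<open>diagonal_tens\<close> and \<open>diagonal_unit\<close>.\<close>

lemma lax_pureI:
  fixes G :: "('o, 'a, (int \<times> int, 'k, 'u) cpx, (int \<times> int, 'k, 'u) cmap) lax_functor"
  assumes C: "symmetric_monoidal_category C" and G: "lax_symmetric_monoidal_functor C (complexes K) G"
    and d: "\<And>X. X \<in> Obj C \<Longrightarrow> diagonal (FO G X)"
  shows "lax_symmetric_monoidal_functor C (Ch_grVect_pure K) G"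
proof -
  interpret C: symmetric_monoidal_category C by (rule C)
  interpret lax_symmetric_monoidal_functor C "complexes K" G by (rule G)
  have c: "chain_complex K (FO G X)" if "X \<in> Obj C" for X
    using F_obj[OF that] by (simp add: complexes_def)
  have p: "pure_homology (FO G X)" if "X \<in> Obj C" for X
    by (rule diagonal_pure[OF c[OF that] d[OF that]])
  have pt: "pure_homology (FO G X \<boxtimes>\<^bsub>complexes K\<^esub> FO G Y)" if "X \<in> Obj C" "Y \<in> Obj C" for X Y
    using diagonal_pure[OF tens_chain_complex[OF c[OF that(1)] c[OF that(2)]] diagonal_tens[OF c[OF that(1)] c[OF that(2)] d[OF that(1)] d[OF that(2)]]]
    by (simp add: complexes_def)
  have pu: "pure_homology (Unit (complexes K) :: (int \<times> int, 'k, 'u) cpx)"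
    using diagonal_pure[OF unit_chain_complex diagonal_unit] by (simp add: complexes_def)
  have Hom: "X \<in> Obj C" "Y \<in> Obj C" if "f \<in> Hom C X Y" for f X Y
    using that C.dom_obj C.cod_obj by (auto simp: Hom_def)
  note o = C.tens_obj C.unit_obj
  show ?thesis
  proof
    show "FO G X \<in> Obj (Ch_grVect_pure K)" if "X \<in> Obj C" for X
      using F_obj[OF that] p[OF that] by (simp add: pure_category_simps)
    show "FA G f \<in> Hom (Ch_grVect_pure K) (FO G X) (FO G Y)" if "f \<in> Hom C X Y" for f X Y
      using F_hom[OF that] p Hom[OF that] by (simp add: Hom_pure)
    show "Mu G X Y \<in> Hom (Ch_grVect_pure K) (FO G X \<boxtimes>\<^bsub>Ch_grVect_pure K\<^esub> FO G Y) (FO G (X \<boxtimes>\<^bsub>C\<^esub> Y))"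
      if "X \<in> Obj C" "Y \<in> Obj C" for X Y
      using Mu_hom[OF that] pt[OF that] p[OF o(1)[OF that]] by (simp add: Hom_pure pure_category_simps)
    show "Eps G \<in> Hom (Ch_grVect_pure K) (Unit (Ch_grVect_pure K)) (FO G (Unit C))"
      using Eps_hom pu p[OF o(2)] by (simp add: Hom_pure pure_category_simps)
  qed (use F_id F_comp Mu_natural Mu_assoc Mu_lunit Mu_runit Mu_symmetric in \<open>simp_all add: pure_category_simps\<close>)
qed

lemma homology_factors_through_pure:
  assumes F: "lax_elements K emb C F"
  obtains G :: "('o, 'a, (int \<times> int, 'k, 'u) cpx, (int \<times> int, 'k, 'u) cmap) lax_functor"
  where "lax_symmetric_monoidal_functor C (Ch_grVect_pure K) G" "weq_step K C (UG G) (HF F)"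
proof -
  interpret F: lax_elements K emb C F by (rule F)
  let ?H = "HF F"
  have H: "lax_elements K emb C ?H" by (rule homology_functor_lax(1)[OF F])
  interpret H: lax_elements K emb C ?H by (rule H)
  note cx = F.FO_complex and T = F.C.tens_obj
  have Hom: "X \<in> Obj C" "Y \<in> Obj C" if "f \<in> Hom C X Y" for f X Y
    using that F.C.dom_obj F.C.cod_obj by (auto simp: Hom_def)
  have bd0: "bd (FO ?H X) n x = \<zero>\<^bsub>sp (FO ?H X) (n + bdeg)\<^esub>" if "X \<in> Obj C" for X n x
    using bd_H_cpx[OF cx[OF that]] by simp
  \<comment> \<open>Homology of degree n sits in bidegree (n, n), and every other bidegree receives
    the zero subspace. Products respect this: diagonal bidegrees add up to diagonal ones, and a
    product with zero is zero, which belongs to every \<open>S X a\<close>.\<close>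
  define S where "S X a = (if fst a = (snd a :: int) then carrier (sp (FO ?H X) (fst a)) else {\<zero>\<^bsub>sp (FO ?H X) (fst a)\<^esub>})" for X a
  let ?G = "sub_functor C fst ?H S"
  have S0: "\<zero>\<^bsub>sp (FO ?H X) (fst a)\<^esub> \<in> S X a" if "X \<in> Obj C" for X a
    using module_zero_closed[OF H.FO_module[OF that]] by (simp add: S_def del: HF_FO)
  have zl: "mul ?H X Y a b \<zero>\<^bsub>sp (FO ?H X) a\<^esub> y = \<zero>\<^bsub>sp (FO ?H (X \<boxtimes>\<^bsub>C\<^esub> Y)) (a + b)\<^esub>"
    if "X \<in> Obj C" "Y \<in> Obj C" "y \<in> carrier (sp (FO ?H Y) b)" for X Y a b y
    by (rule linear_zero[OF bilinear_left[OF H.mul_bilinear[OF that(1,2)] that(3)] H.FO_module[OF that(1)] H.FO_module[OF T[OF that(1,2)]]])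
  have zr: "mul ?H X Y a b x \<zero>\<^bsub>sp (FO ?H Y) b\<^esub> = \<zero>\<^bsub>sp (FO ?H (X \<boxtimes>\<^bsub>C\<^esub> Y)) (a + b)\<^esub>"
    if "X \<in> Obj C" "Y \<in> Obj C" "x \<in> carrier (sp (FO ?H X) a)" for X Y a b x
    by (rule linear_zero[OF bilinear_right[OF H.mul_bilinear[OF that(1,2)] that(3)] H.FO_module[OF that(2)] H.FO_module[OF T[OF that(1,2)]]])
  have S: "S X a \<subseteq> carrier (sp (FO ?H X) (fst a))" if "X \<in> Obj C" for X a
    using module_zero_closed[OF H.FO_module[OF that]] by (simp add: S_def del: HF_FO)
  have S_add: "x \<oplus>\<^bsub>sp (FO ?H X) (fst a)\<^esub> y \<in> S X a" if "X \<in> Obj C" "x \<in> S X a" "y \<in> S X a" for X a x y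
    using that H.FO_module[OF that(1), of "fst a"] by (auto simp: S_def simp del: HF_FO split: if_splits)
  have S_smult: "c \<odot>\<^bsub>sp (FO ?H X) (fst a)\<^esub> x \<in> S X a" if "X \<in> Obj C" "c \<in> carrier K" "x \<in> S X a" for X a c x
    using that H.FO_module[OF that(1), of "fst a"] by (auto simp: S_def simp del: HF_FO split: if_splits)
  have S_bd: "bd (FO ?H X) (fst a) x \<in> S X (a + bdeg)" if "X \<in> Obj C" "x \<in> S X a" for X a x
    using S0[OF that(1), of "a + bdeg"] by (simp add: bd0[OF that(1)] bdeg_prod_def del: HF_FO)
  have S_FA: "fn (FA ?H f) (fst a) x \<in> S Y a" if "f \<in> Hom C X Y" "X \<in> Obj C" "Y \<in> Obj C" "x \<in> S X a" for f X Y a x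
    using that(4) linear_closed[OF H.FA_linear[OF that(1)]] linear_zero[OF H.FA_linear[OF that(1)] H.FO_module[OF that(2)] H.FO_module[OF that(3)]]
    by (auto simp: S_def simp del: HF_FO split: if_splits)
  have S_mul: "mul ?H X Y (fst a) (fst b) x y \<in> S (X \<boxtimes>\<^bsub>C\<^esub> Y) (a + b)"
    if X: "X \<in> Obj C" and Y: "Y \<in> Obj C" and x: "x \<in> S X a" and y: "y \<in> S Y b" for X Y a b x y
  proof (cases "fst a = snd a \<and> fst b = snd b")
    case True
    then show ?thesis
      using H.mul_closed[OF X Y subsetD[OF S[OF X] x] subsetD[OF S[OF Y] y]] by (simp add: S_def del: HF_FO)
  next
    case False
    then have "x = \<zero>\<^bsub>sp (FO ?H X) (fst a)\<^esub> \<or> y = \<zero>\<^bsub>sp (FO ?H Y) (fst b)\<^esub>"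
      using x y by (auto simp: S_def simp del: HF_FO split: if_splits)
    then show ?thesis
      using zl[OF X Y subsetD[OF S[OF Y] y], of "fst a"] zr[OF X Y subsetD[OF S[OF X] x], of "fst b"] S0[OF T[OF X Y], of "a + b"]
      by (auto simp del: HF_FO)
  qed
  have S_one: "one_elt ?H \<in> S (Unit C) 0"
    using H.one_closed' by (simp add: S_def del: HF_FO)
  have \<phi>: "fst (a + b) = fst a + fst b" "fst (bdeg :: int \<times> int) = bdeg" "hdeg (fst a) = hdeg a" for a b :: "int \<times> int"
    by (simp_all add: bdeg_prod_def hdeg_prod_def)
  have G: "lax_elements K emb C ?G"
    "\<lbrakk>X \<in> Obj C; Y \<in> Obj C; x \<in> S X a; y \<in> S Y b\<rbrakk> \<Longrightarrow> mul ?G X Y a b x y = mul ?H X Y (fst a) (fst b) x y"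
    "one_elt ?G = one_elt ?H"
    "\<lbrakk>f \<in> Hom C X Y; x \<in> S X a\<rbrakk> \<Longrightarrow> fn (FA ?G f) a x = fn (FA ?H f) (fst a) x" for X Y a b x y f
    by (rule sub_functor_lax[where \<phi> = fst, OF H \<phi>], (rule S S0 S_add S_smult S_bd S_FA S_mul S_one | assumption)+)+
  interpret G: lax_elements K emb C ?G by (rule G(1))
  have carG: "carrier (sp (FO ?G X) a) = S X a" for X a
    by (simp add: sub_functor_simps)
  have dG: "diagonal (FO ?G X)" for X
    by (simp add: diagonal_def carG S_def) (simp add: sub_functor_simps)
  note cG = G.FO_complex and P = weight_functor_pre_lax[OF G(1)]
  interpret U: pre_lax K emb C "UG ?G" by (rule P)
  have spU: "sp (FO (UG ?G) X) = U_sp (FO ?G X)" if "X \<in> Obj C" for X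
    by (rule UG_sp[OF G(1) that])
  have off: "U_comp (FO ?G X) n x p = \<zero>\<^bsub>sp (FO ?G X) (n, p)\<^esub>" if "X \<in> Obj C" "x \<in> carrier (U_sp (FO ?G X) n)" "p \<noteq> n" for X n x p
    using U_comp_closed[OF cG[OF that(1)] that(2), of p] dG that(3) unfolding diagonal_def by blast
  \<comment> \<open>All other components vanish by \<open>off\<close>, so the diagonal component
    determines an element of the direct sum and \<open>\<eta>\<close> is injective;
    \<open>U_in\<close> provides preimages, which makes it surjective.\<close>
  define \<eta> where "\<eta> X n x = U_comp (FO ?G X) n x n" for X n x
  have \<eta>_lin: "\<eta> X n \<in> linear_maps K (sp (FO (UG ?G) X) n) (sp (FO ?H X) n)" if X: "X \<in> Obj C" for X n
    using U_comp_linear[OF cG[OF X], of n n] S[OF X, of "(n, n)"]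
    by (auto simp: linear_maps_def \<eta>_def spU[OF X] carG sub_functor_simps simp del: HF_FO UG_FO)
  have \<eta>_S: "\<eta> X n x \<in> S X (n, n)" if "X \<in> Obj C" "x \<in> carrier (U_sp (FO ?G X) n)" for X n x
    using U_comp_closed[OF cG[OF that(1)] that(2), of n] by (simp add: \<eta>_def carG)
  have \<eta>_FA: "\<eta> Y n (fn (FA (UG ?G) f) n x) = fn (FA ?H f) n (\<eta> X n x)"
    if f: "f \<in> Hom C X Y" and X: "X \<in> Obj C" and Y: "Y \<in> Obj C" and x: "x \<in> carrier (sp (FO (UG ?G) X) n)" for f X Y n x
  proof -
    have x: "x \<in> carrier (U_sp (FO ?G X) n)" using x by (simp only: spU[OF X])
    show ?thesis
      using G(4)[OF f \<eta>_S[OF X x]] U_comp_FA[OF G(1) f X Y x, of n] by (simp add: \<eta>_def)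
  qed
  have \<eta>_mul: "\<eta> (X \<boxtimes>\<^bsub>C\<^esub> Y) (a + b) (mul (UG ?G) X Y a b x y) = mul ?H X Y a b (\<eta> X a x) (\<eta> Y b y)"
    if X: "X \<in> Obj C" and Y: "Y \<in> Obj C" and x: "x \<in> carrier (sp (FO (UG ?G) X) a)" and y: "y \<in> carrier (sp (FO (UG ?G) Y) b)" for X Y a b x y
  proof -
    have x: "x \<in> carrier (U_sp (FO ?G X) a)" and y: "y \<in> carrier (U_sp (FO ?G Y) b)"
      using x y by (simp_all only: spU[OF X] spU[OF Y])
    show ?thesis
      using U_comp_mul[OF G(1) X Y x y off[OF X x] off[OF Y y] order_refl] G(2)[OF X Y \<eta>_S[OF X x] \<eta>_S[OF Y y]] by (simp add: \<eta>_def)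
  qed
  have \<eta>_one: "\<eta> (Unit C) 0 (one_elt (UG ?G)) = one_elt ?H"
    using U_comp_one[OF G(1), of 0] G(3) by (simp add: \<eta>_def)
  have \<eta>_inj: "inj_on (\<eta> X n) (carrier (sp (FO (UG ?G) X) n))" if X: "X \<in> Obj C" for X n
  proof (rule inj_onI)
    fix x y assume xy: "x \<in> carrier (sp (FO (UG ?G) X) n)" "y \<in> carrier (sp (FO (UG ?G) X) n)" and e: "\<eta> X n x = \<eta> X n y"
    have x: "x \<in> carrier (U_sp (FO ?G X) n)" and y: "y \<in> carrier (U_sp (FO ?G X) n)"
      using xy by (simp_all only: spU[OF X])
    show "x = y"
    proof (rule U_eqI[OF cG[OF X] x y])
      show "U_comp (FO ?G X) n x p = U_comp (FO ?G X) n y p" for p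
        using e off[OF X x] off[OF X y] by (cases "p = n") (simp_all add: \<eta>_def)
    qed
  qed
  have \<eta>_bd: "\<eta> X (n + bdeg) (bd (FO (UG ?G) X) n x) = bd (FO ?H X) n (\<eta> X n x)"
    if X: "X \<in> Obj C" and x: "x \<in> carrier (sp (FO (UG ?G) X) n)" for X n x
  proof -
    have x: "x \<in> carrier (U_sp (FO ?G X) n)" using x by (simp only: spU[OF X])
    show ?thesis
      using U_comp_bd[OF cG[OF X] x, of "n + bdeg"] by (simp add: \<eta>_def sub_functor_simps bd0[OF X] del: HF_FO)
  qed
  \<comment> \<open>Up to here \<open>UG ?G\<close> is only known to be \<open>pre_lax\<close>; its
    laws come from those of \<open>HF F\<close> through the injection \<open>\<eta>\<close>.\<close>
  have UL: "lax_elements K emb C (UG ?G)"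
    by (rule lax_elements_pullback[where \<phi> = "\<lambda>n. n" and \<eta> = \<eta>, OF P(1) H refl refl refl \<eta>_lin \<eta>_inj \<eta>_bd \<eta>_FA \<eta>_mul \<eta>_one])
  let ?e = "\<lambda>X. \<lparr>src = FO (UG ?G) X, tgt = FO ?H X, fn = \<lambda>n. restrict (\<eta> X n) (carrier (sp (FO (UG ?G) X) n))\<rparr>"
  have e: "chain_map K (?e X)" "quasi_iso K (?e X)" if X: "X \<in> Obj C" for X
  proof -
    have l: "?e X \<in> linear_cmaps (FO (UG ?G) X) (FO ?H X)"
      using linear_restrict[OF \<eta>_lin[OF X] U.FO_module[OF X]] by (simp add: linear_cmaps_def linear_cmap_def del: HF_FO UG_FO)
    show c: "chain_map K (?e X)"
      unfolding chain_map_iff[OF l U.FO_complex[OF X] H.FO_complex[OF X]]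
      using \<eta>_bd[OF X] linear_closed[OF chain_complex_bd[OF U.FO_complex[OF X]]] by (simp del: HF_FO UG_FO)
    have z: "\<eta> X n \<zero>\<^bsub>sp (FO (UG ?G) X) n\<^esub> = \<zero>\<^bsub>sp (FO ?H X) n\<^esub>" for n
      by (rule linear_zero[OF \<eta>_lin[OF X] U.FO_module[OF X] H.FO_module[OF X]])
    \<comment> \<open>The differential of \<open>HF F\<close> is zero and \<open>\<eta>\<close> is
      injective, so \<open>UG ?G\<close> has zero differential too. Being a quasi-isomorphism then
      amounts to bijectivity of \<open>\<eta>\<close>.\<close>
    have bU: "bd (FO (UG ?G) X) n x = \<zero>\<^bsub>sp (FO (UG ?G) X) (n + bdeg)\<^esub>" if "x \<in> carrier (sp (FO (UG ?G) X) n)" for n x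
      using inj_onD[OF \<eta>_inj[OF X] _ linear_closed[OF chain_complex_bd[OF U.FO_complex[OF X]] that] module_zero_closed[OF U.FO_module[OF X]]]
      by (simp add: \<eta>_bd[OF X that] bd0[OF X] z del: HF_FO UG_FO)
    have z0: "\<zero>\<^bsub>sp (FO (UG ?G) X) n\<^esub> \<in> boundaries (FO (UG ?G) X) n" for n
      using submodule_closed(2)[OF boundaries_submodule[OF U.FO_complex[OF X]] cycle_module_module[OF U.FO_complex[OF X]]]
      by (simp del: HF_FO UG_FO)
    have surj: "\<exists>x \<in> carrier (sp (FO (UG ?G) X) n). \<eta> X n x = y" if y: "y \<in> carrier (sp (FO ?H X) n)" for n y
    proof -
      have y': "y \<in> carrier (sp (FO ?G X) (n, n))" using y by (simp add: carG S_def)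
      show ?thesis
        using U_in_closed[OF cG[OF X] y'] U_comp_in[OF cG[OF X] y', of n]
        by (intro bexI[of _ "U_in (FO ?G X) n n y"]) (simp_all add: \<eta>_def spU[OF X] del: UG_FO)
    qed
    show "quasi_iso K (?e X)"
      unfolding quasi_iso_iff[OF c] cmap.simps
    proof (intro allI conjI ballI impI)
      fix n x assume x: "x \<in> cycles (FO (UG ?G) X) n"
        and "restrict (\<eta> X n) (carrier (sp (FO (UG ?G) X) n)) x \<in> boundaries (FO ?H X) n"
      then have "\<eta> X n x = \<eta> X n \<zero>\<^bsub>sp (FO (UG ?G) X) n\<^esub>"
        unfolding z using boundaries_H[OF cx[OF X], of n] cycles_closed[OF x] by (simp del: UG_FO)
      then have "x = \<zero>\<^bsub>sp (FO (UG ?G) X) n\<^esub>"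
        by (rule inj_onD[OF \<eta>_inj[OF X] _ cycles_closed[OF x] module_zero_closed[OF U.FO_module[OF X]]])
      then show "x \<in> boundaries (FO (UG ?G) X) n"
        using z0 by (simp only:)
    next
      fix n y assume y: "y \<in> cycles (FO ?H X) n"
      obtain x where x: "x \<in> carrier (sp (FO (UG ?G) X) n)" "\<eta> X n x = y"
        using surj[OF cycles_closed[OF y]] by blast
      have "x \<in> cycles (FO (UG ?G) X) n"
        using x(1) bU[OF x(1)] unfolding cycles_def by simp
      moreover have "y \<ominus>\<^bsub>sp (FO ?H X) n\<^esub> y \<in> boundaries (FO ?H X) n"
        using module_diff_self[OF H.FO_module[OF X] cycles_closed[OF y]] boundaries_H[OF cx[OF X], of n] by simp
      ultimately show "\<exists>x \<in> cycles (FO (UG ?G) X) n. y \<ominus>\<^bsub>sp (FO ?H X) n\<^esub> restrict (\<eta> X n) (carrier (sp (FO (UG ?G) X) n)) x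
          \<in> boundaries (FO ?H X) n"
        using x by (intro bexI[of _ x]) (simp_all del: HF_FO UG_FO)
    qed
  qed
  have "weq_step K C (UG ?G) ?H"
  proof (rule weq_stepI[OF UL H, where \<eta> = ?e])
    show "?e X \<in> Hom (complexes K) (FO (UG ?G) X) (FO ?H X)" if "X \<in> Obj C" for X
      using e(1)[OF that] by (simp add: Hom_complexes del: HF_FO UG_FO)
    show "quasi_iso K (?e X)" if "X \<in> Obj C" for X
      by (rule e(2)[OF that])
    show "fn (?e Y) n (fn (FA (UG ?G) f) n x) = fn (FA ?H f) n (fn (?e X) n x)"
      if f: "f \<in> Hom C X Y" and x: "x \<in> carrier (sp (FO (UG ?G) X) n)" for f X Y n x
      using x linear_closed[OF U.FA_linear[OF f] x] \<eta>_FA[OF f Hom[OF f] x] by (simp del: HF_FO UG_FO)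
    show "fn (?e (X \<boxtimes>\<^bsub>C\<^esub> Y)) (a + b) (mul (UG ?G) X Y a b x y) = mul ?H X Y a b (fn (?e X) a x) (fn (?e Y) b y)"
      if "X \<in> Obj C" "Y \<in> Obj C" "x \<in> carrier (sp (FO (UG ?G) X) a)" "y \<in> carrier (sp (FO (UG ?G) Y) b)" for X Y a b x y
      using that U.mul_closed[OF that] \<eta>_mul[OF that] by (simp del: HF_FO UG_FO)
    show "fn (?e (Unit C)) 0 (one_elt (UG ?G)) = one_elt ?H"
      using U.one_closed' \<eta>_one by (simp del: HF_FO UG_FO)
  qed
  then show thesis
    using lax_pureI[OF F.C.symmetric_monoidal_category_axioms G.lax dG] that by blast
qed

end

text \<open>The two conditions on \<open>'u\<close> make the type large enough for faithful copies
  of the direct sums, tensor products and homology modules that occur. They enter the proof as the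
  assumptions of \<open>small_ring\<close>.\<close>

theorem proposition3p3:
  fixes K :: "('k, 'z) ring_scheme"
    and C :: "('o, 'a) smc"
    and F :: "('o, 'a, (int, 'k, 'u) cpx, (int, 'k, 'u) cmap) lax_functor"
  assumes "field K"
    and "infinite (UNIV :: 'u set)"
    and "\<exists>\<iota> :: 'k \<Rightarrow> 'u. inj_on \<iota> (carrier K)"
    and "symmetric_monoidal_category C"
    and "lax_symmetric_monoidal_functor C (Ch K) F"
  shows "formal K C F \<longleftrightarrow>
    (\<exists>F' :: ('o, 'a, (int, 'k, 'u) cpx, (int, 'k, 'u) cmap) lax_functor.
       lax_symmetric_monoidal_functor C (Ch K) F' \<and>
       weakly_equivalent K C F F' \<and>
       (\<exists>G :: ('o, 'a, (int \<times> int, 'k, 'u) cpx, (int \<times> int, 'k, 'u) cmap) lax_functor.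
          lax_symmetric_monoidal_functor C (Ch_grVect_pure K) G \<and>
          F' = lax_comp (Ch K) (U_functor K) G))"
    (is "_ \<longleftrightarrow> ?R")
proof -
  obtain emb :: "'k \<Rightarrow> 'u" where emb: "inj_on emb (carrier K)"
    using assms(3) by blast
  interpret K: field K by (rule assms(1))
  interpret small_ring K emb
    by unfold_locales (rule emb assms(2))+
  note C = assms(4)
  have F: "lax_elements K emb C F"
    using assms(5) by (intro lax_elementsI[OF C]) (simp add: Ch_def)
  show ?thesis
  proof
    assume "formal K C F"
    then have FH: "weakly_equivalent K C F (HF F)"
      by (simp add: formal_def Ch_def)
    obtain G :: "('o, 'a, (int \<times> int, 'k, 'u) cpx, (int \<times> int, 'k, 'u) cmap) lax_functor"
      where G: "lax_symmetric_monoidal_functor C (Ch_grVect_pure K) G" and s: "weq_step K C (UG G) (HF F)"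
      using homology_factors_through_pure[OF F] by blast
    have "lax_symmetric_monoidal_functor C (Ch K) (UG G)"
      using s by (simp add: weq_step_def)
    moreover have "equivclp (weq_step K C) F (UG G)"
      using FH s unfolding weakly_equivalent_def by (blast intro: equivclp_trans equivclp_sym r_into_equivclp)
    ultimately have "weakly_equivalent K C F (UG G)"
      using FH by (simp add: weakly_equivalent_def)
    then show ?R
      using G unfolding weakly_equivalent_def Ch_def by blast
  next
    assume ?R
    then obtain G :: "('o, 'a, (int \<times> int, 'k, 'u) cpx, (int \<times> int, 'k, 'u) cmap) lax_functor"
      where w: "weakly_equivalent K C F (UG G)" and G: "lax_symmetric_monoidal_functor C (Ch_grVect_pure K) G"
      unfolding Ch_def by blast
    \<comment> \<open>Weak equivalence includes that both functors are lax, and this supplies the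
      laws for \<open>UG G\<close>.\<close>
    have U: "lax_elements K emb C (UG G)"
      using w by (intro lax_elementsI[OF C]) (simp add: weakly_equivalent_def Ch_def)
    have "equivclp (weq_step K C) (UG G) (HF (UG G))"
      by (rule pure_formal[OF lax_elementsI[OF C lax_pureD(1)[OF G]] U lax_pureD(2)[OF G]])
    moreover have "weakly_equivalent K C (HF F) (HF (UG G))"
      by (rule weakly_equivalent_homology[OF C w])
    \<comment> \<open>The zig-zag runs from \<open>F\<close> to \<open>UG G\<close>, on to the
      homology of \<open>UG G\<close>, and back to the homology of \<open>F\<close> because homology
      preserves weak equivalences.\<close>
    ultimately have "weakly_equivalent K C F (HF F)"
      using w unfolding weakly_equivalent_def by (blast intro: equivclp_trans equivclp_sym)
    then show "formal K C F"
      by (simp add: formal_def Ch_def)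
  qed
qed

end
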